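(* Let $k$ be a field of characteristic different from $2$, let $\varepsilon\in\{\pm1\}$, and let $\delta\in k$, with $\delta=0$ if $\varepsilon=-1$. Let $\mathcal{B}(\delta,\varepsilon)$ be the marked Brauer category. Let $I\in B_{1,1}(\delta,\varepsilon)$ be the diagram with the single through string $\{1,1'\}$, $X\in B_{2,2}(\delta,\varepsilon)$ the diagram with through strings $\{1,2'\},\{2,1'\}$, $\cup\in B_{2,0}(\delta,\varepsilon)$ the diagram with a single cup carrying a bead, and $\cap\in B_{0,2}(\delta,\varepsilon)$ the diagram with a single cap carrying an arrow pointing to the right. Then $\mathcal{B}(\delta,\varepsilon)$ is generated, as a strict $k$-linear tensor category (with tensor product and composition obeying the interchange rule given in the context), by $I,X,\cup,\cap$ subject to the following relations, which form a complete set of relations (here $\otimes$ binds more tightly than $\circ$): $$I\circ I=I,\quad (I\otimes I)\circ X=X=X\circ(I\otimes I),\quad (I\otimes I)\circ\cup=\cup,\quad \cap\circ(I\otimes I)=\cap,$$ $$X\circ X=I\otimes I,\quad \cap\circ X=\varepsilon\,\cap,\quad X\circ\cup=\cup,\quad \cap\circ\cup=\delta,$$ $$(\cap\otimes I)\circ(I\otimes\cup)=I,\quad (I\otimes\cap)\circ(\cup\otimes I)=\varepsilon I,$$ $$(\cap\otimes I)\circ(I\otimes X)=(I\otimes\cap)\circ(X\otimes I),\quad (I\otimes X)\circ(\cup\otimes I)=(X\otimes I)\circ(I\otimes\cup),$$ $$(I\otimes I\otimes\cup)\circ\cup=\varepsilon\,(\cup\otimes I\otimes I)\circ\cup,\quad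 \cap\circ(I\otimes I\otimes\cap)=\varepsilon\,\cap\circ(\cap\otimes I\otimes I),$$ $$(\cap\otimes I\otimes I)\circ(I\otimes I\otimes\cup)=\varepsilon\,\cup\circ\cap,$$ $$(X\otimes I)\circ(I\otimes X)\circ(X\otimes I)=(I\otimes X)\circ(X\otimes I)\circ(I\otimes X).$$ (In the relations $\circ$ is read from left to right as stacking from top to bottom.) Furthermore, declaring $I$ and $X$ to be even, and $\cup$ and $\cap$ to be odd when $\varepsilon=-1$ (even when $\varepsilon=1$), yields a $\mathbb{Z}_2$-grading on the Hom-spaces which coincides with the grading of the spaces $B_{r,s}(\delta,\varepsilon)$ by number of markings.
   Context: A Brauer diagram for $(r,s)$ is a partition of $\{1,\dots,r,1',\dots,s'\}$ into two-element subsets (edges), drawn with vertices $1,\dots,r$ in a top row and $1',\dots,s'$ in a bottom row. An edge joining two top vertices is a cup, an edge joining two bottom vertices is a cap, any other edge is a through string. A marked Brauer diagram is a Brauer diagram in which each cup carries one bead and each cap carries one arrow (pointing along the edge, toward its left or right endpoint), with no two markings (beads or arrows) at the same height. Up to equivalence it is the data of the Brauer diagram, the total order of all markings from top to bottom, and a direction for each arrow. Two markings are adjacent if no other marking has height strictly between them. $B_{r,s}(\delta,\varepsilon)$ is the $k$-vector space spanned by marked Brauer diagrams for $(r,s)$ modulo: (i) interchanging the heights of two adjacent markings multiplies the diagram by $\varepsilon$; (ii) reversing the direction of one arrow multiplies the diagram by $\varepsilon$. If $r+s$ is odd, $B_{r,s}(\delta,\varepsilon)=0$. Grading: if $\varepsilon=1$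 all diagrams are even; if $\varepsilon=-1$ the degree of a diagram is its number of markings mod $2$. Tensor product $B_{r,s}\otimes B_{t,u}\to B_{r+t,s+u}$: $D_1\otimes D_2$ places $D_1$ to the left of $D_2$, with all markings of $D_1$ above all markings of $D_2$. Composition $B_{r,s}\times B_{s,t}\to B_{r,t}$, $(D_1,D_2)\mapsto D_1\circ D_2$: stack $D_1$ above $D_2$, identifying the bottom vertices of $D_1$ with the top vertices of $D_2$ (markings of $D_1$ lie above those of $D_2$), then simplify: (1) if $m$ closed loops occur, delete them and multiply by $\delta^m$; (2) whenever a bead and an arrow are consecutive along the same edge and adjacent in height (which can be arranged using (i)), remove both and multiply by $1$ if the arrow is above the bead and points along the edge toward the bead, or the bead is above the arrow and the arrow points away from the bead, and by $\varepsilon$ otherwise; repeat until each cup carries one bead, each cap one arrow, and through strings carry no marking. The marked Brauer category $\mathcal{B}(\delta,\varepsilon)$ has objects $[a]$, $a=0,1,2,\dots$, morphism spaces $\mathrm{Hom}([a],[b])=B_{a,b}(\delta,\varepsilon)$, composition of morphisms given by the bilinear extension of the vertical stacking operation $(D_1,D_2)\mapsto D_1\circ D_2$ (stack $D_1$ above $D_2$ and simplify by rules (1) and (2)), and $[a]\otimes[b]=[a+b]$ with tensor product of morphisms given by the bilinear extension of the horizontal concatenation $(D_1,D_2)\mapsto D_1\otimes D_2$ ($D_1$ to the left of $D_2$, with all markings of $D_1$ above all markings of $D_2$). The tensor product and composition are strictly associative and unital and satisfy, for homogeneous morphisms, the interchange rule $(f\otimes g)\circ(h\otimes j)=(-1)^{\bar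 g\,\bar h}(f\circ h)\otimes(g\circ j)$; "strict $k$-linear tensor category" is understood in this ($\mathbb{Z}_2$-graded, enriched in superspaces) sense. "Generated subject to the relations" means that every morphism is a $k$-linear combination of morphisms obtained from $I,X,\cup,\cap$ by compositions and tensor products, and any two such expressions for the same morphism can be transformed into each other using $k$-linear combinations of equations derived from the listed relations by tensor products and compositions (together with the axioms of such a category). *)

theory Defs
  imports "HOL-Library.Poly_Mapping" "HOL-Library.Set_Algebras" "HOL-Library.Disjoint_Sets"
    "HOL-Computational_Algebra.Computational_Algebra"
begin

section \<open>Formal linear combinations\<close>

definition scale :: "'k \<Rightarrow> ('a \<Rightarrow>\<^sub>0 'k) \<Rightarrow> ('a \<Rightarrow>\<^sub>0 'k::field)"
  where "scale c x = Poly_Mapping.map ((*) c) x"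

lemma lookup_scale [simp]: "Poly_Mapping.lookup (scale c x) a = c * Poly_Mapping.lookup x a"
  by (simp add: scale_def Poly_Mapping.map.rep_eq when_def)

interpretation comb: vector_space "scale :: 'k::field \<Rightarrow> ('a \<Rightarrow>\<^sub>0 'k) \<Rightarrow> ('a \<Rightarrow>\<^sub>0 'k)"
  by standard (auto intro!: poly_mapping_eqI simp: lookup_add algebra_simps)

definition combinations :: "'a set \<Rightarrow> ('a \<Rightarrow>\<^sub>0 'k::field) set"
  where "combinations A = {x. Poly_Mapping.keys x \<subseteq> A}"

definition basis :: "'a \<Rightarrow> ('a \<Rightarrow>\<^sub>0 'k::field)"
  where "basis a = Poly_Mapping.single a 1"

definition bilinear_extension ::
    "('a \<Rightarrow> 'b \<Rightarrow> ('c \<Rightarrow>\<^sub>0 'k)) \<Rightarrow> ('a \<Rightarrow>\<^sub>0 'k) \<Rightarrow> ('b \<Rightarrow>\<^sub>0 'k) \<Rightarrow> ('c \<Rightarrow>\<^sub>0 'k::field)"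
  where "bilinear_extension h x y =
    (\<Sum>a\<in>Poly_Mapping.keys x. \<Sum>b\<in>Poly_Mapping.keys y.
       scale (Poly_Mapping.lookup x a * Poly_Mapping.lookup y b) (h a b))"


section \<open>Marked Brauer diagrams\<close>

text \<open>
  \<open>Top i\<close> is the vertex \<open>i\<close> and \<open>Bot i\<close> the vertex \<open>i'\<close>, numbered from 1. The vertices
  \<open>Mid i\<close> do not occur in diagrams for \<open>(r, s)\<close>; they are the glued vertices of a stack of two
  diagrams.

  A marking is recorded together with the edge carrying it: \<open>Bead {u, v}\<close> lies on the edge
  \<open>{u, v}\<close>, and \<open>Arrow u v\<close> lies on \<open>{u, v}\<close> and points from \<open>u\<close> towards \<open>v\<close>. A diagram is a set
  of edges with the list of its markings from top to bottom.
\<close>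

datatype vertex = Top nat | Mid nat | Bot nat

datatype mark = Bead "vertex set" | Arrow vertex vertex

type_synonym diagram = "vertex set set \<times> mark list"

primrec mark_edge :: "mark \<Rightarrow> vertex set" where
  "mark_edge (Bead e) = e"
| "mark_edge (Arrow u v) = {u, v}"

definition brauer_diagram :: "nat \<Rightarrow> nat \<Rightarrow> vertex set set \<Rightarrow> bool"
  where "brauer_diagram r s E \<longleftrightarrow>
    partition_on (Top ` {1..r} \<union> Bot ` {1..s}) E \<and> (\<forall>e\<in>E. card e = 2)"

definition cups :: "vertex set set \<Rightarrow> vertex set set"
  where "cups E = {e \<in> E. e \<subseteq> range Top}"

definition caps :: "vertex set set \<Rightarrow> vertex set set"
  where "caps E = {e \<in> E. e \<subseteq> range Bot}"

definition marked_diagrams :: "nat \<Rightarrow> nat \<Rightarrow> diagram set"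
  where "marked_diagrams r s = {(E, L).
    brauer_diagram r s E \<and>
    distinct (map mark_edge L) \<and>
    {e. Bead e \<in> set L} = cups E \<and>
    {{u, v} | u v. Arrow u v \<in> set L} = caps E}"


section \<open>The spaces of morphisms\<close>

definition diagram_relations :: "'k::field \<Rightarrow> nat \<Rightarrow> nat \<Rightarrow> (diagram \<Rightarrow>\<^sub>0 'k) set"
  where "diagram_relations \<epsilon> r s =
    {basis (E, L1 @ [x, y] @ L2) - scale \<epsilon> (basis (E, L1 @ [y, x] @ L2)) | E L1 x y L2.
       (E, L1 @ [x, y] @ L2) \<in> marked_diagrams r s} \<union>
    {basis (E, L1 @ [Arrow u v] @ L2) - scale \<epsilon> (basis (E, L1 @ [Arrow v u] @ L2)) | E L1 u v L2.
       (E, L1 @ [Arrow u v] @ L2) \<in> marked_diagrams r s}"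

definition null_space :: "'k::field \<Rightarrow> nat \<Rightarrow> nat \<Rightarrow> (diagram \<Rightarrow>\<^sub>0 'k) set"
  where "null_space \<epsilon> r s = comb.span (diagram_relations \<epsilon> r s)"

text \<open>
  Elements of the quotient are cosets. The sum of two cosets is their elementwise sum; a
  scalar multiple \<open>c F\<close> is written \<open>scale c ` F + null_space \<epsilon> r s\<close>, which is a coset also for
  \<open>c = 0\<close>.
\<close>

definition coset :: "'k::field \<Rightarrow> nat \<Rightarrow> nat \<Rightarrow> (diagram \<Rightarrow>\<^sub>0 'k) \<Rightarrow> (diagram \<Rightarrow>\<^sub>0 'k) set"
  where "coset \<epsilon> r s f = f +o null_space \<epsilon> r s"

definition Hom :: "'k::field \<Rightarrow> nat \<Rightarrow> nat \<Rightarrow> (diagram \<Rightarrow>\<^sub>0 'k) set set"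
  where "Hom \<epsilon> r s = coset \<epsilon> r s ` combinations (marked_diagrams r s)"

text \<open>The degree of a diagram or of an expression with \<open>n\<close> markings.\<close>

definition degree_of :: "'k::field \<Rightarrow> nat \<Rightarrow> nat"
  where "degree_of \<epsilon> n = (if \<epsilon> = - 1 then n mod 2 else 0)"

definition Hom_part :: "'k::field \<Rightarrow> nat \<Rightarrow> nat \<Rightarrow> nat \<Rightarrow> (diagram \<Rightarrow>\<^sub>0 'k) set set"
  where "Hom_part \<epsilon> r s p = coset \<epsilon> r s `
    combinations {(E, L) \<in> marked_diagrams r s. degree_of \<epsilon> (length L) = p}"


section \<open>Tensor product\<close>

primrec map_mark :: "(vertex \<Rightarrow> vertex) \<Rightarrow> mark \<Rightarrow> mark" where
  "map_mark f (Bead e) = Bead (f ` e)"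
| "map_mark f (Arrow u v) = Arrow (f u) (f v)"

definition map_edges :: "(vertex \<Rightarrow> vertex) \<Rightarrow> vertex set set \<Rightarrow> vertex set set"
  where "map_edges f E = (\<lambda>e. f ` e) ` E"

primrec shift :: "nat \<Rightarrow> nat \<Rightarrow> vertex \<Rightarrow> vertex" where
  "shift r s (Top i) = Top (r + i)"
| "shift r s (Mid i) = Mid i"
| "shift r s (Bot i) = Bot (s + i)"

fun juxtapose :: "nat \<Rightarrow> nat \<Rightarrow> diagram \<Rightarrow> diagram \<Rightarrow> diagram" where
  "juxtapose r s (E1, L1) (E2, L2) =
     (E1 \<union> map_edges (shift r s) E2, L1 @ map (map_mark (shift r s)) L2)"

definition tensor :: "'k::field \<Rightarrow> nat \<Rightarrow> nat \<Rightarrow> nat \<Rightarrow> nat \<Rightarrow>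
    (diagram \<Rightarrow>\<^sub>0 'k) set \<Rightarrow> (diagram \<Rightarrow>\<^sub>0 'k) set \<Rightarrow> (diagram \<Rightarrow>\<^sub>0 'k) set"
  where "tensor \<epsilon> r s t u F G =
    (\<Union>f\<in>F. \<Union>g\<in>G. coset \<epsilon> (r + t) (s + u)
       (bilinear_extension (\<lambda>D1 D2. basis (juxtapose r s D1 D2)) f g))"


section \<open>Composition\<close>

primrec bot_to_mid :: "vertex \<Rightarrow> vertex" where
  "bot_to_mid (Top i) = Top i"
| "bot_to_mid (Mid i) = Mid i"
| "bot_to_mid (Bot i) = Mid i"

primrec top_to_mid :: "vertex \<Rightarrow> vertex" where
  "top_to_mid (Top i) = Mid i"
| "top_to_mid (Mid i) = Mid i"
| "top_to_mid (Bot i) = Bot i"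

text \<open>
  A cap of the upper and a cup of the lower diagram may have the same two endpoints and then
  become one element of the edge set of the stack. They form a closed loop by themselves, and a
  connected component does not depend on multiplicities of edges; once the loops are deleted
  no such edges are left.
\<close>

fun stack :: "diagram \<Rightarrow> diagram \<Rightarrow> diagram" where
  "stack (E1, L1) (E2, L2) =
     (map_edges bot_to_mid E1 \<union> map_edges top_to_mid E2,
      map (map_mark bot_to_mid) L1 @ map (map_mark top_to_mid) L2)"

definition connected_by :: "vertex set set \<Rightarrow> (vertex \<times> vertex) set"
  where "connected_by E = {(u, v). \<exists>e\<in>E. u \<in> e \<and> v \<in> e}\<^sup>*"

definition loops :: "vertex set set \<Rightarrow> vertex set set"
  where "loops E = {C \<in> \<Union>E // connected_by E. C \<subseteq> range Mid}"

fun delete_loops :: "diagram \<Rightarrow> diagram" where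
  "delete_loops (E, L) =
     ({e \<in> E. \<not> e \<subseteq> \<Union>(loops E)}, filter (\<lambda>x. \<not> mark_edge x \<subseteq> \<Union>(loops E)) L)"

text \<open>
  \<open>simplify_step \<epsilon> D c D'\<close> means that the loop-free stack \<open>D\<close> may be replaced by \<open>c\<close> times \<open>D'\<close>.
  The rule \<open>contract\<close> only forgets a glued vertex \<open>b\<close>: it contracts an edge \<open>{a, b}\<close> without
  marking, so that a bead and an arrow which are consecutive along a string eventually lie on edges
  \<open>{a, b}\<close> and \<open>{b, c}\<close> sharing a glued vertex \<open>b\<close>.
\<close>

inductive simplify_step :: "'k::field \<Rightarrow> diagram \<Rightarrow> 'k \<Rightarrow> diagram \<Rightarrow> bool" for \<epsilon> where
  interchange:
    "simplify_step \<epsilon> (E, L1 @ [x, y] @ L2) \<epsilon> (E, L1 @ [y, x] @ L2)"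
| contract:
    "{a, b} \<in> E \<Longrightarrow> a \<noteq> b \<Longrightarrow> b \<in> range Mid \<Longrightarrow> {a, b} \<notin> mark_edge ` set L \<Longrightarrow>
     simplify_step \<epsilon> (E, L) 1
       (map_edges (id(b := a)) (E - {{a, b}}), map (map_mark (id(b := a))) L)"
| arrow_above_towards:
    "b \<in> range Mid \<Longrightarrow>
     simplify_step \<epsilon> (E, L1 @ [Arrow c b, Bead {a, b}] @ L2) 1 (E, L1 @ L2)"
| bead_above_away:
    "b \<in> range Mid \<Longrightarrow>
     simplify_step \<epsilon> (E, L1 @ [Bead {a, b}, Arrow b c] @ L2) 1 (E, L1 @ L2)"
| arrow_above_away:
    "b \<in> range Mid \<Longrightarrow>
     simplify_step \<epsilon> (E, L1 @ [Arrow b c, Bead {a, b}] @ L2) \<epsilon> (E, L1 @ L2)"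
| bead_above_towards:
    "b \<in> range Mid \<Longrightarrow>
     simplify_step \<epsilon> (E, L1 @ [Bead {a, b}, Arrow c b] @ L2) \<epsilon> (E, L1 @ L2)"

inductive simplifies_to :: "'k::field \<Rightarrow> diagram \<Rightarrow> 'k \<Rightarrow> diagram \<Rightarrow> bool" for \<epsilon> where
  stop: "simplifies_to \<epsilon> D 1 D"
| step: "simplify_step \<epsilon> D c D' \<Longrightarrow> simplifies_to \<epsilon> D' c' D'' \<Longrightarrow> simplifies_to \<epsilon> D (c * c') D''"

definition composites ::
    "'k::field \<Rightarrow> 'k \<Rightarrow> nat \<Rightarrow> nat \<Rightarrow> diagram \<Rightarrow> diagram \<Rightarrow> (diagram \<Rightarrow>\<^sub>0 'k) set"
  where "composites \<delta> \<epsilon> r t D1 D2 =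
    {scale (\<delta> ^ card (loops (fst (stack D1 D2))) * c) (basis D) | c D.
       simplifies_to \<epsilon> (delete_loops (stack D1 D2)) c D \<and> D \<in> marked_diagrams r t}"

text \<open>
  The union ranges over all representatives and over all ways \<open>h\<close> of carrying out the
  simplifications; it is a single coset exactly because the result does not depend on them.
\<close>

definition compose :: "'k::field \<Rightarrow> 'k \<Rightarrow> nat \<Rightarrow> nat \<Rightarrow> nat \<Rightarrow>
    (diagram \<Rightarrow>\<^sub>0 'k) set \<Rightarrow> (diagram \<Rightarrow>\<^sub>0 'k) set \<Rightarrow> (diagram \<Rightarrow>\<^sub>0 'k) set"
  where "compose \<delta> \<epsilon> r s t F G =
    (\<Union>f\<in>F. \<Union>g\<in>G.
     \<Union>h\<in>{h. \<forall>D1\<in>marked_diagrams r s. \<forall>D2\<in>marked_diagrams s t.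
              h D1 D2 \<in> composites \<delta> \<epsilon> r t D1 D2}.
       coset \<epsilon> r t (bilinear_extension h f g))"


section \<open>Expressions in the generators\<close>

text \<open>
  \<open>Unit\<close> is the empty tensor product, that is, the identity of the unit object \<open>[0]\<close>;
  \<open>f \<odot> g\<close> is the composition with \<open>f\<close> on top.
\<close>

datatype word =
    Unit
  | Strand
  | Cross
  | Cup
  | Cap
  | Comp word word  (infixl \<open>\<odot>\<close> 65)
  | Tens word word  (infixl \<open>\<otimes>\<close> 70)

primrec src :: "word \<Rightarrow> nat" where
  "src Unit = 0"
| "src Strand = 1"
| "src Cross = 2"
| "src Cup = 2"
| "src Cap = 0"
| "src (f \<odot> g) = src f"
| "src (f \<otimes> g) = src f + src g"

primrec tgt :: "word \<Rightarrow> nat" where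
  "tgt Unit = 0"
| "tgt Strand = 1"
| "tgt Cross = 2"
| "tgt Cup = 0"
| "tgt Cap = 2"
| "tgt (f \<odot> g) = tgt g"
| "tgt (f \<otimes> g) = tgt f + tgt g"

primrec well_typed :: "word \<Rightarrow> bool" where
  "well_typed Unit = True"
| "well_typed Strand = True"
| "well_typed Cross = True"
| "well_typed Cup = True"
| "well_typed Cap = True"
| "well_typed (f \<odot> g) = (well_typed f \<and> well_typed g \<and> tgt f = src g)"
| "well_typed (f \<otimes> g) = (well_typed f \<and> well_typed g)"

definition words :: "nat \<Rightarrow> nat \<Rightarrow> word set"
  where "words r s = {w. well_typed w \<and> src w = r \<and> tgt w = s}"

primrec odd_generators :: "word \<Rightarrow> nat" where
  "odd_generators Unit = 0"
| "odd_generators Strand = 0"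
| "odd_generators Cross = 0"
| "odd_generators Cup = 1"
| "odd_generators Cap = 1"
| "odd_generators (f \<odot> g) = odd_generators f + odd_generators g"
| "odd_generators (f \<otimes> g) = odd_generators f + odd_generators g"

definition word_degree :: "'k::field \<Rightarrow> word \<Rightarrow> nat"
  where "word_degree \<epsilon> w = degree_of \<epsilon> (odd_generators w)"

primrec identity :: "nat \<Rightarrow> word" where
  "identity 0 = Unit"
| "identity (Suc a) = Strand \<otimes> identity a"

text \<open>A triple \<open>(f, c, g)\<close> stands for the relation \<open>f = c g\<close>.\<close>

definition relations :: "'k::field \<Rightarrow> 'k \<Rightarrow> (word \<times> 'k \<times> word) set"
  where "relations \<delta> \<epsilon> = {
    (Strand \<odot> Strand, 1, Strand),
    (Strand \<otimes> Strand \<odot> Cross, 1, Cross),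
    (Cross, 1, Cross \<odot> Strand \<otimes> Strand),
    (Strand \<otimes> Strand \<odot> Cup, 1, Cup),
    (Cap \<odot> Strand \<otimes> Strand, 1, Cap),
    (Cross \<odot> Cross, 1, Strand \<otimes> Strand),
    (Cap \<odot> Cross, \<epsilon>, Cap),
    (Cross \<odot> Cup, 1, Cup),
    (Cap \<odot> Cup, \<delta>, Unit),
    (Cap \<otimes> Strand \<odot> Strand \<otimes> Cup, 1, Strand),
    (Strand \<otimes> Cap \<odot> Cup \<otimes> Strand, \<epsilon>, Strand),
    (Cap \<otimes> Strand \<odot> Strand \<otimes> Cross, 1, Strand \<otimes> Cap \<odot> Cross \<otimes> Strand),
    (Strand \<otimes> Cross \<odot> Cup \<otimes> Strand, 1, Cross \<otimes> Strand \<odot> Strand \<otimes> Cup),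
    (Strand \<otimes> Strand \<otimes> Cup \<odot> Cup, \<epsilon>, Cup \<otimes> Strand \<otimes> Strand \<odot> Cup),
    (Cap \<odot> Strand \<otimes> Strand \<otimes> Cap, \<epsilon>, Cap \<odot> Cap \<otimes> Strand \<otimes> Strand),
    (Cap \<otimes> Strand \<otimes> Strand \<odot> Strand \<otimes> Strand \<otimes> Cup, \<epsilon>, Cup \<odot> Cap),
    (Cross \<otimes> Strand \<odot> Strand \<otimes> Cross \<odot> Cross \<otimes> Strand, 1,
     Strand \<otimes> Cross \<odot> Cross \<otimes> Strand \<odot> Strand \<otimes> Cross)}"

definition exprs :: "nat \<Rightarrow> nat \<Rightarrow> (word \<Rightarrow>\<^sub>0 'k::field) set"
  where "exprs r s = combinations (words r s)"

text \<open>
  Equality of expressions that can be derived from the relations and the axioms of a strict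
  linear tensor category with signs. Linearity is built into the expressions, hence the axioms
  need to be stated for words only. The identity of \<open>[a]\<close> is the tensor power \<open>identity a\<close> of
  \<open>Strand\<close>.
\<close>

inductive derivable ::
    "'k::field \<Rightarrow> 'k \<Rightarrow> nat \<Rightarrow> nat \<Rightarrow> (word \<Rightarrow>\<^sub>0 'k) \<Rightarrow> (word \<Rightarrow>\<^sub>0 'k) \<Rightarrow> bool" for \<delta> \<epsilon> where
  relation:
    "(f, c, g) \<in> relations \<delta> \<epsilon> \<Longrightarrow>
     derivable \<delta> \<epsilon> (src f) (tgt f) (basis f) (scale c (basis g))"
| comp_assoc:
    "f \<in> words r s \<Longrightarrow> g \<in> words s t \<Longrightarrow> h \<in> words t u \<Longrightarrow>
     derivable \<delta> \<epsilon> r u (basis ((f \<odot> g) \<odot> h)) (basis (f \<odot> (g \<odot> h)))"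
| comp_identity_left:
    "f \<in> words r s \<Longrightarrow> derivable \<delta> \<epsilon> r s (basis (identity r \<odot> f)) (basis f)"
| comp_identity_right:
    "f \<in> words r s \<Longrightarrow> derivable \<delta> \<epsilon> r s (basis (f \<odot> identity s)) (basis f)"
| tens_assoc:
    "f \<in> words r s \<Longrightarrow> g \<in> words t u \<Longrightarrow> h \<in> words v w \<Longrightarrow>
     derivable \<delta> \<epsilon> (r + t + v) (s + u + w) (basis ((f \<otimes> g) \<otimes> h)) (basis (f \<otimes> (g \<otimes> h)))"
| tens_unit_left:
    "f \<in> words r s \<Longrightarrow> derivable \<delta> \<epsilon> r s (basis (Unit \<otimes> f)) (basis f)"
| tens_unit_right:
    "f \<in> words r s \<Longrightarrow> derivable \<delta> \<epsilon> r s (basis (f \<otimes> Unit)) (basis f)"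
| tens_comp:
    "f \<in> words r s \<Longrightarrow> g \<in> words t u \<Longrightarrow> h \<in> words s v \<Longrightarrow> j \<in> words u w \<Longrightarrow>
     derivable \<delta> \<epsilon> (r + t) (v + w)
       (basis ((f \<otimes> g) \<odot> (h \<otimes> j)))
       (scale ((- 1) ^ (word_degree \<epsilon> g * word_degree \<epsilon> h)) (basis ((f \<odot> h) \<otimes> (g \<odot> j))))"
| refl:
    "x \<in> exprs r s \<Longrightarrow> derivable \<delta> \<epsilon> r s x x"
| sym:
    "derivable \<delta> \<epsilon> r s x y \<Longrightarrow> derivable \<delta> \<epsilon> r s y x"
| trans:
    "derivable \<delta> \<epsilon> r s x y \<Longrightarrow> derivable \<delta> \<epsilon> r s y z \<Longrightarrow> derivable \<delta> \<epsilon> r s x z"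
| add:
    "derivable \<delta> \<epsilon> r s x x' \<Longrightarrow> derivable \<delta> \<epsilon> r s y y' \<Longrightarrow> derivable \<delta> \<epsilon> r s (x + y) (x' + y')"
| scale:
    "derivable \<delta> \<epsilon> r s x x' \<Longrightarrow> derivable \<delta> \<epsilon> r s (scale c x) (scale c x')"
| comp:
    "derivable \<delta> \<epsilon> r s x x' \<Longrightarrow> derivable \<delta> \<epsilon> s t y y' \<Longrightarrow>
     derivable \<delta> \<epsilon> r t
       (bilinear_extension (\<lambda>f g. basis (f \<odot> g)) x y)
       (bilinear_extension (\<lambda>f g. basis (f \<odot> g)) x' y')"
| tens:
    "derivable \<delta> \<epsilon> r s x x' \<Longrightarrow> derivable \<delta> \<epsilon> t u y y' \<Longrightarrow>
     derivable \<delta> \<epsilon> (r + t) (s + u)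
       (bilinear_extension (\<lambda>f g. basis (f \<otimes> g)) x y)
       (bilinear_extension (\<lambda>f g. basis (f \<otimes> g)) x' y')"


section \<open>Evaluation in the marked Brauer category\<close>

primrec eval_word :: "'k::field \<Rightarrow> 'k \<Rightarrow> word \<Rightarrow> (diagram \<Rightarrow>\<^sub>0 'k) set" where
  "eval_word \<delta> \<epsilon> Unit = coset \<epsilon> 0 0 (basis ({}, []))"
| "eval_word \<delta> \<epsilon> Strand = coset \<epsilon> 1 1 (basis ({{Top 1, Bot 1}}, []))"
| "eval_word \<delta> \<epsilon> Cross = coset \<epsilon> 2 2 (basis ({{Top 1, Bot 2}, {Top 2, Bot 1}}, []))"
| "eval_word \<delta> \<epsilon> Cup = coset \<epsilon> 2 0 (basis ({{Top 1, Top 2}}, [Bead {Top 1, Top 2}]))"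
| "eval_word \<delta> \<epsilon> Cap = coset \<epsilon> 0 2 (basis ({{Bot 1, Bot 2}}, [Arrow (Bot 1) (Bot 2)]))"
| "eval_word \<delta> \<epsilon> (f \<odot> g) =
     compose \<delta> \<epsilon> (src f) (tgt f) (tgt g) (eval_word \<delta> \<epsilon> f) (eval_word \<delta> \<epsilon> g)"
| "eval_word \<delta> \<epsilon> (f \<otimes> g) =
     tensor \<epsilon> (src f) (tgt f) (src g) (tgt g) (eval_word \<delta> \<epsilon> f) (eval_word \<delta> \<epsilon> g)"

definition eval_expr ::
    "'k::field \<Rightarrow> 'k \<Rightarrow> nat \<Rightarrow> nat \<Rightarrow> (word \<Rightarrow>\<^sub>0 'k) \<Rightarrow> (diagram \<Rightarrow>\<^sub>0 'k) set"
  where "eval_expr \<delta> \<epsilon> r s x =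
    (\<Sum>w\<in>Poly_Mapping.keys x. scale (Poly_Mapping.lookup x w) ` eval_word \<delta> \<epsilon> w)
      + null_space \<epsilon> r s"

text \<open>The morphisms that are homogeneous of degree \<open>p\<close> by virtue of the degrees of the generators.\<close>

definition generated_part ::
    "'k::field \<Rightarrow> 'k \<Rightarrow> nat \<Rightarrow> nat \<Rightarrow> nat \<Rightarrow> (diagram \<Rightarrow>\<^sub>0 'k) set set"
  where "generated_part \<delta> \<epsilon> r s p =
    eval_expr \<delta> \<epsilon> r s ` combinations {w \<in> words r s. word_degree \<epsilon> w = p}"

definition Z2_grading ::
    "'k::field \<Rightarrow> 'k \<Rightarrow> (nat \<Rightarrow> nat \<Rightarrow> nat \<Rightarrow> (diagram \<Rightarrow>\<^sub>0 'k) set set) \<Rightarrow> bool"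
  where "Z2_grading \<delta> \<epsilon> P \<longleftrightarrow>
    (\<forall>r s. \<forall>p\<in>{0, 1}. P r s p \<subseteq> Hom \<epsilon> r s \<and> null_space \<epsilon> r s \<in> P r s p \<and>
       (\<forall>F\<in>P r s p. \<forall>G\<in>P r s p. F + G \<in> P r s p) \<and>
       (\<forall>F\<in>P r s p. \<forall>c. scale c ` F + null_space \<epsilon> r s \<in> P r s p)) \<and>
    (\<forall>r s. \<forall>F\<in>Hom \<epsilon> r s.
       \<exists>!(F0, F1). F0 \<in> P r s 0 \<and> F1 \<in> P r s 1 \<and> F = F0 + F1) \<and>
    (\<forall>r s t. \<forall>p\<in>{0, 1}. \<forall>q\<in>{0, 1}. \<forall>F\<in>P r s p. \<forall>G\<in>P s t q.
       compose \<delta> \<epsilon> r s t F G \<in> P r t ((p + q) mod 2)) \<and>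
    (\<forall>r s t u. \<forall>p\<in>{0, 1}. \<forall>q\<in>{0, 1}. \<forall>F\<in>P r s p. \<forall>G\<in>P t u q.
       tensor \<epsilon> r s t u F G \<in> P (r + t) (s + u) ((p + q) mod 2))"

end

theory Submission
  imports Defs
begin

text \<open>
  Composition is well defined because simplification has an invariant. Place the vertices of a
  loop-free stack at rational heights such that every string is traversed monotonically and
  different strings occupy disjoint ranges; every marking then has a position. The sign of a list
  of markings is \<open>\<epsilon>\<close> to the number of inversions of the positions plus the number of backward
  arrows, and each simplification step changes it exactly by the coefficient of the step. The
  remaining edges are determined by connectivity. Associativity and interchange follow by reducing
  one and the same stack in two orders.

  For completeness, words are rewritten as lists of elementary layers. The relations bend the
  bottom vertices to the top and turn a morphism from \<open>[n]\<close> to \<open>[0]\<close> into a normal form indexed by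
  a list of natural numbers, each entry recording the partner of the first remaining strand. These
  lists correspond to the perfect matchings of \<open>{1..n}\<close>, and the signs, which vanish on no diagram
  but respect the relations of the Hom-spaces, show that the normal forms are linearly independent.
  Unbending carries the independence over to all Hom-spaces, and counting Brauer diagrams shows
  that the normal forms span.

  The gradings agree because the parity of the number of markings depends only on \<open>r\<close> and \<open>s\<close>.
\<close>

section \<open>The sign of a list of markings as an invariant of simplification\<close>

section \<open>Signs of mark lists\<close>

text \<open>Loops are the obstacle to treating composition by rewriting alone: in a stack of three
  diagrams a loop may close at either stage, and in general a loop admits no monotone heights. The
  predicate \<open>reduces\<close> therefore counts closed components and asks for an actual
  simplification only if there are none. This is enough: with a loop present,
  \<open>\<delta> ^ m\<close> vanishes for \<epsilon> = -1, and all signs are 1 for \<epsilon> = 1.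

  In the completeness half no coefficient is computed. Rewriting is done up to a factor 1 or
  \<epsilon>, or up to any scalar once circles are removed, since \<delta> may be 0. The
  coefficients are recovered from soundness: the values of the normal forms are independent, so
  combinations of equal value agree. Spanning is not shown by drawing a given diagram either. The
  normal forms have pairwise different edge sets, and they are at least as numerous as the Brauer
  diagrams for (r, s).

  Characteristic 2 is excluded because degrees are defined by the test \<epsilon> = -1, which has to
  fail for \<epsilon> = 1.\<close>

lemma pow_cong_parity:
  fixes e :: "'k::field"
  assumes "e * e = 1" "even m = even n"
  shows "e ^ m = e ^ n"
proof -
  have ev: "e ^ k = 1" if "even k" for k
    using that assms(1) by (metis evenE power2_eq_square power_mult power_one)
  show ?thesis
  proof (cases "even m")
    case True then show ?thesis using ev assms(2) by simp
  next
    case False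
    then obtain i j where "m = Suc i" "n = Suc j" "even i" "even j"
      using assms(2) by (metis even_Suc odd_pos gr0_conv_Suc)
    then show ?thesis using ev by simp
  qed
qed

primrec inversions :: "rat list \<Rightarrow> nat" where
  "inversions [] = 0"
| "inversions (x # xs) = length (filter (\<lambda>y. y < x) xs) + inversions xs"

lemma inversions_append:
  "inversions (xs @ ys) =
     inversions xs + inversions ys + (\<Sum>x\<leftarrow>xs. length (filter (\<lambda>y. y < x) ys))"
  by (induction xs) auto

lemma inversions_swap:
  assumes "x \<noteq> y"
  shows "even (inversions (L1 @ [x, y] @ L2)) \<longleftrightarrow> odd (inversions (L1 @ [y, x] @ L2))"
proof -
  have *: "(\<Sum>z\<leftarrow>L1. length (filter (\<lambda>w. w < z) ([x, y] @ L2))) =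
      (\<Sum>z\<leftarrow>L1. length (filter (\<lambda>w. w < z) ([y, x] @ L2)))"
    by (intro arg_cong[of _ _ sum_list] map_cong) auto
  show ?thesis
    using assms unfolding inversions_append * by auto
qed

text \<open>Every other entry compares alike with \<open>x\<close> and \<open>y\<close>, so it forms
  two inversions with the pair or none. Only the inversion inside the pair can affect the
  parity.\<close>

lemma inversions_remove:
  assumes "\<And>z. z \<in> set L1 \<union> set L2 ==> z \<noteq> x \<and> z \<noteq> y \<and> (z < x \<longleftrightarrow> z < y)" "x \<noteq> y"
  shows "even (inversions (L1 @ [x, y] @ L2)) \<longleftrightarrow>
    (even (inversions (L1 @ L2)) \<longleftrightarrow> x < y)"
proof -
  have gt: "x < z \<longleftrightarrow> y < z" if "z \<in> set L1 \<union> set L2" for z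
    using assms(1)[OF that] by (metis linorder_neqE not_less_iff_gr_or_eq)
  have "(\<Sum>z\<leftarrow>L1. length (filter (\<lambda>w. w < z) ([x, y] @ L2))) =
      (\<Sum>z\<leftarrow>L1. (if x < z then 2 else 0) + length (filter (\<lambda>w. w < z) L2))"
    using gt by (intro arg_cong[of _ _ sum_list] map_cong) auto
  also have "\<dots> = (\<Sum>z\<leftarrow>L1. (if x < z then 2 else 0)) + (\<Sum>z\<leftarrow>L1. length (filter (\<lambda>w. w < z) L2))"
    by (rule sum_list_addf)
  finally have 1: "(\<Sum>z\<leftarrow>L1. length (filter (\<lambda>w. w < z) ([x, y] @ L2))) = \<dots>" .
  have 2: "even (\<Sum>z\<leftarrow>L1. (if x < z then 2 else (0::nat)))"
    by (induction L1) auto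
  have 3: "filter (\<lambda>w. w < y) L2 = filter (\<lambda>w. w < x) L2"
    using assms(1) by (intro filter_cong) auto
  show ?thesis
    using assms(2) 2 unfolding inversions_append 1 by (auto simp: 3)
qed

lemma inversions_map_cong:
  assumes "\<And>x y. x \<in> set L ==> y \<in> set L ==> f x < f y \<longleftrightarrow> g x < g y"
  shows "inversions (map f L) = inversions (map g L)"
  using assms
proof (induction L)
  case (Cons a L)
  have "filter (\<lambda>y. f y < f a) L = filter (\<lambda>y. g y < g a) L"
    using Cons.prems by (intro filter_cong) auto
  then show ?case using Cons by (simp add: filter_map o_def)
qed simp

section \<open>Linear arrangements\<close>

text \<open>The third condition says that the two ends of an edge are neighbours in the order of
  heights, so each component is a path traversed monotonically. Rational values leave room for
  inserting a vertex between two others.\<close>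

definition arrangement :: "(vertex \<Rightarrow> rat) \<Rightarrow> vertex set set \<Rightarrow> bool" where
  "arrangement \<rho> E \<longleftrightarrow> inj_on \<rho> (\<Union>E) \<and> (\<forall>e\<in>E. card e = 2) \<and>
     (\<forall>u v w. {u, v} \<in> E \<longrightarrow> w \<in> \<Union>E \<longrightarrow> \<rho> u < \<rho> w \<longrightarrow> \<rho> w < \<rho> v \<longrightarrow> False)"

text \<open>On a two-element edge this is twice the midpoint. Positions are only compared, so the
  division is dropped.\<close>

definition position :: "(vertex \<Rightarrow> rat) \<Rightarrow> mark \<Rightarrow> rat" where
  "position \<rho> x = sum \<rho> (mark_edge x)"

primrec backward :: "(vertex \<Rightarrow> rat) \<Rightarrow> mark \<Rightarrow> bool" where
  "backward \<rho> (Bead e) = False"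
| "backward \<rho> (Arrow u v) = (\<rho> v < \<rho> u)"

definition sign :: "'k::field \<Rightarrow> (vertex \<Rightarrow> rat) \<Rightarrow> mark list \<Rightarrow> 'k" where
  "sign \<epsilon> \<rho> L = \<epsilon> ^ (inversions (map (position \<rho>) L) + length (filter (backward \<rho>) L))"

definition marked :: "diagram \<Rightarrow> bool" where
  "marked D \<longleftrightarrow> distinct (map mark_edge (snd D)) \<and> mark_edge ` set (snd D) \<subseteq> fst D"

lemma mark_edge_map_mark [simp]: "mark_edge (map_mark f x) = f ` mark_edge x"
  by (cases x) auto

lemma arrangement_eq: "arrangement \<rho> E ==> u \<in> \<Union>E ==> v \<in> \<Union>E ==> \<rho> u = \<rho> v ==> u = v"
  unfolding arrangement_def inj_on_def by blast

lemma arrangement_between: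
  "arrangement \<rho> E ==> {u, v} \<in> E ==> w \<in> \<Union>E ==> \<rho> u < \<rho> w ==> \<rho> w < \<rho> v ==> False"
  unfolding arrangement_def by blast

lemma arrangement_edge:
  assumes "arrangement \<rho> E" "e \<in> E"
  obtains u v where "e = {u, v}" "\<rho> u < \<rho> v" "u \<noteq> v" "u \<in> \<Union>E" "v \<in> \<Union>E"
proof -
  have "card e = 2" using assms unfolding arrangement_def by blast
  then obtain u v where uv: "e = {u, v}" "u \<noteq> v" by (meson card_2_iff)
  moreover from uv have "u \<in> \<Union>E" "v \<in> \<Union>E" using assms(2) by blast+
  ultimately have "\<rho> u \<noteq> \<rho> v" using arrangement_eq[OF assms(1)] by blast
  then show thesis using that[of u v] that[of v u] uv assms(2) by (cases "\<rho> u < \<rho> v") auto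
qed

text \<open>If the intervals of two edges overlapped, neither could contain an end of the other in
  its interior, so the ends would have to coincide.\<close>

lemma arrangement_separated:
  assumes "arrangement \<rho> E" "{u, v} \<in> E" "{u', v'} \<in> E" "\<rho> u < \<rho> v" "\<rho> u' < \<rho> v'" "{u, v} \<noteq> {u', v'}"
  shows "\<rho> v \<le> \<rho> u' \<or> \<rho> v' \<le> \<rho> u"
proof (rule ccontr)
  assume "\<not> ?thesis"
  then have lt: "\<rho> u' < \<rho> v" "\<rho> u < \<rho> v'" by auto
  have m: "u \<in> \<Union>E" "v \<in> \<Union>E" "u' \<in> \<Union>E" "v' \<in> \<Union>E" using assms by blast+
  have "\<rho> u' \<le> \<rho> u" "\<rho> u \<le> \<rho> u'" "\<rho> v' \<le> \<rho> v" "\<rho> v \<le> \<rho> v'"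
    using arrangement_between[OF assms(1,2) m(3)] arrangement_between[OF assms(1,3) m(1)]
      arrangement_between[OF assms(1,2) m(4)] arrangement_between[OF assms(1,3) m(2)] assms(4,5) lt
    by (meson not_le)+
  then have "u = u'" "v = v'" using arrangement_eq[OF assms(1)] m by auto
  then show False using assms(6) by simp
qed

lemma arrangement_middle:
  assumes "arrangement \<rho> E" "{a, b} \<in> E" "{b, c} \<in> E" "a \<noteq> c"
  shows "(\<rho> a < \<rho> b \<and> \<rho> b < \<rho> c) \<or> (\<rho> c < \<rho> b \<and> \<rho> b < \<rho> a)"
proof -
  have m: "a \<in> \<Union>E" "b \<in> \<Union>E" "c \<in> \<Union>E" using assms by blast+
  have "card {a, b} = 2" "card {b, c} = 2" using assms(1-3) unfolding arrangement_def by blast+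
  then have ne: "a \<noteq> b" "b \<noteq> c" by auto
  have n: "\<rho> a \<noteq> \<rho> b" "\<rho> b \<noteq> \<rho> c" "\<rho> a \<noteq> \<rho> c"
    using arrangement_eq[OF assms(1)] m ne assms(4) by blast+
  have "{b, a} \<in> E" "{c, b} \<in> E" using assms by (simp_all add: insert_commute)
  then show ?thesis
    using arrangement_between[OF assms(1,2) m(3)] arrangement_between[OF assms(1,3) m(1)]
     arrangement_between[OF assms(1) _ m(3), of b a] arrangement_between[OF assms(1) _ m(1), of c b] n
    by (metis linorder_less_linear)
qed

lemma position_distinct:
  assumes "arrangement \<rho> E" "mark_edge x \<in> E" "mark_edge y \<in> E" "mark_edge x \<noteq> mark_edge y"
  shows "position \<rho> x \<noteq> position \<rho> y"
proof -
  obtain u v where 1: "mark_edge x = {u, v}" "\<rho> u < \<rho> v" "u \<noteq> v" using arrangement_edge assms(1,2) by metis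
  obtain u' v' where 2: "mark_edge y = {u', v'}" "\<rho> u' < \<rho> v'" "u' \<noteq> v'" using arrangement_edge assms(1,3) by metis
  have "\<rho> v \<le> \<rho> u' \<or> \<rho> v' \<le> \<rho> u" using arrangement_separated[of \<rho> E u v u' v'] assms 1 2 by simp
  then show ?thesis using 1 2 by (auto simp: position_def)
qed

text \<open>Contraction of {a, b} onto \<open>a\<close> with the heights kept. If \<open>b\<close>
  has a second neighbour, \<open>b\<close> lies between it and \<open>a\<close>, so the new edge
  covers exactly two adjacent intervals.\<close>

locale contraction =
  fixes \<rho> E a b
  assumes arr: "arrangement \<rho> E" and ab: "{a, b} \<in> E" and ne: "a \<noteq> b"
begin

definition "f = id(b := a)"

lemma edge_cases:
  assumes "e \<in> E - {{a, b}}"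
  obtains "b \<notin> e" "f ` e = e"
  | c where "e = {b, c}" "c \<noteq> a" "c \<noteq> b" "f ` e = {a, c}"
      "(\<rho> a < \<rho> b \<and> \<rho> b < \<rho> c) \<or> (\<rho> c < \<rho> b \<and> \<rho> b < \<rho> a)"
proof (cases "b \<in> e")
  case False
  then have "f ` e = e" by (auto simp: f_def image_def)
  with False that show ?thesis by blast
next
  case True
  obtain u v where "e = {u, v}" "u \<noteq> v" using arrangement_edge[OF arr] assms by blast
  then obtain c where c: "e = {b, c}" "c \<noteq> b" using True by (metis doubleton_eq_iff insert_iff singletonD)
  moreover from this have "c \<noteq> a" using assms by (auto simp: insert_commute)
  moreover have "f ` e = {a, c}" using c by (auto simp: f_def)
  ultimately show ?thesis using that(2)[of c] arrangement_middle[OF arr ab, of c] assms by blast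
qed

text \<open>Two further neighbours of \<open>b\<close> would both lie on the side away from
  \<open>a\<close>, and yet on different sides of \<open>b\<close>.\<close>

lemma unique_other:
  assumes "{b, c} \<in> E" "{b, c'} \<in> E" "c \<noteq> a" "c' \<noteq> a"
  shows "c = c'"
proof (rule ccontr)
  assume n: "c \<noteq> c'"
  have "{c, b} \<in> E" using assms(1) by (simp add: insert_commute)
  from arrangement_middle[OF arr this assms(2) n] arrangement_middle[OF arr ab assms(1)] arrangement_middle[OF arr ab assms(2)]
  show False using assms(3,4) by force
qed

text \<open>The vertex \<open>b\<close> would lie strictly between the ends of such an edge.\<close>

lemma no_shortcut: "{b, c} \<in> E ==> c \<noteq> a ==> {a, c} \<notin> E"
proof
  assume 1: "{b, c} \<in> E" "c \<noteq> a" "{a, c} \<in> E"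
  then have 2: "{c, a} \<in> E" by (simp add: insert_commute)
  have "b \<in> \<Union>E" using ab by blast
  from arrangement_between[OF arr 1(3) this] arrangement_between[OF arr 2 this]
    arrangement_middle[OF arr ab 1(1) 1(2)[symmetric]] show False by argo
qed

lemma inj_edges: "inj_on ((`) f) (E - {{a, b}})"
proof (rule inj_onI)
  fix e e' assume e: "e \<in> E - {{a, b}}" and e': "e' \<in> E - {{a, b}}" and eq: "f ` e = f ` e'"
  show "e = e'"
    using e
  proof (cases rule: edge_cases)
    case 1 note c = this
    show ?thesis using e'
    proof (cases rule: edge_cases)
      case 1 then show ?thesis using eq c(2) by (simp only:)
    next
      case (2 c)
      have "e = {a, c}" using eq 2(4) \<open>f ` e = e\<close> by (simp only:)
      moreover have "{b, c} \<in> E" using DiffD1[OF e'] unfolding 2(1) .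
      ultimately show ?thesis using no_shortcut[of c] 2(2) DiffD1[OF e] by simp
    qed
  next
    case (2 c) note c = this
    have bc: "{b, c} \<in> E" using DiffD1[OF e] unfolding c(1) .
    show ?thesis using e'
    proof (cases rule: edge_cases)
      case 1
      have "e' = {a, c}" using eq c(4) 1(2) by (simp only:)
      then show ?thesis using no_shortcut[of c] c(2) bc DiffD1[OF e'] by simp
    next
      case (2 c')
      have "{b, c'} \<in> E" using DiffD1[OF e'] unfolding 2(1) .
      then have "c = c'" by (rule unique_other[OF bc _ c(2) 2(2)])
      then show ?thesis using c(1) 2(1) by (simp only:)
    qed
  qed
qed

lemma vertices: "\<Union>(map_edges f (E - {{a, b}})) \<subseteq> \<Union>E - {b}"
proof
  fix w assume "w \<in> \<Union>(map_edges f (E - {{a, b}}))"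
  then obtain e where e: "e \<in> E - {{a, b}}" "w \<in> f ` e" by (auto simp: map_edges_def)
  from e(1) show "w \<in> \<Union>E - {b}" using e ab ne by (cases rule: edge_cases) (auto simp: f_def split: if_splits)
qed

lemma arrangement_contract: "arrangement \<rho> (map_edges f (E - {{a, b}}))"
  unfolding arrangement_def
proof (intro conjI ballI allI impI)
  show "inj_on \<rho> (\<Union> (map_edges f (E - {{a, b}})))"
    using arr vertices unfolding arrangement_def by (meson Diff_subset inj_on_subset)
  fix e' assume "e' \<in> map_edges f (E - {{a, b}})"
  then obtain e where e: "e \<in> E - {{a, b}}" "e' = f ` e" by (auto simp: map_edges_def)
  have "card e = 2" using arr e unfolding arrangement_def by blast
  with e(1) show "card e' = 2" using e by (cases rule: edge_cases) auto
next
  fix u v w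
  assume uv: "{u, v} \<in> map_edges f (E - {{a, b}})"
    and w: "w \<in> \<Union> (map_edges f (E - {{a, b}}))" and lt: "\<rho> u < \<rho> w" "\<rho> w < \<rho> v"
  from uv obtain e where e: "e \<in> E - {{a, b}}" "{u, v} = f ` e" by (auto simp: map_edges_def)
  have w': "w \<in> \<Union>E" "w \<noteq> b" using w vertices by auto
  have ba: "{b, a} \<in> E" using ab by (simp add: insert_commute)
  have wb: "\<rho> w \<noteq> \<rho> b" using arrangement_eq[OF arr] w' ab by blast
  from e(1) show False
  proof (cases rule: edge_cases)
    case 1 then show ?thesis using arrangement_between[OF arr _ w'(1) lt] e by simp
  next
    case (2 c)
    then have bc: "{b, c} \<in> E" "{c, b} \<in> E" using e by (auto simp: insert_commute)
    have "{u, v} = {a, c}" unfolding 2(4)[symmetric] by (rule e(2))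
    then have "(u = a \<and> v = c) \<or> (u = c \<and> v = a)" by (simp only: doubleton_eq_iff)
    then show ?thesis
    proof
      assume uv: "u = a \<and> v = c"
      then have o: "\<rho> a < \<rho> b" "\<rho> b < \<rho> c" using 2(5) lt by auto
      show ?thesis
      proof (cases "\<rho> w < \<rho> b")
        case True then show ?thesis using arrangement_between[OF arr ab w'(1)] lt uv by simp
      next
        case False then show ?thesis using arrangement_between[OF arr bc(1) w'(1)] lt uv wb by simp
      qed
    next
      assume uv: "u = c \<and> v = a"
      then have o: "\<rho> c < \<rho> b" "\<rho> b < \<rho> a" using 2(5) lt by auto
      show ?thesis
      proof (cases "\<rho> w < \<rho> b")
        case True then show ?thesis using arrangement_between[OF arr bc(2) w'(1)] lt uv by simp
      next
        case False then show ?thesis using arrangement_between[OF arr ba w'(1)] lt uv wb by simp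
      qed
    qed
  qed
qed

text \<open>Intervals of distinct edges do not overlap, neither before nor after the contraction. An
  edge that avoids {b, c} as well as {a, c} in this sense lies on the same side of both, so passing
  from one to the other does not reorder positions.\<close>

lemma less_contract:
  assumes x: "mark_edge x \<in> E - {{a, b}}" and y: "mark_edge y \<in> E - {{a, b}}"
  shows "position \<rho> (map_mark f x) < position \<rho> (map_mark f y) \<longleftrightarrow> position \<rho> x < position \<rho> y"
proof (cases "mark_edge x = mark_edge y")
  case True then show ?thesis by (simp add: position_def)
next
  case False
  then have F: "f ` mark_edge x \<noteq> f ` mark_edge y" using inj_edges x y by (auto simp: inj_on_def)
  let ?E = "map_edges f (E - {{a, b}})"
  have inE: "f ` mark_edge x \<in> ?E" "f ` mark_edge y \<in> ?E" using x y by (auto simp: map_edges_def)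
  have key: "(sum \<rho> {a, c} < sum \<rho> g \<longleftrightarrow> sum \<rho> {b, c} < sum \<rho> g) \<and>
     (sum \<rho> g < sum \<rho> {a, c} \<longleftrightarrow> sum \<rho> g < sum \<rho> {b, c})"
    if c: "{b, c} \<in> E" "c \<noteq> a" "c \<noteq> b" "(\<rho> a < \<rho> b \<and> \<rho> b < \<rho> c) \<or> (\<rho> c < \<rho> b \<and> \<rho> b < \<rho> a)"
      "{a, c} \<in> ?E" and g: "g \<in> E" "g \<in> ?E" "g \<noteq> {b, c}" "g \<noteq> {a, c}" for c g
  proof -
    obtain u v where uv: "g = {u, v}" "\<rho> u < \<rho> v" "u \<noteq> v" using arrangement_edge[OF arr g(1)] by metis
    have s: "sum \<rho> {a, c} = \<rho> a + \<rho> c" "sum \<rho> {b, c} = \<rho> b + \<rho> c" "sum \<rho> g = \<rho> u + \<rho> v"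
      using c ne uv by auto
    have ca: "{c, b} \<in> E" "{c, a} \<in> ?E" using c(1,5) by (simp_all only: insert_commute)
    have uvE: "{u, v} \<in> E" "{u, v} \<in> ?E" using g(1,2) unfolding uv(1) .
    have n: "{b, c} \<noteq> {u, v}" "{a, c} \<noteq> {u, v}" "{c, b} \<noteq> {u, v}" "{c, a} \<noteq> {u, v}"
      using g(3,4) unfolding uv(1) by (metis insert_commute)+
    from c(4) show ?thesis
    proof
      assume o: "\<rho> a < \<rho> b \<and> \<rho> b < \<rho> c"
      then have "\<rho> a < \<rho> c" by simp
      from arrangement_separated[OF arr c(1) uvE(1) _ uv(2) n(1)]
        arrangement_separated[OF arrangement_contract c(5) uvE(2) this uv(2) n(2)]
      show ?thesis using o uv(2) unfolding s by auto
    next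
      assume o: "\<rho> c < \<rho> b \<and> \<rho> b < \<rho> a"
      then have "\<rho> c < \<rho> a" by simp
      from arrangement_separated[OF arr ca(1) uvE(1) _ uv(2) n(3)]
        arrangement_separated[OF arrangement_contract ca(2) uvE(2) this uv(2) n(4)]
      show ?thesis using o uv(2) unfolding s by auto
    qed
  qed
  show ?thesis using x
  proof (cases rule: edge_cases)
    case 1 note c = this
    show ?thesis using y
    proof (cases rule: edge_cases)
      case 1 then show ?thesis using c(2) by (simp add: position_def)
    next
      case (2 d)
      have m: "{b, d} \<in> E" "mark_edge x \<in> E" using DiffD1[OF y] DiffD1[OF x] unfolding 2(1) .
      have "mark_edge x \<in> ?E" "{a, d} \<in> ?E" using inE by (simp_all only: c(2) 2(4))
      moreover have "mark_edge x \<noteq> {a, d}" using F unfolding c(2) 2(4) .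
      moreover have "mark_edge x \<noteq> {b, d}" using False unfolding 2(1) .
      ultimately have "sum \<rho> (mark_edge x) < sum \<rho> {a, d} \<longleftrightarrow> sum \<rho> (mark_edge x) < sum \<rho> {b, d}"
        using key[OF m(1) 2(2,3,5) _ m(2)] by blast
      then show ?thesis unfolding position_def mark_edge_map_mark c(2) 2(4) unfolding 2(1) .
    qed
  next
    case (2 d) note c = this
    have bd: "{b, d} \<in> E" using DiffD1[OF x] unfolding c(1) .
    show ?thesis using y
    proof (cases rule: edge_cases)
      case 1
      have m: "mark_edge y \<in> E" using y by (rule DiffD1)
      have "mark_edge y \<in> ?E" "{a, d} \<in> ?E" using inE by (simp_all only: 1(2) c(4))
      moreover have "mark_edge y \<noteq> {a, d}" using F[symmetric] unfolding 1(2) c(4) .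
      moreover have "mark_edge y \<noteq> {b, d}" using False[symmetric] unfolding c(1) .
      ultimately have "sum \<rho> {a, d} < sum \<rho> (mark_edge y) \<longleftrightarrow> sum \<rho> {b, d} < sum \<rho> (mark_edge y)"
        using key[OF bd c(2,3,5) _ m] by blast
      then show ?thesis unfolding position_def mark_edge_map_mark 1(2) c(4) unfolding c(1) .
    next
      case (2 c')
      have "{b, c'} \<in> E" using DiffD1[OF y] unfolding 2(1) .
      then have "d = c'" by (rule unique_other[OF bd _ c(2) 2(2)])
      then have "mark_edge x = mark_edge y" by (simp only: c(1) 2(1))
      then show ?thesis using False by contradiction
    qed
  qed
qed

lemma backward_contract:
  assumes x: "mark_edge x \<in> E - {{a, b}}"
  shows "backward \<rho> (map_mark f x) \<longleftrightarrow> backward \<rho> x"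
proof (cases x)
  case (Arrow u v)
  from x show ?thesis
  proof (cases rule: edge_cases)
    case 1
    from 1(1) show ?thesis using Arrow by (auto simp: f_def)
  next
    case (2 c)
    have "f b = a" "f c = c" using 2(3) by (simp_all add: f_def)
    moreover have "{u, v} = {b, c}" using 2(1) Arrow by simp
    then have "(u = b \<and> v = c) \<or> (u = c \<and> v = b)" by (simp only: doubleton_eq_iff)
    ultimately show ?thesis using Arrow 2(5) by force
  qed
qed simp

lemma sign_contract:
  assumes "mark_edge ` set L \<subseteq> E - {{a, b}}"
  shows "sign \<epsilon> \<rho> (map (map_mark f) L) = sign \<epsilon> \<rho> L"
proof -
  have "inversions (map (position \<rho> \<circ> map_mark f) L) = inversions (map (position \<rho>) L)"
    using assms less_contract by (intro inversions_map_cong) (auto simp: image_subset_iff)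
  moreover have "filter (backward \<rho> \<circ> map_mark f) L = filter (backward \<rho>) L"
    using assms backward_contract by (intro filter_cong) (auto simp: image_subset_iff)
  ultimately show ?thesis by (simp add: sign_def filter_map)
qed

end

lemma sign_swap:
  assumes "\<epsilon> * \<epsilon> = 1" "arrangement \<rho> E" "marked (E, L1 @ [x, y] @ L2)"
  shows "sign \<epsilon> \<rho> (L1 @ [x, y] @ L2) = \<epsilon> * sign \<epsilon> \<rho> (L1 @ [y, x] @ L2)"
proof -
  have "position \<rho> x \<noteq> position \<rho> y"
    using assms by (intro position_distinct) (auto simp: marked_def)
  from inversions_swap[OF this, of "map (position \<rho>) L1" "map (position \<rho>) L2"]
  show ?thesis unfolding sign_def power_Suc[symmetric]
    by (intro pow_cong_parity[OF assms(1)]) auto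
qed

lemma sign_reverse:
  assumes "\<epsilon> * \<epsilon> = 1" "arrangement \<rho> E" "marked (E, L1 @ [Arrow u v] @ L2)"
  shows "sign \<epsilon> \<rho> (L1 @ [Arrow u v] @ L2) = \<epsilon> * sign \<epsilon> \<rho> (L1 @ [Arrow v u] @ L2)"
proof -
  have e: "{u, v} \<in> E" using assms by (auto simp: marked_def)
  then have "card {u, v} = 2" using assms(2) unfolding arrangement_def by blast
  then have "\<rho> u \<noteq> \<rho> v" using e arrangement_eq[OF assms(2)] by (metis Union_iff card_2_iff doubleton_eq_iff insertI1 insert_absorb2)
  then show ?thesis unfolding sign_def power_Suc[symmetric]
    by (intro pow_cong_parity[OF assms(1)]) (auto simp: position_def insert_commute)
qed

text \<open>The two edges occupy adjacent intervals, so no other position falls between those of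
  \<open>x\<close> and \<open>y\<close>, and inversions with other markings come in pairs. What
  remains is the inversion inside the pair, decided by the side of \<open>b\<close> on which
  \<open>a\<close> lies, and the directions of the two markings. For a bead and an arrow this is the
  case distinction of the four cancellation rules.\<close>

lemma sign_cancel:
  assumes "\<epsilon> * \<epsilon> = 1" "arrangement \<rho> E" "marked (E, L1 @ [x, y] @ L2)"
    "mark_edge x = {a, b} \<and> mark_edge y = {b, c}"
  shows "sign \<epsilon> \<rho> (L1 @ [x, y] @ L2) =
    (if (\<rho> a < \<rho> b) = (backward \<rho> x = backward \<rho> y) then 1 else \<epsilon>) * sign \<epsilon> \<rho> (L1 @ L2)" (is ?goal)
    and "(\<rho> a < \<rho> b \<and> \<rho> b < \<rho> c) \<or> (\<rho> c < \<rho> b \<and> \<rho> b < \<rho> a)"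
proof -
  have xy: "mark_edge x \<in> E" "mark_edge y \<in> E" "mark_edge x \<noteq> mark_edge y"
    using assms(3) by (auto simp: marked_def)
  have E: "{a, b} \<in> E" "{b, c} \<in> E" and n: "{a, b} \<noteq> {b, c}"
    using xy assms(4) by simp_all
  have ac: "a \<noteq> c" using n by (metis insert_commute)
  note mid = arrangement_middle[OF assms(2) E ac]
  then show "(\<rho> a < \<rho> b \<and> \<rho> b < \<rho> c) \<or> (\<rho> c < \<rho> b \<and> \<rho> b < \<rho> a)" .
  have c2: "a \<noteq> b" "b \<noteq> c" using mid by auto
  have p: "position \<rho> x = \<rho> a + \<rho> b" "position \<rho> y = \<rho> b + \<rho> c"
    using c2 assms(4) by (auto simp: position_def)
  have r: "z \<noteq> position \<rho> x \<and> z \<noteq> position \<rho> y \<and> (z < position \<rho> x \<longleftrightarrow> z < position \<rho> y)"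
    if z: "z \<in> set (map (position \<rho>) L1) \<union> set (map (position \<rho>) L2)" for z
  proof -
    obtain m where m: "z = position \<rho> m" "m \<in> set L1 \<union> set L2" using z by auto
    have d: "distinct (map mark_edge (L1 @ [x, y] @ L2))" using assms(3) by (simp add: marked_def)
    have "mark_edge m \<noteq> mark_edge x" "mark_edge m \<noteq> mark_edge y"
      using d m(2) by (auto simp: image_iff)
    moreover have "mark_edge m \<in> E" using m(2) assms(3) by (auto simp: marked_def)
    ultimately have mE: "mark_edge m \<in> E" "mark_edge m \<noteq> {a, b}" "mark_edge m \<noteq> {b, c}"
      using assms(4) by simp_all
    obtain u v where uv: "mark_edge m = {u, v}" "\<rho> u < \<rho> v" "u \<noteq> v"
      using arrangement_edge[OF assms(2) mE(1)] by metis
    have zz: "z = \<rho> u + \<rho> v" using m uv by (simp add: position_def)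
    have uvE: "{u, v} \<in> E" using mE(1) unfolding uv(1) .
    have E': "{b, a} \<in> E" "{c, b} \<in> E" using E by (simp_all only: insert_commute)
    have n': "{a, b} \<noteq> {u, v}" "{b, c} \<noteq> {u, v}" "{b, a} \<noteq> {u, v}" "{c, b} \<noteq> {u, v}"
      using mE(2,3) unfolding uv(1) by (metis insert_commute)+
    from mid show ?thesis
    proof
      assume o: "\<rho> a < \<rho> b \<and> \<rho> b < \<rho> c"
      from arrangement_separated[OF assms(2) E(1) uvE _ uv(2) n'(1)]
        arrangement_separated[OF assms(2) E(2) uvE _ uv(2) n'(2)]
      show ?thesis using o uv(2) unfolding p zz by auto
    next
      assume o: "\<rho> c < \<rho> b \<and> \<rho> b < \<rho> a"
      from arrangement_separated[OF assms(2) E'(1) uvE _ uv(2) n'(3)]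
        arrangement_separated[OF assms(2) E'(2) uvE _ uv(2) n'(4)]
      show ?thesis using o uv(2) unfolding p zz by auto
    qed
  qed
  have "position \<rho> x \<noteq> position \<rho> y" using mid p by auto
  from inversions_remove[of "map (position \<rho>) L1" "map (position \<rho>) L2", OF r this]
  have "even (inversions (map (position \<rho>) (L1 @ [x, y] @ L2))) \<longleftrightarrow>
     (even (inversions (map (position \<rho>) (L1 @ L2))) \<longleftrightarrow> \<rho> a < \<rho> b)"
    using mid by (auto simp: p)
  moreover have "even (length (filter (backward \<rho>) (L1 @ [x, y] @ L2))) \<longleftrightarrow>
     (even (length (filter (backward \<rho>) (L1 @ L2))) \<longleftrightarrow> backward \<rho> x = backward \<rho> y)"
    by simp
  ultimately have par: "even (inversions (map (position \<rho>) (L1 @ [x, y] @ L2)) + length (filter (backward \<rho>) (L1 @ [x, y] @ L2))) \<longleftrightarrow>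
     (even (inversions (map (position \<rho>) (L1 @ L2)) + length (filter (backward \<rho>) (L1 @ L2))) \<longleftrightarrow>
      (\<rho> a < \<rho> b) = (backward \<rho> x = backward \<rho> y))"
    unfolding even_add by argo
  show ?goal
  proof (cases "(\<rho> a < \<rho> b) = (backward \<rho> x = backward \<rho> y)")
    case True
    have "sign \<epsilon> \<rho> (L1 @ [x, y] @ L2) = sign \<epsilon> \<rho> (L1 @ L2)"
      unfolding sign_def by (rule pow_cong_parity[OF assms(1)]) (use par True in blast)
    then show ?goal using True by simp
  next
    case False
    have "sign \<epsilon> \<rho> (L1 @ [x, y] @ L2) = \<epsilon> * sign \<epsilon> \<rho> (L1 @ L2)"
      unfolding sign_def power_Suc[symmetric]
      by (rule pow_cong_parity[OF assms(1)]) (use par False in \<open>simp only: even_Suc simp_thms\<close>)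
    then show ?goal unfolding if_not_P[OF False] .
  qed
qed

text \<open>One and the same \<rho> serves the whole simplification: a contraction keeps the heights
  of the surviving vertices, and the other rules do not touch the edges.\<close>

lemma simplify_step_sign:
  assumes "simplify_step \<epsilon> D c D'" and e: "\<epsilon> * \<epsilon> = 1" "arrangement \<rho> (fst D)" "marked D"
  shows "arrangement \<rho> (fst D') \<and> marked D' \<and> sign \<epsilon> \<rho> (snd D) = c * sign \<epsilon> \<rho> (snd D')"
  using assms(1)
proof cases
  case (interchange E L1 x y L2)
  then show ?thesis using sign_swap[of \<epsilon> \<rho> E L1 x y L2] e by (auto simp: marked_def)
next
  case (contract a b E L)
  interpret contraction \<rho> E a b using contract e by unfold_locales auto
  have L: "mark_edge ` set L \<subseteq> E - {{a, b}}" using e contract by (auto simp: marked_def)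
  have "distinct (map ((`) f) (map mark_edge L))"
    using e contract L inj_edges by (subst distinct_map) (auto simp: marked_def inj_on_subset)
  moreover have "mark_edge ` set (map (map_mark f) L) = (`) f ` (mark_edge ` set L)"
    by (simp add: image_image)
  ultimately have "marked (map_edges f (E - {{a, b}}), map (map_mark f) L)"
    using image_mono[OF L, of "(`) f"] by (simp add: marked_def map_edges_def o_def)
  then show ?thesis using arrangement_contract sign_contract[OF L, symmetric] unfolding contract(1-3) f_def by simp
next
  case (arrow_above_towards b E L1 c a L2)
  then have "sign \<epsilon> \<rho> (snd D) = sign \<epsilon> \<rho> (snd D')"
    using sign_cancel[OF e(1), of \<rho> E L1 "Arrow c b" "Bead {a, b}" L2 c b a] e(2,3)
    by (auto simp: insert_commute)
  then show ?thesis using e arrow_above_towards by (auto simp: marked_def)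
next
  case (bead_above_away b E L1 a c L2)
  then have "sign \<epsilon> \<rho> (snd D) = sign \<epsilon> \<rho> (snd D')"
    using sign_cancel[OF e(1), of \<rho> E L1 "Bead {a, b}" "Arrow b c" L2 a b c] e(2,3)
    by (auto simp: insert_commute)
  then show ?thesis using e bead_above_away by (auto simp: marked_def)
next
  case (arrow_above_away b E L1 c a L2)
  then have "sign \<epsilon> \<rho> (snd D) = \<epsilon> * sign \<epsilon> \<rho> (snd D')"
    using sign_cancel[OF e(1), of \<rho> E L1 "Arrow b c" "Bead {a, b}" L2 c b a] e(2,3)
    by (auto simp: insert_commute)
  then show ?thesis using e arrow_above_away by (auto simp: marked_def)
next
  case (bead_above_towards b E L1 a c L2)
  then have "sign \<epsilon> \<rho> (snd D) = \<epsilon> * sign \<epsilon> \<rho> (snd D')"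
    using sign_cancel[OF e(1), of \<rho> E L1 "Bead {a, b}" "Arrow c b" L2 a b c] e(2,3)
    by (auto simp: insert_commute)
  then show ?thesis using e bead_above_towards by (auto simp: marked_def)
qed

lemma simplifies_to_sign:
  assumes "simplifies_to \<epsilon> D c D'" "\<epsilon> * \<epsilon> = 1" "arrangement \<rho> (fst D)" "marked D"
  shows "arrangement \<rho> (fst D') \<and> marked D' \<and> sign \<epsilon> \<rho> (snd D) = c * sign \<epsilon> \<rho> (snd D')"
  using assms
proof (induction)
  case (step D c D' c' D'')
  then show ?case using simplify_step_sign[OF step(1)] by auto
qed simp

lemma simplifies_to_trans:
  "simplifies_to \<epsilon> D c D' ==> simplifies_to \<epsilon> D' c' D'' ==> simplifies_to \<epsilon> D (c * c') D''"
proof (induction rule: simplifies_to.induct)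
  case (step D c D1 c1 D2)
  then show ?case using simplifies_to.step[OF step(1)] by (simp add: mult.assoc)
qed simp

lemma simplifies_to_step: "simplify_step \<epsilon> D c D' ==> simplifies_to \<epsilon> D c D'"
  using simplifies_to.step[OF _ simplifies_to.stop] by simp

lemma simplify_step_coeff: "simplify_step \<epsilon> D c D' ==> c \<in> {1, \<epsilon>}"
  by (induction rule: simplify_step.induct) auto

lemma simplifies_to_coeff: "simplifies_to \<epsilon> D c D' ==> \<epsilon> * \<epsilon> = 1 ==> c \<in> {1, \<epsilon>}"
proof (induction rule: simplifies_to.induct)
  case (step D c D1 c1 D2)
  then show ?case using simplify_step_coeff[OF step(1)] by auto
qed simp

section \<open>Connectivity\<close>

lemma connected_edge: "e \<in> E ==> u \<in> e ==> v \<in> e ==> (u, v) \<in> connected_by E"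
  unfolding connected_by_def by (rule r_into_rtrancl) auto

lemma connected_refl [simp]: "(u, u) \<in> connected_by E"
  unfolding connected_by_def by simp

lemma connected_trans: "(u, v) \<in> connected_by E ==> (v, w) \<in> connected_by E ==> (u, w) \<in> connected_by E"
  unfolding connected_by_def by (rule rtrancl_trans)

lemma connected_sym: "(u, v) \<in> connected_by E ==> (v, u) \<in> connected_by E"
  unfolding connected_by_def by (rule symD[OF sym_rtrancl]) (auto simp: sym_def)

lemma connected_map:
  assumes "(u, v) \<in> connected_by E"
    "\<And>e u v. e \<in> E ==> u \<in> e ==> v \<in> e ==> (f u, f v) \<in> connected_by E'"
  shows "(f u, f v) \<in> connected_by E'"
  using assms(1) unfolding connected_by_def[of E]
proof (induction rule: rtrancl_induct)
  case (step v w)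
  then show ?case using assms(2) connected_trans by blast
qed simp

lemma connected_mono: "(u, v) \<in> connected_by E ==> E \<subseteq> E' ==> (u, v) \<in> connected_by E'"
  using connected_map[of u v E id E'] connected_edge by (metis id_apply subsetD)

lemma connected_in: "(u, v) \<in> connected_by E ==> u = v \<or> (u \<in> \<Union>E \<and> v \<in> \<Union>E)"
  unfolding connected_by_def by (induction rule: rtrancl_induct) auto

text \<open>Sending \<open>b\<close> to \<open>a\<close> maps paths to paths. Conversely every
  vertex is connected in \<open>E\<close> with its image, by the edge {a, b} itself.\<close>

lemma connected_contract:
  assumes "{a, b} \<in> E" "a \<noteq> b" "u \<noteq> b" "v \<noteq> b"
  shows "(u, v) \<in> connected_by (map_edges (id(b := a)) (E - {{a, b}})) \<longleftrightarrow> (u, v) \<in> connected_by E"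
    (is "_ \<in> connected_by ?E \<longleftrightarrow> _")
proof
  let ?f = "id(b := a)"
  assume "(u, v) \<in> connected_by E"
  then have "(?f u, ?f v) \<in> connected_by ?E"
  proof (rule connected_map)
    fix e x y assume e: "e \<in> E" "x \<in> e" "y \<in> e"
    show "(?f x, ?f y) \<in> connected_by ?E"
    proof (cases "e = {a, b}")
      case True then show ?thesis using e by auto
    next
      case False
      then have "?f ` e \<in> ?E" using e by (auto simp: map_edges_def)
      then show ?thesis using connected_edge[of "?f ` e" ?E "?f x" "?f y"] e by blast
    qed
  qed
  then show "(u, v) \<in> connected_by ?E" using assms by simp
next
  let ?f = "id(b := a)"
  assume "(u, v) \<in> connected_by ?E"
  then have "(id u, id v) \<in> connected_by E"
  proof (rule connected_map)
    fix e x y assume e: "e \<in> ?E" "x \<in> e" "y \<in> e"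
    then obtain g where g': "g \<in> E" "e = ?f ` g" unfolding map_edges_def by blast
    obtain x' y' where g: "g \<in> E" "x = ?f x'" "y = ?f y'" "x' \<in> g" "y' \<in> g"
      using e(2,3) g'(1) unfolding g'(2) by blast
    have *: "(?f z, z) \<in> connected_by E" for z using connected_edge[OF assms(1)] by auto
    have "(x', y') \<in> connected_by E" using connected_edge g by blast
    then show "(id x, id y) \<in> connected_by E"
      using *[of x'] *[of y'] g(2,3) by (metis connected_sym connected_trans id_apply)
  qed
  then show "(u, v) \<in> connected_by E" by simp
qed

lemma simplify_step_connected:
  assumes "simplify_step \<epsilon> D c D'"
  shows "\<Union>(fst D') \<subseteq> \<Union>(fst D) \<and> (\<forall>u\<in>\<Union>(fst D'). \<forall>v\<in>\<Union>(fst D').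
    (u, v) \<in> connected_by (fst D') \<longleftrightarrow> (u, v) \<in> connected_by (fst D))"
  using assms
proof cases
  case (contract a b E L)
  have D: "fst D = E" "fst D' = map_edges (id(b := a)) (E - {{a, b}})" unfolding contract(1,3) by simp_all
  have im: "(id(b := a)) ` e \<subseteq> insert a (e - {b})" for e :: "vertex set" by auto
  have sub: "w \<in> \<Union>E \<and> w \<noteq> b" if w: "w \<in> \<Union>(fst D')" for w
  proof -
    have "w \<in> (\<Union>e\<in>E - {{a, b}}. (id(b := a)) ` e)" using w unfolding D map_edges_def .
    then obtain e where e: "e \<in> E - {{a, b}}" "w \<in> (id(b := a)) ` e" by (elim UN_E)
    have "w \<in> insert a (e - {b})" using im e(2) by (rule subsetD)
    moreover have "a \<in> \<Union>E" using contract(4) by (meson UnionI insertI1)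
    moreover have "e \<in> E" using e(1) by (rule DiffD1)
    ultimately show ?thesis using contract(5) by (metis DiffE UnionI insert_iff)
  qed
  have "(u, v) \<in> connected_by (fst D') \<longleftrightarrow> (u, v) \<in> connected_by E"
    if "u \<in> \<Union>(fst D')" "v \<in> \<Union>(fst D')" for u v
    unfolding D by (rule connected_contract[OF contract(4,5)]) (use that sub in simp_all)
  then show ?thesis using sub unfolding D(1) by (meson subsetI)
qed auto

lemma simplifies_to_connected:
  assumes "simplifies_to \<epsilon> D c D'"
  shows "\<Union>(fst D') \<subseteq> \<Union>(fst D) \<and> (\<forall>u\<in>\<Union>(fst D'). \<forall>v\<in>\<Union>(fst D').
    (u, v) \<in> connected_by (fst D') \<longleftrightarrow> (u, v) \<in> connected_by (fst D))"
  using assms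
proof induction
  case (step D c D' c' D'')
  note 1 = simplify_step_connected[OF step(1)]
  show ?case
  proof (intro conjI ballI)
    show "\<Union>(fst D'') \<subseteq> \<Union>(fst D)" using 1 step.IH by (meson subset_trans)
    fix u v assume uv: "u \<in> \<Union>(fst D'')" "v \<in> \<Union>(fst D'')"
    then have "u \<in> \<Union>(fst D')" "v \<in> \<Union>(fst D')" using step.IH by (meson subsetD)+
    then show "(u, v) \<in> connected_by (fst D'') \<longleftrightarrow> (u, v) \<in> connected_by (fst D)"
      using bspec[OF bspec[OF conjunct2[OF 1]]] bspec[OF bspec[OF conjunct2[OF step.IH]]] uv by metis
  qed
qed simp

section \<open>Strings of a loop-free stack: their heights and the reduction of their
  markings\<close>

section \<open>Systems of strings\<close>

text \<open>\<open>d e v\<close> labels the end of \<open>e\<close> at \<open>v\<close>; in a stack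
  of two diagrams it says that the edge leaves \<open>v\<close> downwards. A top vertex has one
  edge, labelled True, a bottom vertex one, labelled False, and a glued vertex one of each. The last
  clause excludes closed loops. In this abstract form the condition survives the removal of a glued
  vertex, after which an edge need not come from one of the two diagrams.\<close>

definition ready :: "(vertex set \<Rightarrow> vertex \<Rightarrow> bool) \<Rightarrow> vertex set set \<Rightarrow> bool" where
  "ready d E \<longleftrightarrow> finite E \<and> (\<forall>e\<in>E. card e = 2) \<and>
     (\<forall>v\<in>\<Union>E. \<forall>q. if v \<in> range (if q then Bot else Top) then \<nexists>e. e \<in> E \<and> v \<in> e \<and> d e v = q
        else \<exists>!e. e \<in> E \<and> v \<in> e \<and> d e v = q) \<and>
     (\<forall>v\<in>\<Union>E. \<exists>w. w \<notin> range Mid \<and> (v, w) \<in> connected_by E)"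

lemma connected_closed:
  assumes "(u, v) \<in> connected_by E" "u \<in> S" "\<And>e. e \<in> E ==> e \<inter> S \<noteq> {} ==> e \<subseteq> S"
  shows "v \<in> S"
  using assms(1) unfolding connected_by_def
proof (induction rule: rtrancl_induct)
  case base then show ?case using assms(2) .
next
  case (step y z)
  then show ?case using assms(3) by blast
qed

lemma readyD:
  assumes "ready d E" "v \<in> \<Union>E"
  shows "v \<in> range (if q then Bot else Top) ==> \<nexists>e. e \<in> E \<and> v \<in> e \<and> d e v = q"
    "v \<notin> range (if q then Bot else Top) ==> \<exists>!e. e \<in> E \<and> v \<in> e \<and> d e v = q"
    "\<exists>w. w \<notin> range Mid \<and> (v, w) \<in> connected_by E"
proof -
  have 1: "\<forall>v\<in>\<Union>E. \<forall>q. if v \<in> range (if q then Bot else Top) then \<nexists>e. e \<in> E \<and> v \<in> e \<and> d e v = q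
        else \<exists>!e. e \<in> E \<and> v \<in> e \<and> d e v = q" and
    2: "\<forall>v\<in>\<Union>E. \<exists>w. w \<notin> range Mid \<and> (v, w) \<in> connected_by E"
    using assms(1) unfolding ready_def by simp_all
  show "v \<in> range (if q then Bot else Top) ==> \<nexists>e. e \<in> E \<and> v \<in> e \<and> d e v = q"
    using bspec[OF 1 assms(2), THEN spec, of q] by (simp only: if_True not_False_eq_True)
  show "v \<notin> range (if q then Bot else Top) ==> \<exists>!e. e \<in> E \<and> v \<in> e \<and> d e v = q"
    using bspec[OF 1 assms(2), THEN spec, of q] by (simp only: if_False not_False_eq_True)
  show "\<exists>w. w \<notin> range Mid \<and> (v, w) \<in> connected_by E" using bspec[OF 2 assms(2)] .
qed

lemma ready_unique:
  assumes "ready d E" "e \<in> E" "e' \<in> E" "v \<in> e" "v \<in> e'" "d e v = d e' v"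
  shows "e = e'"
proof -
  have v: "v \<in> \<Union>E" using assms(2,4) by (rule UnionI)
  have "v \<notin> range (if d e v then Bot else Top)"
    using readyD(1)[OF assms(1) v, of "d e v"] assms by blast
  from readyD(2)[OF assms(1) v this] show ?thesis using assms by metis
qed

text \<open>A vertex has at most one edge for each label, and both labels occur only at glued
  vertices.\<close>

lemma ready_two_edges:
  assumes r: "ready d E" and e: "e1 \<in> E" "e2 \<in> E" "e3 \<in> E" "v \<in> e1" "v \<in> e2" "v \<in> e3" "e1 \<noteq> e2"
  shows "e3 = e1 \<or> e3 = e2" "v \<in> range Mid"
proof -
  have v: "v \<in> \<Union>E" using e(1,4) by (rule UnionI)
  note u = ready_unique[OF r]
  have n: "d e1 v \<noteq> d e2 v" using u[OF e(1,2,4,5)] e(7) by (rule contrapos_nn[rotated])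
  show "e3 = e1 \<or> e3 = e2"
  proof (cases "d e3 v = d e1 v")
    case True then show ?thesis using u[OF e(3,1,6,4)] by (intro disjI1)
  next
    case False then have "d e3 v = d e2 v" using n by argo
    then show ?thesis using u[OF e(3,2,6,5)] by (intro disjI2)
  qed
  have "v \<notin> range Bot"
  proof
    assume "v \<in> range Bot"
    then have "\<not> d e v" if "e \<in> E" "v \<in> e" for e using readyD(1)[OF r v, of True] that by simp
    from this[OF e(1,4)] this[OF e(2,5)] show False using n by argo
  qed
  moreover have "v \<notin> range Top"
  proof
    assume "v \<in> range Top"
    then have "d e v" if "e \<in> E" "v \<in> e" for e using readyD(1)[OF r v, of False] that by simp
    from this[OF e(1,4)] this[OF e(2,5)] show False using n by argo
  qed
  ultimately show "v \<in> range Mid" by (cases v) auto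
qed

lemma ex1_bij_betw:
  assumes "bij_betw h A B" "\<And>x. x \<in> A ==> Q (h x) = P x"
  shows "(\<exists>!y. y \<in> B \<and> Q y) \<longleftrightarrow> (\<exists>!x. x \<in> A \<and> P x)" "(\<exists>y. y \<in> B \<and> Q y) \<longleftrightarrow> (\<exists>x. x \<in> A \<and> P x)"
proof -
  have B: "B = h ` A" and i: "inj_on h A" using assms(1) by (auto simp: bij_betw_def)
  show "(\<exists>!y. y \<in> B \<and> Q y) \<longleftrightarrow> (\<exists>!x. x \<in> A \<and> P x)"
  proof
    assume "\<exists>!y. y \<in> B \<and> Q y"
    then obtain y where y: "y \<in> B" "Q y" "\<And>z. z \<in> B ==> Q z ==> z = y" by blast
    then obtain x where x: "x \<in> A" "y = h x" unfolding B by blast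
    show "\<exists>!x. x \<in> A \<and> P x"
    proof (rule ex1I[of _ x])
      show "x \<in> A \<and> P x" using x y(2) assms(2)[OF x(1)] by simp
      fix z assume z: "z \<in> A \<and> P z"
      then have "h z = y" using y(3)[of "h z"] assms(2)[of z] unfolding B by simp
      then show "z = x" using inj_onD[OF i, of z x] x z by simp
    qed
  next
    assume "\<exists>!x. x \<in> A \<and> P x"
    then obtain x where x: "x \<in> A" "P x" "\<And>z. z \<in> A ==> P z ==> z = x" by blast
    show "\<exists>!y. y \<in> B \<and> Q y"
    proof (rule ex1I[of _ "h x"])
      show "h x \<in> B \<and> Q (h x)" using x(1,2) assms(2) unfolding B by simp
      fix y assume "y \<in> B \<and> Q y"
      then obtain z where "z \<in> A" "y = h z" "Q (h z)" unfolding B by blast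
      then show "y = h x" using x(3)[of z] assms(2)[of z] by simp
    qed
  qed
  show "(\<exists>y. y \<in> B \<and> Q y) \<longleftrightarrow> (\<exists>x. x \<in> A \<and> P x)"
    unfolding B using assms(2) by auto
qed

text \<open>A glued vertex \<open>b\<close> with its neighbours: \<open>a\<close> along the edge
  labelled True at \<open>b\<close>, and \<open>c\<close> along the edge labelled False. The locale
  describes the removal of \<open>b\<close>.\<close>

locale middle_vertex =
  fixes d E b
  assumes r: "ready d E" and bE: "b \<in> \<Union>E" and bM: "b \<in> range Mid"
begin

definition "out_edge = (THE e. e \<in> E \<and> b \<in> e \<and> d e b)"
definition "in_edge = (THE e. e \<in> E \<and> b \<in> e \<and> \<not> d e b)"
definition "a = (THE v. v \<noteq> b \<and> v \<in> out_edge)"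
definition "c = (THE v. v \<noteq> b \<and> v \<in> in_edge)"

lemma fin: "finite E" and card2: "e \<in> E ==> card e = 2"
  using r unfolding ready_def by auto

lemma b_edges: "out_edge \<in> E" "b \<in> out_edge" "d out_edge b" "in_edge \<in> E" "b \<in> in_edge" "\<not> d in_edge b"
proof -
  have nb: "b \<notin> range Bot" "b \<notin> range Top" using bM by auto
  have "\<exists>!e. e \<in> E \<and> b \<in> e \<and> d e b" "\<exists>!e. e \<in> E \<and> b \<in> e \<and> \<not> d e b"
    using readyD(2)[OF r bE, of True] readyD(2)[OF r bE, of False] nb by simp_all
  from theI'[OF this(1)] theI'[OF this(2)]
  show "out_edge \<in> E" "b \<in> out_edge" "d out_edge b" "in_edge \<in> E" "b \<in> in_edge" "\<not> d in_edge b"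
    unfolding out_edge_def in_edge_def by auto
qed

lemma edge_other: "e \<in> E ==> b \<in> e ==> (THE v. v \<noteq> b \<and> v \<in> e) \<noteq> b \<and> e = {b, THE v. v \<noteq> b \<and> v \<in> e}"
proof -
  assume e: "e \<in> E" "b \<in> e"
  then obtain x y where "e = {x, y}" "x \<noteq> y" using card2 by (meson card_2_iff)
  with e(2) obtain z where z: "e = {b, z}" "z \<noteq> b" by blast
  then have "(THE v. v \<noteq> b \<and> v \<in> e) = z" by (intro the_equality) auto
  with z show ?thesis by simp
qed

lemma out_edge: "out_edge = {a, b}" "a \<noteq> b" and in_edge: "in_edge = {b, c}" "c \<noteq> b"
  using edge_other[OF b_edges(1,2)] edge_other[OF b_edges(4,5)] unfolding a_def c_def
  by (simp_all only: insert_commute simp_thms)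

lemma edges: "{a, b} \<in> E" "{b, c} \<in> E" "d {a, b} b" "\<not> d {b, c} b"
  using b_edges out_edge(1) in_edge(1) by simp_all

lemma edges_ne: "{a, b} \<noteq> {b, c}"
  using edges(3,4) by metis

lemma ac: "a \<noteq> c"
  using edges_ne by (metis insert_commute)

lemma only_edges: "e \<in> E ==> b \<in> e ==> e = {a, b} \<or> e = {b, c}"
  using ready_two_edges(1)[OF r edges(1,2), of e b] edges_ne by simp

text \<open>The triangle on a, b, c would be a whole component without outer vertices. Consequently
  the merged edge never coincides with an old one.\<close>

lemma no_ac: "{a, c} \<notin> E"
proof
  assume *: "{a, c} \<in> E"
  let ?S = "{a, b, c}"
  have ne: "{a, b} \<noteq> {a, c}" "{b, c} \<noteq> {a, c}" using out_edge(2) in_edge(2) ac by (simp_all only: doubleton_eq_iff) auto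
  have Ma: "a \<in> range Mid" using ready_two_edges(2)[OF r edges(1) * *, of a] ne(1) by simp
  have Mc: "c \<in> range Mid" using ready_two_edges(2)[OF r edges(2) * *, of c] ne(2) by simp
  have cl: "e \<subseteq> ?S" if e: "e \<in> E" "e \<inter> ?S \<noteq> {}" for e
  proof -
    from e(2) consider "a \<in> e" | "b \<in> e" | "c \<in> e" by blast
    then have "e = {a, b} \<or> e = {b, c} \<or> e = {a, c}"
    proof cases
      case 1 then have "e = {a, b} \<or> e = {a, c}" by (intro ready_two_edges(1)[OF r edges(1) * e(1), of a]) (use ne(1) in simp_all)
      then show ?thesis by argo
    next
      case 2 then show ?thesis using only_edges[OF e(1)] by argo
    next
      case 3 then have "e = {b, c} \<or> e = {a, c}" by (intro ready_two_edges(1)[OF r edges(2) * e(1), of c]) (use ne(2) in simp_all)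
      then show ?thesis by argo
    qed
    then show ?thesis by (elim disjE) simp_all
  qed
  obtain w where w: "w \<notin> range Mid" "(b, w) \<in> connected_by E" using readyD(3)[OF r bE] by blast
  have "w \<in> ?S" by (rule connected_closed[OF w(2)]) (use cl in simp_all)
  then show False using w(1) Ma Mc bM by auto
qed

text \<open>In \<open>d'\<close> the merged edge {a, c} inherits at either end the label of the edge
  that it replaces there. The map \<open>h\<close> sends every old edge to the new edge that
  contains it or equals it after the removal of \<open>b\<close>.\<close>

definition "E' = insert {a, c} (E - {{a, b}, {b, c}})"
definition "d' = (\<lambda>e v. if e = {a, c} then (if v = a then d {a, b} a else d {b, c} c) else d e v)"
definition "h = (\<lambda>e. if e = {a, b} \<or> e = {b, c} then {a, c} else e)"

lemma image_f: "e \<in> E ==> b \<notin> e ==> (id(b := x)) ` e = e"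
  by auto

text \<open>Contracting {a, b} onto \<open>a\<close> and contracting {b, c} onto \<open>c\<close>
  give the same edge set, so whichever of the two edges is unmarked may be contracted.\<close>

lemma contract_edge:
  assumes pq: "p = a \<and> q = c \<or> p = c \<and> q = a"
  shows "map_edges (id(b := p)) (E - {{p, b}}) = E'"
proof -
  let ?R = "E - {{a, b}, {b, c}}"
  have 1: "(id(b := p)) ` {q, b} = {a, c}" using pq out_edge(2) in_edge(2) by auto
  have 2: "(id(b := p)) ` e = e" if "e \<in> ?R" for e
    by (rule image_f) (use that only_edges in blast)+
  have cb: "{c, b} = {b, c}" by (rule insert_commute)
  have R: "?R = E - {{p, b}, {q, b}}" using pq
  proof (elim disjE conjE)
    assume "p = a" "q = c" then show ?thesis by (simp only: cb)
  next
    assume "p = c" "q = a" then show ?thesis by (simp only: cb insert_commute[of "{a, b}" "{b, c}"])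
  qed
  have "{q, b} \<in> E" "{p, b} \<noteq> {q, b}" using pq edges(1,2) edges_ne cb by metis+
  then have "E - {{p, b}} = insert {q, b} ?R" unfolding R by blast
  then have "map_edges (id(b := p)) (E - {{p, b}}) = insert ((id(b := p)) ` {q, b}) ((\<lambda>e. (id(b := p)) ` e) ` ?R)"
    unfolding map_edges_def by (simp only: image_insert)
  also have "(\<lambda>e. (id(b := p)) ` e) ` ?R = (\<lambda>e. e) ` ?R" by (rule image_cong) (use 2 in simp_all)
  finally show ?thesis unfolding 1 E'_def image_ident .
qed

lemmas contract_out = contract_edge[of a c, simplified] and contract_in = contract_edge[of c a, simplified]

lemma b_not_in: "e \<in> E' ==> b \<notin> e"
  unfolding E'_def using only_edges out_edge(2) in_edge(2) by auto

lemma vertices': "\<Union>E' = \<Union>E - {b}"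
proof
  show "\<Union>E' \<subseteq> \<Union>E - {b}"
  proof
    fix v assume "v \<in> \<Union>E'"
    then obtain e where e: "e \<in> E'" "v \<in> e" by blast
    have "a \<in> \<Union>E" "c \<in> \<Union>E" using edges(1,2) by (meson UnionI insertI1 insertI2)+
    then have "v \<in> \<Union>E" using e unfolding E'_def by auto
    then show "v \<in> \<Union>E - {b}" using b_not_in[OF e(1)] e(2) by auto
  qed
  show "\<Union>E - {b} \<subseteq> \<Union>E'"
  proof
    fix v assume v: "v \<in> \<Union>E - {b}"
    then obtain e where e: "e \<in> E" "v \<in> e" by blast
    show "v \<in> \<Union>E'"
    proof (cases "e = {a, b} \<or> e = {b, c}")
      case True then have "v \<in> {a, c}" using e(2) v by auto
      then show ?thesis unfolding E'_def by (meson UnionI insertI1)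
    next
      case False then have "e \<in> E'" using e(1) unfolding E'_def by simp
      then show ?thesis using e(2) by (rule UnionI)
    qed
  qed
qed

lemma connected': "u \<noteq> b ==> v \<noteq> b ==> (u, v) \<in> connected_by E' \<longleftrightarrow> (u, v) \<in> connected_by E"
  using connected_contract[OF edges(1) out_edge(2), of u v] unfolding contract_out .

text \<open>A vertex other than \<open>b\<close> lies on at most one of {a, b} and {b, c}, and {a,
  c} is not an old edge. Hence the count of edges at each remaining vertex is preserved.\<close>

lemma bij_h:
  assumes "v \<noteq> b"
  shows "bij_betw h {e \<in> E. v \<in> e} {e \<in> E'. v \<in> e}"
  unfolding bij_betw_def
proof
  show "inj_on h {e \<in> E. v \<in> e}"
  proof (rule inj_onI)
    fix x y assume x: "x \<in> {e \<in> E. v \<in> e}" and y: "y \<in> {e \<in> E. v \<in> e}" and eq: "h x = h y"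
    have k: "x' = y'" if "x' = {a, b} \<or> x' = {b, c}" "y' = {a, b} \<or> y' = {b, c}" "v \<in> x'" "v \<in> y'" for x' y'
      using that assms ac by auto
    have xE: "x \<noteq> {a, c}" "y \<noteq> {a, c}" using x y no_ac by auto
    show "x = y"
      using eq k[of x y] x y xE unfolding h_def by (auto split: if_splits)
  qed
  show "h ` {e \<in> E. v \<in> e} = {e \<in> E'. v \<in> e}"
  proof
    show "h ` {e \<in> E. v \<in> e} \<subseteq> {e \<in> E'. v \<in> e}"
      using assms unfolding h_def E'_def by auto
    show "{e \<in> E'. v \<in> e} \<subseteq> h ` {e \<in> E. v \<in> e}"
    proof
      fix e assume e: "e \<in> {e \<in> E'. v \<in> e}"
      show "e \<in> h ` {e \<in> E. v \<in> e}"
      proof (cases "e = {a, c}")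
        case True
        then have "v = a \<or> v = c" using e by simp
        then show ?thesis
        proof
          assume "v = a" then show ?thesis using True edges(1) unfolding h_def by (intro image_eqI[of _ _ "{a, b}"]) auto
        next
          assume "v = c" then show ?thesis using True edges(2) unfolding h_def by (intro image_eqI[of _ _ "{b, c}"]) auto
        qed
      next
        case False then show ?thesis using e unfolding h_def E'_def by (intro image_eqI[of _ _ e]) auto
      qed
    qed
  qed
qed

lemma d'_h: "e \<in> E ==> v \<in> e ==> v \<noteq> b ==> d' (h e) v = d e v"
proof -
  assume e: "e \<in> E" "v \<in> e" "v \<noteq> b"
  consider "e = {a, b}" | "e = {b, c}" | "e \<noteq> {a, b}" "e \<noteq> {b, c}" by blast
  then show ?thesis
  proof cases
    case 1 then have "v = a" using e by simp
    then show ?thesis using 1 by (simp add: d'_def h_def)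
  next
    case 2 then have "v = c" using e by simp
    then show ?thesis using 2 ac by (simp add: d'_def h_def)
  next
    case 3
    have "e \<noteq> {a, c}" using e no_ac by metis
    then show ?thesis using 3 by (simp add: d'_def h_def)
  qed
qed

lemma ready': "ready d' E'"
  unfolding ready_def
proof (intro conjI ballI allI)
  show "finite E'" using fin unfolding E'_def by simp
  show "card e = 2" if "e \<in> E'" for e using that card2 ac unfolding E'_def by auto
next
  fix v q assume v': "v \<in> \<Union>E'"
  then have v: "v \<in> \<Union>E" "v \<noteq> b" using vertices' by auto
  note bij = ex1_bij_betw[OF bij_h[OF v(2)], of "\<lambda>e. d' e v = q" "\<lambda>e. d e v = q"]
  have eq: "(\<exists>!e. e \<in> E' \<and> v \<in> e \<and> d' e v = q) \<longleftrightarrow> (\<exists>!e. e \<in> E \<and> v \<in> e \<and> d e v = q)"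
    "(\<exists>e. e \<in> E' \<and> v \<in> e \<and> d' e v = q) \<longleftrightarrow> (\<exists>e. e \<in> E \<and> v \<in> e \<and> d e v = q)"
    using bij d'_h v(2) by simp_all
  show "if v \<in> range (if q then Bot else Top) then \<nexists>e. e \<in> E' \<and> v \<in> e \<and> d' e v = q
        else \<exists>!e. e \<in> E' \<and> v \<in> e \<and> d' e v = q"
    unfolding eq using readyD(1,2)[OF r v(1), of q] by (cases "v \<in> range (if q then Bot else Top)") simp_all
next
  fix v assume v': "v \<in> \<Union>E'"
  then have v: "v \<in> \<Union>E" "v \<noteq> b" using vertices' by auto
  obtain w where w: "w \<notin> range Mid" "(v, w) \<in> connected_by E" using readyD(3)[OF r v(1)] by blast
  then have "w \<noteq> b" using bM by blast
  then show "\<exists>w. w \<notin> range Mid \<and> (v, w) \<in> connected_by E'" using connected'[OF v(2)] w by blast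
qed

lemma card_less: "card (\<Union>E' \<inter> range Mid) < card (\<Union>E \<inter> range Mid)"
proof (rule psubset_card_mono)
  have "finite e" if "e \<in> E" for e using card2[OF that] by (metis card.infinite zero_neq_numeral)
  then show "finite (\<Union>E \<inter> range Mid)" using fin by blast
  show "\<Union>E' \<inter> range Mid \<subset> \<Union>E \<inter> range Mid" unfolding vertices' using bE bM by blast
qed

text \<open>The heights of \<open>a\<close> and \<open>c\<close> are consecutive in the arrangement
  of \<open>E'\<close>, so their midpoint is a free place for \<open>b\<close>.\<close>

lemma arrangement_extend:
  assumes "arrangement \<rho>' E'"
  shows "arrangement (\<rho>'(b := (\<rho>' a + \<rho>' c) / 2)) E" (is "arrangement ?\<rho> E")
proof -
  have ac': "{a, c} \<in> E'" "{c, a} \<in> E'" unfolding E'_def by (simp_all add: insert_commute)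
  have V: "w \<in> \<Union>E'" if "w \<in> \<Union>E" "w \<noteq> b" for w using that vertices' by simp
  have aV: "a \<in> \<Union>E'" "c \<in> \<Union>E'" using ac' by (meson UnionI insertI1)+
  have nac: "\<rho>' a \<noteq> \<rho>' c" using arrangement_eq[OF assms aV] ac by blast
  have out: "\<not> (min (\<rho>' a) (\<rho>' c) < \<rho>' w \<and> \<rho>' w < max (\<rho>' a) (\<rho>' c))" if "w \<in> \<Union>E'" for w
    using arrangement_between[OF assms ac'(1) that] arrangement_between[OF assms ac'(2) that]
    by (auto simp: min_def max_def)
  have mid: "min (\<rho>' a) (\<rho>' c) < ?\<rho> b \<and> ?\<rho> b < max (\<rho>' a) (\<rho>' c)" using nac by (auto simp: min_def max_def field_simps)
  have same: "?\<rho> w = \<rho>' w" if "w \<noteq> b" for w using that by simp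
  show ?thesis unfolding arrangement_def
  proof (intro conjI ballI allI impI)
    show "inj_on ?\<rho> (\<Union>E)"
    proof (rule inj_onI)
      fix u v assume u: "u \<in> \<Union>E" and v: "v \<in> \<Union>E" and eq: "?\<rho> u = ?\<rho> v"
      show "u = v"
      proof (rule ccontr)
        assume n: "u \<noteq> v"
        then consider "u = b" "v \<noteq> b" | "u \<noteq> b" "v = b" | "u \<noteq> b" "v \<noteq> b" by blast
        then show False
        proof cases
          case 1 then show ?thesis using out[OF V[OF v]] mid eq same[of v] by metis
        next
          case 2 then show ?thesis using out[OF V[OF u]] mid eq same[of u] by metis
        next
          case 3 then show ?thesis using arrangement_eq[OF assms V[OF u] V[OF v]] eq n by simp
        qed
      qed
    qed
    show "card e = 2" if "e \<in> E" for e using card2[OF that] .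
  next
    fix u v w assume uv: "{u, v} \<in> E" and w: "w \<in> \<Union>E" and l1: "?\<rho> u < ?\<rho> w" and l2: "?\<rho> w < ?\<rho> v"
    have ne: "w \<noteq> u" "w \<noteq> v" using l1 l2 by auto
    show False
    proof (cases "{u, v} = {a, b} \<or> {u, v} = {b, c}")
      case True
      then have c: "(u = b \<and> (v = a \<or> v = c)) \<or> (v = b \<and> (u = a \<or> u = c))"
        by (auto simp: doubleton_eq_iff)
      then have wb: "w \<noteq> b" using ne by blast
      have "min (\<rho>' a) (\<rho>' c) < \<rho>' w \<and> \<rho>' w < max (\<rho>' a) (\<rho>' c)"
        using c l1 l2 mid same[OF wb] same[OF out_edge(2)] same[OF in_edge(2)] by (auto simp: min_less_iff_disj less_max_iff_disj)
      then show False using out[OF V[OF w wb]] by blast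
    next
      case False
      then have uv': "{u, v} \<in> E'" using uv unfolding E'_def by simp
      have ub: "u \<noteq> b" "v \<noteq> b" using b_not_in[OF uv'] by auto
      show False
      proof (cases "w = b")
        case True
        have lt: "\<rho>' u < \<rho>' v" using l1 l2 same[OF ub(1)] same[OF ub(2)] by simp
        have n: "{u, v} \<noteq> {a, c}" "{u, v} \<noteq> {c, a}" using uv no_ac by (metis insert_commute)+
        have "\<rho>' v \<le> min (\<rho>' a) (\<rho>' c) \<or> max (\<rho>' a) (\<rho>' c) \<le> \<rho>' u"
        proof (cases "\<rho>' a < \<rho>' c")
          case True then show ?thesis using arrangement_separated[OF assms uv' ac'(1) lt True n(1)] by auto
        next
          case False
          have ca: "\<rho>' c < \<rho>' a" using nac False by simp
          from arrangement_separated[OF assms uv' ac'(2) lt ca n(2)] show ?thesis using ca by auto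
        qed
        then show ?thesis using l1 l2 mid same[OF ub(1)] same[OF ub(2)] True by auto
      next
        case False
        show ?thesis using arrangement_between[OF assms uv' V[OF w False]] l1 l2 same[OF ub(1)] same[OF ub(2)] same[OF False] by simp
      qed
    qed
  qed
qed

end

text \<open>Without common vertices the edges can be numbered arbitrarily; the edge with number n
  has its two ends at 2n and 2n + 1.\<close>

lemma arrangement_of_disjoint:
  assumes "finite E" "\<And>e. e \<in> E ==> card e = 2" "\<And>e e' v. e \<in> E ==> e' \<in> E ==> v \<in> e ==> v \<in> e' ==> e = e'"
  shows "\<exists>\<rho>. arrangement \<rho> E"
proof -
  obtain n where n: "inj_on (n :: vertex set \<Rightarrow> nat) E" using assms(1) finite_imp_inj_to_nat_seg by blast
  define ed where "ed v = (THE e. e \<in> E \<and> v \<in> e)" for v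
  have ed: "ed v = e" if "e \<in> E" "v \<in> e" for v e
    unfolding ed_def using that assms(3) by (intro the_equality) blast+
  define g :: "vertex set \<Rightarrow> vertex" where "g e = (SOME v. v \<in> e)" for e
  define m :: "vertex \<Rightarrow> nat" where "m v = (if v = g (ed v) then 0 else 1)" for v
  define k where "k v = 2 * n (ed v) + m v" for v
  define \<rho> :: "vertex \<Rightarrow> rat" where "\<rho> v = of_nat (k v)" for v
  have m: "m v \<le> 1" for v unfolding m_def by simp
  have two: "\<exists>v. e \<subseteq> {g e, v}" if e: "e \<in> E" for e
  proof -
    obtain x y where xy: "e = {x, y}" using assms(2)[OF e] by (meson card_2_iff)
    have "x \<in> e" unfolding xy by simp
    then have "g e \<in> e" unfolding g_def by (rule someI)
    then have "g e = x \<or> g e = y" using xy by simp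
    then have "e \<subseteq> {g e, y} \<or> e \<subseteq> {g e, x}" using xy by auto
    then show ?thesis by blast
  qed
  have same: "ed u = ed v" if uv: "u \<in> \<Union>E" "v \<in> \<Union>E" and eq: "k u = k v" for u v
  proof -
    have E: "ed u \<in> E" "ed v \<in> E" using uv ed by auto
    have "n (ed u) = n (ed v)" using m[of u] m[of v] eq unfolding k_def by presburger
    then show ?thesis using E by (rule inj_onD[OF n])
  qed
  have "arrangement \<rho> E" unfolding arrangement_def
  proof (intro conjI ballI allI impI)
    show "inj_on \<rho> (\<Union>E)"
    proof (rule inj_onI)
      fix u v assume u: "u \<in> \<Union>E" and v: "v \<in> \<Union>E" and "\<rho> u = \<rho> v"
      then have k: "k u = k v" unfolding \<rho>_def by simp
      then have ee: "ed u = ed v" using u v by (intro same)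
      obtain e where e: "e \<in> E" "u \<in> e" using u by blast
      obtain e' where e': "e' \<in> E" "v \<in> e'" using v by blast
      have eqs: "ed u = e" "ed v = e" "e' = e" using ed[OF e] ed[OF e'] ee by simp_all
      have "m u = m v" using k ee unfolding k_def by simp
      then have "(u = g e) = (v = g e)" unfolding m_def eqs by (auto split: if_splits)
      moreover obtain w where "e \<subseteq> {g e, w}" using two[OF e(1)] by blast
      ultimately show "u = v" using e(2) e'(2) unfolding eqs by blast
    qed
    show "card e = 2" if "e \<in> E" for e using assms(2)[OF that] .
  next
    fix u v w assume uv: "{u, v} \<in> E" and l: "\<rho> u < \<rho> w" "\<rho> w < \<rho> v"
    have "ed u = ed v" using ed[OF uv, of u] ed[OF uv, of v] by simp
    moreover have "k u < k w" "k w < k v" using l unfolding \<rho>_def by simp_all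
    ultimately show False using m[of u] m[of v] unfolding k_def by presburger
  qed
  then show ?thesis by blast
qed

lemma ready_disjoint:
  assumes "ready d E" "\<Union>E \<inter> range Mid = {}" "e \<in> E" "e' \<in> E" "v \<in> e" "v \<in> e'"
  shows "e = e'"
  using ready_two_edges(2)[OF assms(1,3,4,4,5,6,6)] assms(2-) by blast

text \<open>Induction on the number of glued vertices: one is removed, the rest is arranged, and it
  is put back at a midpoint.\<close>

theorem ready_arrangement:
  assumes "ready d E"
  shows "\<exists>\<rho>. arrangement \<rho> E"
  using assms
proof (induction "card (\<Union>E \<inter> range Mid)" arbitrary: d E rule: less_induct)
  case less
  show ?case
  proof (cases "\<Union>E \<inter> range Mid = {}")
    case True
    show ?thesis
      by (rule arrangement_of_disjoint)
        (use less.prems ready_disjoint[OF less.prems True] in \<open>auto simp: ready_def\<close>)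
  next
    case False
    then obtain b where b: "b \<in> \<Union>E" "b \<in> range Mid" by blast
    interpret middle_vertex d E b using less.prems b by unfold_locales
    show ?thesis using less.hyps[OF card_less ready'] arrangement_extend by blast
  qed
qed

section \<open>Existence of simplifications\<close>

primrec is_bead :: "mark \<Rightarrow> bool" where
  "is_bead (Bead e) = True"
| "is_bead (Arrow u v) = False"

definition homogeneous :: "(vertex set \<Rightarrow> vertex \<Rightarrow> bool) \<Rightarrow> vertex set \<Rightarrow> bool" where
  "homogeneous d e \<longleftrightarrow> (\<forall>v\<in>e. d e v) \<or> (\<forall>v\<in>e. \<not> d e v)"

text \<open>An edge labelled True at both ends behaves like a cup and carries a bead; labelled False
  at both ends it behaves like a cap and carries an arrow; with mixed labels it is a piece of a
  through string and is unmarked. Without glued vertices this is the marking condition of a marked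
  diagram.\<close>

definition marks_ok :: "(vertex set \<Rightarrow> vertex \<Rightarrow> bool) \<Rightarrow> vertex set set \<Rightarrow> mark list \<Rightarrow> bool" where
  "marks_ok d E L \<longleftrightarrow> distinct (map mark_edge L) \<and>
     (\<forall>x\<in>set L. mark_edge x \<in> E \<and> (\<forall>v\<in>mark_edge x. d (mark_edge x) v = is_bead x)) \<and>
     (\<forall>e\<in>E. homogeneous d e \<longrightarrow> e \<in> mark_edge ` set L)"

lemma is_bead_map_mark [simp]: "is_bead (map_mark f x) = is_bead x"
  by (cases x) auto

lemma map_mark_idle: "(\<And>v. v \<in> mark_edge x ==> f v = v) ==> map_mark f x = x"
  by (cases x) auto

lemma interchange_move:
  "\<exists>k. simplifies_to \<epsilon> (E, P @ x # Q @ y # R) k (E, P @ x # y # Q @ R)"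
proof (induction Q arbitrary: R rule: rev_induct)
  case Nil
  then show ?case using simplifies_to.stop by auto
next
  case (snoc q Q)
  obtain k where k: "simplifies_to \<epsilon> (E, P @ x # Q @ y # q # R) k (E, P @ x # y # Q @ q # R)"
    using snoc[of "q # R"] by blast
  have "simplify_step \<epsilon> (E, (P @ x # Q) @ [q, y] @ R) \<epsilon> (E, (P @ x # Q) @ [y, q] @ R)"
    by (rule simplify_step.interchange)
  then show ?case using simplifies_to.step[OF _ k] by fastforce
qed

lemma make_adjacent:
  assumes "x \<in> set L" "y \<in> set L" "x \<noteq> y"
  shows "\<exists>k p q L1 L2. simplifies_to \<epsilon> (E, L) k (E, L1 @ [p, q] @ L2) \<and>
    ((p = x \<and> q = y) \<or> (p = y \<and> q = x)) \<and> mset L = mset (L1 @ [p, q] @ L2)"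
proof -
  have *: "\<exists>k L1 L2. simplifies_to \<epsilon> (E, L) k (E, L1 @ [p, q] @ L2) \<and> mset L = mset (L1 @ [p, q] @ L2)"
    if L: "L = P @ p # Q @ q # R" for P p Q q R
  proof -
    obtain k where k: "simplifies_to \<epsilon> (E, P @ p # Q @ q # R) k (E, P @ p # q # Q @ R)"
      using interchange_move by blast
    show ?thesis unfolding L
      by (rule exI[of _ k], rule exI[of _ P], rule exI[of _ "Q @ R"]) (use k in simp)
  qed
  obtain P T where PT: "L = P @ x # T" using assms(1) by (meson split_list)
  show ?thesis
  proof (cases "y \<in> set T")
    case True
    then obtain Q R where "T = Q @ y # R" by (meson split_list)
    then show ?thesis using *[of P x Q y R] PT by blast
  next
    case False
    then have "y \<in> set P" using assms PT by auto
    then obtain Q R where "P = Q @ y # R" by (meson split_list)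
    then have "L = Q @ y # R @ x # T" using PT by simp
    from *[OF this] show ?thesis by blast
  qed
qed

text \<open>The four rules cover all cases of order and direction; which coefficient results is
  irrelevant for existence.\<close>

lemma cancel_step:
  assumes "b \<in> range Mid" "y = Arrow b c \<or> y = Arrow c b"
    "(p = Bead {a, b} \<and> q = y) \<or> (p = y \<and> q = Bead {a, b})"
  shows "\<exists>k. simplify_step \<epsilon> (E, L1 @ [p, q] @ L2) k (E, L1 @ L2)"
  using assms(2,3) simplify_step.intros(3-6)[OF assms(1), of \<epsilon> E L1] by blast

context middle_vertex
begin

lemma h_image:
  assumes "e \<in> E"
  shows "e \<noteq> {a, b} ==> (id(b := a)) ` e = h e" "e \<noteq> {b, c} ==> (id(b := c)) ` e = h e"
proof -
  have 1: "(id(b := a)) ` {b, c} = {a, c}" "(id(b := c)) ` {a, b} = {a, c}" using in_edge(2) out_edge(2) by auto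
  have h: "h {b, c} = {a, c}" "h {a, b} = {a, c}" unfolding h_def by simp_all
  have 2: "b \<notin> e" "h e = e" if "e \<noteq> {a, b}" "e \<noteq> {b, c}"
    using only_edges[OF assms] that unfolding h_def by (blast, simp only: if_False simp_thms)
  show "(id(b := a)) ` e = h e" if n: "e \<noteq> {a, b}"
  proof (cases "e = {b, c}")
    case True then show ?thesis using 1 h by (simp only:)
  next
    case False show ?thesis unfolding 2(2)[OF n False] by (rule image_f[OF assms 2(1)[OF n False]])
  qed
  show "(id(b := c)) ` e = h e" if n: "e \<noteq> {b, c}"
  proof (cases "e = {a, b}")
    case True then show ?thesis using 1 h by (simp only:)
  next
    case False show ?thesis unfolding 2(2)[OF False n] by (rule image_f[OF assms 2(1)[OF False n]])
  qed
qed

text \<open>The renaming \<open>g\<close> of markings is left general, since the contraction runs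
  towards \<open>a\<close> or towards \<open>c\<close> according to which edge is free. By
  \<open>bc\<close> and \<open>ab\<close>, if one of the two edges is marked then the other has
  mixed labels; by \<open>T\<close> and \<open>F\<close> the merged edge receives a marking whenever
  its labels agree.\<close>

lemma marks_ok_h:
  assumes dist: "distinct (map mark_edge L)"
    and L: "\<And>x. x \<in> set L ==> mark_edge x \<in> E \<and> (\<forall>v\<in>mark_edge x. d (mark_edge x) v = is_bead x)"
    and bc: "{b, c} \<in> mark_edge ` set L ==> \<not> d {a, b} a"
    and ab: "{a, b} \<in> mark_edge ` set L ==> d {b, c} c"
    and hom: "\<And>e. e \<in> E - {{a, b}, {b, c}} ==> homogeneous d e ==> e \<in> mark_edge ` set L"
    and T: "d {a, b} a ==> d {b, c} c ==> {a, b} \<in> mark_edge ` set L"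
    and F: "\<not> d {a, b} a ==> \<not> d {b, c} c ==> {b, c} \<in> mark_edge ` set L"
    and g: "\<And>x. x \<in> set L ==> mark_edge (g x) = h (mark_edge x) \<and> is_bead (g x) = is_bead x"
  shows "marks_ok d' E' (map g L)"
proof -
  have abT: "d {a, b} a" if "{a, b} \<in> mark_edge ` set L"
  proof -
    obtain x where x: "x \<in> set L" "{a, b} = mark_edge x" using \<open>{a, b} \<in> mark_edge ` set L\<close> by (rule imageE)
    from conjunct2[OF L[OF x(1)]] have "\<forall>v\<in>{a, b}. d {a, b} v = is_bead x" unfolding x(2)[symmetric] .
    then show ?thesis using edges(3) by simp
  qed
  have notboth: "\<not> ({a, b} \<in> mark_edge ` set L \<and> {b, c} \<in> mark_edge ` set L)"
    using abT bc by blast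
  have hE: "h e = {a, c} \<longleftrightarrow> e = {a, b} \<or> e = {b, c}" if "e \<in> E" for e
    using no_ac that unfolding h_def by auto
  have dab: "h {a, b} = {a, c}" "h {b, c} = {a, c}" unfolding h_def by simp_all
  show ?thesis unfolding marks_ok_def
  proof (intro conjI ballI impI)
    have "map mark_edge (map g L) = map h (map mark_edge L)" using g by simp
    moreover have "inj_on h (set (map mark_edge L))"
    proof (rule inj_onI)
      fix x y assume x: "x \<in> set (map mark_edge L)" and y: "y \<in> set (map mark_edge L)" and eq: "h x = h y"
      have E: "x \<in> E" "y \<in> E" using x y L by auto
      show "x = y"
      proof (cases "h x = {a, c}")
        case True
        have "x = {a, b} \<or> x = {b, c}" using iffD1[OF hE[OF E(1)] True] .
        moreover have "y = {a, b} \<or> y = {b, c}" using iffD1[OF hE[OF E(2)] True[unfolded eq]] .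
        moreover have "x \<in> mark_edge ` set L" "y \<in> mark_edge ` set L" using x y by simp_all
        ultimately show ?thesis using notboth by metis
      next
        case False
        then have "h x = x" "h y = y" using eq unfolding h_def by (simp_all split: if_splits)
        then show ?thesis using eq by metis
      qed
    qed
    ultimately show "distinct (map mark_edge (map g L))" using dist by (simp only: distinct_map)
  next
    fix x' assume "x' \<in> set (map g L)"
    then obtain x where x: "x \<in> set L" "x' = g x" by auto
    note gx = g[OF x(1)] and Lx = L[OF x(1)]
    show "mark_edge x' \<in> E'" using gx Lx unfolding x(2) h_def E'_def by simp
    fix v assume v: "v \<in> mark_edge x'"
    have eq: "mark_edge x' = h (mark_edge x)" "is_bead x' = is_bead x" using gx x(2) by simp_all
    have "d' (h (mark_edge x)) v = is_bead x"
    proof (cases "v \<in> mark_edge x \<and> v \<noteq> b")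
      case True
      then show ?thesis using d'_h[of "mark_edge x" v] Lx by simp
    next
      case False
      have vb: "v \<noteq> b" using b_not_in v \<open>mark_edge x' \<in> E'\<close> by blast
      then have n: "v \<notin> mark_edge x" using False by simp
      then have "h (mark_edge x) \<noteq> mark_edge x" using v unfolding eq(1) by metis
      then consider "mark_edge x = {a, b}" | "mark_edge x = {b, c}" unfolding h_def by (meson)
      then show ?thesis
      proof cases
        case 1
        have "v \<in> {a, c}" using v unfolding eq(1) 1 dab(1) .
        moreover have "v \<noteq> a" using n unfolding 1 by simp
        ultimately have "v = c" by simp
        moreover have "d {b, c} c" by (rule ab, unfold 1[symmetric], rule imageI[OF x(1)])
        moreover have "is_bead x" using Lx edges(3) unfolding 1 by simp
        ultimately show ?thesis unfolding 1 dab(1) d'_def using ac by simp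
      next
        case 2
        have "v \<in> {a, c}" using v unfolding eq(1) 2 dab(2) .
        moreover have "v \<noteq> c" using n unfolding 2 by simp
        ultimately have "v = a" by simp
        moreover have "\<not> d {a, b} a" by (rule bc, unfold 2[symmetric], rule imageI[OF x(1)])
        moreover have "\<not> is_bead x" using Lx edges(4) unfolding 2 by simp
        ultimately show ?thesis unfolding 2 dab(2) d'_def by simp
      qed
    qed
    then show "d' (mark_edge x') v = is_bead x'" unfolding eq .
  next
    fix e assume e: "e \<in> E'" and hom': "homogeneous d' e"
    have im: "h e' \<in> mark_edge ` set (map g L)" if e': "e' \<in> mark_edge ` set L" for e'
    proof -
      obtain x where x: "x \<in> set L" "e' = mark_edge x" using e' by blast
      then have "h e' = mark_edge (g x)" using g by simp
      then show ?thesis using x(1) by simp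
    qed
    show "e \<in> mark_edge ` set (map g L)"
    proof (cases "e = {a, c}")
      case True
      have "(d {a, b} a \<and> d {b, c} c) \<or> (\<not> d {a, b} a \<and> \<not> d {b, c} c)"
        using hom' ac unfolding True homogeneous_def d'_def by simp
      then show ?thesis using im[OF T] im[OF F] unfolding dab True by blast
    next
      case False
      then have e': "e \<in> E - {{a, b}, {b, c}}" using e unfolding E'_def by simp
      then have "h e = e" unfolding h_def by simp
      moreover have "homogeneous d e" using hom' False unfolding homogeneous_def d'_def by simp
      ultimately show ?thesis using im[OF hom[OF e']] by simp
    qed
  qed
qed

text \<open>The labels at \<open>b\<close> differ, so if both edges are marked, {a, b} carries a
  bead and {b, c} an arrow. Interchanges bring these together and a rule removes them. After this,
  or if one of the edges was unmarked from the start, an unmarked edge is contracted.\<close>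

lemma reduce_marks:
  assumes "marks_ok d E L"
  shows "\<exists>k L'. simplifies_to \<epsilon> (E, L) k (E', L') \<and> marks_ok d' E' L'"
proof -
  have dist: "distinct (map mark_edge L)"
    and L: "\<And>x. x \<in> set L ==> mark_edge x \<in> E \<and> (\<forall>v\<in>mark_edge x. d (mark_edge x) v = is_bead x)"
    and hom: "\<And>e. e \<in> E ==> homogeneous d e ==> e \<in> mark_edge ` set L"
    using assms unfolding marks_ok_def by simp_all
  have homab: "homogeneous d {a, b} \<longleftrightarrow> d {a, b} a" and hombc: "homogeneous d {b, c} \<longleftrightarrow> \<not> d {b, c} c"
    using edges(3,4) unfolding homogeneous_def by simp_all
  show ?thesis
  proof (cases "{a, b} \<in> mark_edge ` set L")
    case False
    then have na: "\<not> d {a, b} a" using hom[OF edges(1)] homab by blast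
    have "simplify_step \<epsilon> (E, L) 1 (E', map (map_mark (id(b := a))) L)"
      using simplify_step.contract[OF edges(1) out_edge(2) bM False, of \<epsilon>] unfolding contract_out .
    moreover have "marks_ok d' E' (map (map_mark (id(b := a))) L)"
    proof (rule marks_ok_h[OF dist L])
      show "{b, c} \<in> mark_edge ` set L" if "\<not> d {b, c} c" using hom[OF edges(2)] hombc that by blast
      show "e \<in> mark_edge ` set L" if "e \<in> E - {{a, b}, {b, c}}" "homogeneous d e" for e
        using hom[OF DiffD1[OF that(1)] that(2)] .
      show "mark_edge (map_mark (id(b := a)) x) = h (mark_edge x) \<and> is_bead (map_mark (id(b := a)) x) = is_bead x"
        if x: "x \<in> set L" for x
      proof -
        have "mark_edge x \<noteq> {a, b}" using False x by (metis imageI)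
        then show ?thesis using h_image(1)[OF conjunct1[OF L[OF x]]] by simp
      qed
    qed (use na False in simp_all)
    ultimately show ?thesis using simplifies_to_step by blast
  next
    case ab: True
    show ?thesis
    proof (cases "{b, c} \<in> mark_edge ` set L")
      case False
      then have na: "d {b, c} c" using hom[OF edges(2)] hombc by blast
      have False': "{c, b} \<notin> mark_edge ` set L" and cb: "{c, b} \<in> E"
        using False edges(2) by (metis insert_commute)+
      have "simplify_step \<epsilon> (E, L) 1 (E', map (map_mark (id(b := c))) L)"
        using simplify_step.contract[OF cb in_edge(2) bM False', of \<epsilon>] unfolding contract_in .
      moreover have "marks_ok d' E' (map (map_mark (id(b := c))) L)"
      proof (rule marks_ok_h[OF dist L])
        show "e \<in> mark_edge ` set L" if "e \<in> E - {{a, b}, {b, c}}" "homogeneous d e" for e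
          using hom[OF DiffD1[OF that(1)] that(2)] .
        show "mark_edge (map_mark (id(b := c)) x) = h (mark_edge x) \<and> is_bead (map_mark (id(b := c)) x) = is_bead x"
          if x: "x \<in> set L" for x
        proof -
          have "mark_edge x \<noteq> {b, c}" using False x by (metis imageI)
          then show ?thesis using h_image(2)[OF conjunct1[OF L[OF x]]] by simp
        qed
      qed (use na False ab in simp_all)
      ultimately show ?thesis using simplifies_to_step by blast
    next
      case bc: True
      obtain x where x: "x \<in> set L" "mark_edge x = {a, b}" using ab by (metis imageE)
      obtain y where y: "y \<in> set L" "mark_edge y = {b, c}" using bc by (metis imageE)
      have dx: "\<forall>v\<in>{a, b}. d {a, b} v = is_bead x" using conjunct2[OF L[OF x(1)]] unfolding x(2) .
      have dy: "\<forall>v\<in>{b, c}. d {b, c} v = is_bead y" using conjunct2[OF L[OF y(1)]] unfolding y(2) .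
      have bx: "is_bead x" "d {a, b} a" and by': "\<not> is_bead y" "\<not> d {b, c} c"
        using dx dy edges(3,4) by simp_all
      have xB: "x = Bead {a, b}" using bx(1) x(2) by (cases x) auto
      have "\<exists>u v. y = Arrow u v \<and> {u, v} = {b, c}" using by'(1) y(2) by (cases y) auto
      then have yA: "y = Arrow b c \<or> y = Arrow c b" by (metis doubleton_eq_iff)
      have "x \<noteq> y" using bx(1) by'(1) by blast
      then obtain k p q L1 L2 where adj: "simplifies_to \<epsilon> (E, L) k (E, L1 @ [p, q] @ L2)"
        "(p = x \<and> q = y) \<or> (p = y \<and> q = x)" "mset L = mset (L1 @ [p, q] @ L2)"
        using make_adjacent[OF x(1) y(1), of \<epsilon> E] by blast
      obtain k' where can: "simplify_step \<epsilon> (E, L1 @ [p, q] @ L2) k' (E, L1 @ L2)"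
        using cancel_step[OF bM yA, of p a q \<epsilon> E L1 L2] adj(2) xB by blast
      have setL: "set L = set (L1 @ L2) \<union> {x, y}" using mset_eq_setD[OF adj(3)] adj(2) by auto
      have "mset (map mark_edge L) = mset (map mark_edge (L1 @ [p, q] @ L2))" using adj(3) by (simp only: mset_map)
      then have dist': "distinct (map mark_edge (L1 @ [p, q] @ L2))" using dist mset_eq_imp_distinct_iff by blast
      have "mark_edge p \<notin> mark_edge ` set (L1 @ L2)" "mark_edge q \<notin> mark_edge ` set (L1 @ L2)"
        using dist' by auto
      then have un: "{a, b} \<notin> mark_edge ` set (L1 @ L2)" "{b, c} \<notin> mark_edge ` set (L1 @ L2)"
        using adj(2) x(2) y(2) by auto
      let ?L = "L1 @ L2"
      have L': "\<And>x. x \<in> set ?L ==> mark_edge x \<in> E \<and> (\<forall>v\<in>mark_edge x. d (mark_edge x) v = is_bead x)"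
        by (rule L) (use setL in simp)
      have "simplify_step \<epsilon> (E, ?L) 1 (E', map (map_mark (id(b := a))) ?L)"
        using simplify_step.contract[OF edges(1) out_edge(2) bM un(1), of \<epsilon>] unfolding contract_out .
      moreover have "marks_ok d' E' (map (map_mark (id(b := a))) ?L)"
      proof (rule marks_ok_h[OF _ L'])
        show "distinct (map mark_edge ?L)" using dist' by auto
        show "e \<in> mark_edge ` set ?L" if e: "e \<in> E - {{a, b}, {b, c}}" "homogeneous d e" for e
        proof -
          have "e \<in> mark_edge ` set L" using hom[OF DiffD1[OF e(1)] e(2)] .
          moreover have "mark_edge ` set L = mark_edge ` set ?L \<union> {{a, b}, {b, c}}"
            unfolding setL using x(2) y(2) by simp
          ultimately show ?thesis using e(1) by blast
        qed
        show "mark_edge (map_mark (id(b := a)) x) = h (mark_edge x) \<and> is_bead (map_mark (id(b := a)) x) = is_bead x"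
          if x: "x \<in> set ?L" for x
        proof -
          have "mark_edge x \<noteq> {a, b}" using un(1) x by (metis imageI)
          then show ?thesis using h_image(1)[OF conjunct1[OF L'[OF x]]] by simp
        qed
      qed (use bx by' un in blast)+
      ultimately show ?thesis
        using simplifies_to_trans[OF adj(1) simplifies_to.step[OF can simplifies_to_step]] by blast
    qed
  qed
qed

end

theorem ready_simplification:
  assumes "ready d E" "marks_ok d E L"
  shows "\<exists>k E' L' d'. simplifies_to \<epsilon> (E, L) k (E', L') \<and> ready d' E' \<and> marks_ok d' E' L' \<and>
    \<Union>E' = \<Union>E - range Mid"
  using assms
proof (induction "card (\<Union>E \<inter> range Mid)" arbitrary: d E L rule: less_induct)
  case less
  show ?case
  proof (cases "\<Union>E \<inter> range Mid = {}")
    case True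
    then have "\<Union>E = \<Union>E - range Mid" by blast
    then show ?thesis using simplifies_to.stop less.prems by blast
  next
    case False
    then obtain b where b: "b \<in> \<Union>E" "b \<in> range Mid" by blast
    interpret middle_vertex d E b using less.prems b by unfold_locales
    obtain k L' where 1: "simplifies_to \<epsilon> (E, L) k (E', L')" "marks_ok d' E' L'"
      using reduce_marks[OF less.prems(2)] by blast
    obtain k' E'' L'' d'' where 2: "simplifies_to \<epsilon> (E', L') k' (E'', L'')" "ready d'' E''" "marks_ok d'' E'' L''"
      "\<Union>E'' = \<Union>E' - range Mid" using less.hyps[OF card_less ready' 1(2)] by blast
    have "\<Union>E'' = \<Union>E - range Mid" unfolding 2(4) vertices' using b(2) by blast
    then show ?thesis using simplifies_to_trans[OF 1(1) 2(1)] 2(2,3) by blast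
  qed
qed

abbreviation ends :: "nat \<Rightarrow> nat \<Rightarrow> vertex set" where
  "ends r s \<equiv> Top ` {1..r} \<union> Bot ` {1..s}"

text \<open>Without glued vertices the labels are forced: True at top vertices and False at bottom
  vertices.\<close>

lemma ready_marked:
  assumes "ready d E" "marks_ok d E L" "\<Union>E = ends r s"
  shows "(E, L) \<in> marked_diagrams r s"
proof -
  have noM: "\<Union>E \<inter> range Mid = {}" unfolding assms(3) by auto
  have card2: "card e = 2" if "e \<in> E" for e using assms(1) that unfolding ready_def by simp
  have dist: "distinct (map mark_edge L)"
    and L: "\<And>x. x \<in> set L ==> mark_edge x \<in> E \<and> (\<forall>v\<in>mark_edge x. d (mark_edge x) v = is_bead x)"
    and hom: "\<And>e. e \<in> E ==> homogeneous d e ==> e \<in> mark_edge ` set L"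
    using assms(2) unfolding marks_ok_def by simp_all
  have d: "d e v \<longleftrightarrow> v \<in> range Top" if "e \<in> E" "v \<in> e" for e v
  proof -
    have v: "v \<in> \<Union>E" using that by (rule UnionI)
    then have "v \<in> range Top \<or> v \<in> range Bot" unfolding assms(3) by auto
    then show ?thesis using readyD(1)[OF assms(1) v, of True] readyD(1)[OF assms(1) v, of False] that by auto
  qed
  have dB: "\<not> d e v \<longleftrightarrow> v \<in> range Bot" if "e \<in> E" "v \<in> e" for e v
  proof -
    have "v \<in> \<Union>E" using that by (rule UnionI)
    then show ?thesis unfolding d[OF that] assms(3) by auto
  qed
  have ne: "\<exists>v. v \<in> e" if "e \<in> E" for e using card2[OF that] by (metis card.empty ex_in_conv zero_neq_numeral)
  have "partition_on (ends r s) E"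
  proof (rule partition_onI)
    show "\<Union>E = ends r s" by (rule assms(3))
    show "{} \<notin> E" using ne by blast
    show "disjnt p q" if "p \<in> E" "q \<in> E" "p \<noteq> q" for p q
      using ready_disjoint[OF assms(1) noM that(1,2)] that(3) by (auto simp: disjnt_def)
  qed
  then have "brauer_diagram r s E" using card2 by (simp add: brauer_diagram_def)
  moreover have "{e. Bead e \<in> set L} = cups E"
  proof (intro set_eqI iffI; clarify)
    fix e assume "Bead e \<in> set L"
    from L[OF this] show "e \<in> cups E" using d unfolding cups_def by auto
  next
    fix e assume "e \<in> cups E"
    then have e: "e \<in> E" "e \<subseteq> range Top" unfolding cups_def by auto
    then have all: "\<forall>v\<in>e. d e v" using d by blast
    then have "e \<in> mark_edge ` set L" using hom[OF e(1)] unfolding homogeneous_def by blast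
    then obtain x where x: "x \<in> set L" "mark_edge x = e" by blast
    have "is_bead x" using L[OF x(1)] all ne[OF e(1)] unfolding x(2) by blast
    then have "x = Bead e" using x(2) by (cases x) auto
    then show "Bead e \<in> set L" using x(1) by simp
  qed
  moreover have "{{u, v} | u v. Arrow u v \<in> set L} = caps E"
  proof (intro set_eqI iffI)
    fix e assume "e \<in> {{u, v} | u v. Arrow u v \<in> set L}"
    then obtain u v where e: "e = {u, v}" "Arrow u v \<in> set L" by blast
    from L[OF e(2)] show "e \<in> caps E" using dB unfolding caps_def e(1) by auto
  next
    fix e assume "e \<in> caps E"
    then have e: "e \<in> E" "e \<subseteq> range Bot" unfolding caps_def by auto
    then have all: "\<forall>v\<in>e. \<not> d e v" using dB by blast
    then have "e \<in> mark_edge ` set L" using hom[OF e(1)] unfolding homogeneous_def by blast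
    then obtain x where x: "x \<in> set L" "mark_edge x = e" by blast
    have "\<not> is_bead x" using L[OF x(1)] all ne[OF e(1)] unfolding x(2) by blast
    then obtain u v where "x = Arrow u v" by (cases x) auto
    then show "e \<in> {{u, v} | u v. Arrow u v \<in> set L}" using x by auto
  qed
  ultimately show ?thesis using dist unfolding marked_diagrams_def by simp
qed

section \<open>Simplifying a part of a larger stack, and counting the loops that close\<close>

section \<open>Simplification in context\<close>

lemma map_edges_Un: "map_edges f (A \<union> B) = map_edges f A \<union> map_edges f B"
  by (simp add: map_edges_def image_Un)

lemma map_edges_comp: "map_edges f (map_edges g E) = map_edges (f \<circ> g) E"
  by (simp add: map_edges_def image_image image_comp)

lemma map_mark_comp: "map_mark f (map_mark g x) = map_mark (f \<circ> g) x"
  by (cases x) (simp_all add: image_comp)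

lemma map_edges_cong: "(\<And>v. v \<in> \<Union>E ==> f v = g v) ==> map_edges f E = map_edges g E"
  unfolding map_edges_def by (rule image_cong[OF HOL.refl], rule image_cong[OF HOL.refl]) blast

lemma map_mark_cong: "(\<And>v. v \<in> mark_edge x ==> f v = g v) ==> map_mark f x = map_mark g x"
  by (cases x) (auto intro: image_cong)

lemma map_marks_cong:
  "(\<And>v. v \<in> \<Union>(mark_edge ` set L) ==> f v = g v) ==> map (map_mark f) L = map (map_mark g) L"
  by (intro map_cong refl map_mark_cong) auto

lemma Union_map_edges: "\<Union>(map_edges f E) = f ` \<Union>E"
  by (auto simp: map_edges_def)

definition map_diagram :: "(vertex \<Rightarrow> vertex) \<Rightarrow> diagram \<Rightarrow> diagram" where
  "map_diagram f D = (map_edges f (fst D), map (map_mark f) (snd D))"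

lemma simplify_step_map:
  assumes "simplify_step \<epsilon> D k D'" "inj f" "f ` range Mid \<subseteq> range Mid"
  shows "simplify_step \<epsilon> (map_diagram f D) k (map_diagram f D')"
  using assms(1)
proof cases
  case (interchange E L1 x y L2)
  then show ?thesis using simplify_step.interchange[of \<epsilon> _ "map (map_mark f) L1"] by (simp add: map_diagram_def)
next
  case (contract a b E L)
  have ii: "inj ((`) f)" by (simp add: inj_on_def inj_image_eq_iff[OF assms(2)])
  have e: "{f a, f b} = f ` {a, b}" by simp
  have 1: "{f a, f b} \<in> map_edges f E" using contract(4) unfolding e map_edges_def by (rule imageI)
  have 2: "f a \<noteq> f b" using assms(2) contract(5) by (simp add: inj_eq)
  have 3: "f b \<in> range Mid" using contract(6) assms(3) by blast
  have 4: "{f a, f b} \<notin> mark_edge ` set (map (map_mark f) L)"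
  proof
    assume "{f a, f b} \<in> mark_edge ` set (map (map_mark f) L)"
    then obtain x where x: "x \<in> set L" "f ` {a, b} = f ` mark_edge x" by auto
    then have "{a, b} = mark_edge x" using ii by (simp only: inj_eq)
    then show False using contract(7) x(1) by blast
  qed
  have c: "id(f b := f a) \<circ> f = f \<circ> id(b := a)" using assms(2) by (auto simp: fun_eq_iff inj_eq)
  have "map_edges f E - {{f a, f b}} = map_edges f (E - {{a, b}})"
    unfolding e map_edges_def using image_set_diff[OF ii, of E "{{a, b}}"] by simp
  then have A: "map_edges (id(f b := f a)) (map_edges f E - {{f a, f b}}) = map_edges f (map_edges (id(b := a)) (E - {{a, b}}))"
    by (simp only: map_edges_comp c)
  have B: "map (map_mark (id(f b := f a))) (map (map_mark f) L) = map (map_mark f) (map (map_mark (id(b := a))) L)"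
    by (simp only: map_map o_def[of "map_mark _"] map_mark_comp c)
  show ?thesis unfolding contract(1-3) map_diagram_def fst_conv snd_conv A[symmetric] B[symmetric]
    by (rule simplify_step.contract[OF 1 2 3 4])
next
  case (arrow_above_towards b E L1 c a L2)
  moreover have "f b \<in> range Mid" using arrow_above_towards(4) assms(3) by blast
  ultimately show ?thesis using simplify_step.arrow_above_towards[of "f b" \<epsilon> _ "map (map_mark f) L1"] by (simp add: map_diagram_def)
next
  case (bead_above_away b E L1 a c L2)
  moreover have "f b \<in> range Mid" using bead_above_away(4) assms(3) by blast
  ultimately show ?thesis using simplify_step.bead_above_away[of "f b" \<epsilon> _ "map (map_mark f) L1"] by (simp add: map_diagram_def)
next
  case (arrow_above_away b E L1 c a L2)
  moreover have "f b \<in> range Mid" using arrow_above_away(4) assms(3) by blast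
  ultimately show ?thesis using simplify_step.arrow_above_away[of "f b" \<epsilon> _ "map (map_mark f) L1"] by (simp add: map_diagram_def)
next
  case (bead_above_towards b E L1 a c L2)
  moreover have "f b \<in> range Mid" using bead_above_towards(4) assms(3) by blast
  ultimately show ?thesis using simplify_step.bead_above_towards[of "f b" \<epsilon> _ "map (map_mark f) L1"] by (simp add: map_diagram_def)
qed

lemma simplifies_to_map:
  assumes "simplifies_to \<epsilon> D k D'" "inj f" "f ` range Mid \<subseteq> range Mid"
  shows "simplifies_to \<epsilon> (map_diagram f D) k (map_diagram f D')"
  using assms(1)
proof induction
  case (step D c D' c' D'')
  then show ?case using simplify_step_map[OF step(1) assms(2,3)] simplifies_to.step by blast
qed (rule simplifies_to.stop)

text \<open>The surrounding edges \<open>F\<close> meet the part only in vertices that survive the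
  step. Hence a contracted vertex occurs neither in \<open>F\<close> nor in the surrounding
  markings.\<close>

lemma simplify_step_context:
  assumes "simplify_step \<epsilon> D k D'" "\<Union>(fst D) \<inter> \<Union>F \<subseteq> \<Union>(fst D')" "mark_edge ` set (La @ Lb) \<subseteq> F"
  shows "simplify_step \<epsilon> (fst D \<union> F, La @ snd D @ Lb) k (fst D' \<union> F, La @ snd D' @ Lb)"
  using assms(1)
proof cases
  case (interchange E L1 x y L2)
  then show ?thesis using simplify_step.interchange[of \<epsilon> _ "La @ L1" x y "L2 @ Lb"] by simp
next
  case (contract a b E L)
  have bE: "b \<in> \<Union>E" using contract(4) by (meson UnionI insertI1 insertI2)
  have D: "fst D = E" "fst D' = map_edges (id(b := a)) (E - {{a, b}})" "snd D = L" "snd D' = map (map_mark (id(b := a))) L"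
    unfolding contract(1,3) by simp_all
  have "b \<notin> \<Union>(fst D')" unfolding D Union_map_edges using contract(5) by auto
  then have bF: "b \<notin> \<Union>F" using assms(2) bE unfolding D(1) by blast
  then have nF: "{a, b} \<notin> F" by blast
  have 1: "{a, b} \<in> E \<union> F" using contract(4) by blast
  have 2: "{a, b} \<notin> mark_edge ` set (La @ L @ Lb)" using contract(7) nF assms(3) by auto
  have "map_edges (id(b := a)) F = map_edges id F" by (rule map_edges_cong) (use bF in auto)
  then have F: "map_edges (id(b := a)) F = F" by (simp add: map_edges_def)
  have "E \<union> F - {{a, b}} = (E - {{a, b}}) \<union> F" using nF by blast
  then have 3: "map_edges (id(b := a)) (E \<union> F - {{a, b}}) = map_edges (id(b := a)) (E - {{a, b}}) \<union> F"
    by (simp only: map_edges_Un F)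
  have 4: "map (map_mark (id(b := a))) K = K" if "mark_edge ` set K \<subseteq> F" for K
    by (rule map_idI, rule map_mark_idle) (use that bF in auto)
  have 5: "map (map_mark (id(b := a))) (La @ L @ Lb) = La @ map (map_mark (id(b := a))) L @ Lb"
    using 4[of La] 4[of Lb] assms(3) by (simp add: image_Un)
  show ?thesis using simplify_step.contract[OF 1 contract(5,6) 2, of \<epsilon>] unfolding 3 5 D contract(2) .
next
  case (arrow_above_towards b E L1 c a L2)
  then show ?thesis using simplify_step.arrow_above_towards[of b \<epsilon> _ "La @ L1" c a "L2 @ Lb"] by simp
next
  case (bead_above_away b E L1 a c L2)
  then show ?thesis using simplify_step.bead_above_away[of b \<epsilon> _ "La @ L1" a c "L2 @ Lb"] by simp
next
  case (arrow_above_away b E L1 c a L2)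
  then show ?thesis using simplify_step.arrow_above_away[of b \<epsilon> _ "La @ L1" c a "L2 @ Lb"] by simp
next
  case (bead_above_towards b E L1 a c L2)
  then show ?thesis using simplify_step.bead_above_towards[of b \<epsilon> _ "La @ L1" a c "L2 @ Lb"] by simp
qed

lemma simplifies_to_context:
  assumes "simplifies_to \<epsilon> D k D'" "\<Union>(fst D) \<inter> \<Union>F \<subseteq> \<Union>(fst D')" "mark_edge ` set (La @ Lb) \<subseteq> F"
  shows "simplifies_to \<epsilon> (fst D \<union> F, La @ snd D @ Lb) k (fst D' \<union> F, La @ snd D' @ Lb)"
  using assms
proof induction
  case (step D c D' c' D'')
  have sub: "\<Union>(fst D') \<subseteq> \<Union>(fst D)" "\<Union>(fst D'') \<subseteq> \<Union>(fst D')"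
    by (rule conjunct1[OF simplify_step_connected[OF step(1)]], rule conjunct1[OF simplifies_to_connected[OF step(2)]])
  have 1: "\<Union>(fst D) \<inter> \<Union>F \<subseteq> \<Union>(fst D')" using step.prems(1) sub(2) by (rule subset_trans)
  have 2: "\<Union>(fst D') \<inter> \<Union>F \<subseteq> \<Union>(fst D'')" using step.prems(1) sub(1) by (meson Int_mono subset_refl subset_trans)
  show ?case by (rule simplifies_to.step[OF simplify_step_context[OF step(1) 1 step.prems(2)] step.IH[OF 2 step.prems(2)]])
qed (rule simplifies_to.stop)

section \<open>Closed components\<close>

text \<open>If \<open>Q\<close> consists of the outer vertices, these are the closed loops. In
  contrast to \<open>loops\<close> this also makes sense for a part of a stack, some of whose outer
  vertices are glued vertices of the whole.\<close>

definition closed_components :: "vertex set set \<Rightarrow> vertex set \<Rightarrow> vertex set set" where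
  "closed_components E Q = {C \<in> \<Union>E // connected_by E. C \<inter> Q = {}}"

definition component :: "vertex set set \<Rightarrow> vertex \<Rightarrow> vertex set" where
  "component E v = connected_by E `` {v}"

lemma component_iff: "w \<in> component E v \<longleftrightarrow> (v, w) \<in> connected_by E"
  by (simp add: component_def)

lemma component_eq:
  assumes "(v, w) \<in> connected_by E"
  shows "component E v = component E w"
  using connected_trans[OF assms] connected_trans[OF connected_sym[OF assms]]
  unfolding set_eq_iff component_iff by blast

lemma component_self: "v \<in> component E v"
  by (simp add: component_iff)

lemma component_sub: "v \<in> \<Union>E ==> component E v \<subseteq> \<Union>E"
  using connected_in by (fastforce simp: component_iff)

lemma closed_iff: "C \<in> closed_components E Q \<longleftrightarrow> (\<exists>v\<in>\<Union>E. C = component E v) \<and> C \<inter> Q = {}"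
  unfolding closed_components_def quotient_def component_def by blast

lemma closed_image: "closed_components E Q = {C \<in> component E ` \<Union>E. C \<inter> Q = {}}"
  by (auto simp only: set_eq_iff closed_iff mem_Collect_eq image_iff)

lemma finite_closed: "finite (\<Union>E) ==> finite (closed_components E Q)"
  unfolding closed_image by simp

text \<open>\<open>E\<close> is a part of the edge set \<open>E \<union> F\<close>, and
  \<open>E'\<close> is what the part is replaced by. \<open>O'\<close> is the set of outer vertices
  of the part and \<open>Q\<close> that of the whole.\<close>

locale gluing =
  fixes E E' F O' Q
  assumes O': "\<Union>E' = O'" "O' \<subseteq> \<Union>E"
    and conn: "\<And>u v. u \<in> O' ==> v \<in> O' ==> (u, v) \<in> connected_by E \<longleftrightarrow> (u, v) \<in> connected_by E'"
    and EF: "\<Union>E \<inter> \<Union>F \<subseteq> O'" and Q: "Q \<inter> \<Union>E \<subseteq> O'"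
    and finE: "finite (\<Union>E)" "finite (\<Union>F)"
begin

abbreviation "W \<equiv> O' \<union> \<Union>F"

lemma glue_connected:
  assumes "u \<in> W" "v \<in> W"
  shows "(u, v) \<in> connected_by (E \<union> F) \<longleftrightarrow> (u, v) \<in> connected_by (E' \<union> F)"
proof
  assume "(u, v) \<in> connected_by (E' \<union> F)"
  then have "(id u, id v) \<in> connected_by (E \<union> F)"
  proof (rule connected_map)
    fix e x y assume e: "e \<in> E' \<union> F" "x \<in> e" "y \<in> e"
    show "(id x, id y) \<in> connected_by (E \<union> F)"
    proof (cases "e \<in> F")
      case True then show ?thesis using connected_edge[of e "E \<union> F"] e by simp
    next
      case False
      then have E': "e \<in> E'" using e by simp
      then have "x \<in> O'" "y \<in> O'" using e O' by auto
      then have "(x, y) \<in> connected_by E" using conn connected_edge[OF E' e(2,3)] by simp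
      then show ?thesis using connected_mono[of x y E "E \<union> F"] by simp
    qed
  qed
  then show "(u, v) \<in> connected_by (E \<union> F)" by simp
next
  assume uv: "(u, v) \<in> connected_by (E \<union> F)"
  define P where "P x w \<longleftrightarrow> w \<in> O' \<and> (x, w) \<in> connected_by E" for x w
  \<comment> \<open>A path through \<open>E\<close> is pushed to the boundary: each vertex goes to a
    boundary vertex of its own component of \<open>E\<close>. A component without any is collapsed
    to the arbitrary constant \<open>Top 0\<close>, which is harmless because no edge of
    \<open>F\<close> meets such a component.\<close>
  define f where "f x = (if x \<in> W then x else if \<exists>w. P x w then SOME w. P x w else Top 0)" for x
  have fP: "P x (f x)" if "x \<in> \<Union>E" "\<exists>w. P x w" for x
  proof (cases "x \<in> W")
    case True
    then have "x \<in> O'" using EF that by blast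
    then show ?thesis unfolding P_def f_def by simp
  next
    case False
    then have "f x = (SOME w. P x w)" using that unfolding f_def by simp
    then show ?thesis using someI_ex[OF that(2)] by simp
  qed
  from uv have "(f u, f v) \<in> connected_by (E' \<union> F)"
  proof (rule connected_map)
    fix e x y assume e: "e \<in> E \<union> F" "x \<in> e" "y \<in> e"
    show "(f x, f y) \<in> connected_by (E' \<union> F)"
    proof (cases "e \<in> F")
      case True
      then have "x \<in> W" "y \<in> W" using e by auto
      then have "f x = x" "f y = y" unfolding f_def by simp_all
      then show ?thesis using connected_edge[of e "E' \<union> F" x y] True e by simp
    next
      case False
      then have E: "e \<in> E" using e by simp
      then have V: "x \<in> \<Union>E" "y \<in> \<Union>E" using e by auto
      have xy: "(x, y) \<in> connected_by E" using connected_edge[OF E e(2,3)] .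
      have PP: "P x w \<longleftrightarrow> P y w" for w
        unfolding P_def using xy connected_sym[OF xy] connected_trans by blast
      show ?thesis
      proof (cases "\<exists>w. P x w")
        case True
        then have "P x (f x)" "P y (f y)" using fP V PP by auto
        then have 1: "f x \<in> O'" "f y \<in> O'" "(x, f x) \<in> connected_by E" "(y, f y) \<in> connected_by E" unfolding P_def by auto
        then have "(f x, f y) \<in> connected_by E" using xy connected_sym connected_trans by metis
        then have "(f x, f y) \<in> connected_by E'" using conn 1 by simp
        then show ?thesis using connected_mono by blast
      next
        case False
        then have n: "\<nexists>w. P x w" "\<nexists>w. P y w" using PP by auto
        have "x \<notin> O'" "y \<notin> O'" using n unfolding P_def by auto
        then have "x \<notin> W" "y \<notin> W" using EF V by blast+
        then have "f x = Top 0" "f y = Top 0" using n unfolding f_def by (simp_all only: if_False simp_thms)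
        then show ?thesis by simp
      qed
    qed
  qed
  moreover have "f u = u" "f v = v" using assms unfolding f_def by simp_all
  ultimately show "(u, v) \<in> connected_by (E' \<union> F)" by simp
qed

lemma component_inner:
  assumes "v \<in> \<Union>E" "component E v \<inter> O' = {}"
  shows "component (E \<union> F) v = component E v"
proof
  show "component E v \<subseteq> component (E \<union> F) v"
    using connected_mono[of v _ E "E \<union> F"] by (auto simp: component_iff)
  show "component (E \<union> F) v \<subseteq> component E v"
  proof
    fix w assume "w \<in> component (E \<union> F) v"
    then have "(v, w) \<in> connected_by (E \<union> F)" by (simp add: component_iff)
    then show "w \<in> component E v"
    proof (rule connected_closed)
      show "v \<in> component E v" by (rule component_self)
      fix e assume e: "e \<in> E \<union> F" "e \<inter> component E v \<noteq> {}"
      then obtain x where x: "x \<in> e" "x \<in> component E v" by blast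
      have xE: "x \<in> \<Union>E" using component_sub[OF assms(1)] x by blast
      have "e \<notin> F" using x xE EF assms(2) by blast
      then have "e \<in> E" using e by simp
      then show "e \<subseteq> component E v"
        using x connected_edge[of e E x] connected_trans by (auto simp: component_iff)
    qed
  qed
qed

lemma closed_inner: "{C \<in> closed_components (E \<union> F) Q. C \<inter> W = {}} = closed_components E O'"
proof (intro set_eqI iffI)
  fix C assume "C \<in> {C \<in> closed_components (E \<union> F) Q. C \<inter> W = {}}"
  then obtain v where v: "v \<in> \<Union>(E \<union> F)" "C = component (E \<union> F) v" "C \<inter> W = {}" by (auto simp: closed_iff)
  have "v \<in> C" using v(2) component_self by simp
  then have vE: "v \<in> \<Union>E" using v by blast
  have "component E v \<subseteq> C" unfolding v(2) using connected_mono[of v _ E "E \<union> F"] by (auto simp: component_iff)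
  then have d: "component E v \<inter> O' = {}" using v(3) by blast
  then show "C \<in> closed_components E O'" using component_inner[OF vE d] vE v by (auto simp: closed_iff)
next
  fix C assume "C \<in> closed_components E O'"
  then obtain v where v: "v \<in> \<Union>E" "C = component E v" "C \<inter> O' = {}" by (auto simp: closed_iff)
  have C: "C = component (E \<union> F) v" using component_inner v by simp
  have sub: "C \<subseteq> \<Union>E" using component_sub v by simp
  then have "C \<inter> W = {}" "C \<inter> Q = {}" using v(3) EF Q by blast+
  then show "C \<in> {C \<in> closed_components (E \<union> F) Q. C \<inter> W = {}}" using C v(1) by (auto simp: closed_iff)
qed

lemma component_outer:
  assumes "w \<in> W"
  shows "component (E \<union> F) w \<inter> W = component (E' \<union> F) w"
proof -
  have "component (E' \<union> F) w \<subseteq> W" using component_sub[of w "E' \<union> F"] assms O'(1) by simp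
  then show ?thesis using glue_connected[OF assms] unfolding set_eq_iff Int_iff component_iff subset_iff by blast
qed

lemma closed_outer:
  "bij_betw (\<lambda>C. C \<inter> W) {C \<in> closed_components (E \<union> F) Q. C \<inter> W \<noteq> {}} (closed_components (E' \<union> F) Q)"
  unfolding bij_betw_def
proof
  have k: "C = component (E \<union> F) w" if C: "C \<in> closed_components (E \<union> F) Q" "w \<in> C" for C w
  proof -
    obtain v where "C = component (E \<union> F) v" using C(1) by (auto simp: closed_iff)
    then show ?thesis using C(2) component_eq by (simp add: component_iff)
  qed
  show "inj_on (\<lambda>C. C \<inter> W) {C \<in> closed_components (E \<union> F) Q. C \<inter> W \<noteq> {}}"
  proof (rule inj_onI)
    fix C C' assume C: "C \<in> {C \<in> closed_components (E \<union> F) Q. C \<inter> W \<noteq> {}}" and C': "C' \<in> {C \<in> closed_components (E \<union> F) Q. C \<inter> W \<noteq> {}}"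
      and eq: "C \<inter> W = C' \<inter> W"
    then obtain w where "w \<in> C" "w \<in> C'" by blast
    then show "C = C'" using k[of C w] k[of C' w] C C' by simp
  qed
  show "(\<lambda>C. C \<inter> W) ` {C \<in> closed_components (E \<union> F) Q. C \<inter> W \<noteq> {}} = closed_components (E' \<union> F) Q"
  proof (intro set_eqI iffI)
    fix X assume "X \<in> (\<lambda>C. C \<inter> W) ` {C \<in> closed_components (E \<union> F) Q. C \<inter> W \<noteq> {}}"
    then obtain C w where C: "X = C \<inter> W" "C \<in> closed_components (E \<union> F) Q" "w \<in> C" "w \<in> W" by blast
    then have "X = component (E' \<union> F) w" using k[OF C(2,3)] component_outer[OF C(4)] by simp
    moreover have "w \<in> \<Union>(E' \<union> F)" using C(4) O'(1) by simp
    moreover have "X \<inter> Q = {}" using C(1,2) by (auto simp: closed_iff)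
    ultimately show "X \<in> closed_components (E' \<union> F) Q" by (auto simp: closed_iff)
  next
    fix X assume "X \<in> closed_components (E' \<union> F) Q"
    then obtain w where w: "w \<in> W" "X = component (E' \<union> F) w" "X \<inter> Q = {}" using O'(1) by (auto simp: closed_iff)
    let ?C = "component (E \<union> F) w"
    have X: "X = ?C \<inter> W" using component_outer[OF w(1)] w(2) by simp
    have wE: "w \<in> \<Union>(E \<union> F)" using w(1) O'(2) by auto
    have "?C \<subseteq> \<Union>(E \<union> F)" using component_sub[OF wE] .
    then have "x \<notin> ?C \<inter> Q" for x using X w(3) Q by (cases "x \<in> W") blast+
    then have "?C \<inter> Q = {}" by blast
    then have "?C \<in> closed_components (E \<union> F) Q" using wE by (auto simp: closed_iff)
    moreover have "?C \<inter> W \<noteq> {}" using component_self w(1) by blast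
    ultimately show "X \<in> (\<lambda>C. C \<inter> W) ` {C \<in> closed_components (E \<union> F) Q. C \<inter> W \<noteq> {}}" using X by blast
  qed
qed

text \<open>A loop of the whole either avoids the boundary and \<open>F\<close>, and is then a loop
  of the part, or it meets them and remains a loop after the part has been replaced.\<close>

lemma card_closed: "card (closed_components (E \<union> F) Q) = card (closed_components E O') + card (closed_components (E' \<union> F) Q)"
proof -
  let ?A = "{C \<in> closed_components (E \<union> F) Q. C \<inter> W = {}}" and ?B = "{C \<in> closed_components (E \<union> F) Q. C \<inter> W \<noteq> {}}"
  have fin: "finite (closed_components (E \<union> F) Q)" by (rule finite_closed) (use finE in simp)
  have "closed_components (E \<union> F) Q = ?A \<union> ?B" by blast
  moreover have "card (?A \<union> ?B) = card ?A + card ?B" by (rule card_Un_disjoint) (use fin in auto)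
  ultimately show ?thesis using closed_inner bij_betw_same_card[OF closed_outer] by simp
qed

end

lemma connected_map_inj:
  assumes "inj f"
  shows "(f u, f v) \<in> connected_by (map_edges f E) \<longleftrightarrow> (u, v) \<in> connected_by E"
proof
  assume "(f u, f v) \<in> connected_by (map_edges f E)"
  then have "(inv f (f u), inv f (f v)) \<in> connected_by E"
  proof (rule connected_map)
    fix e x y assume "e \<in> map_edges f E" "x \<in> e" "y \<in> e"
    then obtain g x' y' where "g \<in> E" "x' \<in> g" "y' \<in> g" "x = f x'" "y = f y'" unfolding map_edges_def by blast
    then show "(inv f x, inv f y) \<in> connected_by E" using connected_edge assms by simp
  qed
  then show "(u, v) \<in> connected_by E" using assms by simp
next
  assume "(u, v) \<in> connected_by E"
  then show "(f u, f v) \<in> connected_by (map_edges f E)"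
  proof (rule connected_map)
    fix e x y assume "e \<in> E" "x \<in> e" "y \<in> e"
    then show "(f x, f y) \<in> connected_by (map_edges f E)"
      using connected_edge[of "f ` e" "map_edges f E" "f x" "f y"] by (simp add: map_edges_def)
  qed
qed

lemma component_map:
  assumes "inj f" "v \<in> \<Union>E"
  shows "component (map_edges f E) (f v) = f ` component E v"
proof -
  have "f v \<in> \<Union>(map_edges f E)" unfolding Union_map_edges using assms(2) by (rule imageI)
  then have "component (map_edges f E) (f v) \<subseteq> f ` \<Union>E" using component_sub unfolding Union_map_edges[symmetric] by blast
  then show ?thesis using connected_map_inj[OF assms(1)] by (fastforce simp: component_iff)
qed

lemma card_closed_map:
  assumes "inj f"
  shows "card (closed_components (map_edges f E) (f ` Q)) = card (closed_components E Q)"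
proof -
  have "closed_components (map_edges f E) (f ` Q) = (`) f ` closed_components E Q"
  proof (intro set_eqI iffI)
    fix C assume "C \<in> closed_components (map_edges f E) (f ` Q)"
    then obtain v where v: "v \<in> \<Union>E" "C = component (map_edges f E) (f v)" "C \<inter> f ` Q = {}"
      unfolding closed_iff Union_map_edges by blast
    then have C: "C = f ` component E v" using component_map[OF assms] by simp
    then have "component E v \<inter> Q = {}" using v(3) by blast
    then have "component E v \<in> closed_components E Q" unfolding closed_iff using v(1) by blast
    with C show "C \<in> (`) f ` closed_components E Q" by (rule image_eqI)
  next
    fix C assume "C \<in> (`) f ` closed_components E Q"
    then obtain C' where C': "C = f ` C'" "C' \<in> closed_components E Q" by blast
    then obtain v where v': "v \<in> \<Union>E" "C' = component E v" "C' \<inter> Q = {}" unfolding closed_iff by blast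
    have v: "v \<in> \<Union>E" "C = f ` component E v" "component E v \<inter> Q = {}" using v' C'(1) by simp_all
    have "C \<inter> f ` Q = f ` (component E v \<inter> Q)" unfolding v(2) using image_Int[OF assms] by blast
    moreover have "\<exists>w\<in>f ` \<Union>E. C = component (map_edges f E) w"
      using v(2) component_map[OF assms v(1)] v(1) by (intro bexI[of _ "f v"]) (simp_all only: imageI)
    ultimately show "C \<in> closed_components (map_edges f E) (f ` Q)"
      unfolding closed_iff Union_map_edges using v(3) by simp
  qed
  then show ?thesis using assms by (simp add: card_image inj_on_def inj_image_eq_iff)
qed

section \<open>Reductions\<close>

text \<open>Only for \<open>m = 0\<close> is \<open>D'\<close> tied to the markings of
  \<open>D\<close>. In the presence of loops the number \<open>m\<close> and the connections between
  outer vertices determine enough, because \<open>\<delta> ^ m = 0\<close> for \<epsilon> = -1 and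
  signs are trivial for \<epsilon> = 1. Counting the closed components instead of deleting them
  allows loops to close at any stage of a reduction.\<close>

definition reduces :: "'k::field \<Rightarrow> vertex set \<Rightarrow> diagram \<Rightarrow> nat \<Rightarrow> 'k \<Rightarrow> diagram \<Rightarrow> bool" where
  "reduces \<epsilon> Q D m k D' \<longleftrightarrow> \<Union>(fst D') = Q \<and> Q \<subseteq> \<Union>(fst D) \<and>
     (\<forall>u\<in>Q. \<forall>v\<in>Q. (u, v) \<in> connected_by (fst D) \<longleftrightarrow> (u, v) \<in> connected_by (fst D')) \<and>
     m = card (closed_components (fst D) Q) \<and> (m = 0 \<longrightarrow> simplifies_to \<epsilon> D k D') \<and> k \<in> {1, \<epsilon>}"

lemma reduces_connected:
  assumes "reduces \<epsilon> Q D m k D'" "u \<in> Q" "v \<in> Q"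
  shows "(u, v) \<in> connected_by (fst D) \<longleftrightarrow> (u, v) \<in> connected_by (fst D')"
proof -
  have "\<forall>u\<in>Q. \<forall>v\<in>Q. (u, v) \<in> connected_by (fst D) \<longleftrightarrow> (u, v) \<in> connected_by (fst D')"
    using assms(1) unfolding reduces_def by simp
  then show ?thesis using assms(2,3) by blast
qed

text \<open>The means of comparing different orders of reduction: a part is replaced by its result,
  the loop numbers add up and the coefficients multiply.\<close>

lemma reduces_context:
  assumes r: "reduces \<epsilon> O' (E, L) m k (E', L')" and r': "reduces \<epsilon> Q (E' \<union> F, La @ L' @ Lb) m' k' D"
    and EF: "\<Union>E \<inter> \<Union>F \<subseteq> O'" and Q: "Q \<inter> \<Union>E \<subseteq> O'"
    and F: "mark_edge ` set (La @ Lb) \<subseteq> F" and fin: "finite (\<Union>E)" "finite (\<Union>F)" and e: "\<epsilon> * \<epsilon> = 1"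
  shows "reduces \<epsilon> Q (E \<union> F, La @ L @ Lb) (m + m') (k * k') D"
proof -
  interpret gluing E E' F O' Q
    by unfold_locales (use r EF Q fin in \<open>auto simp: reduces_def\<close>)
  have D: "\<Union>(fst D) = Q" "Q \<subseteq> W" using r' O'(1) unfolding reduces_def by auto
  have conn': "(u, v) \<in> connected_by (E \<union> F) \<longleftrightarrow> (u, v) \<in> connected_by (fst D)" if "u \<in> Q" "v \<in> Q" for u v
  proof -
    have "u \<in> W" "v \<in> W" using that D(2) by auto
    then show ?thesis using glue_connected r' that unfolding reduces_def by simp
  qed
  have m: "m + m' = card (closed_components (E \<union> F) Q)" using r r' card_closed unfolding reduces_def by simp
  have s: "simplifies_to \<epsilon> (E \<union> F, La @ L @ Lb) (k * k') D" if "m + m' = 0"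
  proof -
    have 1: "simplifies_to \<epsilon> (E, L) k (E', L')" and 2: "simplifies_to \<epsilon> (E' \<union> F, La @ L' @ Lb) k' D"
      using that r r' unfolding reduces_def by auto
    have "simplifies_to \<epsilon> (E \<union> F, La @ L @ Lb) k (E' \<union> F, La @ L' @ Lb)"
      using simplifies_to_context[OF 1, of F La Lb] EF F O'(1) by simp
    then show ?thesis using 2 by (rule simplifies_to_trans)
  qed
  have kk: "k * k' \<in> {1, \<epsilon>}" using r r' e unfolding reduces_def by auto
  have "Q \<subseteq> \<Union>(E \<union> F)" using D(2) O'(2) by auto
  then show ?thesis unfolding reduces_def fst_conv using D(1) conn' m s kk by blast
qed

lemma reduces_map:
  assumes "reduces \<epsilon> Q D m k D'" "inj f" "f ` range Mid \<subseteq> range Mid"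
  shows "reduces \<epsilon> (f ` Q) (map_diagram f D) m k (map_diagram f D')"
  unfolding reduces_def map_diagram_def fst_conv Union_map_edges
proof (intro conjI ballI impI)
  note r = assms(1)[unfolded reduces_def]
  show "f ` \<Union>(fst D') = f ` Q" "f ` Q \<subseteq> f ` \<Union>(fst D)" using r by (simp, meson image_mono)
  show "m = card (closed_components (map_edges f (fst D)) (f ` Q))" using r card_closed_map[OF assms(2)] by simp
  show "k \<in> {1, \<epsilon>}" using r by blast
  show "simplifies_to \<epsilon> (map_edges f (fst D), map (map_mark f) (snd D)) k (map_edges f (fst D'), map (map_mark f) (snd D'))"
    if "m = 0" using simplifies_to_map[of \<epsilon> D k D' f] assms(2,3) r that unfolding map_diagram_def by blast
  fix u v assume "u \<in> f ` Q" "v \<in> f ` Q"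
  then obtain u' v' where "u' \<in> Q" "v' \<in> Q" "u = f u'" "v = f v'" by blast
  then show "((u, v) \<in> connected_by (map_edges f (fst D))) = ((u, v) \<in> connected_by (map_edges f (fst D')))"
    using r connected_map_inj[OF assms(2)] by simp
qed

section \<open>Independence of all choices, and the composite of two diagrams\<close>

section \<open>Uniqueness of reductions\<close>

definition cong :: "'k::field \<Rightarrow> nat \<Rightarrow> nat \<Rightarrow> (diagram \<Rightarrow>\<^sub>0 'k) \<Rightarrow> (diagram \<Rightarrow>\<^sub>0 'k) \<Rightarrow> bool" where
  "cong \<epsilon> r s f g \<longleftrightarrow> f - g \<in> null_space \<epsilon> r s"

lemma cong_refl [simp]: "cong \<epsilon> r s f f"
  by (simp add: cong_def null_space_def comb.span_zero)

lemma cong_sym: "cong \<epsilon> r s f g ==> cong \<epsilon> r s g f"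
  unfolding cong_def null_space_def using comb.span_neg[of "f - g"] by simp

lemma cong_trans: "cong \<epsilon> r s f g ==> cong \<epsilon> r s g h ==> cong \<epsilon> r s f h"
  unfolding cong_def null_space_def using comb.span_add[of "f - g" _ "g - h"] by simp

lemma cong_add: "cong \<epsilon> r s f g ==> cong \<epsilon> r s f' g' ==> cong \<epsilon> r s (f + f') (g + g')"
  unfolding cong_def null_space_def using comb.span_add[of "f - g" _ "f' - g'"] by (simp add: algebra_simps)

lemma cong_scale: "cong \<epsilon> r s f g ==> cong \<epsilon> r s (scale c f) (scale c g)"
  unfolding cong_def null_space_def using comb.span_scale[of "f - g" _ c] by (simp add: comb.scale_right_diff_distrib)

lemma cong_sum: "(\<And>i. i \<in> I ==> cong \<epsilon> r s (f i) (g i)) ==> cong \<epsilon> r s (sum f I) (sum g I)"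
  by (induction I rule: infinite_finite_induct) (auto intro: cong_add)

abbreviation top_flow :: "vertex set \<Rightarrow> vertex \<Rightarrow> bool" where
  "top_flow \<equiv> \<lambda>_ v. v \<in> range Top"

lemma brauer_edge:
  assumes "brauer_diagram r s E"
  shows "\<Union>E = ends r s" "e \<in> E ==> card e = 2" "e \<in> E ==> e' \<in> E ==> v \<in> e ==> v \<in> e' ==> e = e'" "finite E"
proof -
  have p: "partition_on (ends r s) E" using assms by (simp add: brauer_diagram_def)
  show u: "\<Union>E = ends r s" using p by (simp add: partition_on_def)
  show "e \<in> E ==> card e = 2" using assms by (simp add: brauer_diagram_def)
  show "e \<in> E ==> e' \<in> E ==> v \<in> e ==> v \<in> e' ==> e = e'"
    using p unfolding partition_on_def disjoint_def by blast
  have "finite (ends r s)" by simp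
  then show "finite E" using u by (metis finite_UnionD)
qed

text \<open>A marked diagram is a system of strings without glued vertices in which an end of an
  edge is labelled True iff it lies at the top.\<close>

lemma marked_diagrams_iff:
  "(E, L) \<in> marked_diagrams r s \<longleftrightarrow> brauer_diagram r s E \<and> marks_ok top_flow E L"
proof
  assume a: "(E, L) \<in> marked_diagrams r s"
  then have b: "brauer_diagram r s E" and dist: "distinct (map mark_edge L)"
    and B: "{e. Bead e \<in> set L} = cups E" and A: "{{u, v} | u v. Arrow u v \<in> set L} = caps E"
    unfolding marked_diagrams_def by auto
  have bead: "Bead e \<in> set L \<longleftrightarrow> e \<in> cups E" for e using B by blast
  have V: "\<Union>E = ends r s" using brauer_edge(1)[OF b] .
  have "mark_edge x \<in> E \<and> (\<forall>v\<in>mark_edge x. (v \<in> range Top) = is_bead x)" if "x \<in> set L" for x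
  proof (cases x)
    case (Bead e) then show ?thesis using bead that unfolding cups_def by auto
  next
    case (Arrow u v)
    then have "{u, v} \<in> caps E" using A that by blast
    then show ?thesis using Arrow unfolding caps_def by auto
  qed
  moreover have "e \<in> mark_edge ` set L" if e: "e \<in> E" "homogeneous top_flow e" for e
    using e(2) unfolding homogeneous_def
  proof
    assume "\<forall>v\<in>e. v \<in> range Top"
    then have "Bead e \<in> set L" using bead e(1) unfolding cups_def by blast
    then show ?thesis by force
  next
    assume n: "\<forall>v\<in>e. v \<notin> range Top"
    have "e \<subseteq> ends r s" using e(1) V by blast
    then have "e \<subseteq> range Bot" using n by blast
    then have "e \<in> caps E" using e(1) unfolding caps_def by blast
    then obtain u v where "e = {u, v}" "Arrow u v \<in> set L" using A by blast
    then show ?thesis by force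
  qed
  ultimately show "brauer_diagram r s E \<and> marks_ok top_flow E L"
    using b dist unfolding marks_ok_def by blast
next
  assume a: "brauer_diagram r s E \<and> marks_ok top_flow E L"
  then have b: "brauer_diagram r s E" by simp
  note bE = brauer_edge[OF b]
  have "ready top_flow E" unfolding ready_def
  proof (intro conjI ballI allI)
    show "finite E" by (rule bE(4))
    show "card e = 2" if "e \<in> E" for e using bE(2)[OF that] .
  next
    fix v q assume v: "v \<in> \<Union>E"
    then have "v \<in> ends r s" using bE(1) by simp
    then have TB: "v \<in> range Bot \<longleftrightarrow> v \<notin> range Top" by auto
    obtain e where e: "e \<in> E" "v \<in> e" using v by blast
    have ex1: "\<exists>!e. e \<in> E \<and> v \<in> e" using e bE(3)[OF _ e(1) _ e(2)] by blast
    show "if v \<in> range (if q then Bot else Top) then \<nexists>e. e \<in> E \<and> v \<in> e \<and> (v \<in> range Top) = q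
         else \<exists>!e. e \<in> E \<and> v \<in> e \<and> (v \<in> range Top) = q"
      using ex1 by (cases q; cases "v \<in> range Top") (simp_all only: if_True if_False TB simp_thms)
    have "v \<notin> range Mid" using \<open>v \<in> ends r s\<close> by auto
    then show "\<exists>w. w \<notin> range Mid \<and> (v, w) \<in> connected_by E" by (meson connected_refl)
  qed
  then show "(E, L) \<in> marked_diagrams r s" using ready_marked a bE(1) by blast
qed

lemma brauer_arrangement: "brauer_diagram r s E ==> \<exists>\<rho>. arrangement \<rho> E"
  by (rule arrangement_of_disjoint[OF brauer_edge(4,2,3)])

lemma marks_ok_marked: "marks_ok d E L ==> marked (E, L)"
  by (auto simp: marks_ok_def marked_def)

text \<open>Only the edge and the kind of each marking enter, so permuting the list or reversing
  arrows is allowed.\<close>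

lemma marks_ok_cong:
  assumes "marks_ok d E L" "mset (map (\<lambda>x. (mark_edge x, is_bead x)) L) = mset (map (\<lambda>x. (mark_edge x, is_bead x)) L')"
  shows "marks_ok d E L'"
proof -
  let ?p = "\<lambda>x. (mark_edge x, is_bead x)"
  have s: "?p ` set L = ?p ` set L'" using mset_eq_setD[OF assms(2)] by simp
  have "mset (map fst (map ?p L)) = mset (map fst (map ?p L'))" using assms(2) by (simp only: mset_map)
  then have m: "mset (map mark_edge L) = mset (map mark_edge L')" by (simp add: o_def)
  have d: "distinct (map mark_edge L')" using assms(1) mset_eq_imp_distinct_iff[OF m] unfolding marks_ok_def by simp
  have e: "mark_edge ` set L' = mark_edge ` set L" using mset_eq_setD[OF m] by simp
  have "mark_edge x \<in> E \<and> (\<forall>v\<in>mark_edge x. d (mark_edge x) v = is_bead x)" if "x \<in> set L'" for x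
  proof -
    have "?p x \<in> ?p ` set L" unfolding s using that by (rule imageI)
    then obtain y where "y \<in> set L" "mark_edge y = mark_edge x" "is_bead y = is_bead x" by auto
    then show ?thesis using assms(1) unfolding marks_ok_def by metis
  qed
  then show ?thesis using d assms(1) unfolding marks_ok_def e by blast
qed

lemma sign_sq: "\<epsilon> * \<epsilon> = 1 ==> sign \<epsilon> \<rho> L * sign \<epsilon> \<rho> L = (1::'k::field)"
  unfolding sign_def by (metis power_mult_distrib power_one)

text \<open>An interchange or a reversal changes the sign of a list by the same factor \<epsilon> by
  which the relations change the diagram. The signed diagram \<open>N L\<close> is therefore
  constant modulo the relations.\<close>

locale remarking =
  fixes \<epsilon> :: "'k::field" and r s E \<rho>
  assumes ee: "\<epsilon> * \<epsilon> = 1" and brauer: "brauer_diagram r s E" and arr: "arrangement \<rho> E"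
begin

definition N where "N L = scale (sign \<epsilon> \<rho> L) (basis (E, L))"

lemma N_step:
  assumes "basis (E, L) - scale \<epsilon> (basis (E, L')) \<in> diagram_relations \<epsilon> r s" "sign \<epsilon> \<rho> L = \<epsilon> * sign \<epsilon> \<rho> L'"
  shows "cong \<epsilon> r s (N L) (N L')"
proof -
  have "cong \<epsilon> r s (basis (E, L)) (scale \<epsilon> (basis (E, L')))"
    using comb.span_base[OF assms(1)] by (simp add: cong_def null_space_def)
  from cong_scale[OF this, of "\<epsilon> * sign \<epsilon> \<rho> L'"] have
    "cong \<epsilon> r s (scale (\<epsilon> * sign \<epsilon> \<rho> L') (basis (E, L))) (scale (\<epsilon> * sign \<epsilon> \<rho> L' * \<epsilon>) (basis (E, L')))" by simp
  moreover have "\<epsilon> * sign \<epsilon> \<rho> L' * \<epsilon> = sign \<epsilon> \<rho> L'" using ee by (metis mult.commute mult.left_commute mult_1)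
  ultimately show ?thesis unfolding N_def assms(2) by simp
qed

lemma N_swap:
  assumes "marks_ok top_flow E (L1 @ [x, y] @ L2)"
  shows "cong \<epsilon> r s (N (L1 @ [x, y] @ L2)) (N (L1 @ [y, x] @ L2))"
proof (rule N_step)
  have "(E, L1 @ [x, y] @ L2) \<in> marked_diagrams r s" using assms brauer by (simp add: marked_diagrams_iff)
  then show "basis (E, L1 @ [x, y] @ L2) - scale \<epsilon> (basis (E, L1 @ [y, x] @ L2)) \<in> diagram_relations \<epsilon> r s"
    unfolding diagram_relations_def by blast
  show "sign \<epsilon> \<rho> (L1 @ [x, y] @ L2) = \<epsilon> * sign \<epsilon> \<rho> (L1 @ [y, x] @ L2)"
    by (rule sign_swap[OF ee arr marks_ok_marked[OF assms]])
qed

lemma N_reverse: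
  assumes "marks_ok top_flow E (L1 @ [Arrow u v] @ L2)"
  shows "cong \<epsilon> r s (N (L1 @ [Arrow u v] @ L2)) (N (L1 @ [Arrow v u] @ L2))"
proof (rule N_step)
  have "(E, L1 @ [Arrow u v] @ L2) \<in> marked_diagrams r s" using assms brauer by (simp add: marked_diagrams_iff)
  then show "basis (E, L1 @ [Arrow u v] @ L2) - scale \<epsilon> (basis (E, L1 @ [Arrow v u] @ L2)) \<in> diagram_relations \<epsilon> r s"
    unfolding diagram_relations_def by blast
  show "sign \<epsilon> \<rho> (L1 @ [Arrow u v] @ L2) = \<epsilon> * sign \<epsilon> \<rho> (L1 @ [Arrow v u] @ L2)"
    by (rule sign_reverse[OF ee arr marks_ok_marked[OF assms]])
qed

lemma N_move:
  "marks_ok top_flow E (P @ x # Q @ R) ==> cong \<epsilon> r s (N (P @ x # Q @ R)) (N (P @ Q @ x # R))"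
proof (induction Q arbitrary: P)
  case (Cons q Q)
  have "cong \<epsilon> r s (N (P @ x # q # Q @ R)) (N (P @ q # x # Q @ R))"
    using N_swap[of P x q "Q @ R"] Cons.prems by simp
  moreover have "marks_ok top_flow E ((P @ [q]) @ x # Q @ R)"
    by (rule marks_ok_cong[OF Cons.prems]) simp
  then have "cong \<epsilon> r s (N (P @ q # x # Q @ R)) (N (P @ q # Q @ x # R))"
    using Cons.IH[of "P @ [q]"] by simp
  ultimately show ?case using cong_trans by fastforce
qed simp

lemma N_perm:
  "marks_ok top_flow E (P @ L) ==> mset L = mset L' ==> cong \<epsilon> r s (N (P @ L)) (N (P @ L'))"
proof (induction L arbitrary: P L')
  case (Cons x L)
  then have "x \<in> set L'" using mset_eq_setD[OF Cons.prems(2)] by auto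
  then obtain Q R where L': "L' = Q @ x # R" by (meson split_list)
  then have m: "mset L = mset (Q @ R)" using Cons.prems(2) by simp
  have 1: "cong \<epsilon> r s (N ((P @ [x]) @ L)) (N ((P @ [x]) @ Q @ R))"
    using Cons.IH[of "P @ [x]" "Q @ R"] Cons.prems(1) m by simp
  have "marks_ok top_flow E (P @ x # Q @ R)"
    by (rule marks_ok_cong[OF Cons.prems(1)]) (use m in \<open>simp only: mset_map mset_append mset.simps\<close>)
  from N_move[OF this] show ?case using cong_trans[OF 1] L' by simp
qed simp

lemma N_orient:
  "list_all2 (\<lambda>x y. y = x \<or> (\<exists>u v. x = Arrow u v \<and> y = Arrow v u)) L L' ==>
   marks_ok top_flow E (P @ L) ==> cong \<epsilon> r s (N (P @ L)) (N (P @ L'))"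
proof (induction L L' arbitrary: P rule: list_all2_induct)
  case (Cons x L y L')
  have 1: "cong \<epsilon> r s (N (P @ x # L)) (N (P @ y # L))"
    using Cons.hyps(1) N_reverse[of P _ _ L] Cons.prems by auto
  have "marks_ok top_flow E ((P @ [y]) @ L)"
    by (rule marks_ok_cong[OF Cons.prems]) (use Cons.hyps(1) in \<open>auto simp: insert_commute\<close>)
  from Cons.IH[OF this] show ?case using cong_trans[OF 1] by simp
qed simp

text \<open>Two correct lists of markings on a Brauer diagram mark the same edges in the same kinds,
  so reversing arrows and then permuting turns one into the other.\<close>

lemma N_unique:
  assumes "marks_ok top_flow E L" "marks_ok top_flow E L'"
  shows "cong \<epsilon> r s (N L) (N L')"
proof -
  have ne: "\<exists>v. v \<in> e" if "e \<in> E" for e using brauer_edge(2)[OF brauer that] by (metis card.empty ex_in_conv zero_neq_numeral)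
  have sub: "mark_edge ` set K \<subseteq> mark_edge ` set K'" if K: "marks_ok top_flow E K" "marks_ok top_flow E K'" for K K'
  proof
    fix e assume "e \<in> mark_edge ` set K"
    then obtain x where x: "x \<in> set K" "e = mark_edge x" by blast
    have "mark_edge x \<in> E \<and> (\<forall>v\<in>mark_edge x. (v \<in> range Top) = is_bead x)"
      using K(1) x(1) unfolding marks_ok_def by blast
    then have "e \<in> E" "homogeneous top_flow e" unfolding homogeneous_def x(2) by (simp, cases "is_bead x") simp_all
    then show "e \<in> mark_edge ` set K'" using K(2) unfolding marks_ok_def by blast
  qed
  then have eq: "mark_edge ` set L = mark_edge ` set L'" using assms by blast
  define g where "g x = (SOME y. y \<in> set L' \<and> mark_edge y = mark_edge x)" for x
  have g: "g x \<in> set L' \<and> mark_edge (g x) = mark_edge x" if "x \<in> set L" for x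
  proof -
    have "mark_edge x \<in> mark_edge ` set L'" using eq that by blast
    then have "\<exists>y. y \<in> set L' \<and> mark_edge y = mark_edge x" by auto
    then show ?thesis unfolding g_def by (rule someI_ex)
  qed
  have dist: "distinct (map mark_edge L)" "distinct (map mark_edge L')" using assms unfolding marks_ok_def by simp_all
  have gm: "map mark_edge (map g L) = map mark_edge L" using g by simp
  have dg: "distinct (map g L)" using dist(1) unfolding gm[symmetric] distinct_map[of mark_edge] by (rule conjunct1)
  have dL': "distinct L'" using dist(2) unfolding distinct_map by (rule conjunct1)
  have "set (map g L) = set L'"
  proof
    show "set (map g L) \<subseteq> set L'" using g by auto
    show "set L' \<subseteq> set (map g L)"
    proof
      fix y assume y: "y \<in> set L'"
      then obtain x where x: "x \<in> set L" "mark_edge y = mark_edge x" using eq by (metis imageE imageI)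
      then have "mark_edge (g x) = mark_edge y" "g x \<in> set L'" using g by simp_all
      then have "g x = y" using dist(2) y by (simp add: distinct_map inj_on_def)
      then show "y \<in> set (map g L)" using x(1) by auto
    qed
  qed
  then have mg: "mset (map g L) = mset L'" using dg dL' by (simp only: set_eq_iff_mset_eq_distinct)
  have or: "g x = x \<or> (\<exists>u v. x = Arrow u v \<and> g x = Arrow v u)" if x: "x \<in> set L" for x
  proof -
    have E: "mark_edge x \<in> E" "\<forall>v\<in>mark_edge x. (v \<in> range Top) = is_bead x"
      using assms(1) x unfolding marks_ok_def by blast+
    have "\<forall>v\<in>mark_edge (g x). (v \<in> range Top) = is_bead (g x)"
      using assms(2) g[OF x] unfolding marks_ok_def by blast
    then have ib: "is_bead (g x) = is_bead x" using E ne[OF E(1)] g[OF x] by auto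
    show ?thesis
    proof (cases x)
      case (Bead e) then show ?thesis using ib g[OF x] by (cases "g x") auto
    next
      case (Arrow u v)
      then obtain u' v' where "g x = Arrow u' v'" using ib by (cases "g x") auto
      then show ?thesis using Arrow g[OF x] by (auto simp: doubleton_eq_iff)
    qed
  qed
  have all: "list_all2 (\<lambda>x y. y = x \<or> (\<exists>u v. x = Arrow u v \<and> y = Arrow v u)) L (map g L)"
    unfolding list_all2_map2 using or by (intro list_all2_all_nthI) (auto dest: nth_mem)
  have "marks_ok top_flow E (map g L)"
  proof (rule marks_ok_cong[OF assms(2)])
    show "mset (map (\<lambda>x. (mark_edge x, is_bead x)) L') = mset (map (\<lambda>x. (mark_edge x, is_bead x)) (map g L))"
      unfolding mset_map[of _ L'] mset_map[of _ "map g L"] mg ..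
  qed
  then have "cong \<epsilon> r s (N (map g L)) (N L')" using N_perm[of "[]" "map g L" L'] mg by simp
  then show ?thesis using cong_trans[OF N_orient[OF all, of "[]"]] assms(1) by simp
qed

end

lemma brauer_connected:
  assumes "brauer_diagram r s E" "(u, v) \<in> connected_by E"
  shows "u = v \<or> {u, v} \<in> E"
proof (cases "u \<in> \<Union>E")
  case True
  then obtain e where e: "e \<in> E" "u \<in> e" by blast
  have v: "v \<in> e"
    by (rule connected_closed[OF assms(2) e(2)]) (use brauer_edge(3)[OF assms(1) e(1)] in blast)
  obtain x y where "e = {x, y}" using brauer_edge(2)[OF assms(1) e(1)] by (meson card_2_iff)
  then have "u = v \<or> e = {u, v}" using e(2) v by auto
  then show ?thesis using e(1) by auto
next
  case False then show ?thesis using connected_in[OF assms(2)] by blast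
qed

lemma brauer_eqI:
  assumes "brauer_diagram r s E" "brauer_diagram r s E'"
    "\<And>e u v. e \<in> E ==> u \<in> e ==> v \<in> e ==> (u, v) \<in> connected_by E'"
  shows "E = E'"
proof -
  have sub: "E \<subseteq> E'"
  proof
    fix e assume e: "e \<in> E"
    obtain x y where xy: "e = {x, y}" "x \<noteq> y" using brauer_edge(2)[OF assms(1) e] by (meson card_2_iff)
    then show "e \<in> E'" using brauer_connected[OF assms(2) assms(3)[OF e, of x y]] by simp
  qed
  moreover have "E' \<subseteq> E"
  proof
    fix e assume e: "e \<in> E'"
    obtain x y where xy: "e = {x, y}" using brauer_edge(2)[OF assms(2) e] by (meson card_2_iff)
    have "x \<in> ends r s" using e xy brauer_edge(1)[OF assms(2)] by blast
    then obtain g where g: "g \<in> E" "x \<in> g" using brauer_edge(1)[OF assms(1)] by blast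
    have "g = e" using brauer_edge(3)[OF assms(2) _ e, of g x] g sub xy by blast
    then show "e \<in> E" using g by simp
  qed
  ultimately show ?thesis by blast
qed

text \<open>\<kappa> compares two lists of markings on the same edges: it is 1 for the independence
  of choices, and \<epsilon> when the lists differ by a defining relation. Without loops both
  results are compared through signs in one arrangement. With loops, either \<epsilon> = 1, where
  all signs are trivial, or \<delta> = 0, where both sides vanish.\<close>

theorem reduces_unique:
  fixes \<epsilon> \<delta> :: "'k::field"
  assumes r: "reduces \<epsilon> (ends r s) (E, L) m k D" and r': "reduces \<epsilon> (ends r s) (E, L') m' k' D'"
    and D: "D \<in> marked_diagrams r s" "D' \<in> marked_diagrams r s"
    and good: "m = 0 ==> \<exists>\<rho>. arrangement \<rho> E" "m = 0 ==> marked (E, L) \<and> marked (E, L')"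
    and \<kappa>: "\<And>\<rho>. arrangement \<rho> E ==> marked (E, L) ==> marked (E, L') ==> sign \<epsilon> \<rho> L = \<kappa> * sign \<epsilon> \<rho> L'" "\<kappa> = 1 \<or> \<kappa> = \<epsilon>"
    and e: "\<epsilon> = 1 \<or> (\<epsilon> = - 1 \<and> \<delta> = 0)"
  shows "cong \<epsilon> r s (scale (\<delta> ^ m * k) (basis D)) (scale (\<kappa> * (\<delta> ^ m' * k')) (basis D'))"
proof -
  obtain E0 K where D0: "D = (E0, K)" by (cases D)
  obtain E1 K' where D1: "D' = (E1, K')" by (cases D')
  have mm: "m = m'" using r r' unfolding reduces_def by simp
  have ee: "\<epsilon> * \<epsilon> = 1" using e by auto
  have b: "brauer_diagram r s E0" "brauer_diagram r s E1" and ok: "marks_ok top_flow E0 K" "marks_ok top_flow E1 K'"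
    using D unfolding D0 D1 marked_diagrams_iff by auto
  have "E0 = E1"
  proof (rule brauer_eqI[OF b])
    fix e u v assume "e \<in> E0" "u \<in> e" "v \<in> e"
    then have "(u, v) \<in> connected_by E0" "u \<in> ends r s" "v \<in> ends r s"
      using connected_edge brauer_edge(1)[OF b(1)] by auto
    then show "(u, v) \<in> connected_by E1"
      using reduces_connected[OF r, of u v] reduces_connected[OF r', of u v] unfolding D0 D1 fst_conv by simp
  qed
  note EE = this[symmetric]
  have kk: "k = 1 \<or> k = \<epsilon>" "k' = 1 \<or> k' = \<epsilon>" using r r' unfolding reduces_def by auto
  show ?thesis
  proof (cases "m = 0")
    case True
    obtain \<rho> where arrE: "arrangement \<rho> E" using good(1)[OF True] by blast
    have s1: "simplifies_to \<epsilon> (E, L) k (E0, K)" and s2: "simplifies_to \<epsilon> (E, L') k' (E0, K')"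
      using r r' True mm unfolding reduces_def D0 D1 EE by simp_all
    have mk: "marked (E, L)" "marked (E, L')" using good(2)[OF True] by simp_all
    have a0: "arrangement \<rho> E0" and sg: "sign \<epsilon> \<rho> L = k * sign \<epsilon> \<rho> K" "sign \<epsilon> \<rho> L' = k' * sign \<epsilon> \<rho> K'"
      using simplifies_to_sign[OF s1 ee] simplifies_to_sign[OF s2 ee] arrE mk by simp_all
    interpret remarking \<epsilon> r s E0 \<rho> using ee b(1) a0 by unfold_locales
    have c: "cong \<epsilon> r s (N K) (N K')" using N_unique ok EE by simp
    have "k * sign \<epsilon> \<rho> K = \<kappa> * (k' * sign \<epsilon> \<rho> K')" using \<kappa>(1)[OF arrE mk] sg by simp
    then have "(sign \<epsilon> \<rho> K * sign \<epsilon> \<rho> K) * k = \<kappa> * k' * sign \<epsilon> \<rho> K' * sign \<epsilon> \<rho> K"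
      by (simp add: algebra_simps)
    then have k: "k = (\<kappa> * k' * sign \<epsilon> \<rho> K') * sign \<epsilon> \<rho> K" using sign_sq[OF ee, of \<rho> K] by simp
    have "cong \<epsilon> r s (scale (\<kappa> * k' * sign \<epsilon> \<rho> K') (N K)) (scale (\<kappa> * k' * sign \<epsilon> \<rho> K') (N K'))"
      by (rule cong_scale[OF c])
    moreover have "scale (\<kappa> * k' * sign \<epsilon> \<rho> K') (N K) = scale k (basis (E0, K))"
      unfolding N_def using k by simp
    moreover have "scale (\<kappa> * k' * sign \<epsilon> \<rho> K') (N K') = scale (\<kappa> * k') (basis (E0, K'))"
      unfolding N_def using sign_sq[OF ee, of \<rho> K'] by (simp add: mult.assoc)
    ultimately show ?thesis using True mm D0 D1 EE by simp
  next
    case False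
    show ?thesis
    proof (cases "\<epsilon> = 1")
      case True
      obtain \<rho> where a0: "arrangement \<rho> E0" using brauer_arrangement[OF b(1)] by blast
      interpret remarking \<epsilon> r s E0 \<rho> using ee b(1) a0 by unfold_locales
      have c: "cong \<epsilon> r s (N K) (N K')" using N_unique ok EE by simp
      then have "cong \<epsilon> r s (basis (E0, K)) (basis (E0, K'))" unfolding N_def unfolding sign_def True by simp
      then show ?thesis using cong_scale kk \<kappa>(2) True mm D0 D1 EE by auto
    next
      case e2: False
      then have "\<delta> = 0" using e by simp
      then show ?thesis using False mm by (simp add: power_0_left)
    qed
  qed
qed

section \<open>Stacks\<close>

definition matching :: "vertex set set \<Rightarrow> bool" where
  "matching A \<longleftrightarrow> finite A \<and> (\<forall>e\<in>A. card e = 2) \<and> (\<forall>e\<in>A. \<forall>e'\<in>A. \<forall>v. v \<in> e \<longrightarrow> v \<in> e' \<longrightarrow> e = e')"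

lemma matchingD:
  assumes "matching A"
  shows "finite A" "e \<in> A ==> card e = 2" "e \<in> A ==> e' \<in> A ==> v \<in> e ==> v \<in> e' ==> e = e'"
  using assms unfolding matching_def by blast+

lemma matching_subset: "matching A ==> B \<subseteq> A ==> matching B"
  unfolding matching_def using finite_subset[of B A] by (intro conjI) (simp_all add: subset_iff)

lemma matching_Un:
  assumes A: "matching A" and B: "matching B" and d: "\<Union>A \<inter> \<Union>B = {}"
  shows "matching (A \<union> B)"
  unfolding matching_def
proof (intro conjI ballI allI impI)
  show "finite (A \<union> B)" using matchingD(1)[OF A] matchingD(1)[OF B] by simp
  show "card e = 2" if "e \<in> A \<union> B" for e using that matchingD(2)[OF A] matchingD(2)[OF B] by blast
  fix e e' v assume e: "e \<in> A \<union> B" "e' \<in> A \<union> B" "v \<in> e" "v \<in> e'"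
  then have "\<not> (v \<in> \<Union>A \<and> v \<in> \<Union>B)" using d by blast
  then consider "e \<in> A" "e' \<in> A" | "e \<in> B" "e' \<in> B" using e by blast
  then show "e = e'"
  proof cases
    case 1 then show ?thesis using matchingD(3)[OF A _ _ e(3,4)] by blast
  next
    case 2 then show ?thesis using matchingD(3)[OF B _ _ e(3,4)] by blast
  qed
qed

lemma matching_map:
  assumes "matching A" "inj_on f (\<Union>A)"
  shows "matching (map_edges f A)"
  unfolding matching_def
proof (intro conjI ballI allI impI)
  show "finite (map_edges f A)" using assms(1) by (simp add: matching_def map_edges_def)
  show "card e = 2" if "e \<in> map_edges f A" for e
  proof -
    from that obtain g where g: "g \<in> A" "e = f ` g" unfolding map_edges_def by blast
    have "inj_on f g" using assms(2) g(1) by (meson Union_upper inj_on_subset)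
    then show ?thesis unfolding g(2) using matchingD(2)[OF assms(1) g(1)] by (simp add: card_image)
  qed
  fix e e' v assume e: "e \<in> map_edges f A" "e' \<in> map_edges f A" "v \<in> e" "v \<in> e'"
  from e(1,3) obtain g x where g: "g \<in> A" "e = f ` g" "x \<in> g" "v = f x" unfolding map_edges_def by blast
  from e(2,4) obtain g' x' where g': "g' \<in> A" "e' = f ` g'" "x' \<in> g'" "v = f x'" unfolding map_edges_def by blast
  have "x = x'" by (rule inj_onD[OF assms(2)]) (use g g' in auto)
  then have "g = g'" using matchingD(3)[OF assms(1) g(1) g'(1) g(3)] g'(3) by simp
  then show "e = e'" using g(2) g'(2) by simp
qed

lemma brauer_matching: "brauer_diagram r s E ==> matching E"
  unfolding matching_def by (intro conjI ballI allI impI) (rule brauer_edge; assumption)+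

text \<open>The two edges at a glued vertex are told apart by membership in \<open>B\<close>. For a
  stack of two diagrams \<open>B\<close> is the lower layer, so that the label means that the edge
  lies below the vertex.\<close>

definition flow :: "vertex set set \<Rightarrow> vertex set \<Rightarrow> vertex \<Rightarrow> bool" where
  "flow B e v \<longleftrightarrow> v \<in> range Top \<or> (v \<in> range Mid \<and> e \<in> B)"

locale matching_pair =
  fixes A B
  assumes A: "matching A" and B: "matching B"
    and Mid: "\<And>v. v \<in> \<Union>(A \<union> B) ==> v \<in> range Mid \<longleftrightarrow> v \<in> \<Union>A \<and> v \<in> \<Union>B"
    and outer: "\<And>v. v \<in> \<Union>(A \<union> B) ==> \<exists>w. w \<notin> range Mid \<and> (v, w) \<in> connected_by (A \<union> B)"
begin

text \<open>A common edge would meet no other edge, hence form a closed loop between glued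
  vertices.\<close>

lemma disjoint: "A \<inter> B = {}"
proof (rule ccontr)
  assume "A \<inter> B \<noteq> {}"
  then obtain e where e: "e \<in> A" "e \<in> B" by blast
  have "e \<noteq> {}" using matchingD(2)[OF A e(1)] by auto
  then obtain v where v: "v \<in> e" by blast
  then obtain w where w: "w \<notin> range Mid" "(v, w) \<in> connected_by (A \<union> B)" using outer e(1) by blast
  have "w \<in> e"
  proof (rule connected_closed[OF w(2) v])
    fix g assume g: "g \<in> A \<union> B" "g \<inter> e \<noteq> {}"
    then obtain x where "x \<in> g" "x \<in> e" by blast
    then have "g = e" using g(1) matchingD(3)[OF A _ e(1), of g x] matchingD(3)[OF B _ e(2), of g x] by blast
    then show "g \<subseteq> e" by simp
  qed
  then have "w \<in> range Mid" using Mid[of w] e by blast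
  then show False using w(1) by contradiction
qed

lemma ready_flow: "ready (flow B) (A \<union> B)"
  unfolding ready_def
proof (intro conjI ballI allI)
  show "finite (A \<union> B)" using matchingD(1)[OF A] matchingD(1)[OF B] by simp
  show "card e = 2" if "e \<in> A \<union> B" for e using that matchingD(2)[OF A] matchingD(2)[OF B] by blast
next
  fix v q assume v: "v \<in> \<Union>(A \<union> B)"
  have uA: "\<exists>!e. e \<in> A \<and> v \<in> e" if "v \<in> \<Union>A"
  proof -
    from that obtain e where e: "e \<in> A" "v \<in> e" by blast
    then show ?thesis using matchingD(3)[OF A _ e(1) _ e(2)] by blast
  qed
  have uB: "\<exists>!e. e \<in> B \<and> v \<in> e" if "v \<in> \<Union>B"
  proof -
    from that obtain e where e: "e \<in> B" "v \<in> e" by blast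
    then show ?thesis using matchingD(3)[OF B _ e(1) _ e(2)] by blast
  qed
  show "if v \<in> range (if q then Bot else Top) then \<nexists>e. e \<in> A \<union> B \<and> v \<in> e \<and> flow B e v = q
        else \<exists>!e. e \<in> A \<union> B \<and> v \<in> e \<and> flow B e v = q"
  proof (cases "v \<in> range Mid")
    case True
    then have 1: "v \<in> \<Union>A" "v \<in> \<Union>B" "v \<notin> range Top" "v \<notin> range Bot" using Mid[OF v] by auto
    have fl: "flow B e v \<longleftrightarrow> e \<in> B" for e unfolding flow_def using True 1(3) by blast
    have "e \<in> A \<union> B \<and> v \<in> e \<and> flow B e v = q \<longleftrightarrow> (if q then e \<in> B \<and> v \<in> e else e \<in> A \<and> v \<in> e)" for e
      unfolding fl using disjoint by auto
    then show ?thesis using uA[OF 1(1)] uB[OF 1(2)] 1(3,4) by (cases q) simp_all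
  next
    case False
    then have TB: "v \<in> range Bot \<longleftrightarrow> v \<notin> range Top" by (cases v) auto
    have fl: "flow B e v \<longleftrightarrow> v \<in> range Top" for e unfolding flow_def using False by blast
    have ex1: "\<exists>!e. e \<in> A \<union> B \<and> v \<in> e"
    proof (cases "v \<in> \<Union>A")
      case True
      then have "v \<notin> \<Union>B" using Mid[OF v] False by blast
      then have "e \<in> A \<union> B \<and> v \<in> e \<longleftrightarrow> e \<in> A \<and> v \<in> e" for e by blast
      then show ?thesis using uA[OF True] by simp
    next
      case F: False
      then have "v \<in> \<Union>B" using v by blast
      moreover have "e \<in> A \<union> B \<and> v \<in> e \<longleftrightarrow> e \<in> B \<and> v \<in> e" for e using F by blast
      ultimately show ?thesis using uB by simp
    qed
    show ?thesis unfolding fl using ex1 by (cases q; cases "v \<in> range Top") (simp_all only: if_True if_False TB simp_thms)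
  qed
  show "\<exists>w. w \<notin> range Mid \<and> (v, w) \<in> connected_by (A \<union> B)" using outer[OF v] .
qed

end

lemma marks_ok_filter:
  assumes "marks_ok d E L"
  shows "marks_ok d {e \<in> E. P e} (filter (\<lambda>x. P (mark_edge x)) L)"
  using assms unfolding marks_ok_def by (auto simp: distinct_map_filter)

lemma marks_ok_map:
  assumes L: "marks_ok d E L" and f: "inj_on f (\<Union>E)" and d: "\<And>e v. e \<in> E ==> v \<in> e ==> d' (f ` e) (f v) = d e v"
  shows "marks_ok d' (map_edges f E) (map (map_mark f) L)"
proof -
  have inE: "mark_edge x \<in> E" "\<And>v. v \<in> mark_edge x ==> d (mark_edge x) v = is_bead x" if "x \<in> set L" for x
    using L that unfolding marks_ok_def by blast+
  have "inj_on ((`) f) E"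
    by (rule inj_onI) (use f in \<open>meson Union_upper inj_on_image_eq_iff\<close>)
  then have "inj_on ((`) f) (set (map mark_edge L))" by (rule inj_on_subset) (use inE in auto)
  moreover have "map mark_edge (map (map_mark f) L) = map ((`) f) (map mark_edge L)" by simp
  ultimately have 1: "distinct (map mark_edge (map (map_mark f) L))"
    using L unfolding marks_ok_def by (simp only: distinct_map[of "(`) f"])
  have 2: "mark_edge y \<in> map_edges f E \<and> (\<forall>v\<in>mark_edge y. d' (mark_edge y) v = is_bead y)"
    if "y \<in> set (map (map_mark f) L)" for y
  proof -
    from that obtain x where x: "x \<in> set L" "y = map_mark f x" by auto
    show ?thesis unfolding x(2) using inE[OF x(1)] d[OF inE(1)[OF x(1)]] by (auto simp: map_edges_def)
  qed
  have 3: "g \<in> mark_edge ` set (map (map_mark f) L)" if g: "g \<in> map_edges f E" "homogeneous d' g" for g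
  proof -
    from g(1) obtain e where e: "e \<in> E" "g = f ` e" unfolding map_edges_def by blast
    have "homogeneous d e" using g(2) d[OF e(1)] unfolding e(2) homogeneous_def by auto
    then obtain x where x: "x \<in> set L" "e = mark_edge x" using L e(1) unfolding marks_ok_def by blast
    have "g = mark_edge (map_mark f x)" unfolding e(2) x(2) by simp
    moreover have "map_mark f x \<in> set (map (map_mark f) L)" using x(1) by simp
    ultimately show ?thesis by (rule image_eqI)
  qed
  show ?thesis unfolding marks_ok_def using 1 2 3 by blast
qed

lemma marks_ok_Un:
  assumes "marks_ok d A K" "marks_ok d B L" "A \<inter> B = {}"
  shows "marks_ok d (A \<union> B) (K @ L)"
  using assms unfolding marks_ok_def by (auto simp: image_Un)

lemma marked_Un:
  assumes "marked (A, K)" "marked (B, L)" "A \<inter> B = {}"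
  shows "marked (A \<union> B, K @ L)"
  using assms unfolding marked_def by (auto simp: image_Un)

lemma marked_map:
  assumes "marked (E, L)" "inj_on f (\<Union>E)"
  shows "marked (map_edges f E, map (map_mark f) L)"
proof -
  have "inj_on ((`) f) E"
    by (rule inj_onI) (use assms(2) in \<open>meson Union_upper inj_on_image_eq_iff\<close>)
  then have "inj_on ((`) f) (set (map mark_edge L))" by (rule inj_on_subset) (use assms(1) in \<open>auto simp: marked_def\<close>)
  moreover have "map mark_edge (map (map_mark f) L) = map ((`) f) (map mark_edge L)" by simp
  ultimately have "distinct (map mark_edge (map (map_mark f) L))"
    using assms(1) unfolding marked_def snd_conv by (simp only: distinct_map[of "(`) f"])
  moreover have "mark_edge ` set (map (map_mark f) L) \<subseteq> map_edges f E"
    using assms(1) by (auto simp: marked_def map_edges_def)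
  ultimately show ?thesis by (simp add: marked_def)
qed

definition alive :: "vertex set set \<Rightarrow> vertex set set" where
  "alive E = {e \<in> E. \<not> e \<subseteq> \<Union>(loops E)}"

lemma loops_component: "C \<in> loops E \<longleftrightarrow> (\<exists>v\<in>\<Union>E. C = component E v) \<and> C \<subseteq> range Mid"
  unfolding loops_def quotient_def component_def by blast

lemma in_loops_iff: "v \<in> \<Union>(loops E) \<longleftrightarrow> v \<in> \<Union>E \<and> component E v \<subseteq> range Mid"
proof
  assume "v \<in> \<Union>(loops E)"
  then obtain C where C: "C \<in> loops E" "v \<in> C" by blast
  then obtain u where "u \<in> \<Union>E" "C = component E u" "C \<subseteq> range Mid"
    unfolding loops_component by blast
  then have u: "u \<in> \<Union>E" "v \<in> component E u" "component E u \<subseteq> range Mid" using C(2) by simp_all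
  then have "component E u = component E v" using component_eq by (simp add: component_iff)
  then show "v \<in> \<Union>E \<and> component E v \<subseteq> range Mid" using u component_sub[OF u(1)] by blast
next
  assume "v \<in> \<Union>E \<and> component E v \<subseteq> range Mid"
  then have "component E v \<in> loops E" unfolding loops_component by blast
  then show "v \<in> \<Union>(loops E)" using component_self by blast
qed

lemma in_loops_connected:
  assumes "(u, v) \<in> connected_by E" "u \<in> \<Union>(loops E)"
  shows "v \<in> \<Union>(loops E)"
  using assms component_eq[OF assms(1)] connected_in[OF assms(1)] unfolding in_loops_iff by auto

lemma alive_edge: "e \<in> E ==> v \<in> e ==> e \<in> alive E \<longleftrightarrow> v \<notin> \<Union>(loops E)"
  using in_loops_connected[OF connected_edge] unfolding alive_def by blast

lemma alive_connected:
  assumes "(u, v) \<in> connected_by E" "u \<notin> \<Union>(loops E)"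
  shows "(u, v) \<in> connected_by (alive E)"
  using assms(1) unfolding connected_by_def[of E]
proof (induction rule: rtrancl_induct)
  case (step y z)
  then obtain e where e: "e \<in> E" "y \<in> e" "z \<in> e" by blast
  have "(u, y) \<in> connected_by E" using step(1) unfolding connected_by_def .
  then have "y \<notin> \<Union>(loops E)" using in_loops_connected[OF connected_sym] assms(2) by blast
  then have "e \<in> alive E" using alive_edge e by blast
  then show ?case using connected_edge[OF _ e(2,3)] connected_trans[OF step.IH] by blast
qed simp

lemma connected_alive: "(u, v) \<in> connected_by (alive E) ==> (u, v) \<in> connected_by E"
  by (rule connected_mono) (auto simp: alive_def)

lemma Union_alive: "\<Union>(alive E) = \<Union>E - \<Union>(loops E)"
proof (intro set_eqI iffI)
  fix v assume "v \<in> \<Union>(alive E)"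
  then obtain e where "e \<in> alive E" "v \<in> e" by blast
  moreover then have "e \<in> E" unfolding alive_def by blast
  ultimately show "v \<in> \<Union>E - \<Union>(loops E)" using alive_edge by blast
next
  fix v assume v: "v \<in> \<Union>E - \<Union>(loops E)"
  then obtain e where "e \<in> E" "v \<in> e" by blast
  then show "v \<in> \<Union>(alive E)" using alive_edge v by blast
qed

lemma bot_to_mid_inj: "inj_on bot_to_mid (range Top \<union> range Bot)"
  and top_to_mid_inj: "inj_on top_to_mid (range Top \<union> range Bot)"
  by (auto simp: inj_on_def)

lemma ends_sub: "ends r s \<subseteq> range Top \<union> range Bot"
  by auto

locale stacking =
  fixes r s t E1 L1 E2 L2
  assumes D1: "(E1, L1) \<in> marked_diagrams r s" and D2: "(E2, L2) \<in> marked_diagrams s t"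
begin

definition "A0 = map_edges bot_to_mid E1"
definition "B0 = map_edges top_to_mid E2"
definition "SE = A0 \<union> B0"
definition "SL = map (map_mark bot_to_mid) L1 @ map (map_mark top_to_mid) L2"

lemma stack_eq: "stack (E1, L1) (E2, L2) = (SE, SL)"
  by (simp add: SE_def SL_def A0_def B0_def)

lemma br: "brauer_diagram r s E1" "brauer_diagram s t E2" and mk: "marks_ok top_flow E1 L1" "marks_ok top_flow E2 L2"
  using D1 D2 unfolding marked_diagrams_iff by auto

lemma inj1: "inj_on bot_to_mid (\<Union>E1)" and inj2: "inj_on top_to_mid (\<Union>E2)"
  using brauer_edge(1)[OF br(1)] brauer_edge(1)[OF br(2)] inj_on_subset[OF bot_to_mid_inj ends_sub]
    inj_on_subset[OF top_to_mid_inj ends_sub] by simp_all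

lemma VA: "\<Union>A0 = Top ` {1..r} \<union> Mid ` {1..s}" and VB: "\<Union>B0 = Mid ` {1..s} \<union> Bot ` {1..t}"
  unfolding A0_def B0_def Union_map_edges brauer_edge(1)[OF br(1)] brauer_edge(1)[OF br(2)]
  by (simp_all add: image_Un image_image)

lemma VS: "\<Union>SE = ends r t \<union> Mid ` {1..s}"
  unfolding SE_def Union_Un_distrib VA VB by blast

lemma finS: "finite SE" "finite (\<Union>SE)"
  unfolding VS using matchingD(1)[OF brauer_matching[OF br(1)]] matchingD(1)[OF brauer_matching[OF br(2)]]
  by (auto simp: SE_def A0_def B0_def map_edges_def)

lemma mA: "matching A0" and mB: "matching B0"
  unfolding A0_def B0_def using matching_map brauer_matching br inj1 inj2 by auto

lemma loops_closed: "loops SE = closed_components SE (ends r t)"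
proof -
  have k: "C \<subseteq> range Mid \<longleftrightarrow> C \<inter> ends r t = {}" if "C = component SE v" "v \<in> \<Union>SE" for C v
  proof -
    have sub: "C \<subseteq> ends r t \<union> Mid ` {1..s}" using component_sub[OF that(2)] unfolding that(1) VS .
    have disj: "x \<notin> range Mid" if "x \<in> ends r t" for x using that by auto
    have mid: "x \<in> range Mid" if "x \<in> Mid ` {1..s}" for x using that by auto
    show ?thesis
    proof
      assume "C \<subseteq> range Mid" then show "C \<inter> ends r t = {}" using disj by (meson disjoint_iff subsetD)
    next
      assume "C \<inter> ends r t = {}" then show "C \<subseteq> range Mid" using sub mid by (meson UnE disjoint_iff subset_iff)
    qed
  qed
  show ?thesis
  proof (rule set_eqI)
    fix C
    show "C \<in> loops SE \<longleftrightarrow> C \<in> closed_components SE (ends r t)"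
    proof (cases "\<exists>v\<in>\<Union>SE. C = component SE v")
      case True
      then obtain v where "C = component SE v" "v \<in> \<Union>SE" by (elim bexE)
      from k[OF this] show ?thesis unfolding loops_component closed_iff by (simp only:)
    next
      case False then show ?thesis unfolding loops_component closed_iff by (simp only: simp_thms)
    qed
  qed
qed

definition "A = A0 \<inter> alive SE"
definition "B = B0 \<inter> alive SE"

lemma AB: "A \<union> B = alive SE"
  unfolding A_def B_def using SE_def alive_def by auto

lemma pair: "matching_pair A B"
proof
  show "matching A" "matching B" unfolding A_def B_def using matching_subset[OF mA] matching_subset[OF mB] by simp_all
  fix v assume v: "v \<in> \<Union>(A \<union> B)"
  then have nl: "v \<notin> \<Union>(loops SE)" "v \<in> \<Union>SE" unfolding AB Union_alive by simp_all
  have iff: "v \<in> \<Union>A \<longleftrightarrow> v \<in> \<Union>A0" "v \<in> \<Union>B \<longleftrightarrow> v \<in> \<Union>B0"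
    using alive_edge[of _ SE v] nl(1) unfolding A_def B_def SE_def by blast+
  show "v \<in> range Mid \<longleftrightarrow> v \<in> \<Union>A \<and> v \<in> \<Union>B"
    unfolding iff using nl(2) unfolding SE_def Union_Un_distrib VA VB by auto
  have "\<not> component SE v \<subseteq> range Mid" using nl in_loops_iff by blast
  then obtain w where "w \<notin> range Mid" "(v, w) \<in> connected_by SE" unfolding subset_iff component_iff by blast
  then show "\<exists>w. w \<notin> range Mid \<and> (v, w) \<in> connected_by (A \<union> B)"
    unfolding AB using alive_connected nl(1) by blast
qed

definition "AL = filter (\<lambda>x. \<not> mark_edge x \<subseteq> \<Union>(loops SE)) SL"

lemma delete_eq: "delete_loops (stack (E1, L1) (E2, L2)) = (alive SE, AL)"
  unfolding stack_eq by (simp add: alive_def AL_def)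

text \<open>At a glued vertex an upper edge has label False and a lower edge label True, which are
  the labels of a bottom and of a top vertex in the diagrams before gluing.\<close>

lemma marks: "marks_ok (flow B) (alive SE) AL"
proof -
  interpret matching_pair A B by (rule pair)
  let ?P = "\<lambda>e. \<not> e \<subseteq> \<Union>(loops SE)"
  let ?E1 = "{e \<in> E1. ?P (bot_to_mid ` e)}" and ?E2 = "{e \<in> E2. ?P (top_to_mid ` e)}"
  have A: "map_edges bot_to_mid ?E1 = A" unfolding A_def alive_def A0_def SE_def map_edges_def by blast
  have B: "map_edges top_to_mid ?E2 = B" unfolding B_def alive_def B0_def SE_def map_edges_def by blast
  have "marks_ok (flow B) (map_edges bot_to_mid ?E1) (map (map_mark bot_to_mid) (filter (\<lambda>x. ?P (bot_to_mid ` mark_edge x)) L1))"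
  proof (rule marks_ok_map[OF marks_ok_filter[OF mk(1), of "\<lambda>e. ?P (bot_to_mid ` e)"]])
    show "inj_on bot_to_mid (\<Union>?E1)" by (rule inj_on_subset[OF inj1]) blast
    fix e v assume e: "e \<in> ?E1" "v \<in> e"
    have "bot_to_mid ` e \<in> A" unfolding A[symmetric] map_edges_def using e(1) by (rule imageI)
    then have "bot_to_mid ` e \<notin> B" using disjoint by blast
    moreover have "bot_to_mid v \<in> range Top \<longleftrightarrow> v \<in> range Top" by (cases v) auto
    ultimately show "flow B (bot_to_mid ` e) (bot_to_mid v) = (v \<in> range Top)" by (simp add: flow_def)
  qed
  moreover have "marks_ok (flow B) (map_edges top_to_mid ?E2) (map (map_mark top_to_mid) (filter (\<lambda>x. ?P (top_to_mid ` mark_edge x)) L2))"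
  proof (rule marks_ok_map[OF marks_ok_filter[OF mk(2), of "\<lambda>e. ?P (top_to_mid ` e)"]])
    show "inj_on top_to_mid (\<Union>?E2)" by (rule inj_on_subset[OF inj2]) blast
    fix e v assume e: "e \<in> ?E2" "v \<in> e"
    have 1: "top_to_mid ` e \<in> B" unfolding B[symmetric] map_edges_def using e(1) by (rule imageI)
    have "v \<in> ends s t" using e brauer_edge(1)[OF br(2)] by blast
    then have "top_to_mid v \<in> range Top \<or> top_to_mid v \<in> range Mid \<longleftrightarrow> v \<in> range Top" by auto
    then show "flow B (top_to_mid ` e) (top_to_mid v) = (v \<in> range Top)" using 1 by (simp add: flow_def)
  qed
  ultimately have "marks_ok (flow B) (A \<union> B) (map (map_mark bot_to_mid) (filter (\<lambda>x. ?P (bot_to_mid ` mark_edge x)) L1) @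
     map (map_mark top_to_mid) (filter (\<lambda>x. ?P (top_to_mid ` mark_edge x)) L2))"
    unfolding A B by (rule marks_ok_Un[OF _ _ disjoint])
  then show ?thesis unfolding AB AL_def SL_def by (simp add: filter_map o_def)
qed

lemma ready: "ready (flow B) (alive SE)"
  using matching_pair.ready_flow[OF pair] unfolding AB .

lemma V_alive: "\<Union>(alive SE) - range Mid = ends r t"
proof -
  have "v \<notin> \<Union>(loops SE)" if "v \<in> ends r t" for v
  proof
    assume "v \<in> \<Union>(loops SE)"
    then have "v \<in> range Mid" using component_self unfolding in_loops_iff by blast
    then show False using that by auto
  qed
  moreover have "ends r t \<inter> range Mid = {}" by auto
  ultimately show ?thesis unfolding Union_alive VS by blast
qed

lemma exists_simplification:
  "\<exists>k D. simplifies_to \<epsilon> (alive SE, AL) k D \<and> D \<in> marked_diagrams r t"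
proof -
  obtain k E' L' d' where 1: "simplifies_to \<epsilon> (alive SE, AL) k (E', L')" "ready d' E'" "marks_ok d' E' L'"
    "\<Union>E' = \<Union>(alive SE) - range Mid" using ready_simplification[OF ready marks, of \<epsilon>] by blast
  have "\<Union>E' = ends r t" using 1(4) V_alive by (simp only:)
  then have "(E', L') \<in> marked_diagrams r t" by (rule ready_marked[OF 1(2,3)])
  then show ?thesis using 1(1) by blast
qed

lemma no_loops:
  assumes "loops SE = {}"
  shows "alive SE = SE" "AL = SL"
proof -
  have ne: "e \<noteq> {}" if "e \<in> SE" for e
    using that matchingD(2)[OF mA, of e] matchingD(2)[OF mB, of e] unfolding SE_def by auto
  then show 1: "alive SE = SE" unfolding alive_def assms by auto
  have "mark_edge x \<in> SE" if x: "x \<in> set SL" for x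
    using x mk unfolding SL_def SE_def A0_def B0_def map_edges_def marks_ok_def by auto
  then show "AL = SL" unfolding AL_def assms using ne by (intro filter_True) auto
qed

text \<open>Translates the prescribed order, loops being deleted before anything else, into
  \<open>reduces\<close>, which demands a simplification of the full stack only if there was no loop
  to delete.\<close>

lemma reduces_of_simplifies:
  assumes "simplifies_to \<epsilon> (alive SE, AL) k D" "D \<in> marked_diagrams r t" "\<epsilon> * \<epsilon> = 1"
  shows "reduces \<epsilon> (ends r t) (SE, SL) (card (loops SE)) k D"
  unfolding reduces_def fst_conv
proof (intro conjI ballI impI)
  obtain E L where D: "D = (E, L)" by (cases D)
  have b: "brauer_diagram r t E" using assms(2) unfolding D marked_diagrams_iff by blast
  show V: "\<Union>(fst D) = ends r t" unfolding D fst_conv by (rule brauer_edge(1)[OF b])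
  show "ends r t \<subseteq> \<Union>SE" unfolding VS by blast
  show "card (loops SE) = card (closed_components SE (ends r t))" unfolding loops_closed ..
  show "k \<in> {1, \<epsilon>}" by (rule simplifies_to_coeff[OF assms(1,3)])
  show "simplifies_to \<epsilon> (SE, SL) k D" if "card (loops SE) = 0"
  proof -
    have "finite (loops SE)" unfolding loops_closed using finite_closed finS(2) by blast
    then have "loops SE = {}" using that by simp
    then show ?thesis using assms(1) no_loops by simp
  qed
  fix u v assume uv: "u \<in> ends r t" "v \<in> ends r t"
  then have "u \<notin> \<Union>(loops SE)" using V_alive Union_alive by blast
  then have "(u, v) \<in> connected_by SE \<longleftrightarrow> (u, v) \<in> connected_by (alive SE)"
    using alive_connected connected_alive by blast
  moreover have "(u, v) \<in> connected_by (fst D) \<longleftrightarrow> (u, v) \<in> connected_by (alive SE)"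
    using conjunct2[OF simplifies_to_connected[OF assms(1)]] uv V by simp
  ultimately show "(u, v) \<in> connected_by SE \<longleftrightarrow> (u, v) \<in> connected_by (fst D)" by simp
qed

lemma good:
  assumes "reduces \<epsilon> (ends r t) (SE, SL) 0 k D"
  shows "\<exists>\<rho>. arrangement \<rho> SE" "marked (SE, SL)"
proof -
  have "finite (loops SE)" unfolding loops_closed using finite_closed finS(2) by blast
  then have "loops SE = {}" using assms unfolding loops_closed reduces_def by simp
  note n = no_loops[OF this]
  show "\<exists>\<rho>. arrangement \<rho> SE" using ready_arrangement[OF ready] unfolding n .
  show "marked (SE, SL)" using marks_ok_marked[OF marks] unfolding n .
qed

end

text \<open>Since no loop is deleted here, a composite can be recognised by a reduction in stages,
  unlike a member of \<open>composites\<close>.\<close>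

definition composite :: "'k::field \<Rightarrow> 'k \<Rightarrow> nat \<Rightarrow> nat \<Rightarrow> diagram \<Rightarrow> diagram \<Rightarrow> 'k \<Rightarrow> diagram \<Rightarrow> bool" where
  "composite \<delta> \<epsilon> r t D1 D2 c D \<longleftrightarrow> D \<in> marked_diagrams r t \<and>
     (\<exists>m k. c = \<delta> ^ m * k \<and> reduces \<epsilon> (ends r t) (stack D1 D2) m k D)"

locale parameters =
  fixes \<delta> \<epsilon> :: "'k::field"
  assumes eps: "\<epsilon> = 1 \<or> (\<epsilon> = - 1 \<and> \<delta> = 0)"
begin

lemma ee: "\<epsilon> * \<epsilon> = 1" using eps by auto

lemma composites_nonempty:
  assumes "D1 \<in> marked_diagrams r s" "D2 \<in> marked_diagrams s t"
  shows "composites \<delta> \<epsilon> r t D1 D2 \<noteq> {}"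
proof -
  obtain E1 L1 E2 L2 where D: "D1 = (E1, L1)" "D2 = (E2, L2)" by (cases D1; cases D2)
  interpret stacking r s t E1 L1 E2 L2 by unfold_locales (use assms D in simp_all)
  obtain k D where "simplifies_to \<epsilon> (alive SE, AL) k D" "D \<in> marked_diagrams r t" using exists_simplification by blast
  then show ?thesis unfolding composites_def D delete_eq by blast
qed

lemma composites_composite:
  assumes "D1 \<in> marked_diagrams r s" "D2 \<in> marked_diagrams s t" "x \<in> composites \<delta> \<epsilon> r t D1 D2"
  shows "\<exists>c D. x = scale c (basis D) \<and> composite \<delta> \<epsilon> r t D1 D2 c D"
proof -
  obtain E1 L1 E2 L2 where D: "D1 = (E1, L1)" "D2 = (E2, L2)" by (cases D1; cases D2)
  interpret stacking r s t E1 L1 E2 L2 by unfold_locales (use assms D in simp_all)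
  obtain k D' where x: "x = scale (\<delta> ^ card (loops SE) * k) (basis D')" "simplifies_to \<epsilon> (alive SE, AL) k D'"
    "D' \<in> marked_diagrams r t" using assms(3) unfolding composites_def D delete_eq unfolding stack_eq fst_conv by blast
  then show ?thesis using reduces_of_simplifies[OF x(2,3) ee] unfolding composite_def D stack_eq by blast
qed

lemma composite_exists:
  assumes "D1 \<in> marked_diagrams r s" "D2 \<in> marked_diagrams s t"
  shows "\<exists>c D. composite \<delta> \<epsilon> r t D1 D2 c D"
  using composites_nonempty[OF assms] composites_composite[OF assms] by blast

text \<open>The lists of markings may differ on both sides. With \<kappa> = \<epsilon> this is what
  makes composition respect the relations of the Hom-spaces.\<close>

lemma composite_unique':
  assumes D: "(E1, L1) \<in> marked_diagrams r s" "(E2, L2) \<in> marked_diagrams s t"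
    "(E1, L1') \<in> marked_diagrams r s" "(E2, L2') \<in> marked_diagrams s t"
    and c: "composite \<delta> \<epsilon> r t (E1, L1) (E2, L2) c D" "composite \<delta> \<epsilon> r t (E1, L1') (E2, L2') c' D'"
    and \<kappa>: "\<kappa> = 1 \<or> \<kappa> = \<epsilon>" "\<And>\<rho> E K K'. K = snd (stack (E1, L1) (E2, L2)) ==> K' = snd (stack (E1, L1') (E2, L2')) ==>
       arrangement \<rho> E ==> marked (E, K) ==> marked (E, K') ==> sign \<epsilon> \<rho> K = \<kappa> * sign \<epsilon> \<rho> K'"
  shows "cong \<epsilon> r t (scale c (basis D)) (scale (\<kappa> * c') (basis D'))"
proof -
  interpret a: stacking r s t E1 L1 E2 L2 by unfold_locales (use D in simp_all)
  interpret b: stacking r s t E1 L1' E2 L2' by unfold_locales (use D in simp_all)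
  obtain m k where 1: "c = \<delta> ^ m * k" "reduces \<epsilon> (ends r t) (a.SE, a.SL) m k D" "D \<in> marked_diagrams r t"
    using c(1) unfolding composite_def a.stack_eq by blast
  obtain m' k' where 2: "c' = \<delta> ^ m' * k'" "reduces \<epsilon> (ends r t) (a.SE, b.SL) m' k' D'" "D' \<in> marked_diagrams r t"
    using c(2) unfolding composite_def b.stack_eq by blast
  have mm: "m = m'" using 1(2) 2(2) unfolding reduces_def by simp
  show ?thesis unfolding 1(1) 2(1)
  proof (rule reduces_unique[OF 1(2) 2(2) 1(3) 2(3)])
    show "\<exists>\<rho>. arrangement \<rho> a.SE" if "m = 0" using a.good(1) 1(2) unfolding that by blast
    show "marked (a.SE, a.SL) \<and> marked (a.SE, b.SL)" if "m = 0"
      using a.good(2) b.good(2) 1(2) 2(2) unfolding mm[symmetric] that by blast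
    show "sign \<epsilon> \<rho> a.SL = \<kappa> * sign \<epsilon> \<rho> b.SL" if "arrangement \<rho> a.SE" "marked (a.SE, a.SL)" "marked (a.SE, b.SL)" for \<rho>
      using \<kappa>(2)[OF _ _ that] unfolding a.stack_eq b.stack_eq by simp
    show "\<kappa> = 1 \<or> \<kappa> = \<epsilon>" by (rule \<kappa>(1))
    show "\<epsilon> = 1 \<or> (\<epsilon> = - 1 \<and> \<delta> = 0)" by (rule eps)
  qed
qed

lemma composite_unique:
  assumes "D1 \<in> marked_diagrams r s" "D2 \<in> marked_diagrams s t"
    "composite \<delta> \<epsilon> r t D1 D2 c D" "composite \<delta> \<epsilon> r t D1 D2 c' D'"
  shows "cong \<epsilon> r t (scale c (basis D)) (scale c' (basis D'))"
proof -
  obtain E1 L1 E2 L2 where D: "D1 = (E1, L1)" "D2 = (E2, L2)" by (cases D1; cases D2)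
  show ?thesis using composite_unique'[of E1 L1 r s E2 L2 t L1 L2 c D c' D' 1] assms unfolding D by simp
qed

end

section \<open>Associativity, interchange and units at the level of diagrams\<close>

section \<open>Associativity and interchange of diagrams\<close>

lemma brauer_iff: "brauer_diagram r s E \<longleftrightarrow> matching E \<and> \<Union>E = ends r s"
proof
  assume "brauer_diagram r s E"
  then show "matching E \<and> \<Union>E = ends r s" using brauer_matching brauer_edge(1) by simp
next
  assume a: "matching E \<and> \<Union>E = ends r s"
  then have m: "matching E" by simp
  have "{} \<notin> E" using matchingD(2)[OF m, of "{}"] by auto
  moreover have "disjnt p q" if "p \<in> E" "q \<in> E" "p \<noteq> q" for p q
    using matchingD(3)[OF m that(1,2)] that(3) unfolding disjnt_iff by blast
  ultimately have "partition_on (ends r s) E" using a by (intro partition_onI) simp_all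
  then show "brauer_diagram r s E" using matchingD(2)[OF m] by (simp add: brauer_diagram_def)
qed

lemma marked_diagrams_cong_on:
  assumes "(E, L) \<in> marked_diagrams r s" "\<And>v. v \<in> ends r s ==> f v = g v"
  shows "map_edges f E = map_edges g E" "map (map_mark f) L = map (map_mark g) L"
proof -
  have b: "brauer_diagram r s E" and m: "marks_ok top_flow E L" using assms(1) unfolding marked_diagrams_iff by auto
  then have fg': "f v = g v" if "v \<in> \<Union>E" for v using that assms(2) brauer_edge(1)[OF b] by simp
  then show "map_edges f E = map_edges g E" by (rule map_edges_cong)
  have "\<Union>(mark_edge ` set L) \<subseteq> \<Union>E" using m unfolding marks_ok_def by blast
  then show "map (map_mark f) L = map (map_mark g) L" using fg' by (intro map_marks_cong) blast
qed

lemma marked_diagrams_cong: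
  assumes "(E, L) \<in> marked_diagrams r s" "\<And>i. f (Top i) = g (Top i)" "\<And>i. f (Bot i) = g (Bot i)"
  shows "map_edges f E = map_edges g E" "map (map_mark f) L = map (map_mark g) L"
  by (rule marked_diagrams_cong_on[OF assms(1)]; use assms(2,3) in auto)+

lemma map_mark_id: "map_mark id x = x"
  by (cases x) auto

lemma marked_diagrams_idle:
  assumes "D \<in> marked_diagrams r s" "\<And>v. v \<in> ends r s ==> f v = v"
  shows "map_diagram f D = D"
proof -
  obtain E L where D: "D = (E, L)" by (cases D)
  have "map_edges f E = map_edges id E" "map (map_mark f) L = map (map_mark id) L"
    using marked_diagrams_cong_on[OF assms(1)[unfolded D], of f id] assms(2) by simp_all
  then show ?thesis unfolding D map_diagram_def by (simp add: map_edges_def map_mark_id map_idI)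
qed

lemma ends_image: "f ` ends r s = (\<lambda>i. f (Top i)) ` {1..r} \<union> (\<lambda>i. f (Bot i)) ` {1..s}"
  by (simp add: image_Un image_image)

lemma closed_empty:
  assumes "finite (\<Union>E)" "card (closed_components E Q) = 0" "v \<in> \<Union>E"
  obtains w where "w \<in> Q" "(v, w) \<in> connected_by E"
proof -
  have "closed_components E Q = {}" using assms finite_closed by simp
  then have "component E v \<notin> closed_components E Q" by simp
  then have "component E v \<inter> Q \<noteq> {}" unfolding closed_iff using assms(3) by blast
  then show ?thesis using that by (auto simp: component_iff)
qed

lemma closed_none:
  assumes "\<And>v. v \<in> \<Union>E ==> \<exists>w\<in>Q. (v, w) \<in> connected_by E"
  shows "closed_components E Q = {}"
proof -
  have "C \<notin> closed_components E Q" for C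
  proof
    assume "C \<in> closed_components E Q"
    then obtain v where v: "v \<in> \<Union>E" "C = component E v" "C \<inter> Q = {}" unfolding closed_iff by blast
    from assms[OF v(1)] v(2,3) show False by (auto simp: component_iff)
  qed
  then show ?thesis by blast
qed

text \<open>In a stack of three diagrams the upper seam consists of the \<open>Mid\<close> vertices
  of even index and the lower seam of those of odd index. \<open>up\<close> and \<open>down\<close>
  embed the stacks of the upper two and of the lower two diagrams. \<open>even_mid\<close> and
  \<open>odd_mid\<close> embed the two-layer stacks in which one layer is already a
  composite.\<close>

primrec up :: "vertex \<Rightarrow> vertex" where
  "up (Top i) = Top i" | "up (Mid i) = Mid (2 * i)" | "up (Bot i) = Mid (2 * i + 1)"

primrec down :: "vertex \<Rightarrow> vertex" where
  "down (Top i) = Mid (2 * i)" | "down (Mid i) = Mid (2 * i + 1)" | "down (Bot i) = Bot i"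

primrec even_mid :: "vertex \<Rightarrow> vertex" where
  "even_mid (Top i) = Top i" | "even_mid (Mid i) = Mid (2 * i)" | "even_mid (Bot i) = Bot i"

primrec odd_mid :: "vertex \<Rightarrow> vertex" where
  "odd_mid (Top i) = Top i" | "odd_mid (Mid i) = Mid (2 * i + 1)" | "odd_mid (Bot i) = Bot i"

lemma parity_ne: "2 * (i::nat) \<noteq> Suc (2 * j)" "Suc (2 * j) \<noteq> 2 * i"
  by presburger+

lemma inj_renamings: "inj up" "inj down" "inj even_mid" "inj odd_mid"
proof -
  show "inj up"
  proof (rule injI)
    fix x y assume "up x = up y" then show "x = y" by (cases x; cases y) (simp_all add: parity_ne)
  qed
  show "inj down"
  proof (rule injI)
    fix x y assume "down x = down y" then show "x = y" by (cases x; cases y) (simp_all add: parity_ne)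
  qed
  show "inj even_mid"
  proof (rule injI)
    fix x y assume "even_mid x = even_mid y" then show "x = y" by (cases x; cases y) simp_all
  qed
  show "inj odd_mid"
  proof (rule injI)
    fix x y assume "odd_mid x = odd_mid y" then show "x = y" by (cases x; cases y) simp_all
  qed
qed

lemma renamings_Mid: "up ` range Mid \<subseteq> range Mid" "down ` range Mid \<subseteq> range Mid"
  "even_mid ` range Mid \<subseteq> range Mid" "odd_mid ` range Mid \<subseteq> range Mid"
  by auto

lemma stack_map:
  "map_diagram f (stack (E1, L1) (E2, L2)) =
    (map_edges (f \<circ> bot_to_mid) E1 \<union> map_edges (f \<circ> top_to_mid) E2,
     map (map_mark (f \<circ> bot_to_mid)) L1 @ map (map_mark (f \<circ> top_to_mid)) L2)"
  by (simp add: map_diagram_def map_edges_Un map_edges_comp map_mark_comp)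

context parameters
begin

lemma composite_assoc:
  assumes D: "D1 \<in> marked_diagrams r s" "D2 \<in> marked_diagrams s t" "D3 \<in> marked_diagrams t u"
    and c12: "composite \<delta> \<epsilon> r t D1 D2 c12 D12" and c: "composite \<delta> \<epsilon> r u D12 D3 c D"
    and c23: "composite \<delta> \<epsilon> s u D2 D3 c23 D23" and c': "composite \<delta> \<epsilon> r u D1 D23 c' D'"
  shows "cong \<epsilon> r u (scale (c12 * c) (basis D)) (scale (c23 * c') (basis D'))"
proof -
  obtain E1 L1 E2 L2 E3 L3 where P: "D1 = (E1, L1)" "D2 = (E2, L2)" "D3 = (E3, L3)" by (cases D1; cases D2; cases D3)
  obtain E12 L12 E23 L23 where Q: "D12 = (E12, L12)" "D23 = (E23, L23)" by (cases D12; cases D23)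
  note M = D[unfolded P]
  have M12: "(E12, L12) \<in> marked_diagrams r t" and M23: "(E23, L23) \<in> marked_diagrams s u"
    using c12 c23 unfolding composite_def Q by blast+
  have Dm: "D \<in> marked_diagrams r u" "D' \<in> marked_diagrams r u" using c c' unfolding composite_def by blast+
  obtain m12 k12 where r12: "c12 = \<delta> ^ m12 * k12" "reduces \<epsilon> (ends r t) (stack (E1, L1) (E2, L2)) m12 k12 (E12, L12)"
    using c12 unfolding composite_def P Q by blast
  obtain m k where r: "c = \<delta> ^ m * k" "reduces \<epsilon> (ends r u) (stack (E12, L12) (E3, L3)) m k D"
    using c unfolding composite_def P Q by blast
  obtain m23 k23 where r23: "c23 = \<delta> ^ m23 * k23" "reduces \<epsilon> (ends s u) (stack (E2, L2) (E3, L3)) m23 k23 (E23, L23)"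
    using c23 unfolding composite_def P Q by blast
  obtain m' k' where r': "c' = \<delta> ^ m' * k'" "reduces \<epsilon> (ends r u) (stack (E1, L1) (E23, L23)) m' k' D'"
    using c' unfolding composite_def P Q by blast
  define f1 where "f1 = even_mid \<circ> bot_to_mid"
  define f2 where "f2 = up \<circ> top_to_mid"
  define f3 where "f3 = odd_mid \<circ> top_to_mid"
  define X1 where "X1 = map_edges f1 E1"
  define X2 where "X2 = map_edges f2 E2"
  define X3 where "X3 = map_edges f3 E3"
  define l1 where "l1 = map (map_mark f1) L1"
  define l2 where "l2 = map (map_mark f2) L2"
  define l3 where "l3 = map (map_mark f3) L3"
  have b: "brauer_diagram r s E1" "brauer_diagram s t E2" "brauer_diagram t u E3"
    and mk: "marks_ok top_flow E1 L1" "marks_ok top_flow E2 L2" "marks_ok top_flow E3 L3"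
    using M unfolding marked_diagrams_iff by auto
  have V: "\<Union>X1 = Top ` {1..r} \<union> (\<lambda>i. Mid (2 * i)) ` {1..s}"
    "\<Union>X2 = (\<lambda>i. Mid (2 * i)) ` {1..s} \<union> (\<lambda>i. Mid (2 * i + 1)) ` {1..t}"
    "\<Union>X3 = (\<lambda>i. Mid (2 * i + 1)) ` {1..t} \<union> Bot ` {1..u}"
    unfolding X1_def X2_def X3_def Union_map_edges brauer_edge(1)[OF b(1)] brauer_edge(1)[OF b(2)] brauer_edge(1)[OF b(3)]
      ends_image f1_def f2_def f3_def by simp_all
  have fin: "finite (\<Union>X1)" "finite (\<Union>X2)" "finite (\<Union>X3)" unfolding V by simp_all
  have marksF: "mark_edge ` set l1 \<subseteq> X1" "mark_edge ` set l3 \<subseteq> X3"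
    using mk unfolding l1_def l3_def X1_def X3_def map_edges_def marks_ok_def by auto
  have S12: "map_diagram up (stack (E1, L1) (E2, L2)) = (X1 \<union> X2, l1 @ l2)"
    unfolding stack_map X1_def X2_def l1_def l2_def f2_def
    using marked_diagrams_cong[OF M(1), of "up \<circ> bot_to_mid" f1] unfolding f1_def by simp
  have S23: "map_diagram down (stack (E2, L2) (E3, L3)) = (X2 \<union> X3, l2 @ l3)"
    unfolding stack_map X2_def X3_def l2_def l3_def
    using marked_diagrams_cong[OF M(2), of "down \<circ> bot_to_mid" f2] marked_diagrams_cong[OF M(3), of "down \<circ> top_to_mid" f3]
    unfolding f2_def f3_def by simp
  have T12: "map_diagram odd_mid (stack (E12, L12) (E3, L3)) = (map_edges up E12 \<union> X3, map (map_mark up) L12 @ l3)"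
    unfolding stack_map X3_def l3_def f3_def
    using marked_diagrams_cong[OF M12, of "odd_mid \<circ> bot_to_mid" up] by simp
  have T23: "map_diagram even_mid (stack (E1, L1) (E23, L23)) = (X1 \<union> map_edges down E23, l1 @ map (map_mark down) L23)"
    unfolding stack_map X1_def l1_def f1_def
    using marked_diagrams_cong[OF M23, of "even_mid \<circ> top_to_mid" down] by simp
  have idle: "odd_mid ` ends r u = ends r u" "even_mid ` ends r u = ends r u" unfolding ends_image by simp_all
  have idleD: "map_diagram odd_mid D = D" "map_diagram even_mid D' = D'"
    by (rule marked_diagrams_idle[OF Dm(1)] marked_diagrams_idle[OF Dm(2)], auto)+
  have a1: "reduces \<epsilon> (up ` ends r t) (X1 \<union> X2, l1 @ l2) m12 k12 (map_edges up E12, map (map_mark up) L12)"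
    using reduces_map[OF r12(2) inj_renamings(1) renamings_Mid(1)] unfolding S12 unfolding map_diagram_def fst_conv snd_conv .
  have a2: "reduces \<epsilon> (ends r u) (map_edges up E12 \<union> X3, map (map_mark up) L12 @ l3) m k D"
    using reduces_map[OF r(2) inj_renamings(4) renamings_Mid(4)] unfolding T12 idle idleD .
  have upends: "up ` ends r t = Top ` {1..r} \<union> (\<lambda>i. Mid (2 * i + 1)) ` {1..t}" unfolding ends_image by simp
  have R1: "reduces \<epsilon> (ends r u) (X1 \<union> X2 \<union> X3, l1 @ l2 @ l3) (m12 + m) (k12 * k) D"
  proof -
    have "reduces \<epsilon> (ends r u) (X1 \<union> X2 \<union> X3, [] @ (l1 @ l2) @ l3) (m12 + m) (k12 * k) D"
    proof (rule reduces_context[OF a1])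
      show "reduces \<epsilon> (ends r u) (map_edges up E12 \<union> X3, [] @ map (map_mark up) L12 @ l3) m k D" using a2 by simp
      show "\<Union>(X1 \<union> X2) \<inter> \<Union>X3 \<subseteq> up ` ends r t" unfolding upends Union_Un_distrib V by (auto simp: parity_ne)
      show "ends r u \<inter> \<Union>(X1 \<union> X2) \<subseteq> up ` ends r t" unfolding upends Union_Un_distrib V by auto
      show "mark_edge ` set ([] @ l3) \<subseteq> X3" using marksF by simp
    qed (use fin ee in auto)
    then show ?thesis by simp
  qed
  have b1: "reduces \<epsilon> (down ` ends s u) (X2 \<union> X3, l2 @ l3) m23 k23 (map_edges down E23, map (map_mark down) L23)"
    using reduces_map[OF r23(2) inj_renamings(2) renamings_Mid(2)] unfolding S23 unfolding map_diagram_def fst_conv snd_conv .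
  have b2: "reduces \<epsilon> (ends r u) (X1 \<union> map_edges down E23, l1 @ map (map_mark down) L23) m' k' D'"
    using reduces_map[OF r'(2) inj_renamings(3) renamings_Mid(3)] unfolding T23 idle idleD .
  have downends: "down ` ends s u = (\<lambda>i. Mid (2 * i)) ` {1..s} \<union> Bot ` {1..u}" unfolding ends_image by simp
  have R2: "reduces \<epsilon> (ends r u) (X1 \<union> X2 \<union> X3, l1 @ l2 @ l3) (m23 + m') (k23 * k') D'"
  proof -
    have "reduces \<epsilon> (ends r u) (X2 \<union> X3 \<union> X1, l1 @ (l2 @ l3) @ []) (m23 + m') (k23 * k') D'"
    proof (rule reduces_context[OF b1])
      show "reduces \<epsilon> (ends r u) (map_edges down E23 \<union> X1, l1 @ map (map_mark down) L23 @ []) m' k' D'"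
        using b2 by (simp add: Un_commute)
      show "\<Union>(X2 \<union> X3) \<inter> \<Union>X1 \<subseteq> down ` ends s u" unfolding downends Union_Un_distrib V by (auto simp: parity_ne)
      show "ends r u \<inter> \<Union>(X2 \<union> X3) \<subseteq> down ` ends s u" unfolding downends Union_Un_distrib V by auto
      show "mark_edge ` set (l1 @ []) \<subseteq> X1" using marksF by simp
    qed (use fin ee in auto)
    moreover have "X2 \<union> X3 \<union> X1 = X1 \<union> X2 \<union> X3" by blast
    ultimately show ?thesis by simp
  qed
  have mm: "m23 + m' = m12 + m" using R1 R2 unfolding reduces_def by simp
  have inj: "inj_on f1 (\<Union>E1)" "inj_on f2 (\<Union>E2)" "inj_on f3 (\<Union>E3)"
    unfolding brauer_edge(1)[OF b(1)] brauer_edge(1)[OF b(2)] brauer_edge(1)[OF b(3)] f1_def f2_def f3_def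
    by (auto simp: inj_on_def parity_ne)
  have mX: "matching X1" "matching X2" "matching X3"
    unfolding X1_def X2_def X3_def using matching_map brauer_matching b inj by blast+
  have X13: "\<Union>X1 \<inter> \<Union>X3 = {}" unfolding V by (auto simp: parity_ne)
  have eqE: "X1 \<union> X3 \<union> X2 = X1 \<union> X2 \<union> X3" by blast
  \<comment> \<open>Every glued vertex joins the middle layer to an outer one, so the two outer
    layers together can serve as one of the two layers. The labels no longer mean up and down, but
    here they only serve to obtain heights.\<close>
  have pair: "matching_pair (X1 \<union> X3) X2" if "m12 + m = 0"
  proof
    show "matching (X1 \<union> X3)" "matching X2" using matching_Un[OF mX(1,3) X13] mX(2) by simp_all
    fix v assume v: "v \<in> \<Union>(X1 \<union> X3 \<union> X2)"
    show "v \<in> range Mid \<longleftrightarrow> v \<in> \<Union>(X1 \<union> X3) \<and> v \<in> \<Union>X2"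
      using v unfolding Union_Un_distrib V by auto
    have c0: "card (closed_components (X1 \<union> X2 \<union> X3) (ends r u)) = 0" using R1 that unfolding reduces_def by simp
    have "finite (\<Union>(X1 \<union> X2 \<union> X3))" using fin by simp
    from closed_empty[OF this c0, of v] obtain w where "w \<in> ends r u" "(v, w) \<in> connected_by (X1 \<union> X2 \<union> X3)"
      using v unfolding eqE by metis
    moreover then have "w \<notin> range Mid" by auto
    ultimately show "\<exists>w. w \<notin> range Mid \<and> (v, w) \<in> connected_by (X1 \<union> X3 \<union> X2)" unfolding eqE by blast
  qed
  have "cong \<epsilon> r u (scale (\<delta> ^ (m12 + m) * (k12 * k)) (basis D)) (scale (1 * (\<delta> ^ (m23 + m') * (k23 * k'))) (basis D'))"
  proof (rule reduces_unique[OF R1 R2 Dm])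
    show "\<exists>\<rho>. arrangement \<rho> (X1 \<union> X2 \<union> X3)" if "m12 + m = 0"
      using ready_arrangement[OF matching_pair.ready_flow[OF pair[OF that]]] unfolding eqE .
    show "marked (X1 \<union> X2 \<union> X3, l1 @ l2 @ l3) \<and> marked (X1 \<union> X2 \<union> X3, l1 @ l2 @ l3)" if z: "m12 + m = 0"
    proof -
      interpret matching_pair "X1 \<union> X3" X2 by (rule pair[OF z])
      have "X1 \<inter> X3 = {}"
      proof (rule ccontr)
        assume "X1 \<inter> X3 \<noteq> {}"
        then obtain e where e: "e \<in> X1" "e \<in> X3" by blast
        then have "e \<noteq> {}" using matchingD(2)[OF mX(1) e(1)] by auto
        then show False using e X13 by blast
      qed
      then have d: "X1 \<inter> X2 = {}" "(X1 \<union> X2) \<inter> X3 = {}" using disjoint by blast+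
      have "marked (X1, l1)" "marked (X2, l2)" "marked (X3, l3)"
        unfolding X1_def X2_def X3_def l1_def l2_def l3_def using marked_map[OF marks_ok_marked] mk inj by blast+
      then have "marked (X1 \<union> X2 \<union> X3, (l1 @ l2) @ l3)" using marked_Un d by blast
      then show ?thesis by simp
    qed
  qed (use eps in simp_all)
  then show ?thesis unfolding r12(1) r(1) r23(1) r'(1) by (simp add: power_add mult.assoc mult.left_commute)
qed

end

lemma shift_inj: "inj (shift r s)"
proof (rule injI)
  fix x y assume "shift r s x = shift r s y" then show "x = y" by (cases x; cases y) simp_all
qed

lemma add_image: "(\<lambda>i. f (n + i)) ` {1..m::nat} = f ` {n + 1..n + m}"
proof -
  have "(+) n ` {1..m} = {n + 1..n + m}" by (simp add: image_add_atLeastAtMost)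
  then show ?thesis by (simp only: image_image[symmetric, of f "(+) n"])
qed

lemma juxtapose_ends: "ends r s \<union> shift r s ` ends t u = ends (r + t) (s + u)"
proof -
  have "{1..r} \<union> {r + 1..r + t} = {1..r + t}" "{1..s} \<union> {s + 1..s + u} = {1..s + u}" by auto
  then have 1: "Top ` {1..r + t} = Top ` {1..r} \<union> Top ` {r + 1..r + t}"
    and 2: "Bot ` {1..s + u} = Bot ` {1..s} \<union> Bot ` {s + 1..s + u}" by (simp_all only: image_Un[symmetric])
  show ?thesis unfolding ends_image shift.simps add_image 1 2 by blast
qed

lemma juxtapose_disjoint: "ends r s \<inter> shift r s ` ends t u = {}"
  unfolding ends_image by auto

lemma juxtapose_marked:
  assumes "D1 \<in> marked_diagrams r s" "D2 \<in> marked_diagrams t u"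
  shows "juxtapose r s D1 D2 \<in> marked_diagrams (r + t) (s + u)"
proof -
  obtain E1 L1 E2 L2 where D: "D1 = (E1, L1)" "D2 = (E2, L2)" by (cases D1; cases D2)
  have b: "matching E1" "matching E2" and V: "\<Union>E1 = ends r s" "\<Union>E2 = ends t u"
    and mk: "marks_ok top_flow E1 L1" "marks_ok top_flow E2 L2"
    using assms unfolding D marked_diagrams_iff brauer_iff by auto
  let ?E = "map_edges (shift r s) E2"
  have V2: "\<Union>?E = shift r s ` ends t u" unfolding Union_map_edges V ..
  have inj: "inj_on (shift r s) (\<Union>E2)" using shift_inj inj_on_subset by blast
  have m2: "matching ?E" by (rule matching_map[OF b(2) inj])
  have d: "\<Union>E1 \<inter> \<Union>?E = {}" unfolding V V2 by (rule juxtapose_disjoint)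
  have "E1 \<inter> ?E = {}"
  proof (rule ccontr)
    assume "E1 \<inter> ?E \<noteq> {}"
    then obtain e where e: "e \<in> E1" "e \<in> ?E" by blast
    then have "e \<noteq> {}" using matchingD(2)[OF b(1) e(1)] by auto
    then show False using e d by blast
  qed
  moreover have "marks_ok top_flow ?E (map (map_mark (shift r s)) L2)"
  proof (rule marks_ok_map[OF mk(2) inj])
    fix e v show "(shift r s v \<in> range Top) = (v \<in> range Top)" by (cases v) auto
  qed
  ultimately have "marks_ok top_flow (E1 \<union> ?E) (L1 @ map (map_mark (shift r s)) L2)"
    using marks_ok_Un[OF mk(1)] by blast
  moreover have "\<Union>(E1 \<union> ?E) = ends (r + t) (s + u)" unfolding Union_Un_distrib V V2 by (rule juxtapose_ends)
  ultimately show ?thesis using matching_Un[OF b(1) m2 d] unfolding D juxtapose.simps marked_diagrams_iff brauer_iff by blast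
qed

lemma reduces_refl:
  assumes "\<Union>(fst D) = Q"
  shows "reduces \<epsilon> Q D 0 1 D"
proof -
  have "closed_components (fst D) Q = {}" using assms connected_refl by (intro closed_none) blast
  then show ?thesis unfolding reduces_def using assms simplifies_to.stop by simp
qed

lemma reduces_interchanged:
  assumes "simplifies_to \<epsilon> (E, L) c (E, L')" "reduces \<epsilon> Q (E, L') m k D" "\<epsilon> * \<epsilon> = 1"
  shows "reduces \<epsilon> Q (E, L) m (c * k) D"
proof -
  have "c * k \<in> {1, \<epsilon>}" using simplifies_to_coeff[OF assms(1,3)] assms(2,3) unfolding reduces_def by auto
  then show ?thesis using assms(2) simplifies_to_trans[OF assms(1)] unfolding reduces_def fst_conv by blast
qed

lemma interchange_one:
  "simplifies_to \<epsilon> (E, P @ G @ [x] @ R) (\<epsilon> ^ length G) (E, P @ [x] @ G @ R)"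
proof (induction G arbitrary: R rule: rev_induct)
  case Nil then show ?case using simplifies_to.stop by simp
next
  case (snoc g G)
  have "simplify_step \<epsilon> (E, (P @ G) @ [g, x] @ R) \<epsilon> (E, (P @ G) @ [x, g] @ R)" by (rule simplify_step.interchange)
  from simplifies_to.step[OF this, of "\<epsilon> ^ length G" "(E, P @ [x] @ G @ [g] @ R)"] snoc[of "[g] @ R"]
  show ?case by simp
qed

lemma interchange_blocks:
  "simplifies_to \<epsilon> (E, P @ G @ H @ R) (\<epsilon> ^ (length G * length H)) (E, P @ H @ G @ R)"
proof (induction H arbitrary: P)
  case Nil then show ?case using simplifies_to.stop by simp
next
  case (Cons x H)
  have "simplifies_to \<epsilon> (E, P @ G @ [x] @ H @ R) (\<epsilon> ^ length G * \<epsilon> ^ (length G * length H)) (E, (P @ [x]) @ H @ G @ R)"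
    by (rule simplifies_to_trans[OF interchange_one]) (use Cons[of "P @ [x]"] in simp)
  then show ?case by (simp add: power_add)
qed

context parameters
begin

text \<open>The combined stack is a disjoint union of the stack of \<open>f\<close>,
  \<open>h\<close> and a translate of the stack of \<open>g\<close>, \<open>j\<close>, except for
  the order of its markings.\<close>

lemma composite_interchange:
  assumes f: "f \<in> marked_diagrams r s" and g: "g \<in> marked_diagrams t u"
    and h: "h \<in> marked_diagrams s v" and j: "j \<in> marked_diagrams u w"
    and c: "composite \<delta> \<epsilon> r v f h c D" and c': "composite \<delta> \<epsilon> t w g j c' D'"
  shows "composite \<delta> \<epsilon> (r + t) (v + w) (juxtapose r s f g) (juxtapose s v h j)
    (\<epsilon> ^ (length (snd g) * length (snd h)) * (c * c')) (juxtapose r v D D')"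
proof -
  obtain Ef Lf where pf: "f = (Ef, Lf)" by (cases f)
  obtain Eg Lg where pg: "g = (Eg, Lg)" by (cases g)
  obtain Eh Lh where ph: "h = (Eh, Lh)" by (cases h)
  obtain Ej Lj where pj: "j = (Ej, Lj)" by (cases j)
  obtain E L where pD: "D = (E, L)" by (cases D)
  obtain E' L' where pD': "D' = (E', L')" by (cases D')
  \<comment> \<open>The translation of the right-hand stack: by \<open>r\<close> at the top, by
    \<open>s\<close> at the seam and by \<open>v\<close> at the bottom.\<close>
  define \<kappa> where "\<kappa> x = (case x of Top i \<Rightarrow> Top (r + i) | Mid i \<Rightarrow> Mid (s + i) | Bot i \<Rightarrow> Bot (v + i))" for x
  have k_simps [simp]: "\<kappa> (Top i) = Top (r + i)" "\<kappa> (Mid i) = Mid (s + i)" "\<kappa> (Bot i) = Bot (v + i)" for i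
    unfolding \<kappa>_def by simp_all
  have k_inj: "inj \<kappa>"
  proof (rule injI)
    fix x y assume "\<kappa> x = \<kappa> y" then show "x = y" by (cases x; cases y) simp_all
  qed
  have k_Mid: "\<kappa> ` range Mid \<subseteq> range Mid" by auto
  have DM: "(E, L) \<in> marked_diagrams r v" "(E', L') \<in> marked_diagrams t w"
    using c c' unfolding composite_def pD pD' by blast+
  obtain m k where r: "c = \<delta> ^ m * k" "reduces \<epsilon> (ends r v) (stack f h) m k (E, L)"
    using c unfolding composite_def pD by blast
  obtain m' k' where r': "c' = \<delta> ^ m' * k'" "reduces \<epsilon> (ends t w) (stack g j) m' k' (E', L')"
    using c' unfolding composite_def pD' by blast
  interpret a: stacking r s v Ef Lf Eh Lh by unfold_locales (use f h pf ph in simp_all)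
  interpret b: stacking t u w Eg Lg Ej Lj by unfold_locales (use g j pg pj in simp_all)
  let ?Q = "ends (r + t) (v + w)"
  let ?F = "map_edges \<kappa> b.SE" and ?l = "map (map_mark \<kappa>) b.SL"
  have e1: "map_edges (\<kappa> \<circ> bot_to_mid) Eg = map_edges (bot_to_mid \<circ> shift r s) Eg"
    "map (map_mark (\<kappa> \<circ> bot_to_mid)) Lg = map (map_mark (bot_to_mid \<circ> shift r s)) Lg"
    using marked_diagrams_cong[of Eg Lg t u "\<kappa> \<circ> bot_to_mid" "bot_to_mid \<circ> shift r s"] g pg by simp_all
  have e2: "map_edges (\<kappa> \<circ> top_to_mid) Ej = map_edges (top_to_mid \<circ> shift s v) Ej"
    "map (map_mark (\<kappa> \<circ> top_to_mid)) Lj = map (map_mark (top_to_mid \<circ> shift s v)) Lj"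
    using marked_diagrams_cong[of Ej Lj u w "\<kappa> \<circ> top_to_mid" "top_to_mid \<circ> shift s v"] j pj by simp_all
  have e3: "map_edges \<kappa> E' = map_edges (shift r v) E'" "map (map_mark \<kappa>) L' = map (map_mark (shift r v)) L'"
    using marked_diagrams_cong[OF DM(2), of \<kappa> "shift r v"] by simp_all
  have S: "stack (juxtapose r s f g) (juxtapose s v h j) = (a.SE \<union> ?F,
      map (map_mark bot_to_mid) Lf @ map (map_mark (\<kappa> \<circ> bot_to_mid)) Lg @
      map (map_mark top_to_mid) Lh @ map (map_mark (\<kappa> \<circ> top_to_mid)) Lj)"
    unfolding pf pg ph pj juxtapose.simps stack.simps a.SE_def b.SE_def a.A0_def a.B0_def b.A0_def b.B0_def
      map_edges_Un map_edges_comp e1 e2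
    by (auto simp: map_mark_comp)
  have l: "?l = map (map_mark (\<kappa> \<circ> bot_to_mid)) Lg @ map (map_mark (\<kappa> \<circ> top_to_mid)) Lj"
    unfolding b.SL_def by (simp add: map_mark_comp)
  have V: "\<Union>E = ends r v" "\<Union>E' = ends t w" using DM unfolding marked_diagrams_iff brauer_iff by simp_all
  have VF: "\<Union>?F = \<kappa> ` ends t w \<union> \<kappa> ` Mid ` {1..u}" unfolding Union_map_edges b.VS image_Un ..
  have kends: "\<kappa> ` ends t w = shift r v ` ends t w" unfolding ends_image by simp
  have fin: "finite (\<Union>?F)" "finite (\<Union>E)" "finite (\<Union>a.SE)" unfolding VF V using a.finS by simp_all
  have J: "juxtapose r v D D' = (map_edges \<kappa> E' \<union> E, L @ map (map_mark \<kappa>) L')"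
    unfolding pD pD' juxtapose.simps e3 by (simp add: Un_commute)
  have JM: "juxtapose r v D D' \<in> marked_diagrams (r + t) (v + w)"
    using juxtapose_marked DM unfolding pD pD' by blast
  have "\<Union>(fst (juxtapose r v D D')) = ?Q"
    unfolding J fst_conv Union_Un_distrib Union_map_edges V kends using juxtapose_ends[of r v t w] by (simp add: Un_commute)
  \<comment> \<open>The reduction is assembled backwards: the finished diagram, then the right stack
    beside the finished left part, then both stacks.\<close>
  then have R0: "reduces \<epsilon> ?Q (map_edges \<kappa> E' \<union> E, L @ map (map_mark \<kappa>) L' @ []) 0 1 (juxtapose r v D D')"
    unfolding J append_Nil2 by (rule reduces_refl)
  have rk: "reduces \<epsilon> (\<kappa> ` ends t w) (?F, ?l) m' k' (map_edges \<kappa> E', map (map_mark \<kappa>) L')"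
    using reduces_map[OF r'(2) k_inj k_Mid] unfolding pg pj b.stack_eq map_diagram_def by simp
  have marksE: "mark_edge ` set L \<subseteq> E" using DM(1) unfolding marked_diagrams_iff marks_ok_def by blast
  have R1: "reduces \<epsilon> ?Q (?F \<union> E, L @ ?l @ []) (m' + 0) (k' * 1) (juxtapose r v D D')"
  proof (rule reduces_context[OF rk R0])
    show "\<Union>?F \<inter> \<Union>E \<subseteq> \<kappa> ` ends t w" unfolding VF V by auto
    show "?Q \<inter> \<Union>?F \<subseteq> \<kappa> ` ends t w" unfolding VF by auto
  qed (use marksE fin ee in auto)
  have marksF: "mark_edge ` set ?l \<subseteq> ?F"
  proof -
    have "mark_edge ` set b.SL \<subseteq> b.SE"
      using b.mk unfolding b.SL_def b.SE_def b.A0_def b.B0_def map_edges_def marks_ok_def by auto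
    then show ?thesis unfolding map_edges_def by auto
  qed
  have ra: "reduces \<epsilon> (ends r v) (a.SE, a.SL) m k (E, L)" using r(2) unfolding pf ph a.stack_eq .
  have R2: "reduces \<epsilon> ?Q (a.SE \<union> ?F, [] @ a.SL @ ?l) (m + m') (k * k') (juxtapose r v D D')"
  proof (rule reduces_context[OF ra])
    show "reduces \<epsilon> ?Q (E \<union> ?F, [] @ L @ ?l) m' k' (juxtapose r v D D')" using R1 by (simp add: Un_commute)
    show "\<Union>a.SE \<inter> \<Union>?F \<subseteq> ends r v" unfolding a.VS VF by auto
    show "?Q \<inter> \<Union>a.SE \<subseteq> ends r v" unfolding a.VS by auto
  qed (use marksF fin ee in auto)
  let ?P = "map (map_mark bot_to_mid) Lf" and ?G = "map (map_mark (\<kappa> \<circ> bot_to_mid)) Lg"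
  let ?H = "map (map_mark top_to_mid) Lh" and ?R = "map (map_mark (\<kappa> \<circ> top_to_mid)) Lj"
  \<comment> \<open>In the juxtaposed diagrams the markings of \<open>g\<close> stand above those of
    \<open>h\<close>. Moving these blocks past each other separates the two stacks and produces the
    power of \<epsilon>.\<close>
  have "reduces \<epsilon> ?Q (a.SE \<union> ?F, ?P @ ?G @ ?H @ ?R) (m + m') (\<epsilon> ^ (length ?G * length ?H) * (k * k')) (juxtapose r v D D')"
    by (rule reduces_interchanged[OF interchange_blocks _ ee]) (use R2 in \<open>simp add: a.SL_def l\<close>)
  then have "reduces \<epsilon> ?Q (stack (juxtapose r s f g) (juxtapose s v h j)) (m + m')
      (\<epsilon> ^ (length (snd g) * length (snd h)) * (k * k')) (juxtapose r v D D')"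
    unfolding S unfolding pg ph snd_conv length_map .
  then show ?thesis unfolding composite_def using JM r(1) r'(1)
    by (intro conjI exI[of _ "m + m'"] exI[of _ "\<epsilon> ^ (length (snd g) * length (snd h)) * (k * k')"])
      (simp_all add: power_add algebra_simps)
qed

end

section \<open>Straight strands\<close>

text \<open>The effect of contracting all strands {a i, Mid i} at once: each glued vertex takes the
  name of the other end of its strand.\<close>

definition ren :: "nat set \<Rightarrow> (nat \<Rightarrow> vertex) \<Rightarrow> vertex \<Rightarrow> vertex" where
  "ren K a v = (case v of Mid i \<Rightarrow> if i \<in> K then a i else v | _ \<Rightarrow> v)"

lemma ren_simps [simp]: "ren K a (Top i) = Top i" "ren K a (Bot i) = Bot i" "ren K a (Mid i) = (if i \<in> K then a i else Mid i)"
  by (simp_all add: ren_def)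

text \<open>The assumptions on \<open>E\<close> and \<open>L\<close> say that a strand {a i, Mid i}
  occurs neither within a remaining edge nor within a marked one; the induction has to carry this
  through the earlier contractions.\<close>

lemma contract_strands:
  assumes "finite K" "inj_on a K" "a ` K \<inter> Mid ` K = {}"
    "\<And>e i. e \<in> E ==> i \<in> K ==> a i \<in> e ==> Mid i \<notin> e"
    "\<And>x i. x \<in> set L ==> i \<in> K ==> a i \<in> mark_edge x ==> Mid i \<notin> mark_edge x"
  shows "simplifies_to \<epsilon> ((\<lambda>i. {a i, Mid i}) ` K \<union> E, L) 1 (map_edges (ren K a) E, map (map_mark (ren K a)) L)"
  using assms
proof (induction K arbitrary: E L rule: finite_induct)
  case empty
  have "ren {} a = id" by (rule ext) (simp add: ren_def split: vertex.split)
  then have "map (map_mark (ren {} a)) L = L" by (intro map_idI) (simp only: map_mark_id)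
  moreover have "map_edges (ren {} a) E = E" using \<open>ren {} a = id\<close> by (simp add: map_edges_def)
  ultimately show ?case using simplifies_to.stop[of \<epsilon> "(E, L)"] by simp
next
  case (insert i K)
  let ?f = "id(Mid i := a i)" and ?S = "(\<lambda>i. {a i, Mid i}) ` K"
  have ai: "a i \<notin> Mid ` insert i K" using insert.prems(2) by blast
  have aj: "a j \<noteq> a i" "a j \<noteq> Mid i" "j \<noteq> i" if "j \<in> K" for j
  proof -
    show ji: "j \<noteq> i" using that insert.hyps(2) by blast
    show "a j \<noteq> a i" using inj_onD[OF insert.prems(1), of j i] that ji by blast
    show "a j \<noteq> Mid i" using insert.prems(2) that by blast
  qed
  have ne: "a i \<noteq> Mid i" using ai by auto
  have fS: "map_edges ?f ?S = ?S"
  proof -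
    have "?f ` {a j, Mid j} = {a j, Mid j}" if "j \<in> K" for j using aj[OF that] by auto
    then show ?thesis unfolding map_edges_def image_image by (intro image_cong) simp_all
  qed
  have nS: "{a i, Mid i} \<notin> ?S"
  proof
    assume "{a i, Mid i} \<in> ?S"
    then obtain j where "j \<in> K" "{a i, Mid i} = {a j, Mid j}" by blast
    then have "Mid i \<in> {a j, Mid j}" by blast
    then show False using aj[OF \<open>j \<in> K\<close>] by auto
  qed
  have nE: "{a i, Mid i} \<notin> E" using insert.prems(3)[of "{a i, Mid i}" i] by blast
  have nL: "{a i, Mid i} \<notin> mark_edge ` set L"
  proof
    assume "{a i, Mid i} \<in> mark_edge ` set L"
    then obtain x where "x \<in> set L" "{a i, Mid i} = mark_edge x" by blast
    then show False using insert.prems(4)[of x i] by blast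
  qed
  have eq: "((\<lambda>i. {a i, Mid i}) ` insert i K \<union> E) - {{a i, Mid i}} = ?S \<union> E" using nS nE by auto
  have "{a i, Mid i} \<in> (\<lambda>i. {a i, Mid i}) ` insert i K \<union> E" by blast
  from simplify_step.contract[OF this ne _ nL, of \<epsilon>]
  have s: "simplify_step \<epsilon> ((\<lambda>i. {a i, Mid i}) ` insert i K \<union> E, L) 1 (?S \<union> map_edges ?f E, map (map_mark ?f) L)"
    unfolding eq map_edges_Un fS by blast
  have key: "Mid j \<notin> ?f ` e" if "j \<in> K" "a j \<in> ?f ` e" "a j \<in> e ==> Mid j \<notin> e" for j e
  proof
    assume "Mid j \<in> ?f ` e"
    then obtain z where z: "z \<in> e" "?f z = Mid j" by (metis imageE)
    have "z \<noteq> Mid i"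
    proof
      assume "z = Mid i"
      then have "a i = Mid j" using z(2) by simp
      then show False using ai that(1) by simp
    qed
    then have "Mid j \<in> e" using z by simp
    moreover have "a j \<in> e" using that(2) aj[OF that(1)] by (auto split: if_splits)
    ultimately show False using that(3) by blast
  qed
  have "simplifies_to \<epsilon> (?S \<union> map_edges ?f E, map (map_mark ?f) L) 1
      (map_edges (ren K a) (map_edges ?f E), map (map_mark (ren K a)) (map (map_mark ?f) L))"
  proof (rule insert.IH)
    show "inj_on a K" "a ` K \<inter> Mid ` K = {}" using insert.prems(1,2) by auto
    show "Mid j \<notin> e" if e: "e \<in> map_edges ?f E" "j \<in> K" "a j \<in> e" for e j
    proof -
      obtain g where g: "g \<in> E" "e = ?f ` g" using e(1) unfolding map_edges_def by blast
      show ?thesis using key[OF e(2), of g] e(3) insert.prems(3)[OF g(1), of j] e(2) unfolding g(2) by blast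
    qed
    show "Mid j \<notin> mark_edge x" if x: "x \<in> set (map (map_mark ?f) L)" "j \<in> K" "a j \<in> mark_edge x" for x j
    proof -
      obtain y where y: "y \<in> set L" "mark_edge x = ?f ` mark_edge y" using x(1) by auto
      show ?thesis using key[OF x(2), of "mark_edge y"] x(3) insert.prems(4)[OF y(1), of j] x(2) unfolding y(2) by blast
    qed
  qed
  moreover have rf: "ren K a \<circ> ?f = ren (insert i K) a"
  proof
    fix x
    have "ren K a (a i) = a i" using ai by (auto simp: ren_def split: vertex.split)
    then show "(ren K a \<circ> ?f) x = ren (insert i K) a x" by (cases x) auto
  qed
  moreover have "map_mark (ren K a) \<circ> map_mark ?f = map_mark (ren (insert i K) a)"
    by (rule ext) (simp only: o_apply map_mark_comp rf)
  ultimately have "simplifies_to \<epsilon> (?S \<union> map_edges ?f E, map (map_mark ?f) L) 1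
      (map_edges (ren (insert i K) a) E, map (map_mark (ren (insert i K) a)) L)"
    by (simp only: map_edges_comp map_map)
  from simplifies_to.step[OF s this] show ?case by simp
qed

lemma reducesI:
  assumes "simplifies_to \<epsilon> S k D" "\<Union>(fst D) = Q" "\<And>v. v \<in> \<Union>(fst S) ==> \<exists>w\<in>Q. (v, w) \<in> connected_by (fst S)" "\<epsilon> * \<epsilon> = 1"
  shows "reduces \<epsilon> Q S 0 k D"
proof -
  note c = simplifies_to_connected[OF assms(1)]
  have "\<forall>u\<in>Q. \<forall>v\<in>Q. (u, v) \<in> connected_by (fst S) \<longleftrightarrow> (u, v) \<in> connected_by (fst D)"
    using conjunct2[OF c] unfolding assms(2) by blast
  moreover have "Q \<subseteq> \<Union>(fst S)" using conjunct1[OF c] unfolding assms(2) .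
  moreover have "card (closed_components (fst S) Q) = 0" using closed_none[OF assms(3)] by simp
  ultimately show ?thesis unfolding reduces_def using assms(1,2) simplifies_to_coeff[OF assms(1,4)] by simp
qed

section \<open>Identity diagrams\<close>

definition identity_diagram :: "nat \<Rightarrow> diagram" where
  "identity_diagram r = ((\<lambda>i. {Top i, Bot i}) ` {1..r}, [])"

lemma identity_marked: "identity_diagram r \<in> marked_diagrams r r"
proof -
  let ?E = "(\<lambda>i. {Top i, Bot i}) ` {1..r}"
  have "matching ?E" unfolding matching_def by auto
  moreover have "\<Union>?E = ends r r" by auto
  moreover have "marks_ok top_flow ?E []" unfolding marks_ok_def homogeneous_def by auto
  ultimately show ?thesis unfolding identity_diagram_def marked_diagrams_iff brauer_iff by blast
qed

lemma marked_vertices: "(E, L) \<in> marked_diagrams r s ==> \<Union>E = ends r s"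
  "(E, L) \<in> marked_diagrams r s ==> mark_edge ` set L \<subseteq> E"
proof -
  assume M: "(E, L) \<in> marked_diagrams r s"
  show "\<Union>E = ends r s" using M unfolding marked_diagrams_iff brauer_iff by (elim conjE)
  show "mark_edge ` set L \<subseteq> E" using M unfolding marked_diagrams_iff marks_ok_def by (intro image_subsetI) simp
qed

lemma map_mark_o: "map_mark f \<circ> map_mark g = map_mark (f \<circ> g)"
  by (rule ext) (simp add: map_mark_comp)

text \<open>Meant for a permutation diagram as one of the factors: every glued vertex then hangs on
  an unmarked strand that ends at an outer vertex. Contracting these strands relabels the other
  diagram by \<open>h\<close>.\<close>

lemma composite_strands:
  assumes D: "D1 \<in> marked_diagrams r s" "D2 \<in> marked_diagrams s t"
    and S: "stack D1 D2 = ((\<lambda>i. {a i, Mid i}) ` {1..s} \<union> map_edges g E, map (map_mark g) L)"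
    and EL: "(E, L) \<in> marked_diagrams x y" and M: "map_diagram h (E, L) \<in> marked_diagrams r t"
    and a: "inj_on a {1..s}" "\<And>i. i \<in> {1..s} ==> a i \<in> ends r t" "\<And>i. i \<in> {1..s} ==> a i \<notin> g ` ends x y"
    and h: "\<And>v. v \<in> ends x y ==> (ren {1..s} a \<circ> g) v = h v" and e: "\<epsilon> * \<epsilon> = 1"
  shows "composite \<delta> \<epsilon> r t D1 D2 1 (map_diagram h (E, L))"
proof -
  obtain E1 L1 E2 L2 where P: "D1 = (E1, L1)" "D2 = (E2, L2)" by (cases D1; cases D2)
  interpret stacking r s t E1 L1 E2 L2 by unfold_locales (use D P in simp_all)
  have nM: "a i \<notin> range Mid" if "i \<in> {1..s}" for i using a(2)[OF that] by auto
  have sub: "e \<subseteq> g ` ends x y" if "e \<in> map_edges g E" for e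
    using that unfolding marked_vertices(1)[OF EL, symmetric] map_edges_def by blast
  have subL: "mark_edge z \<subseteq> g ` ends x y" if "z \<in> set (map (map_mark g) L)" for z
    by (rule sub) (use that marked_vertices(2)[OF EL] in \<open>auto simp: map_edges_def\<close>)
  have mem: "Mid i \<notin> e" if "e \<subseteq> g ` ends x y" "i \<in> {1..s}" "a i \<in> e" for e i using a(3) that by blast
  have res: "(map_edges (ren {1..s} a) (map_edges g E), map (map_mark (ren {1..s} a)) (map (map_mark g) L)) = map_diagram h (E, L)"
    using marked_diagrams_cong_on[OF EL, of "ren {1..s} a \<circ> g" h, OF h] unfolding map_edges_comp map_diagram_def
    by (simp add: map_mark_o)
  have s: "simplifies_to \<epsilon> (stack D1 D2) 1 (map_diagram h (E, L))"
    unfolding S res[symmetric]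
  proof (rule contract_strands)
    show "a ` {1..s} \<inter> Mid ` {1..s} = {}" using nM by blast
    show "Mid i \<notin> e" if "e \<in> map_edges g E" "i \<in> {1..s}" "a i \<in> e" for e i by (rule mem[OF sub that(2,3)]) (rule that(1))
    show "Mid i \<notin> mark_edge z" if "z \<in> set (map (map_mark g) L)" "i \<in> {1..s}" "a i \<in> mark_edge z" for z i
      by (rule mem[OF subL that(2,3)]) (rule that(1))
  qed (use a in simp_all)
  have V: "\<Union>(fst (map_diagram h (E, L))) = ends r t" using marked_vertices(1) M by (metis prod.collapse)
  have "reduces \<epsilon> (ends r t) (stack D1 D2) 0 1 (map_diagram h (E, L))"
  proof (rule reducesI[OF s V _ e])
    fix v assume "v \<in> \<Union>(fst (stack D1 D2))"
    then have "v \<in> \<Union>SE" unfolding P stack_eq fst_conv .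
    then have "v \<in> ends r t \<union> Mid ` {1..s}" unfolding VS .
    then consider "v \<in> ends r t" | i where "i \<in> {1..s}" "v = Mid i" by blast
    then show "\<exists>w\<in>ends r t. (v, w) \<in> connected_by (fst (stack D1 D2))"
    proof cases
      case 1 then show ?thesis using connected_refl by blast
    next
      case 2
      have "{a i, Mid i} \<in> fst (stack D1 D2)" unfolding S using 2(1) by simp
      then have "(v, a i) \<in> connected_by (fst (stack D1 D2))" unfolding 2(2) by (rule connected_edge) simp_all
      then show ?thesis using a(2)[OF 2(1)] by blast
    qed
  qed
  then show ?thesis unfolding composite_def using M by (intro conjI exI[of _ 0] exI[of _ 1]) simp_all
qed

section \<open>From diagrams to cosets: parity of markings, and bilinear operations\<close>

section \<open>Degrees\<close>

text \<open>Give weight 3 to a top vertex and weight 1 to a bottom vertex. A cup then weighs 6, a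
  cap 2 and a through string 4, so half the weight is odd exactly for the edges that carry a
  marking. The total 3r + s is congruent to s - r modulo 4 and avoids subtraction.\<close>

lemma marked_length:
  assumes "(E, L) \<in> marked_diagrams r s"
  shows "even (length L) \<longleftrightarrow> even ((3 * r + s) div 2)" "even (3 * r + s)"
proof -
  have m: "matching E" and V: "\<Union>E = ends r s" and mk: "marks_ok top_flow E L"
    using assms unfolding marked_diagrams_iff brauer_iff by auto
  define w where "w e = 3 * card (e \<inter> range Top) + card (e \<inter> range Bot)" for e
  have card: "(\<Sum>e\<in>E. card (e \<inter> X)) = card (\<Union>E \<inter> X)" for X
  proof -
    have "card (\<Union>((\<lambda>e. e \<inter> X) ` E)) = (\<Sum>e\<in>E. card (e \<inter> X))"
    proof (rule card_UN_disjoint)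
      show "finite E" by (rule matchingD(1)[OF m])
      show "\<forall>e\<in>E. finite (e \<inter> X)" using matchingD(2)[OF m] by (metis card.infinite finite_Int zero_neq_numeral)
      show "\<forall>e\<in>E. \<forall>e'\<in>E. e \<noteq> e' \<longrightarrow> (e \<inter> X) \<inter> (e' \<inter> X) = {}" using matchingD(3)[OF m] by blast
    qed
    moreover have "\<Union>((\<lambda>e. e \<inter> X) ` E) = \<Union>E \<inter> X" by blast
    ultimately show ?thesis by simp
  qed
  have "ends r s \<inter> range Top = Top ` {1..r}" "ends r s \<inter> range Bot = Bot ` {1..s}" by auto
  then have "card (\<Union>E \<inter> range Top) = r" "card (\<Union>E \<inter> range Bot) = s"
    unfolding V by (simp_all add: card_image inj_on_def)
  then have sum: "(\<Sum>e\<in>E. w e) = 3 * r + s"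
    using card[of "range Top"] card[of "range Bot"] unfolding w_def by (simp add: sum.distrib sum_distrib_left[symmetric])
  have we: "w e = 2 * (w e div 2) \<and> (odd (w e div 2) \<longleftrightarrow> homogeneous top_flow e)" if e: "e \<in> E" for e
  proof -
    obtain x y where xy: "e = {x, y}" "x \<noteq> y" using matchingD(2)[OF m e] by (meson card_2_iff)
    have ends: "x \<in> ends r s" "y \<in> ends r s" using e V unfolding xy(1) by blast+
    have T: "{x, y} \<inter> range Top = (if x \<in> range Top then {x} else {}) \<union> (if y \<in> range Top then {y} else {})"
      "{x, y} \<inter> range Bot = (if x \<in> range Bot then {x} else {}) \<union> (if y \<in> range Bot then {y} else {})" by auto
    have B: "x \<in> range Bot \<longleftrightarrow> x \<notin> range Top" "y \<in> range Bot \<longleftrightarrow> y \<notin> range Top" using ends by auto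
    show ?thesis unfolding w_def xy(1) T B homogeneous_def using xy(2)
      by (cases "x \<in> range Top"; cases "y \<in> range Top") simp_all
  qed
  have "(\<Sum>e\<in>E. w e) = (\<Sum>e\<in>E. 2 * (w e div 2))" by (rule sum.cong) (use we in blast)+
  then have s2: "3 * r + s = 2 * (\<Sum>e\<in>E. w e div 2)" unfolding sum by (simp add: sum_distrib_left)
  then show "even (3 * r + s)" by simp
  have fin: "finite E" by (rule matchingD(1)[OF m])
  have par: "even (\<Sum>e\<in>E. w e div 2) \<longleftrightarrow> even (card {e \<in> E. odd (w e div 2)})"
    using fin by (simp add: even_sum_iff)
  have "{e \<in> E. odd (w e div 2)} = {e \<in> E. homogeneous top_flow e}" using we by blast
  also have "\<dots> = mark_edge ` set L"
  proof
    show "{e \<in> E. homogeneous top_flow e} \<subseteq> mark_edge ` set L" using mk unfolding marks_ok_def by blast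
    show "mark_edge ` set L \<subseteq> {e \<in> E. homogeneous top_flow e}"
    proof
      fix e assume "e \<in> mark_edge ` set L"
      then obtain x where x: "x \<in> set L" "e = mark_edge x" by blast
      then have "mark_edge x \<in> E \<and> (\<forall>v\<in>mark_edge x. (v \<in> range Top) = is_bead x)" using mk unfolding marks_ok_def by blast
      then show "e \<in> {e \<in> E. homogeneous top_flow e}" unfolding homogeneous_def x(2) by (cases "is_bead x") simp_all
    qed
  qed
  finally have "card {e \<in> E. odd (w e div 2)} = card (set (map mark_edge L))" by simp
  also have "\<dots> = length (map mark_edge L)" using mk unfolding marks_ok_def by (intro distinct_card) blast
  finally show "even (length L) \<longleftrightarrow> even ((3 * r + s) div 2)" using par s2 by simp
qed

text \<open>In a composite the middle object contributes four times its size to the sum of the two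
  weights, hence an even number to half of it.\<close>

lemma word_degree_formula:
  assumes "well_typed w"
  shows "even (3 * src w + tgt w) \<and> (even (odd_generators w) \<longleftrightarrow> even ((3 * src w + tgt w) div 2))"
proof -
  have "\<exists>k. 3 * src w + tgt w = 2 * k \<and> (even (odd_generators w) \<longleftrightarrow> even k)"
    using assms
  proof (induction w)
    case (Comp f g)
    then obtain k l where kl: "3 * src f + tgt f = 2 * k" "even (odd_generators f) \<longleftrightarrow> even k"
      "3 * src g + tgt g = 2 * l" "even (odd_generators g) \<longleftrightarrow> even l" "tgt f = src g" by auto
    then have "3 * src f + tgt g = 2 * (k + l - 2 * src g)" "2 * src g \<le> k + l" by linarith+
    moreover have "even (k + l - 2 * src g) \<longleftrightarrow> even (k + l)" using calculation(2) by simp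
    ultimately show ?case using kl by (intro exI[of _ "k + l - 2 * src g"]) simp
  next
    case (Tens f g)
    then obtain k l where kl: "3 * src f + tgt f = 2 * k" "even (odd_generators f) \<longleftrightarrow> even k"
      "3 * src g + tgt g = 2 * l" "even (odd_generators g) \<longleftrightarrow> even l" by auto
    then show ?case by (intro exI[of _ "k + l"]) simp
  qed (auto intro: exI[of _ 0] exI[of _ 1] exI[of _ 2] exI[of _ 3] exI[of _ 4])
  then obtain k where k: "3 * src w + tgt w = 2 * k" "even (odd_generators w) \<longleftrightarrow> even k" by blast
  show ?thesis unfolding k(1) using k(2) by simp
qed

section \<open>Bilinear extension\<close>

lemma combinations_sum:
  assumes "f \<in> combinations A"
  shows "f = (\<Sum>a\<in>Poly_Mapping.keys f. scale (Poly_Mapping.lookup f a) (basis a))"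
proof (rule poly_mapping_eqI)
  fix x
  have "Poly_Mapping.lookup (\<Sum>a\<in>Poly_Mapping.keys f. scale (Poly_Mapping.lookup f a) (basis a)) x =
    (\<Sum>a\<in>Poly_Mapping.keys f. if a = x then Poly_Mapping.lookup f a else 0)"
    by (simp add: lookup_sum basis_def lookup_single when_def if_distrib cong: if_cong)
  also have "\<dots> = (if x \<in> Poly_Mapping.keys f then Poly_Mapping.lookup f x else 0)"
    by (simp add: sum.delta)
  also have "\<dots> = Poly_Mapping.lookup f x" by (simp add: in_keys_iff)
  finally show "Poly_Mapping.lookup f x = Poly_Mapping.lookup (\<Sum>a\<in>Poly_Mapping.keys f. scale (Poly_Mapping.lookup f a) (basis a)) x" by simp
qed

lemma keys_scale: "Poly_Mapping.keys (scale c x) \<subseteq> Poly_Mapping.keys x"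
  by (auto simp: in_keys_iff)

lemma keys_diff: "Poly_Mapping.keys (x - y) \<subseteq> Poly_Mapping.keys x \<union> Poly_Mapping.keys (y :: 'a \<Rightarrow>\<^sub>0 'k::field)"
  by (auto simp: in_keys_iff lookup_minus)

lemma combinations_add: "x \<in> combinations A ==> y \<in> combinations A ==> x + y \<in> combinations A"
  unfolding combinations_def using Poly_Mapping.keys_add[of x y] by blast

lemma combinations_diff: "x \<in> combinations A ==> y \<in> combinations A ==> x - y \<in> combinations A"
  unfolding combinations_def using keys_diff[of x y] by blast

lemma combinations_scale: "x \<in> combinations A ==> scale c x \<in> combinations A"
  unfolding combinations_def using keys_scale[of c x] by blast

lemma combinations_zero: "0 \<in> combinations A"
  by (simp add: combinations_def)

lemma combinations_basis: "a \<in> A ==> basis a \<in> combinations A"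
  by (simp add: combinations_def basis_def)

lemma combinations_sum_in: "(\<And>i. i \<in> I ==> f i \<in> combinations A) ==> sum f I \<in> combinations A"
  by (induction I rule: infinite_finite_induct) (auto intro: combinations_add combinations_zero)

definition linear_extension :: "('a \<Rightarrow> ('c \<Rightarrow>\<^sub>0 'k)) \<Rightarrow> ('a \<Rightarrow>\<^sub>0 'k) \<Rightarrow> ('c \<Rightarrow>\<^sub>0 'k::field)" where
  "linear_extension h x = (\<Sum>a\<in>Poly_Mapping.keys x. scale (Poly_Mapping.lookup x a) (h a))"

lemma linear_extension_superset:
  assumes "finite A" "Poly_Mapping.keys x \<subseteq> A"
  shows "linear_extension h x = (\<Sum>a\<in>A. scale (Poly_Mapping.lookup x a) (h a))"
  unfolding linear_extension_def
  by (rule sum.mono_neutral_left) (use assms in \<open>auto simp: in_keys_iff\<close>)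

lemma linear_extension_add: "linear_extension h (x + y) = linear_extension h x + linear_extension h y"
proof -
  let ?A = "Poly_Mapping.keys x \<union> Poly_Mapping.keys y"
  have "linear_extension h (x + y) = (\<Sum>a\<in>?A. scale (Poly_Mapping.lookup (x + y) a) (h a))"
    by (rule linear_extension_superset) (simp_all add: Poly_Mapping.keys_add)
  also have "\<dots> = (\<Sum>a\<in>?A. scale (Poly_Mapping.lookup x a) (h a)) + (\<Sum>a\<in>?A. scale (Poly_Mapping.lookup y a) (h a))"
    by (simp add: lookup_add comb.scale_left_distrib sum.distrib)
  also have "\<dots> = linear_extension h x + linear_extension h y"
    by (simp add: linear_extension_superset[of ?A x] linear_extension_superset[of ?A y])
  finally show ?thesis .
qed

lemma linear_extension_scale: "linear_extension h (scale c x) = scale c (linear_extension h x)"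
proof -
  have "linear_extension h (scale c x) = (\<Sum>a\<in>Poly_Mapping.keys x. scale (Poly_Mapping.lookup (scale c x) a) (h a))"
    by (rule linear_extension_superset) (simp_all add: keys_scale)
  then show ?thesis by (simp add: linear_extension_def comb.scale_sum_right)
qed

lemma linear_extension_diff: "linear_extension h (x - y) = linear_extension h x - linear_extension h y"
proof -
  have "linear_extension h (x - y + y) = linear_extension h (x - y) + linear_extension h y" by (rule linear_extension_add)
  then show ?thesis by simp
qed

lemma linear_extension_basis: "linear_extension h (basis a) = h a"
  by (simp add: linear_extension_def basis_def)

lemma linear_extension_zero: "linear_extension h 0 = 0"
  by (simp add: linear_extension_def)

lemma linear_extension_sum: "linear_extension h (sum f I) = (\<Sum>i\<in>I. linear_extension h (f i))"
  by (induction I rule: infinite_finite_induct) (simp_all add: linear_extension_zero linear_extension_add)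

lemma bilinear_left: "bilinear_extension h x y = linear_extension (\<lambda>a. linear_extension (h a) y) x"
  by (simp add: bilinear_extension_def linear_extension_def comb.scale_sum_right)

lemma bilinear_right: "bilinear_extension h x y = linear_extension (\<lambda>b. linear_extension (\<lambda>a. h a b) x) y"
  by (simp add: bilinear_extension_def linear_extension_def comb.scale_sum_right mult.commute sum.swap[of _ _ "Poly_Mapping.keys y"])

lemma linear_extension_cong:
  assumes "x \<in> combinations A" "\<And>a. a \<in> A ==> cong \<epsilon> r s (h a) (h' a)"
  shows "cong \<epsilon> r s (linear_extension h x) (linear_extension h' x)"
  unfolding linear_extension_def using assms by (intro cong_sum cong_scale) (auto simp: combinations_def)

text \<open>Both kinds of defining relations as one relation between lists of markings. Its
  stability under renaming and under adding further markings is what makes the operations on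
  diagrams respect the relations.\<close>

definition elementary :: "mark list \<Rightarrow> mark list \<Rightarrow> bool" where
  "elementary K K' \<longleftrightarrow> (\<exists>L1 x y L2. K = L1 @ [x, y] @ L2 \<and> K' = L1 @ [y, x] @ L2) \<or>
     (\<exists>L1 u v L2. K = L1 @ [Arrow u v] @ L2 \<and> K' = L1 @ [Arrow v u] @ L2)"

lemma relation_elementary:
  assumes "z \<in> diagram_relations \<epsilon> r s"
  obtains E K K' where "(E, K) \<in> marked_diagrams r s" "(E, K') \<in> marked_diagrams r s" "elementary K K'"
    "z = basis (E, K) - scale \<epsilon> (basis (E, K'))"
proof -
  obtain E K K' where z: "(E, K) \<in> marked_diagrams r s" "elementary K K'" "z = basis (E, K) - scale \<epsilon> (basis (E, K'))"
    using assms unfolding diagram_relations_def elementary_def by blast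
  have "mset (map (\<lambda>x. (mark_edge x, is_bead x)) K) = mset (map (\<lambda>x. (mark_edge x, is_bead x)) K')"
    using z(2) unfolding elementary_def by (auto simp: insert_commute)
  then have "(E, K') \<in> marked_diagrams r s" using z(1) marks_ok_cong unfolding marked_diagrams_iff by blast
  then show ?thesis using that z by blast
qed

lemma null_space_combinations: "null_space \<epsilon> r s \<subseteq> combinations (marked_diagrams r s)"
proof
  fix x assume "x \<in> null_space \<epsilon> r s"
  then have "x \<in> comb.span (diagram_relations \<epsilon> r s)" by (simp add: null_space_def)
  then show "x \<in> combinations (marked_diagrams r s)"
  proof (induction rule: comb.span_induct_alt)
    case base show ?case by (rule combinations_zero)
  next
    case (step c z y)
    obtain E K K' where "(E, K) \<in> marked_diagrams r s" "(E, K') \<in> marked_diagrams r s" "z = basis (E, K) - scale \<epsilon> (basis (E, K'))"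
      using relation_elementary[OF step(1)] by blast
    then have "z \<in> combinations (marked_diagrams r s)" by (simp only: combinations_diff combinations_scale combinations_basis)
    then show ?case using step(2) by (intro combinations_add combinations_scale)
  qed
qed

lemma coset_mem: "g \<in> coset \<epsilon> r s f \<longleftrightarrow> cong \<epsilon> r s g f"
  unfolding coset_def cong_def elt_set_plus_def by (auto intro: bexI[of _ "g - f"])

lemma coset_eq_iff: "coset \<epsilon> r s f = coset \<epsilon> r s g \<longleftrightarrow> cong \<epsilon> r s f g"
proof
  assume "coset \<epsilon> r s f = coset \<epsilon> r s g"
  then show "cong \<epsilon> r s f g" using coset_mem[of f \<epsilon> r s f] coset_mem[of f \<epsilon> r s g] by simp
next
  assume c: "cong \<epsilon> r s f g"
  then show "coset \<epsilon> r s f = coset \<epsilon> r s g"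
    unfolding set_eq_iff coset_mem using cong_trans cong_sym by blast
qed

lemma cong_combinations:
  assumes "cong \<epsilon> r s g f" "f \<in> combinations (marked_diagrams r s)"
  shows "g \<in> combinations (marked_diagrams r s)"
proof -
  have "g - f \<in> combinations (marked_diagrams r s)" using assms(1) null_space_combinations unfolding cong_def by blast
  then show ?thesis using combinations_add[OF _ assms(2)] by fastforce
qed

section \<open>Composition and tensor product of cosets\<close>

context parameters
begin

definition choice :: "nat \<Rightarrow> nat \<Rightarrow> diagram \<Rightarrow> diagram \<Rightarrow> (diagram \<Rightarrow>\<^sub>0 'k)" where
  "choice r t D1 D2 = (SOME x. x \<in> composites \<delta> \<epsilon> r t D1 D2)"

lemma choice:
  assumes "D1 \<in> marked_diagrams r s" "D2 \<in> marked_diagrams s t"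
  shows "choice r t D1 D2 \<in> composites \<delta> \<epsilon> r t D1 D2"
proof -
  have "\<exists>x. x \<in> composites \<delta> \<epsilon> r t D1 D2" unfolding ex_in_conv by (rule composites_nonempty[OF assms])
  then show ?thesis unfolding choice_def by (rule someI_ex)
qed

lemma composites_cong:
  assumes "D1 \<in> marked_diagrams r s" "D2 \<in> marked_diagrams s t" "x \<in> composites \<delta> \<epsilon> r t D1 D2"
    "composite \<delta> \<epsilon> r t D1 D2 c D"
  shows "cong \<epsilon> r t x (scale c (basis D))"
  using composites_composite[OF assms(1-3)] composite_unique[OF assms(1,2) _ assms(4)] by blast

lemma elementary_context:
  assumes "elementary K K'"
  shows "elementary (P @ map (map_mark f) K @ Q) (P @ map (map_mark f) K' @ Q)"
  using assms[unfolded elementary_def]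
proof (elim disjE exE conjE)
  fix L1 x y L2 assume "K = L1 @ [x, y] @ L2" "K' = L1 @ [y, x] @ L2"
  then have "P @ map (map_mark f) K @ Q = (P @ map (map_mark f) L1) @ [map_mark f x, map_mark f y] @ (map (map_mark f) L2 @ Q)"
    "P @ map (map_mark f) K' @ Q = (P @ map (map_mark f) L1) @ [map_mark f y, map_mark f x] @ (map (map_mark f) L2 @ Q)"
    by simp_all
  then show ?thesis unfolding elementary_def by blast
next
  fix L1 u v L2 assume "K = L1 @ [Arrow u v] @ L2" "K' = L1 @ [Arrow v u] @ L2"
  then have "P @ map (map_mark f) K @ Q = (P @ map (map_mark f) L1) @ [Arrow (f u) (f v)] @ (map (map_mark f) L2 @ Q)"
    "P @ map (map_mark f) K' @ Q = (P @ map (map_mark f) L1) @ [Arrow (f v) (f u)] @ (map (map_mark f) L2 @ Q)"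
    by simp_all
  then show ?thesis unfolding elementary_def by blast
qed

lemma elementary_sign:
  assumes "elementary K K'" "arrangement \<rho> E" "marked (E, K)"
  shows "sign \<epsilon> \<rho> K = \<epsilon> * sign \<epsilon> \<rho> K'"
  using assms(1) unfolding elementary_def
proof (elim disjE exE conjE)
  fix L1 x y L2 assume "K = L1 @ [x, y] @ L2" "K' = L1 @ [y, x] @ L2"
  then show ?thesis using sign_swap[OF ee assms(2), of L1 x y L2] assms(3) by (simp only:)
next
  fix L1 u v L2 assume "K = L1 @ [Arrow u v] @ L2" "K' = L1 @ [Arrow v u] @ L2"
  then show ?thesis using sign_reverse[OF ee assms(2), of L1 u v L2] assms(3) by (simp only:)
qed

lemma elementary_relation:
  "elementary K K' ==> (E, K) \<in> marked_diagrams r s ==> cong \<epsilon> r s (basis (E, K)) (scale \<epsilon> (basis (E, K')))"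
  unfolding cong_def null_space_def diagram_relations_def elementary_def by (rule comb.span_base) blast

text \<open>The null space is spanned by the differences of diagrams that are one elementary change
  apart, with factor \<epsilon>, so testing these is enough.\<close>

lemma linear_extension_respects:
  assumes x: "cong \<epsilon> r s x x'"
    and h: "\<And>E K K'. (E, K) \<in> marked_diagrams r s ==> (E, K') \<in> marked_diagrams r s ==> elementary K K' ==>
      cong \<epsilon> t u (h (E, K)) (scale \<epsilon> (h (E, K')))"
  shows "cong \<epsilon> t u (linear_extension h x) (linear_extension h x')"
proof -
  have "linear_extension h y \<in> null_space \<epsilon> t u" if y: "y \<in> comb.span (diagram_relations \<epsilon> r s)" for y
    using y
  proof (induction rule: comb.span_induct_alt)
    case base
    show ?case by (simp add: linear_extension_zero null_space_def comb.span_zero)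
  next
    case (step c z y)
    obtain E K K' where K: "(E, K) \<in> marked_diagrams r s" "(E, K') \<in> marked_diagrams r s" "elementary K K'"
      "z = basis (E, K) - scale \<epsilon> (basis (E, K'))"
      using relation_elementary[OF step(1)] .
    have "linear_extension h z \<in> null_space \<epsilon> t u"
      using h[OF K(1-3)] unfolding K(4) cong_def by (simp add: linear_extension_diff linear_extension_scale linear_extension_basis)
    then show ?case using step(2) unfolding null_space_def
      by (simp add: linear_extension_add linear_extension_scale comb.span_add comb.span_scale)
  qed
  from this[of "x - x'"] x show ?thesis unfolding cong_def null_space_def by (simp add: linear_extension_diff)
qed

text \<open>\<open>h\<close> may differ from \<open>h0\<close> modulo the relations. This freedom
  absorbs the different ways of carrying out a simplification.\<close>

lemma bilinear_respects:
  assumes f: "cong \<epsilon> r s f f0" "f0 \<in> combinations (marked_diagrams r s)"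
    and g: "cong \<epsilon> t u g g0" "g0 \<in> combinations (marked_diagrams t u)"
    and hh: "\<And>D1 D2. D1 \<in> marked_diagrams r s ==> D2 \<in> marked_diagrams t u ==> cong \<epsilon> v w (h D1 D2) (h0 D1 D2)"
    and left: "\<And>E K K' D. (E, K) \<in> marked_diagrams r s ==> (E, K') \<in> marked_diagrams r s ==> elementary K K' ==>
      D \<in> marked_diagrams t u ==> cong \<epsilon> v w (h0 (E, K) D) (scale \<epsilon> (h0 (E, K') D))"
    and right: "\<And>E K K' D. (E, K) \<in> marked_diagrams t u ==> (E, K') \<in> marked_diagrams t u ==> elementary K K' ==>
      D \<in> marked_diagrams r s ==> cong \<epsilon> v w (h0 D (E, K)) (scale \<epsilon> (h0 D (E, K')))"
  shows "cong \<epsilon> v w (bilinear_extension h f g) (bilinear_extension h0 f0 g0)"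
proof -
  have f': "f \<in> combinations (marked_diagrams r s)" and g': "g \<in> combinations (marked_diagrams t u)"
    using cong_combinations f g by blast+
  have 1: "cong \<epsilon> v w (bilinear_extension h f g) (bilinear_extension h0 f g)"
    unfolding bilinear_left by (intro linear_extension_cong[OF f'] linear_extension_cong[OF g'] hh)
  have 2: "cong \<epsilon> v w (bilinear_extension h0 f g) (bilinear_extension h0 f0 g)"
    unfolding bilinear_left
  proof (rule linear_extension_respects[OF f(1)])
    fix E K K' assume K: "(E, K) \<in> marked_diagrams r s" "(E, K') \<in> marked_diagrams r s" "elementary K K'"
    have "scale \<epsilon> (linear_extension (h0 (E, K')) g) = linear_extension (\<lambda>D. scale \<epsilon> (h0 (E, K') D)) g"
      by (simp add: linear_extension_def comb.scale_sum_right mult.commute)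
    then show "cong \<epsilon> v w (linear_extension (h0 (E, K)) g) (scale \<epsilon> (linear_extension (h0 (E, K')) g))"
      using linear_extension_cong[OF g' left[OF K]] by simp
  qed
  have 3: "cong \<epsilon> v w (bilinear_extension h0 f0 g) (bilinear_extension h0 f0 g0)"
    unfolding bilinear_right
  proof (rule linear_extension_respects[OF g(1)])
    fix E K K' assume K: "(E, K) \<in> marked_diagrams t u" "(E, K') \<in> marked_diagrams t u" "elementary K K'"
    have "scale \<epsilon> (linear_extension (\<lambda>D. h0 D (E, K')) f0) = linear_extension (\<lambda>D. scale \<epsilon> (h0 D (E, K'))) f0"
      by (simp add: linear_extension_def comb.scale_sum_right mult.commute)
    then show "cong \<epsilon> v w (linear_extension (\<lambda>D. h0 D (E, K)) f0) (scale \<epsilon> (linear_extension (\<lambda>D. h0 D (E, K')) f0))"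
      using linear_extension_cong[OF f(2) right[OF K]] by simp
  qed
  show ?thesis using 1 2 3 cong_trans by blast
qed

lemma choice_composite:
  assumes "D1 \<in> marked_diagrams r s" "D2 \<in> marked_diagrams s t" "composite \<delta> \<epsilon> r t D1 D2 c D"
  shows "cong \<epsilon> r t (choice r t D1 D2) (scale c (basis D))"
  by (rule composites_cong[OF assms(1,2) choice[OF assms(1,2)] assms(3)])

lemma choice_elementary:
  assumes D: "(E1, L1) \<in> marked_diagrams r s" "(E2, L2) \<in> marked_diagrams s t"
    "(E1, L1') \<in> marked_diagrams r s" "(E2, L2') \<in> marked_diagrams s t"
    and el: "elementary L1 L1' \<and> L2 = L2' \<or> L1 = L1' \<and> elementary L2 L2'"
  shows "cong \<epsilon> r t (choice r t (E1, L1) (E2, L2)) (scale \<epsilon> (choice r t (E1, L1') (E2, L2')))"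
proof -
  obtain c D where 1: "composite \<delta> \<epsilon> r t (E1, L1) (E2, L2) c D" using composite_exists[OF D(1,2)] by blast
  obtain c' D' where 2: "composite \<delta> \<epsilon> r t (E1, L1') (E2, L2') c' D'" using composite_exists[OF D(3,4)] by blast
  have el': "elementary (snd (stack (E1, L1) (E2, L2))) (snd (stack (E1, L1') (E2, L2')))"
    using el elementary_context[of L1 L1' "[]" bot_to_mid "map (map_mark top_to_mid) L2"]
      elementary_context[of L2 L2' "map (map_mark bot_to_mid) L1" top_to_mid "[]"] by auto
  have "cong \<epsilon> r t (scale c (basis D)) (scale (\<epsilon> * c') (basis D'))"
  proof (rule composite_unique'[OF D 1 2])
    show "\<epsilon> = 1 \<or> \<epsilon> = \<epsilon>" by simp
    show "sign \<epsilon> \<rho> K = \<epsilon> * sign \<epsilon> \<rho> K'" if "K = snd (stack (E1, L1) (E2, L2))" "K' = snd (stack (E1, L1') (E2, L2'))"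
      "arrangement \<rho> E" "marked (E, K)" for \<rho> E K K'
      using elementary_sign[OF el' that(3)] that(4) unfolding that(1,2) by blast
  qed
  then have "cong \<epsilon> r t (scale c (basis D)) (scale \<epsilon> (scale c' (basis D')))" by simp
  moreover have "cong \<epsilon> r t (scale \<epsilon> (scale c' (basis D'))) (scale \<epsilon> (choice r t (E1, L1') (E2, L2')))"
    by (rule cong_scale[OF cong_sym[OF choice_composite[OF D(3,4) 2]]])
  ultimately show ?thesis using choice_composite[OF D(1,2) 1] cong_trans by blast
qed

text \<open>The union in the definition of \<open>compose\<close> collapses to a single coset
  because its members are all equal; this is the well-definedness of composition.\<close>

theorem compose_coset:
  assumes f: "f \<in> combinations (marked_diagrams r s)" and g: "g \<in> combinations (marked_diagrams s t)"
  shows "compose \<delta> \<epsilon> r s t (coset \<epsilon> r s f) (coset \<epsilon> s t g) = coset \<epsilon> r t (bilinear_extension (choice r t) f g)"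
proof -
  let ?H = "{h. \<forall>D1\<in>marked_diagrams r s. \<forall>D2\<in>marked_diagrams s t. h D1 D2 \<in> composites \<delta> \<epsilon> r t D1 D2}"
  have c: "coset \<epsilon> r t (bilinear_extension h f' g') = coset \<epsilon> r t (bilinear_extension (choice r t) f g)"
    if f': "f' \<in> coset \<epsilon> r s f" and g': "g' \<in> coset \<epsilon> s t g" and h: "h \<in> ?H" for f' g' h
    unfolding coset_eq_iff
  proof (rule bilinear_respects)
    show "cong \<epsilon> r s f' f" "cong \<epsilon> s t g' g" using f' g' unfolding coset_mem by simp_all
    show "f \<in> combinations (marked_diagrams r s)" "g \<in> combinations (marked_diagrams s t)" by (rule f, rule g)
    fix D1 D2 assume D: "D1 \<in> marked_diagrams r s" "D2 \<in> marked_diagrams s t"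
    obtain c D' where 1: "composite \<delta> \<epsilon> r t D1 D2 c D'" using composite_exists[OF D] by blast
    have "h D1 D2 \<in> composites \<delta> \<epsilon> r t D1 D2" using h D by blast
    from composites_cong[OF D this 1] show "cong \<epsilon> r t (h D1 D2) (choice r t D1 D2)"
      using cong_sym[OF choice_composite[OF D 1]] cong_trans by blast
  next
    fix E K K' D assume K: "(E, K) \<in> marked_diagrams r s" "(E, K') \<in> marked_diagrams r s" "elementary K K'" and D: "D \<in> marked_diagrams s t"
    obtain E2 L2 where "D = (E2, L2)" by (cases D)
    then show "cong \<epsilon> r t (choice r t (E, K) D) (scale \<epsilon> (choice r t (E, K') D))"
      using choice_elementary[of E K r s E2 L2 t K' L2] K D by simp
  next
    fix E K K' D assume K: "(E, K) \<in> marked_diagrams s t" "(E, K') \<in> marked_diagrams s t" "elementary K K'" and D: "D \<in> marked_diagrams r s"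
    obtain E1 L1 where "D = (E1, L1)" by (cases D)
    then show "cong \<epsilon> r t (choice r t D (E, K)) (scale \<epsilon> (choice r t D (E, K')))"
      using choice_elementary[of E1 L1 r s E K t L1 K'] K D by simp
  qed
  have "f \<in> coset \<epsilon> r s f" "g \<in> coset \<epsilon> s t g" unfolding coset_mem by simp_all
  moreover have "choice r t \<in> ?H" using choice by blast
  ultimately show ?thesis unfolding compose_def using c by (intro set_eqI iffI) blast+
qed

theorem tensor_coset:
  assumes f: "f \<in> combinations (marked_diagrams r s)" and g: "g \<in> combinations (marked_diagrams t u)"
  shows "tensor \<epsilon> r s t u (coset \<epsilon> r s f) (coset \<epsilon> t u g) =
    coset \<epsilon> (r + t) (s + u) (bilinear_extension (\<lambda>D1 D2. basis (juxtapose r s D1 D2)) f g)"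
proof -
  let ?h = "\<lambda>D1 D2. basis (juxtapose r s D1 D2)"
  have c: "coset \<epsilon> (r + t) (s + u) (bilinear_extension ?h f' g') = coset \<epsilon> (r + t) (s + u) (bilinear_extension ?h f g)"
    if f': "f' \<in> coset \<epsilon> r s f" and g': "g' \<in> coset \<epsilon> t u g" for f' g'
    unfolding coset_eq_iff
  proof (rule bilinear_respects)
    show "cong \<epsilon> r s f' f" "cong \<epsilon> t u g' g" using f' g' unfolding coset_mem by simp_all
    show "f \<in> combinations (marked_diagrams r s)" "g \<in> combinations (marked_diagrams t u)" by (rule f, rule g)
    show "cong \<epsilon> (r + t) (s + u) (?h D1 D2) (?h D1 D2)" for D1 D2 by simp
  next
    fix E K K' D assume K: "(E, K) \<in> marked_diagrams r s" "(E, K') \<in> marked_diagrams r s" "elementary K K'" and D: "D \<in> marked_diagrams t u"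
    obtain E2 L2 where D2: "D = (E2, L2)" by (cases D)
    show "cong \<epsilon> (r + t) (s + u) (?h (E, K) D) (scale \<epsilon> (?h (E, K') D))"
      unfolding D2 juxtapose.simps
    proof (rule elementary_relation)
      show "elementary (K @ map (map_mark (shift r s)) L2) (K' @ map (map_mark (shift r s)) L2)"
        using elementary_context[OF K(3), of "[]" id "map (map_mark (shift r s)) L2"] by (simp add: map_mark_id map_idI)
      show "(E \<union> map_edges (shift r s) E2, K @ map (map_mark (shift r s)) L2) \<in> marked_diagrams (r + t) (s + u)"
        using juxtapose_marked[OF K(1) D] unfolding D2 by simp
    qed
  next
    fix E K K' D assume K: "(E, K) \<in> marked_diagrams t u" "(E, K') \<in> marked_diagrams t u" "elementary K K'" and D: "D \<in> marked_diagrams r s"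
    obtain E1 L1 where D1: "D = (E1, L1)" by (cases D)
    show "cong \<epsilon> (r + t) (s + u) (?h D (E, K)) (scale \<epsilon> (?h D (E, K')))"
      unfolding D1 juxtapose.simps
    proof (rule elementary_relation)
      show "elementary (L1 @ map (map_mark (shift r s)) K) (L1 @ map (map_mark (shift r s)) K')"
        using elementary_context[OF K(3), of L1 "shift r s" "[]"] by simp
      show "(E1 \<union> map_edges (shift r s) E, L1 @ map (map_mark (shift r s)) K) \<in> marked_diagrams (r + t) (s + u)"
        using juxtapose_marked[OF D K(1)] unfolding D1 by simp
    qed
  qed
  have "f \<in> coset \<epsilon> r s f" "g \<in> coset \<epsilon> t u g" unfolding coset_mem by simp_all
  then show ?thesis unfolding tensor_def using c by (intro set_eqI iffI) blast+
qed

end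

section \<open>Evaluation of words, and soundness of the relations\<close>

section \<open>Simple transpositions\<close>

definition sw :: "nat \<Rightarrow> nat \<Rightarrow> nat" where
  "sw i j = (if j = i then Suc i else if j = Suc i then i else j)"

lemma sw_sw [simp]: "sw i (sw i j) = j"
  by (simp add: sw_def)

lemma sw_in: "1 \<le> i ==> i \<noteq> n ==> j \<in> {1..n} ==> sw i j \<in> {1..n}"
  by (auto simp: sw_def)

lemma sw_image: "1 \<le> i ==> i \<noteq> n ==> sw i ` {1..n} = {1..n}"
  using sw_in by (force intro: image_eqI[of _ _ "sw i _"])

lemma inj_sw: "inj (sw i)"
  by (metis injI sw_sw)

text \<open>For positive \<open>i\<close> only the value \<open>i = n\<close> would lead out of the
  range 1, ..., n. For \<open>i > n\<close> the diagram is the identity, so composition with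
  identities becomes a special case of composition with crossings.\<close>

definition swap_diagram :: "nat \<Rightarrow> nat \<Rightarrow> diagram" where
  "swap_diagram n i = ((\<lambda>j. {Top (sw i j), Bot j}) ` {1..n}, [])"

definition swap_top :: "nat \<Rightarrow> vertex \<Rightarrow> vertex" where
  "swap_top i v = (case v of Top j \<Rightarrow> Top (sw i j) | _ \<Rightarrow> v)"

definition swap_bot :: "nat \<Rightarrow> vertex \<Rightarrow> vertex" where
  "swap_bot i v = (case v of Bot j \<Rightarrow> Bot (sw i j) | _ \<Rightarrow> v)"

lemma swap_simps [simp]:
  "swap_top i (Top j) = Top (sw i j)" "swap_top i (Bot j) = Bot j" "swap_top i (Mid j) = Mid j"
  "swap_bot i (Top j) = Top j" "swap_bot i (Bot j) = Bot (sw i j)" "swap_bot i (Mid j) = Mid j"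
  by (simp_all add: swap_top_def swap_bot_def)

lemma swap_diagram_alt:
  assumes "1 \<le> i" "i \<noteq> n"
  shows "swap_diagram n i = ((\<lambda>j. {Top j, Bot (sw i j)}) ` {1..n}, [])"
proof -
  have "(\<lambda>j. {Top j, Bot (sw i j)}) ` {1..n} = (\<lambda>j. {Top j, Bot (sw i j)}) ` (sw i ` {1..n})"
    by (simp only: sw_image[OF assms])
  then show ?thesis unfolding swap_diagram_def image_image by simp
qed

lemma marked_map_diagram:
  assumes D: "D \<in> marked_diagrams r s" and inj: "inj_on f (ends r s)" and im: "f ` ends r s = ends t u"
    and T: "\<And>v. v \<in> ends r s ==> f v \<in> range Top \<longleftrightarrow> v \<in> range Top"
  shows "map_diagram f D \<in> marked_diagrams t u"
proof -
  obtain E L where D': "D = (E, L)" by (cases D)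
  have m: "matching E" "\<Union>E = ends r s" "marks_ok top_flow E L" using D unfolding D' marked_diagrams_iff brauer_iff by auto
  have "marks_ok top_flow (map_edges f E) (map (map_mark f) L)"
  proof (rule marks_ok_map[OF m(3)])
    show "inj_on f (\<Union>E)" using inj m(2) by simp
    fix e v assume "e \<in> E" "v \<in> e"
    then have "v \<in> ends r s" using m(2) by blast
    then show "(f v \<in> range Top) = (v \<in> range Top)" by (rule T)
  qed
  moreover have "matching (map_edges f E)" by (rule matching_map) (use m inj in simp_all)
  moreover have "\<Union>(map_edges f E) = ends t u" unfolding Union_map_edges m(2) im ..
  ultimately show ?thesis unfolding D' map_diagram_def marked_diagrams_iff brauer_iff by simp
qed

lemma swap_top_marked:
  assumes "D \<in> marked_diagrams r s" "1 \<le> i" "i \<noteq> r"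
  shows "map_diagram (swap_top i) D \<in> marked_diagrams r s"
proof (rule marked_map_diagram[OF assms(1)])
  show "inj_on (swap_top i) (ends r s)" using inj_sw by (auto simp: inj_on_def)
  have "(\<lambda>j. Top (sw i j)) ` {1..r} = Top ` {1..r}" using sw_image[OF assms(2,3)] by (metis image_image)
  then show "swap_top i ` ends r s = ends r s" unfolding ends_image by simp
qed auto

lemma swap_bot_marked:
  assumes "D \<in> marked_diagrams r s" "1 \<le> i" "i \<noteq> s"
  shows "map_diagram (swap_bot i) D \<in> marked_diagrams r s"
proof (rule marked_map_diagram[OF assms(1)])
  show "inj_on (swap_bot i) (ends r s)" using inj_sw by (auto simp: inj_on_def)
  have "(\<lambda>j. Bot (sw i j)) ` {1..s} = Bot ` {1..s}" using sw_image[OF assms(2,3)] by (metis image_image)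
  then show "swap_bot i ` ends r s = ends r s" unfolding ends_image by simp
qed auto

lemma swap_diagram_identity: "swap_diagram n i = map_diagram (swap_top i) (identity_diagram n)"
  by (simp add: swap_diagram_def identity_diagram_def map_diagram_def map_edges_def image_image)

lemma swap_diagram_marked: "1 \<le> i ==> i \<noteq> n ==> swap_diagram n i \<in> marked_diagrams n n"
  unfolding swap_diagram_identity by (intro swap_top_marked identity_marked)

lemma composite_swap_left:
  assumes D: "D \<in> marked_diagrams r s" and i: "1 \<le> i" "i \<noteq> r" and e: "\<epsilon> * \<epsilon> = (1::'k::field)"
  shows "composite \<delta> \<epsilon> r s (swap_diagram r i) D 1 (map_diagram (swap_top i) D)"
proof -
  obtain E L where D': "D = (E, L)" by (cases D)
  have S: "stack (swap_diagram r i) (E, L) = ((\<lambda>j. {Top (sw i j), Mid j}) ` {1..r} \<union> map_edges top_to_mid E, map (map_mark top_to_mid) L)"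
    by (simp add: swap_diagram_def map_edges_def image_image)
  show ?thesis unfolding D'
    by (rule composite_strands[OF swap_diagram_marked[OF i] _ S _ _ _ _ _ _ e])
      (use D[unfolded D'] swap_top_marked[OF D i] sw_in[OF i] inj_sw D' in \<open>auto simp: inj_on_def\<close>)
qed

lemma composite_swap_right:
  assumes D: "D \<in> marked_diagrams r s" and i: "1 \<le> i" "i \<noteq> s" and e: "\<epsilon> * \<epsilon> = (1::'k::field)"
  shows "composite \<delta> \<epsilon> r s D (swap_diagram s i) 1 (map_diagram (swap_bot i) D)"
proof -
  obtain E L where D': "D = (E, L)" by (cases D)
  have "map_edges top_to_mid ((\<lambda>j. {Top j, Bot (sw i j)}) ` {1..s}) = (\<lambda>j. {Bot (sw i j), Mid j}) ` {1..s}"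
    by (simp add: map_edges_def image_image insert_commute)
  then have S: "stack (E, L) (swap_diagram s i) = ((\<lambda>j. {Bot (sw i j), Mid j}) ` {1..s} \<union> map_edges bot_to_mid E, map (map_mark bot_to_mid) L)"
    unfolding swap_diagram_alt[OF i] by (simp add: Un_commute)
  show ?thesis unfolding D'
    by (rule composite_strands[OF _ swap_diagram_marked[OF i] S _ _ _ _ _ _ e])
      (use D[unfolded D'] swap_bot_marked[OF D i] sw_in[OF i] inj_sw D' in \<open>auto simp: inj_on_def\<close>)
qed

lemma swap_beyond: "swap_diagram n (Suc n) = identity_diagram n"
  unfolding swap_diagram_def identity_diagram_def by (auto simp: sw_def)

lemma composite_identity_left:
  assumes "D \<in> marked_diagrams r s" "\<epsilon> * \<epsilon> = (1::'k::field)"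
  shows "composite \<delta> \<epsilon> r s (identity_diagram r) D 1 D"
proof -
  have "map_diagram (swap_top (Suc r)) D = D" by (rule marked_diagrams_idle[OF assms(1)]) (auto simp: sw_def)
  then show ?thesis using composite_swap_left[OF assms(1) _ _ assms(2), of "Suc r"] unfolding swap_beyond by simp
qed

lemma composite_identity_right:
  assumes "D \<in> marked_diagrams r s" "\<epsilon> * \<epsilon> = (1::'k::field)"
  shows "composite \<delta> \<epsilon> r s D (identity_diagram s) 1 D"
proof -
  have "map_diagram (swap_bot (Suc s)) D = D" by (rule marked_diagrams_idle[OF assms(1)]) (auto simp: sw_def)
  then show ?thesis using composite_swap_right[OF assms(1) _ _ assms(2), of "Suc s"] unfolding swap_beyond by simp
qed

lemma shift_strands:
  "map_edges (shift a a) ((\<lambda>j. {Top (f j), Bot j}) ` {1..b}) = (\<lambda>j. {Top (a + f (j - a)), Bot j}) ` {a + 1..a + b}"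
proof -
  have *: "{a + 1..a + b} = (+) a ` {1..b}" by (simp add: image_add_atLeastAtMost)
  show ?thesis unfolding * map_edges_def image_image by simp
qed

lemma juxtapose_identity: "juxtapose a a (identity_diagram a) (identity_diagram b) = identity_diagram (a + b)"
proof -
  have "{1..a + b} = {1..a} \<union> {a + 1..a + b}" by auto
  moreover have "(\<lambda>j. {Top (a + (j - a)), Bot j}) ` {a + 1..a + b} = (\<lambda>j. {Top j, Bot j}) ` {a + 1..a + b}"
    by (rule image_cong) auto
  ultimately show ?thesis unfolding identity_diagram_def juxtapose.simps shift_strands[of a "\<lambda>j. j" b] by (simp add: image_Un)
qed

lemma juxtapose_identity_swap:
  "1 \<le> i ==> juxtapose a a (identity_diagram a) (swap_diagram n i) = swap_diagram (a + n) (a + i)"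
proof -
  assume i: "1 \<le> i"
  have "{1..a + n} = {1..a} \<union> {a + 1..a + n}" by auto
  moreover have "(\<lambda>j. {Top (a + sw i (j - a)), Bot j}) ` {a + 1..a + n} = (\<lambda>j. {Top (sw (a + i) j), Bot j}) ` {a + 1..a + n}"
    by (rule image_cong) (auto simp: sw_def)
  moreover have "(\<lambda>j. {Top j, Bot j}) ` {1..a} = (\<lambda>j. {Top (sw (a + i) j), Bot j}) ` {1..a}"
    by (rule image_cong) (use i in \<open>auto simp: sw_def\<close>)
  ultimately show ?thesis unfolding identity_diagram_def swap_diagram_def juxtapose.simps shift_strands[of a "sw i" n] by (simp add: image_Un)
qed

lemma juxtapose_swap_identity:
  "i < n ==> juxtapose n n (swap_diagram n i) (identity_diagram b) = swap_diagram (n + b) i"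
proof -
  assume i: "i < n"
  have "{1..n + b} = {1..n} \<union> {n + 1..n + b}" by auto
  moreover have "(\<lambda>j. {Top (n + (j - n)), Bot j}) ` {n + 1..n + b} = (\<lambda>j. {Top (sw i j), Bot j}) ` {n + 1..n + b}"
    by (rule image_cong) (use i in \<open>auto simp: sw_def\<close>)
  ultimately show ?thesis unfolding identity_diagram_def swap_diagram_def juxtapose.simps shift_strands[of n "\<lambda>j. j" b] by (simp add: image_Un)
qed

section \<open>Evaluation of words\<close>

definition cup_diagram :: diagram where
  "cup_diagram = ({{Top 1, Top 2}}, [Bead {Top 1, Top 2}])"

definition cap_diagram :: diagram where
  "cap_diagram = ({{Bot 1, Bot 2}}, [Arrow (Bot 1) (Bot 2)])"

lemma interval_two: "{1..2::nat} = {1, 2}" "{1..1::nat} = {1}" "{1..0::nat} = {}" "{1..3::nat} = {1, 2, 3}"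
  by auto

lemma cup_marked: "cup_diagram \<in> marked_diagrams 2 0" and cap_marked: "cap_diagram \<in> marked_diagrams 0 2"
  unfolding cup_diagram_def cap_diagram_def marked_diagrams_iff brauer_iff interval_two
  by (auto simp: matching_def marks_ok_def homogeneous_def)

lemma empty_identity: "({}, []) = identity_diagram 0"
  by (simp add: identity_diagram_def)

lemma strand_identity: "({{Top 1, Bot 1}}, []) = identity_diagram 1"
  by (simp add: identity_diagram_def)

lemma cross_swap: "({{Top 1, Bot 2}, {Top 2, Bot 1}}, []) = swap_diagram 2 1"
  unfolding swap_diagram_def interval_two by (auto simp: sw_def)

context parameters
begin

text \<open>Modulo the relations every word is a multiple of a single diagram, because the
  generators are diagrams and both operations take two diagrams to a multiple of one.\<close>

definition evaluates :: "word \<Rightarrow> 'k \<Rightarrow> diagram \<Rightarrow> bool" where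
  "evaluates w c D \<longleftrightarrow> D \<in> marked_diagrams (src w) (tgt w) \<and>
     eval_word \<delta> \<epsilon> w = coset \<epsilon> (src w) (tgt w) (scale c (basis D))"

lemma evaluates_base:
  "evaluates Unit 1 (identity_diagram 0)" "evaluates Strand 1 (identity_diagram 1)"
  "evaluates Cross 1 (swap_diagram 2 1)" "evaluates Cup 1 cup_diagram" "evaluates Cap 1 cap_diagram"
  unfolding evaluates_def eval_word.simps empty_identity strand_identity cross_swap cup_diagram_def[symmetric] cap_diagram_def[symmetric]
  using identity_marked[of 0] identity_marked[of 1] swap_diagram_marked[of 1 2] cup_marked cap_marked by simp_all

lemma bilinear_scaled:
  "bilinear_extension h (scale c (basis a)) (scale d (basis b)) = scale (c * d) (h a b)"
  unfolding bilinear_left by (simp add: linear_extension_scale linear_extension_basis)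

lemma scaled_in: "D \<in> marked_diagrams r s ==> scale c (basis D) \<in> combinations (marked_diagrams r s)"
  by (intro combinations_scale combinations_basis)

lemma evaluates_comp:
  assumes f: "evaluates f c1 D1" and g: "evaluates g c2 D2" and fg: "tgt f = src g"
    and c: "composite \<delta> \<epsilon> (src f) (tgt g) D1 D2 c D"
  shows "evaluates (f \<odot> g) (c1 * c2 * c) D"
proof -
  have M: "D1 \<in> marked_diagrams (src f) (tgt f)" "D2 \<in> marked_diagrams (tgt f) (tgt g)"
    using f g unfolding evaluates_def fg by simp_all
  have "eval_word \<delta> \<epsilon> (f \<odot> g) = coset \<epsilon> (src f) (tgt g) (scale (c1 * c2) (choice (src f) (tgt g) D1 D2))"
    using f g compose_coset[OF scaled_in[OF M(1), of c1] scaled_in[OF M(2), of c2]]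
    unfolding evaluates_def bilinear_scaled by (simp add: fg)
  also have "\<dots> = coset \<epsilon> (src f) (tgt g) (scale (c1 * c2) (scale c (basis D)))"
    unfolding coset_eq_iff by (rule cong_scale[OF choice_composite[OF M c]])
  finally show ?thesis using c unfolding evaluates_def composite_def by simp
qed

lemma evaluates_tens:
  assumes f: "evaluates f c1 D1" and g: "evaluates g c2 D2"
  shows "evaluates (f \<otimes> g) (c1 * c2) (juxtapose (src f) (tgt f) D1 D2)"
proof -
  have M: "D1 \<in> marked_diagrams (src f) (tgt f)" "D2 \<in> marked_diagrams (src g) (tgt g)"
    using f g unfolding evaluates_def by simp_all
  then show ?thesis
    using f g tensor_coset[OF scaled_in[OF M(1), of c1] scaled_in[OF M(2), of c2]] juxtapose_marked[OF M]
    unfolding evaluates_def bilinear_scaled by simp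
qed

lemma evaluates_exists: "well_typed w ==> \<exists>c D. evaluates w c D"
proof (induction w)
  case (Comp f g)
  then obtain c1 D1 c2 D2 where 1: "evaluates f c1 D1" "evaluates g c2 D2" "tgt f = src g" by auto
  then have "D1 \<in> marked_diagrams (src f) (tgt f)" "D2 \<in> marked_diagrams (tgt f) (tgt g)" unfolding evaluates_def by simp_all
  then obtain c D where "composite \<delta> \<epsilon> (src f) (tgt g) D1 D2 c D" using composite_exists by blast
  then show ?case using evaluates_comp[OF 1] by blast
next
  case (Tens f g)
  then show ?case using evaluates_tens by (meson well_typed.simps(7))
qed (use evaluates_base in blast)+

lemma evaluates_identity: "evaluates (identity a) 1 (identity_diagram a)"
proof (induction a)
  case 0 then show ?case using evaluates_base by simp
next
  case (Suc a)
  from evaluates_tens[OF evaluates_base(2) this] show ?case using juxtapose_identity[of 1 a] by simp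
qed

text \<open>Fixing a representative for each word turns evaluation into a linear map
  \<open>ev\<close> on expressions, which is easier to handle than sums of cosets.\<close>

definition rep :: "word \<Rightarrow> (diagram \<Rightarrow>\<^sub>0 'k)" where
  "rep w = (SOME x. \<exists>c D. x = scale c (basis D) \<and> evaluates w c D)"

lemma rep:
  assumes "well_typed w"
  obtains c D where "rep w = scale c (basis D)" "evaluates w c D"
proof -
  obtain c D where "evaluates w c D" using evaluates_exists[OF assms] by blast
  then have "\<exists>x c D. x = scale c (basis D) \<and> evaluates w c D" by blast
  then have "\<exists>c D. rep w = scale c (basis D) \<and> evaluates w c D" unfolding rep_def by (rule someI_ex)
  then show thesis using that by blast
qed

lemma
  assumes "w \<in> words r s"
  shows rep_in: "rep w \<in> combinations (marked_diagrams r s)"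
    and rep_coset: "eval_word \<delta> \<epsilon> w = coset \<epsilon> r s (rep w)"
proof -
  have w: "well_typed w" "src w = r" "tgt w = s" using assms unfolding words_def by simp_all
  obtain c D where 1: "rep w = scale c (basis D)" "evaluates w c D" using rep[OF w(1)] .
  have 2: "D \<in> marked_diagrams r s" "eval_word \<delta> \<epsilon> w = coset \<epsilon> r s (scale c (basis D))"
    using 1(2) unfolding evaluates_def w by simp_all
  show "rep w \<in> combinations (marked_diagrams r s)" unfolding 1(1) by (rule scaled_in[OF 2(1)])
  show "eval_word \<delta> \<epsilon> w = coset \<epsilon> r s (rep w)" unfolding 1(1) by (rule 2(2))
qed

lemma rep_evaluates: "w \<in> words r s ==> evaluates w c D ==> cong \<epsilon> r s (rep w) (scale c (basis D))"
  unfolding coset_eq_iff[symmetric] using rep_coset[of w r s] by (simp add: evaluates_def words_def)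

abbreviation ev :: "(word \<Rightarrow>\<^sub>0 'k) \<Rightarrow> (diagram \<Rightarrow>\<^sub>0 'k)" where
  "ev \<equiv> linear_extension rep"

lemma ev_in: "x \<in> exprs r s ==> ev x \<in> combinations (marked_diagrams r s)"
  unfolding linear_extension_def exprs_def
  by (intro combinations_sum_in combinations_scale rep_in) (auto simp: combinations_def)

lemma coset_add: "coset \<epsilon> r s f + coset \<epsilon> r s g = coset \<epsilon> r s (f + g)"
proof (intro set_eqI iffI)
  fix x assume "x \<in> coset \<epsilon> r s f + coset \<epsilon> r s g"
  then obtain a b where "x = a + b" "a \<in> coset \<epsilon> r s f" "b \<in> coset \<epsilon> r s g" by (auto elim: set_plus_elim)
  then show "x \<in> coset \<epsilon> r s (f + g)" unfolding coset_mem using cong_add by blast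
next
  fix x assume "x \<in> coset \<epsilon> r s (f + g)"
  then have "x - g \<in> coset \<epsilon> r s f" "g \<in> coset \<epsilon> r s g" unfolding coset_mem cong_def null_space_def
    by (simp_all add: comb.span_zero diff_diff_eq add.commute)
  then have "(x - g) + g \<in> coset \<epsilon> r s f + coset \<epsilon> r s g" by (rule set_plus_intro)
  then show "x \<in> coset \<epsilon> r s f + coset \<epsilon> r s g" by simp
qed

lemma coset_zero: "coset \<epsilon> r s 0 = null_space \<epsilon> r s"
  by (auto simp: coset_mem cong_def)

lemma coset_scale: "c \<noteq> 0 ==> scale c ` coset \<epsilon> r s f = coset \<epsilon> r s (scale c f)"
proof (intro set_eqI iffI)
  fix x assume "x \<in> scale c ` coset \<epsilon> r s f"
  then show "x \<in> coset \<epsilon> r s (scale c f)" unfolding coset_mem using cong_scale by (auto simp: coset_mem)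
next
  fix x assume c: "c \<noteq> 0" and "x \<in> coset \<epsilon> r s (scale c f)"
  then have "cong \<epsilon> r s (scale (inverse c) x) (scale (inverse c) (scale c f))" unfolding coset_mem by (intro cong_scale)
  then have "scale (inverse c) x \<in> coset \<epsilon> r s f" unfolding coset_mem using c by simp
  moreover have "x = scale c (scale (inverse c) x)" using c by simp
  ultimately show "x \<in> scale c ` coset \<epsilon> r s f" by (rule image_eqI[rotated])
qed

text \<open>For c = 0 the image of a coset is only {0}, and adding the null space makes it a coset
  again.\<close>

lemma coset_scale_null: "scale c ` coset \<epsilon> r s f + null_space \<epsilon> r s = coset \<epsilon> r s (scale c f)"
proof (cases "c = 0")
  case True
  have "f \<in> coset \<epsilon> r s f" unfolding coset_mem by simp
  then have "scale c ` coset \<epsilon> r s f = {0}" using True by auto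
  then show ?thesis using True by (auto simp: coset_zero set_plus_def)
next
  case False
  then show ?thesis by (simp add: coset_scale coset_zero[symmetric] coset_add)
qed

lemma eval_expr_coset:
  assumes "x \<in> exprs r s"
  shows "eval_expr \<delta> \<epsilon> r s x = coset \<epsilon> r s (ev x)"
proof -
  have K: "w \<in> words r s" if "w \<in> Poly_Mapping.keys x" for w using assms that unfolding exprs_def combinations_def by blast
  have "scale (Poly_Mapping.lookup x w) ` eval_word \<delta> \<epsilon> w = coset \<epsilon> r s (scale (Poly_Mapping.lookup x w) (rep w))"
    if "w \<in> Poly_Mapping.keys x" for w
    using that coset_scale rep_coset[OF K[OF that]] by (simp add: in_keys_iff)
  then have 1: "(\<Sum>w\<in>Poly_Mapping.keys x. scale (Poly_Mapping.lookup x w) ` eval_word \<delta> \<epsilon> w) =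
    (\<Sum>w\<in>Poly_Mapping.keys x. coset \<epsilon> r s (scale (Poly_Mapping.lookup x w) (rep w)))" by (rule sum.cong[OF HOL.refl])
  have 2: "(\<Sum>w\<in>A. coset \<epsilon> r s (F w)) + null_space \<epsilon> r s = coset \<epsilon> r s (sum F A)" if "finite A" for A :: "word set" and F
    using that
  proof (induction A rule: finite_induct)
    case empty
    show ?case by (simp add: coset_zero)
  next
    case (insert a A)
    then show ?case by (simp add: Groups.add.assoc coset_add)
  qed
  show ?thesis unfolding eval_expr_def 1 linear_extension_def by (rule 2) simp
qed

section \<open>Soundness\<close>

lemma linear_extension_compose:
  "linear_extension h (linear_extension k x) = linear_extension (\<lambda>a. linear_extension h (k a)) x"
  unfolding linear_extension_def[of k] by (simp add: linear_extension_sum linear_extension_scale) (simp add: linear_extension_def)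

lemma linear_extension_bilinear:
  "linear_extension h (bilinear_extension k x y) = bilinear_extension (\<lambda>a b. linear_extension h (k a b)) x y"
  unfolding bilinear_left linear_extension_compose ..

lemma bilinear_linear:
  "bilinear_extension h (linear_extension k x) (linear_extension l y) = bilinear_extension (\<lambda>a b. bilinear_extension h (k a) (l b)) x y"
proof -
  have "bilinear_extension h (linear_extension k x) (linear_extension l y) =
      linear_extension (\<lambda>a. bilinear_extension h (k a) (linear_extension l y)) x"
    unfolding bilinear_left linear_extension_compose ..
  also have "\<dots> = linear_extension (\<lambda>a. linear_extension (\<lambda>b. bilinear_extension h (k a) (l b)) y) x"
    unfolding bilinear_right[of h] linear_extension_compose ..
  finally show ?thesis unfolding bilinear_left[of "\<lambda>a b. bilinear_extension h (k a) (l b)"] .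
qed

lemma bilinear_cong:
  assumes "x \<in> combinations A" "y \<in> combinations B" "\<And>a b. a \<in> A ==> b \<in> B ==> cong \<epsilon> r s (h a b) (k a b)"
  shows "cong \<epsilon> r s (bilinear_extension h x y) (bilinear_extension k x y)"
  unfolding bilinear_left by (intro linear_extension_cong[OF assms(1)] linear_extension_cong[OF assms(2)] assms(3))

lemma ev_comp:
  assumes x: "x \<in> exprs r s" and y: "y \<in> exprs s t"
  shows "cong \<epsilon> r t (ev (bilinear_extension (\<lambda>f g. basis (f \<odot> g)) x y)) (bilinear_extension (choice r t) (ev x) (ev y))"
  unfolding linear_extension_bilinear bilinear_linear linear_extension_basis
proof (rule bilinear_cong[OF x[unfolded exprs_def] y[unfolded exprs_def]])
  fix f g assume f: "f \<in> words r s" and g: "g \<in> words s t"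
  then have "f \<odot> g \<in> words r t" "src f = r" "tgt f = s" "tgt g = t" unfolding words_def by auto
  then show "cong \<epsilon> r t (rep (f \<odot> g)) (bilinear_extension (choice r t) (rep f) (rep g))"
    unfolding coset_eq_iff[symmetric] compose_coset[OF rep_in[OF f] rep_in[OF g], symmetric]
    using rep_coset[OF f] rep_coset[OF g] rep_coset[of "f \<odot> g" r t] by simp
qed

lemma ev_tens:
  assumes x: "x \<in> exprs r s" and y: "y \<in> exprs t u"
  shows "cong \<epsilon> (r + t) (s + u) (ev (bilinear_extension (\<lambda>f g. basis (f \<otimes> g)) x y))
    (bilinear_extension (\<lambda>D1 D2. basis (juxtapose r s D1 D2)) (ev x) (ev y))"
  unfolding linear_extension_bilinear bilinear_linear linear_extension_basis
proof (rule bilinear_cong[OF x[unfolded exprs_def] y[unfolded exprs_def]])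
  fix f g assume f: "f \<in> words r s" and g: "g \<in> words t u"
  then have "f \<otimes> g \<in> words (r + t) (s + u)" "src f = r" "tgt f = s" "src g = t" "tgt g = u" unfolding words_def by auto
  then show "cong \<epsilon> (r + t) (s + u) (rep (f \<otimes> g)) (bilinear_extension (\<lambda>D1 D2. basis (juxtapose r s D1 D2)) (rep f) (rep g))"
    unfolding coset_eq_iff[symmetric] tensor_coset[OF rep_in[OF f] rep_in[OF g], symmetric]
    using rep_coset[OF f] rep_coset[OF g] rep_coset[of "f \<otimes> g" "r + t" "s + u"] by simp
qed

lemma exprs_bilinear:
  assumes x: "x \<in> combinations A" and y: "y \<in> combinations B" and h: "\<And>a b. a \<in> A ==> b \<in> B ==> h a b \<in> C"
  shows "bilinear_extension (\<lambda>a b. basis (h a b)) x y \<in> combinations C"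
  unfolding bilinear_extension_def
  by (intro combinations_sum_in combinations_scale combinations_basis h) (use x y in \<open>auto simp: combinations_def\<close>)

definition same :: "word \<Rightarrow> 'k \<Rightarrow> word \<Rightarrow> bool" where
  "same f c g \<longleftrightarrow> well_typed f \<and> well_typed g \<and> src f = src g \<and> tgt f = tgt g \<and>
     cong \<epsilon> (src f) (tgt f) (rep f) (scale c (rep g))"

lemma evaluates_typed: "evaluates f c D ==> well_typed f ==> cong \<epsilon> (src f) (tgt f) (rep f) (scale c (basis D))"
  by (rule rep_evaluates) (simp_all add: words_def)

lemma sameI:
  assumes "well_typed f" "well_typed g" "src f = src g" "tgt f = tgt g" "evaluates f c1 D1" "evaluates g c2 D2"
    "cong \<epsilon> (src f) (tgt f) (scale c1 (basis D1)) (scale (c * c2) (basis D2))"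
  shows "same f c g"
proof -
  have "cong \<epsilon> (src f) (tgt f) (scale c (scale c2 (basis D2))) (scale c (rep g))"
    using cong_scale[OF cong_sym[OF evaluates_typed[OF assms(6,2)]]] assms(3,4) by simp
  then have "cong \<epsilon> (src f) (tgt f) (scale (c * c2) (basis D2)) (scale c (rep g))" by simp
  then have "cong \<epsilon> (src f) (tgt f) (rep f) (scale c (rep g))"
    using evaluates_typed[OF assms(5,1)] assms(7) cong_trans by blast
  then show ?thesis using assms unfolding same_def by simp
qed

lemma sameI':
  assumes "well_typed f" "well_typed g" "src f = src g" "tgt f = tgt g" "evaluates f c1 D" "evaluates g c2 D" "c1 = c * c2"
  shows "same f c g"
  by (rule sameI[OF assms(1-6)]) (simp add: assms(7))

lemma same_assoc:
  assumes "well_typed f" "well_typed g" "well_typed h" "tgt f = src g" "tgt g = src h"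
  shows "same ((f \<odot> g) \<odot> h) 1 (f \<odot> (g \<odot> h))"
proof -
  obtain c1 D1 where e1: "evaluates f c1 D1" using evaluates_exists[OF assms(1)] by blast
  obtain c2 D2 where e2: "evaluates g c2 D2" using evaluates_exists[OF assms(2)] by blast
  obtain c3 D3 where e3: "evaluates h c3 D3" using evaluates_exists[OF assms(3)] by blast
  note e = e1 e2 e3
  have M: "D1 \<in> marked_diagrams (src f) (src g)" "D2 \<in> marked_diagrams (src g) (src h)" "D3 \<in> marked_diagrams (src h) (tgt h)"
    using e assms(4,5) unfolding evaluates_def by simp_all
  obtain c12 D12 where p12: "composite \<delta> \<epsilon> (src f) (src h) D1 D2 c12 D12" using composite_exists[OF M(1,2)] by blast
  have M12: "D12 \<in> marked_diagrams (src f) (src h)" using p12 unfolding composite_def by blast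
  obtain c D where p123: "composite \<delta> \<epsilon> (src f) (tgt h) D12 D3 c D" using composite_exists[OF M12 M(3)] by blast
  obtain c23 D23 where p23: "composite \<delta> \<epsilon> (src g) (tgt h) D2 D3 c23 D23" using composite_exists[OF M(2,3)] by blast
  have M23: "D23 \<in> marked_diagrams (src g) (tgt h)" using p23 unfolding composite_def by blast
  obtain c' D' where q123: "composite \<delta> \<epsilon> (src f) (tgt h) D1 D23 c' D'" using composite_exists[OF M(1) M23] by blast
  have a: "evaluates ((f \<odot> g) \<odot> h) (c1 * c2 * c12 * c3 * c) D"
    using evaluates_comp[OF evaluates_comp[OF e(1,2) assms(4)] e(3)] p12 p123 assms(5) by simp
  have b: "evaluates (f \<odot> (g \<odot> h)) (c1 * (c2 * c3 * c23) * c') D'"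
    using evaluates_comp[OF e(1) evaluates_comp[OF e(2,3) assms(5)]] p23 q123 assms(4) by simp
  have "cong \<epsilon> (src f) (tgt h) (scale (c1 * c2 * c3) (scale (c12 * c) (basis D))) (scale (c1 * c2 * c3) (scale (c23 * c') (basis D')))"
    by (rule cong_scale[OF composite_assoc[OF M p12 p123 p23 q123]])
  then have c: "cong \<epsilon> (src f) (tgt h) (scale (c1 * c2 * c12 * c3 * c) (basis D)) (scale (c1 * (c2 * c3 * c23) * c') (basis D'))"
    by (simp add: mult.assoc mult.left_commute)
  show ?thesis by (rule sameI[OF _ _ _ _ a b]) (use assms c in simp_all)
qed

lemma same_identity_left: "well_typed f ==> same (identity (src f) \<odot> f) 1 f"
proof -
  assume f: "well_typed f"
  have i: "well_typed (identity a) \<and> src (identity a) = a \<and> tgt (identity a) = a" for a by (induction a) auto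
  obtain c D where e: "evaluates f c D" using evaluates_exists[OF f] by blast
  have "composite \<delta> \<epsilon> (src f) (tgt f) (identity_diagram (src f)) D 1 D"
    by (rule composite_identity_left[OF _ ee]) (use e in \<open>simp add: evaluates_def\<close>)
  then have "evaluates (identity (src f) \<odot> f) (1 * c * 1) D"
    using evaluates_comp[OF evaluates_identity[of "src f"] e, of 1 D] i by simp
  then show ?thesis by (intro sameI'[OF _ _ _ _ _ e]) (use f i in simp_all)
qed

lemma same_identity_right: "well_typed f ==> same (f \<odot> identity (tgt f)) 1 f"
proof -
  assume f: "well_typed f"
  have i: "well_typed (identity a) \<and> src (identity a) = a \<and> tgt (identity a) = a" for a by (induction a) auto
  obtain c D where e: "evaluates f c D" using evaluates_exists[OF f] by blast
  have "composite \<delta> \<epsilon> (src f) (tgt f) D (identity_diagram (tgt f)) 1 D"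
    by (rule composite_identity_right[OF _ ee]) (use e in \<open>simp add: evaluates_def\<close>)
  then have "evaluates (f \<odot> identity (tgt f)) (c * 1 * 1) D"
    using evaluates_comp[OF e evaluates_identity[of "tgt f"], of 1 D] i by simp
  then show ?thesis by (intro sameI'[OF _ _ _ _ _ e]) (use f i in simp_all)
qed

lemma juxtapose_assoc: "juxtapose (a + b) (c + d) (juxtapose a c D1 D2) D3 = juxtapose a c D1 (juxtapose b d D2 D3)"
proof -
  have "shift a c \<circ> shift b d = shift (a + b) (c + d)"
  proof
    fix v show "(shift a c \<circ> shift b d) v = shift (a + b) (c + d) v" by (cases v) simp_all
  qed
  then show ?thesis by (cases D1; cases D2; cases D3) (simp add: map_edges_Un map_edges_comp map_mark_o Un_assoc)
qed

lemma same_tens_assoc: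
  assumes "well_typed f" "well_typed g" "well_typed h"
  shows "same ((f \<otimes> g) \<otimes> h) 1 (f \<otimes> (g \<otimes> h))"
proof -
  obtain c1 D1 where e1: "evaluates f c1 D1" using evaluates_exists[OF assms(1)] by blast
  obtain c2 D2 where e2: "evaluates g c2 D2" using evaluates_exists[OF assms(2)] by blast
  obtain c3 D3 where e3: "evaluates h c3 D3" using evaluates_exists[OF assms(3)] by blast
  note e = e1 e2 e3
  show ?thesis
    by (rule sameI'[OF _ _ _ _ evaluates_tens[OF evaluates_tens[OF e(1,2)] e(3), simplified juxtapose_assoc src.simps tgt.simps]
      evaluates_tens[OF e(1) evaluates_tens[OF e(2,3)]]]) (use assms in simp_all)
qed

lemma juxtapose_unit: "juxtapose 0 0 (identity_diagram 0) D = D" "juxtapose a b D (identity_diagram 0) = D"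
proof -
  have "shift 0 0 = id"
  proof
    fix v show "shift 0 0 v = id v" by (cases v) simp_all
  qed
  then show "juxtapose 0 0 (identity_diagram 0) D = D"
    by (cases D) (simp add: identity_diagram_def map_edges_def map_mark_id map_idI)
  show "juxtapose a b D (identity_diagram 0) = D"
    by (cases D) (simp add: identity_diagram_def map_edges_def)
qed

lemma same_unit:
  assumes "well_typed f"
  shows "same (Unit \<otimes> f) 1 f" "same (f \<otimes> Unit) 1 f"
proof -
  obtain c D where e: "evaluates f c D" using evaluates_exists assms by blast
  show "same (Unit \<otimes> f) 1 f" by (rule sameI'[OF _ _ _ _ evaluates_tens[OF evaluates_base(1) e] _]) (use e assms juxtapose_unit in simp_all)
  show "same (f \<otimes> Unit) 1 f" by (rule sameI'[OF _ _ _ _ evaluates_tens[OF e evaluates_base(1)] _]) (use e assms juxtapose_unit in simp_all)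
qed

text \<open>\<open>word_degree\<close> depends on the test \<epsilon> = -1. The assumption on the
  characteristic makes this test fail for \<epsilon> = 1; for \<epsilon> = -1 only the parities
  matter.\<close>

lemma sign_word_degree:
  assumes "even (m :: nat) \<longleftrightarrow> even (odd_generators g)" "even n \<longleftrightarrow> even (odd_generators h)" "CHAR('k) \<noteq> 2"
  shows "(- 1) ^ (word_degree \<epsilon> g * word_degree \<epsilon> h) = \<epsilon> ^ (m * n)"
proof -
  have ne: "(- 1 :: 'k) \<noteq> 1"
  proof
    assume "(- 1 :: 'k) = 1"
    then have "(2 :: 'k) = 0" by (metis add.inverse_inverse add_neg_numeral_special(8) one_add_one)
    then have "CHAR('k) dvd 2" using of_nat_eq_0_iff_char_dvd[of 2, where ?'a='k] by simp
    then have "CHAR('k) \<le> 2" "CHAR('k) \<noteq> 0" using dvd_imp_le[of "CHAR('k)" 2] by (simp, metis dvd_0_left_iff zero_neq_numeral)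
    moreover have "CHAR('k) \<noteq> Suc 0" by simp
    ultimately show False using assms(3) by arith
  qed
  show ?thesis
  proof (cases "\<epsilon> = 1")
    case True
    then show ?thesis using ne unfolding word_degree_def degree_of_def by simp
  next
    case False
    then have e: "\<epsilon> = - 1" using eps by blast
    have "((- 1 :: 'k) ^ (odd_generators g mod 2 * (odd_generators h mod 2))) = (- 1) ^ (m * n)"
      by (rule pow_cong_parity) (use assms in \<open>simp_all add: even_mult_iff\<close>)
    then show ?thesis unfolding word_degree_def degree_of_def e by simp
  qed
qed

lemma evaluates_parity:
  assumes "evaluates w c D" "well_typed w"
  shows "even (length (snd D)) \<longleftrightarrow> even (odd_generators w)"
proof -
  obtain E L where D: "D = (E, L)" by (cases D)
  have "(E, L) \<in> marked_diagrams (src w) (tgt w)" using assms(1) unfolding D evaluates_def by blast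
  from marked_length(1)[OF this] word_degree_formula[OF assms(2)] show ?thesis unfolding D by simp
qed

lemma evaluates_interchange:
  assumes w: "well_typed f" "well_typed g" "well_typed h" "well_typed j"
    and fh: "tgt f = src h" and gj: "tgt g = src j"
    and e: "evaluates f c1 D1" "evaluates g c2 D2" "evaluates h c3 D3" "evaluates j c4 D4"
    and c: "composite \<delta> \<epsilon> (src f) (tgt h) D1 D3 c D" and c': "composite \<delta> \<epsilon> (src g) (tgt j) D2 D4 c' D'"
  shows "evaluates ((f \<otimes> g) \<odot> (h \<otimes> j)) (c1 * c2 * (c3 * c4) * (\<epsilon> ^ (length (snd D2) * length (snd D3)) * (c * c')))
    (juxtapose (src f) (tgt h) D D')"
proof -
  have M: "D1 \<in> marked_diagrams (src f) (tgt f)" "D2 \<in> marked_diagrams (src g) (tgt g)"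
    "D3 \<in> marked_diagrams (tgt f) (tgt h)" "D4 \<in> marked_diagrams (tgt g) (tgt j)"
    using e unfolding evaluates_def fh gj by simp_all
  show ?thesis
    using evaluates_comp[OF evaluates_tens[OF e(1,2)] evaluates_tens[OF e(3,4)]] composite_interchange[OF M c c'] fh gj by simp
qed

lemma same_interchange:
  assumes w: "well_typed f" "well_typed g" "well_typed h" "well_typed j" and fh: "tgt f = src h" and gj: "tgt g = src j"
    and ch: "CHAR('k) \<noteq> 2"
  shows "same ((f \<otimes> g) \<odot> (h \<otimes> j)) ((- 1) ^ (word_degree \<epsilon> g * word_degree \<epsilon> h)) ((f \<odot> h) \<otimes> (g \<odot> j))"
proof -
  obtain c1 D1 where e1: "evaluates f c1 D1" using evaluates_exists[OF w(1)] by blast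
  obtain c2 D2 where e2: "evaluates g c2 D2" using evaluates_exists[OF w(2)] by blast
  obtain c3 D3 where e3: "evaluates h c3 D3" using evaluates_exists[OF w(3)] by blast
  obtain c4 D4 where e4: "evaluates j c4 D4" using evaluates_exists[OF w(4)] by blast
  note e = e1 e2 e3 e4
  have M: "D1 \<in> marked_diagrams (src f) (src h)" "D3 \<in> marked_diagrams (src h) (tgt h)"
    "D2 \<in> marked_diagrams (src g) (src j)" "D4 \<in> marked_diagrams (src j) (tgt j)"
    using e unfolding evaluates_def fh gj by simp_all
  obtain c D where c: "composite \<delta> \<epsilon> (src f) (tgt h) D1 D3 c D" using composite_exists[OF M(1,2)] by blast
  obtain c' D' where c': "composite \<delta> \<epsilon> (src g) (tgt j) D2 D4 c' D'" using composite_exists[OF M(3,4)] by blast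
  have s: "(- 1) ^ (word_degree \<epsilon> g * word_degree \<epsilon> h) = \<epsilon> ^ (length (snd D2) * length (snd D3))"
    by (rule sign_word_degree[OF evaluates_parity[OF e(2) w(2)] evaluates_parity[OF e(3) w(3)] ch])
  show ?thesis unfolding s
  proof (rule sameI'[OF _ _ _ _ evaluates_interchange[OF w fh gj e c c']])
    show "evaluates ((f \<odot> h) \<otimes> (g \<odot> j)) ((c1 * c3 * c) * (c2 * c4 * c')) (juxtapose (src f) (tgt h) D D')"
      using evaluates_tens[OF evaluates_comp[OF e(1,3) fh c] evaluates_comp[OF e(2,4) gj c']] by simp
  qed (use w fh gj in \<open>simp_all add: mult_ac\<close>)
qed

end

section \<open>The defining relations\<close>

lemma sw_values: "sw 1 1 = 2" "sw 1 2 = 1" "sw 1 3 = 3" "sw 2 1 = 1" "sw 2 2 = 3" "sw 2 3 = 2"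
  "sw (Suc 0) (Suc 0) = 2" "sw (Suc 0) 2 = Suc 0" "sw (Suc 0) 3 = 3" "sw 2 (Suc 0) = Suc 0"
  by (simp_all add: sw_def)

definition cap_strand :: diagram where
  "cap_strand = ({{Bot 1, Bot 2}, {Top 1, Bot 3}}, [Arrow (Bot 1) (Bot 2)])"

definition strand_cap :: diagram where
  "strand_cap = ({{Top 1, Bot 1}, {Bot 2, Bot 3}}, [Arrow (Bot 2) (Bot 3)])"

definition cup_strand :: diagram where
  "cup_strand = ({{Top 1, Top 2}, {Top 3, Bot 1}}, [Bead {Top 1, Top 2}])"

definition strand_cup :: diagram where
  "strand_cup = ({{Top 1, Bot 1}, {Top 2, Top 3}}, [Bead {Top 2, Top 3}])"

lemma juxtapose_strand:
  "juxtapose 0 2 cap_diagram (identity_diagram 1) = cap_strand"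
  "juxtapose 1 1 (identity_diagram 1) cap_diagram = strand_cap"
  "juxtapose 2 0 cup_diagram (identity_diagram 1) = cup_strand"
  "juxtapose 1 1 (identity_diagram 1) cup_diagram = strand_cup"
  unfolding cap_diagram_def cup_diagram_def identity_diagram_def interval_two cap_strand_def strand_cap_def cup_strand_def strand_cup_def
  by (simp_all add: map_edges_def numeral_eq_Suc insert_commute)

text \<open>Cap and cup are glued to a single closed component, so the loop number is 1 and
  contributes the factor \<delta>.\<close>

lemma cap_cup_composite:
  "composite \<delta> \<epsilon> 0 0 cap_diagram cup_diagram (\<delta> :: 'k::field) (identity_diagram 0)"
proof -
  let ?E = "{{Mid 1, Mid 2}}"
  have st: "fst (stack cap_diagram cup_diagram) = ?E"
    by (simp add: cap_diagram_def cup_diagram_def map_edges_def)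
  have "component ?E (Mid 1) = component ?E (Mid 2)"
    by (rule component_eq, rule connected_edge[of "{Mid 1, Mid 2}"]) simp_all
  then have "closed_components ?E {} = {component ?E (Mid 1)}"
    unfolding closed_image by auto
  then have "card (closed_components ?E {}) = 1" by simp
  then have "reduces \<epsilon> (ends 0 0) (stack cap_diagram cup_diagram) 1 1 (identity_diagram 0)"
    unfolding reduces_def st identity_diagram_def by simp
  then show ?thesis unfolding composite_def using identity_marked[of 0] by (intro conjI exI[of _ 1]) simp_all
qed

text \<open>Serves both snake relations, with \<open>p\<close> and \<open>q\<close> equal to 1 and 3
  in either order. \<open>Mid p\<close> hangs on the bottom vertex and \<open>Mid q\<close> on the
  top vertex; the arrow on {Mid p, Mid 2} and the bead on {Mid q, Mid 2} meet at
  \<open>Mid 2\<close>. The arrow is the upper marking, so its direction decides between 1 and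
  \<epsilon>.\<close>

lemma zigzag:
  assumes e: "\<epsilon> * \<epsilon> = (1::'k::field)" and pq: "p \<noteq> q" "p \<noteq> 2" "q \<noteq> 2"
    and st: "fst (stack D1 D2) = {{Bot 1, Mid p}, {Top 1, Mid q}, {Mid p, Mid 2}, {Mid q, Mid 2}}"
      "snd (stack D1 D2) = [x, Bead {Mid q, Mid 2}]"
    and x: "x = Arrow (Mid p) (Mid 2) \<and> c = 1 \<or> x = Arrow (Mid 2) (Mid p) \<and> c = \<epsilon>"
  shows "composite \<delta> \<epsilon> 1 1 D1 D2 c (identity_diagram 1)"
proof -
  define a where "a i = (if i = p then Bot 1 else Top 1)" for i
  let ?E = "{{Mid p, Mid 2}, {Mid q, Mid 2}}" and ?L = "[x, Bead {Mid q, Mid 2}]"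
  let ?F = "{{Bot 1, Mid 2}, {Top 1, Mid 2}}" and ?y = "map_mark (ren {p, q} a) x"
  have "stack D1 D2 = ((\<lambda>i. {a i, Mid i}) ` {p, q} \<union> ?E, ?L)"
    by (rule prod_eqI) (use st pq in \<open>simp_all add: a_def insert_commute\<close>)
  moreover have "simplifies_to \<epsilon> ((\<lambda>i. {a i, Mid i}) ` {p, q} \<union> ?E, ?L) 1 (map_edges (ren {p, q} a) ?E, map (map_mark (ren {p, q} a)) ?L)"
    by (rule contract_strands) (use pq x in \<open>auto simp: a_def inj_on_def\<close>)
  moreover have "(map_edges (ren {p, q} a) ?E, map (map_mark (ren {p, q} a)) ?L) = (?F, [] @ [?y, Bead {Top 1, Mid 2}] @ [])"
    using pq by (simp add: map_edges_def a_def)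
  ultimately have 1: "simplifies_to \<epsilon> (stack D1 D2) 1 (?F, [] @ [?y, Bead {Top 1, Mid 2}] @ [])" by simp
  have y: "?y = Arrow (Bot 1) (Mid 2) \<and> c = 1 \<or> ?y = Arrow (Mid 2) (Bot 1) \<and> c = \<epsilon>"
    using x pq by (auto simp: a_def)
  have 2: "simplify_step \<epsilon> (?F, [] @ [?y, Bead {Top 1, Mid 2}] @ []) c (?F, [] @ [])"
    using y simplify_step.arrow_above_towards[of "Mid 2" \<epsilon> ?F "[]" "Bot 1" "Top 1" "[]"]
      simplify_step.arrow_above_away[of "Mid 2" \<epsilon> ?F "[]" "Bot 1" "Top 1" "[]"] by auto
  have "simplify_step \<epsilon> (?F, []) 1 (map_edges (id(Mid 2 := Top 1)) (?F - {{Top 1, Mid 2}}), map (map_mark (id(Mid 2 := Top 1))) [])"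
    by (rule simplify_step.contract) simp_all
  moreover have "map_edges (id(Mid 2 := Top 1)) (?F - {{Top 1, Mid 2}}) = fst (identity_diagram 1)"
    by (simp add: insert_Diff_if doubleton_eq_iff map_edges_def identity_diagram_def insert_commute)
  ultimately have 3: "simplify_step \<epsilon> (?F, [] @ []) 1 (identity_diagram 1)" by (simp add: identity_diagram_def)
  have s: "simplifies_to \<epsilon> (stack D1 D2) c (identity_diagram 1)"
    using simplifies_to_trans[OF 1 simplifies_to.step[OF 2 simplifies_to_step[OF 3]]] by simp
  have "reduces \<epsilon> (ends 1 1) (stack D1 D2) 0 c (identity_diagram 1)"
  proof (rule reducesI[OF s _ _ e])
    show "\<Union>(fst (identity_diagram 1)) = ends 1 1" by (auto simp: identity_diagram_def)
    let ?S = "fst (stack D1 D2)"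
    have c: "(Mid p, Bot 1) \<in> connected_by ?S" "(Mid q, Top 1) \<in> connected_by ?S" "(Mid 2, Mid p) \<in> connected_by ?S"
      unfolding st by (rule connected_edge[of "{Bot 1, Mid p}"], simp_all)
        (rule connected_edge[of "{Top 1, Mid q}"], simp_all, rule connected_edge[of "{Mid p, Mid 2}"], simp_all)
    fix v assume "v \<in> \<Union>?S"
    then consider "v \<in> ends 1 1" | "v = Mid p" | "v = Mid q" | "v = Mid 2" unfolding st by auto
    then show "\<exists>w\<in>ends 1 1. (v, w) \<in> connected_by ?S"
    proof cases
      case 1 then show ?thesis using connected_refl by blast
    qed (use c connected_trans[OF c(3,1)] in auto)
  qed
  then show ?thesis unfolding composite_def using identity_marked[of 1] by (intro conjI exI[of _ 0] exI[of _ c]) simp_all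
qed

lemma zigzag_one: "\<epsilon> * \<epsilon> = 1 ==> composite \<delta> \<epsilon> 1 1 cap_strand strand_cup (1::'k::field) (identity_diagram 1)"
  by (rule zigzag[of \<epsilon> 1 3]) (auto simp: cap_strand_def strand_cup_def map_edges_def)

lemma zigzag_two: "\<epsilon> * \<epsilon> = 1 ==> composite \<delta> \<epsilon> 1 1 strand_cap cup_strand (\<epsilon>::'k::field) (identity_diagram 1)"
  by (rule zigzag[of \<epsilon> 3 1]) (auto simp: strand_cap_def cup_strand_def map_edges_def)

context parameters
begin

lemma evaluates_identity_left:
  assumes "evaluates f 1 (identity_diagram (src g))" "evaluates g c D" "tgt f = src g" "src f = src g"
  shows "evaluates (f \<odot> g) c D"
  using evaluates_comp[OF assms(1,2,3), of 1 D] composite_identity_left[OF _ ee, of D "src f" "tgt g"] assms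
  by (simp add: evaluates_def)

lemma evaluates_identity_right:
  assumes "evaluates f c D" "evaluates g 1 (identity_diagram (tgt f))" "tgt f = src g" "tgt f = tgt g"
  shows "evaluates (f \<odot> g) c D"
  using evaluates_comp[OF assms(1,2,3), of 1 D] composite_identity_right[OF _ ee, of D "src f" "tgt g"] assms
  by (simp add: evaluates_def)

lemma evaluates_swap_left:
  assumes "evaluates f 1 (swap_diagram (src g) i)" "evaluates g c D" "tgt f = src g" "src f = src g" "1 \<le> i" "i \<noteq> src g"
  shows "evaluates (f \<odot> g) c (map_diagram (swap_top i) D)"
  using evaluates_comp[OF assms(1,2,3), of 1 "map_diagram (swap_top i) D"] composite_swap_left[OF _ assms(5,6) ee, of D "tgt g"] assms
  by (simp add: evaluates_def)

lemma evaluates_swap_right: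
  assumes "evaluates f c D" "evaluates g 1 (swap_diagram (tgt f) i)" "tgt f = src g" "tgt f = tgt g" "1 \<le> i" "i \<noteq> tgt f"
  shows "evaluates (f \<odot> g) c (map_diagram (swap_bot i) D)"
  using evaluates_comp[OF assms(1,2,3), of 1 "map_diagram (swap_bot i) D"] composite_swap_right[OF _ assms(5,6) ee, of D "src f"] assms
  by (simp add: evaluates_def)

lemma evaluates_strands:
  "evaluates (Strand \<otimes> Strand) 1 (identity_diagram 2)"
  "evaluates (Cross \<otimes> Strand) 1 (swap_diagram 3 1)" "evaluates (Strand \<otimes> Cross) 1 (swap_diagram 3 2)"
  "evaluates (Cap \<otimes> Strand) 1 cap_strand" "evaluates (Strand \<otimes> Cap) 1 strand_cap"
  "evaluates (Cup \<otimes> Strand) 1 cup_strand" "evaluates (Strand \<otimes> Cup) 1 strand_cup"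
proof -
  note b = evaluates_base and t = evaluates_tens
  have n: "(1::nat) + 1 = 2" "(1::nat) + 2 = 3" "(2::nat) + 1 = 3" by simp_all
  show "evaluates (Strand \<otimes> Strand) 1 (identity_diagram 2)"
    using t[OF b(2,2)] unfolding src.simps tgt.simps juxtapose_identity n by simp
  show "evaluates (Cross \<otimes> Strand) 1 (swap_diagram 3 1)"
    using t[OF b(3,2)] juxtapose_swap_identity[of 1 2 1] unfolding src.simps tgt.simps n by simp
  show "evaluates (Strand \<otimes> Cross) 1 (swap_diagram 3 2)"
    using t[OF b(2,3)] juxtapose_identity_swap[of 1 1 2] unfolding src.simps tgt.simps n by simp
  show "evaluates (Cap \<otimes> Strand) 1 cap_strand" "evaluates (Strand \<otimes> Cap) 1 strand_cap"
    "evaluates (Cup \<otimes> Strand) 1 cup_strand" "evaluates (Strand \<otimes> Cup) 1 strand_cup"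
    using t[OF b(5,2)] t[OF b(2,5)] t[OF b(4,2)] t[OF b(2,4)] unfolding src.simps tgt.simps juxtapose_strand by simp_all
qed

lemma relation_same:
  assumes "(f, c, g) \<in> relations \<delta> \<epsilon>"
  shows "same f c g"
proof -
  note b = evaluates_base and s = evaluates_strands
  have n: "(1::nat) + 1 = 2" "(1::nat) + 2 = 3" "(2::nat) + 1 = 3" "(2::nat) + 2 = 4" "(1::nat) + 1 + 2 = 4" "(2::nat) + 1 + 1 = 4" by simp_all
  have id: "composite \<delta> \<epsilon> 2 0 (identity_diagram 2) cup_diagram 1 cup_diagram"
    "composite \<delta> \<epsilon> 0 2 (identity_diagram 0) cap_diagram 1 cap_diagram"
    "composite \<delta> \<epsilon> 2 0 cup_diagram (identity_diagram 0) 1 cup_diagram"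
    "composite \<delta> \<epsilon> 0 2 cap_diagram (identity_diagram 2) 1 cap_diagram"
    using composite_identity_left[OF cup_marked ee] composite_identity_left[OF cap_marked ee]
      composite_identity_right[OF cup_marked ee] composite_identity_right[OF cap_marked ee] by blast+
  note m = identity_marked cup_marked cap_marked
  have len: "length (snd cup_diagram) = 1" "length (snd cap_diagram) = 1" "length (snd (identity_diagram k)) = 0" for k
    by (simp_all add: cup_diagram_def cap_diagram_def identity_diagram_def)
  have jj: "juxtapose 2 0 cup_diagram (identity_diagram 0) = cup_diagram" "juxtapose 0 2 cap_diagram (identity_diagram 0) = cap_diagram"
    "juxtapose 0 0 (identity_diagram 0) D = D" for D by (simp_all add: juxtapose_unit)
  have u: "evaluates Cup 1 (juxtapose 2 0 cup_diagram (identity_diagram 0))" "evaluates Cup 1 (juxtapose 0 0 (identity_diagram 0) cup_diagram)"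
    "evaluates Cap 1 (juxtapose 0 2 cap_diagram (identity_diagram 0))" "evaluates Cap 1 (juxtapose 0 0 (identity_diagram 0) cap_diagram)"
    unfolding jj by (rule b)+
  \<comment> \<open>In the relations between two distant generators, each side has the form
    \<open>(f \<otimes> g) \<odot> (h \<otimes> j)\<close> with an identity in each column, so its
    value is a juxtaposition with the sign of the interchange rule.\<close>
  have ic: "evaluates (p \<odot> q) (\<epsilon> ^ (length (snd D2) * length (snd D3))) (juxtapose r v D D')"
    if e: "evaluates p 1 (juxtapose r s D1 D2)" "evaluates q 1 (juxtapose s v D3 D4)" "tgt p = src q" "src p = r + t" "tgt q = v + w"
      and d: "D1 \<in> marked_diagrams r s" "D2 \<in> marked_diagrams t u" "D3 \<in> marked_diagrams s v" "D4 \<in> marked_diagrams u w"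
        "composite \<delta> \<epsilon> r v D1 D3 1 D" "composite \<delta> \<epsilon> t w D2 D4 1 D'" for p q r s t u v w D1 D2 D3 D4 D D'
    using evaluates_comp[OF e(1-3)] composite_interchange[OF d] e(4,5) by simp
  have t: "evaluates (Cup \<otimes> Strand \<otimes> Strand) 1 (juxtapose 2 0 cup_diagram (identity_diagram 2))"
    "evaluates (Cap \<otimes> Strand \<otimes> Strand) 1 (juxtapose 0 2 cap_diagram (identity_diagram 2))"
    using evaluates_tens[OF evaluates_tens[OF b(4,2)] b(2)] juxtapose_assoc[of 2 1 0 1 cup_diagram "identity_diagram 1" "identity_diagram 1"]
      evaluates_tens[OF evaluates_tens[OF b(5,2)] b(2)] juxtapose_assoc[of 0 1 2 1 cap_diagram "identity_diagram 1" "identity_diagram 1"]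
      juxtapose_identity[of 1 1] by (simp_all add: numeral_eq_Suc)
  have t': "evaluates (Strand \<otimes> Strand \<otimes> Cup) 1 (juxtapose 2 2 (identity_diagram 2) cup_diagram)"
    "evaluates (Strand \<otimes> Strand \<otimes> Cap) 1 (juxtapose 2 2 (identity_diagram 2) cap_diagram)"
    using evaluates_tens[OF s(1) b(4)] evaluates_tens[OF s(1) b(5)] by (simp_all add: numeral_eq_Suc)
  have c1: "evaluates (Strand \<otimes> Strand \<otimes> Cup \<odot> Cup) \<epsilon> (juxtapose 2 0 cup_diagram cup_diagram)"
    using ic[OF t'(1) u(1) _ _ _ m(1,2,2,1) id(1,3)] by (simp add: len numeral_eq_Suc)
  have c2: "evaluates (Cup \<otimes> Strand \<otimes> Strand \<odot> Cup) 1 (juxtapose 2 0 cup_diagram cup_diagram)"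
    using ic[OF t(1) u(2) _ _ _ m(2,1,1,2) id(3,1)] by (simp add: len numeral_eq_Suc)
  have c3: "evaluates (Cap \<odot> Strand \<otimes> Strand \<otimes> Cap) 1 (juxtapose 0 2 cap_diagram cap_diagram)"
    using ic[OF u(3) t'(2) _ _ _ m(3,1,1,3) id(4,2)] by (simp add: len numeral_eq_Suc)
  have c4: "evaluates (Cap \<odot> Cap \<otimes> Strand \<otimes> Strand) \<epsilon> (juxtapose 0 2 cap_diagram cap_diagram)"
    using ic[OF u(4) t(2) _ _ _ m(1,3,3,1) id(2,4)] by (simp add: len numeral_eq_Suc)
  have c5: "evaluates (Cap \<otimes> Strand \<otimes> Strand \<odot> Strand \<otimes> Strand \<otimes> Cup) 1 (juxtapose 0 2 cap_diagram cup_diagram)"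
    using ic[OF t(2) t'(1) _ _ _ m(3,1,1,2) id(4,1)] by (simp add: len numeral_eq_Suc)
  have c6: "evaluates (Cup \<odot> Cap) \<epsilon> (juxtapose 0 2 cap_diagram cup_diagram)"
    using ic[OF u(2) u(3) _ _ _ m(1,2,3,1) id(2,3)] by (simp add: len numeral_eq_Suc)
  have cr1: "evaluates (Strand \<otimes> Strand \<odot> Cross) 1 (swap_diagram 2 1)"
    by (rule evaluates_identity_left) (use s(1) b(3) in simp_all)
  have cr2: "evaluates (Cross \<odot> Strand \<otimes> Strand) 1 (swap_diagram 2 1)"
    by (rule evaluates_identity_right) (use s(1) b(3) in simp_all)
  have cr3: "evaluates (Strand \<otimes> Strand \<odot> Cup) 1 cup_diagram"
    by (rule evaluates_identity_left) (use s(1) b(4) in simp_all)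
  have cr4: "evaluates (Cap \<odot> Strand \<otimes> Strand) 1 cap_diagram"
    by (rule evaluates_identity_right) (use s(1) b(5) in simp_all)
  have cr0: "evaluates (Strand \<odot> Strand) 1 (identity_diagram 1)"
    by (rule evaluates_identity_left) (use b(2) in simp_all)
  have xx: "evaluates (Cross \<odot> Cross) 1 (identity_diagram 2)"
  proof -
    have "evaluates (Cross \<odot> Cross) 1 (map_diagram (swap_top 1) (swap_diagram 2 1))"
      by (rule evaluates_swap_left) (use b(3) in simp_all)
    moreover have "map_diagram (swap_top 1) (swap_diagram 2 1) = identity_diagram 2"
      by (simp add: swap_diagram_def identity_diagram_def map_diagram_def map_edges_def image_image)
    ultimately show ?thesis by simp
  qed
  have ax: "evaluates (Cap \<odot> Cross) 1 ({{Bot 1, Bot 2}}, [] @ [Arrow (Bot 2) (Bot 1)] @ [])"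
  proof -
    have "evaluates (Cap \<odot> Cross) 1 (map_diagram (swap_bot 1) cap_diagram)"
      by (rule evaluates_swap_right) (use b(3,5) in simp_all)
    moreover have "map_diagram (swap_bot 1) cap_diagram = ({{Bot 1, Bot 2}}, [] @ [Arrow (Bot 2) (Bot 1)] @ [])"
      by (simp add: cap_diagram_def map_diagram_def map_edges_def sw_values insert_commute)
    ultimately show ?thesis by simp
  qed
  have ax': "cong \<epsilon> 0 2 (basis ({{Bot 1, Bot 2}}, [] @ [Arrow (Bot 2) (Bot 1)] @ [])) (scale \<epsilon> (basis cap_diagram))"
    unfolding cap_diagram_def
  proof (rule elementary_relation)
    show "elementary ([] @ [Arrow (Bot 2) (Bot 1)] @ []) [Arrow (Bot 1) (Bot 2)]"
      unfolding elementary_def by (intro disjI2 exI[of _ "[]"] exI[of _ "Bot 2"] exI[of _ "Bot 1"]) simp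
    show "({{Bot 1, Bot 2}}, [] @ [Arrow (Bot 2) (Bot 1)] @ []) \<in> marked_diagrams 0 2" using ax unfolding evaluates_def by simp
  qed
  have xu: "evaluates (Cross \<odot> Cup) 1 cup_diagram"
  proof -
    have "evaluates (Cross \<odot> Cup) 1 (map_diagram (swap_top 1) cup_diagram)"
      by (rule evaluates_swap_left) (use b(3,4) in simp_all)
    moreover have "map_diagram (swap_top 1) cup_diagram = cup_diagram"
      by (simp add: cup_diagram_def map_diagram_def map_edges_def sw_values insert_commute)
    ultimately show ?thesis by simp
  qed
  have au: "evaluates (Cap \<odot> Cup) \<delta> (identity_diagram 0)"
    using evaluates_comp[OF b(5,4), of \<delta> "identity_diagram 0"] cap_cup_composite[of \<delta> \<epsilon>] by simp
  have z1: "evaluates (Cap \<otimes> Strand \<odot> Strand \<otimes> Cup) 1 (identity_diagram 1)"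
    using evaluates_comp[OF s(4,7)] zigzag_one[OF ee] by simp
  have z2: "evaluates (Strand \<otimes> Cap \<odot> Cup \<otimes> Strand) \<epsilon> (identity_diagram 1)"
    using evaluates_comp[OF s(5,6)] zigzag_two[OF ee] by simp
  have p1: "evaluates (Cap \<otimes> Strand \<odot> Strand \<otimes> Cross) 1 (map_diagram (swap_bot 2) cap_strand)"
    by (rule evaluates_swap_right) (use s(3,4) in \<open>simp_all add: numeral_eq_Suc\<close>)
  have p2: "evaluates (Strand \<otimes> Cap \<odot> Cross \<otimes> Strand) 1 (map_diagram (swap_bot 1) strand_cap)"
    by (rule evaluates_swap_right) (use s(2,5) in \<open>simp_all add: numeral_eq_Suc\<close>)
  have p12: "map_diagram (swap_bot 2) cap_strand = map_diagram (swap_bot 1) strand_cap"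
    by (simp add: cap_strand_def strand_cap_def map_diagram_def map_edges_def sw_values insert_commute)
  have q1: "evaluates (Strand \<otimes> Cross \<odot> Cup \<otimes> Strand) 1 (map_diagram (swap_top 2) cup_strand)"
    by (rule evaluates_swap_left) (use s(3,6) in \<open>simp_all add: numeral_eq_Suc\<close>)
  have q2: "evaluates (Cross \<otimes> Strand \<odot> Strand \<otimes> Cup) 1 (map_diagram (swap_top 1) strand_cup)"
    by (rule evaluates_swap_left) (use s(2,7) in \<open>simp_all add: numeral_eq_Suc\<close>)
  have q12: "map_diagram (swap_top 2) cup_strand = map_diagram (swap_top 1) strand_cup"
    by (simp add: cup_strand_def strand_cup_def map_diagram_def map_edges_def sw_values insert_commute)
  have "evaluates (Cross \<otimes> Strand \<odot> Strand \<otimes> Cross) 1 (map_diagram (swap_top 1) (swap_diagram 3 2))"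
    by (rule evaluates_swap_left) (use s(2,3) in \<open>simp_all add: numeral_eq_Suc\<close>)
  then have y1: "evaluates (Cross \<otimes> Strand \<odot> Strand \<otimes> Cross \<odot> Cross \<otimes> Strand) 1 (map_diagram (swap_bot 1) (map_diagram (swap_top 1) (swap_diagram 3 2)))"
    by (rule evaluates_swap_right) (use s(2) in \<open>simp_all add: numeral_eq_Suc\<close>)
  have "evaluates (Strand \<otimes> Cross \<odot> Cross \<otimes> Strand) 1 (map_diagram (swap_top 2) (swap_diagram 3 1))"
    by (rule evaluates_swap_left) (use s(2,3) in \<open>simp_all add: numeral_eq_Suc\<close>)
  then have y2: "evaluates (Strand \<otimes> Cross \<odot> Cross \<otimes> Strand \<odot> Strand \<otimes> Cross) 1 (map_diagram (swap_bot 2) (map_diagram (swap_top 2) (swap_diagram 3 1)))"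
    by (rule evaluates_swap_right) (use s(3) in \<open>simp_all add: numeral_eq_Suc\<close>)
  have y12: "map_diagram (swap_bot 1) (map_diagram (swap_top 1) (swap_diagram 3 2)) = map_diagram (swap_bot 2) (map_diagram (swap_top 2) (swap_diagram 3 1))"
    unfolding swap_diagram_def interval_two by (auto simp: map_diagram_def map_edges_def sw_values)
  have axs: "same (Cap \<odot> Cross) \<epsilon> Cap" using sameI[OF _ _ _ _ ax b(5), of \<epsilon>] ax' by simp
  note S = sameI'[OF _ _ _ _ cr0 b(2)] sameI'[OF _ _ _ _ cr1 b(3)] sameI'[OF _ _ _ _ b(3) cr2] sameI'[OF _ _ _ _ cr3 b(4)]
    sameI'[OF _ _ _ _ cr4 b(5)] sameI'[OF _ _ _ _ xx s(1)] sameI'[OF _ _ _ _ xu b(4)] sameI'[OF _ _ _ _ au b(1)]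
    sameI'[OF _ _ _ _ z1 b(2)] sameI'[OF _ _ _ _ z2 b(2)] sameI'[OF _ _ _ _ p1[unfolded p12] p2] sameI'[OF _ _ _ _ q1[unfolded q12] q2]
    sameI'[OF _ _ _ _ c1 c2] sameI'[OF _ _ _ _ c3 c4] sameI'[OF _ _ _ _ c5 c6] sameI'[OF _ _ _ _ y1[unfolded y12] y2]
  show ?thesis
    using assms unfolding relations_def insert_iff prod.inject empty_iff
    by (elim disjE conjE FalseE, simp_all only:) (rule S axs; (simp add: ee; fail))+
qed

lemma identity_typed: "well_typed (identity a)" "src (identity a) = a" "tgt (identity a) = a"
  by (induction a) auto

lemma same_ev:
  "same f c g ==> f \<in> words r s ==> basis f \<in> exprs r s \<and> scale c (basis g) \<in> exprs r s \<and> cong \<epsilon> r s (ev (basis f)) (ev (scale c (basis g)))"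
  unfolding exprs_def linear_extension_scale linear_extension_basis
  by (intro conjI combinations_basis combinations_scale) (auto simp: same_def words_def)

lemma ev_comp_cong:
  assumes x: "x \<in> exprs r s" "x' \<in> exprs r s" "y \<in> exprs s t" "y' \<in> exprs s t"
    and c: "cong \<epsilon> r s (ev x) (ev x')" "cong \<epsilon> s t (ev y) (ev y')"
  shows "bilinear_extension (\<lambda>f g. basis (f \<odot> g)) x y \<in> exprs r t"
    and "cong \<epsilon> r t (ev (bilinear_extension (\<lambda>f g. basis (f \<odot> g)) x y)) (ev (bilinear_extension (\<lambda>f g. basis (f \<odot> g)) x' y'))"
proof -
  have w: "f \<odot> g \<in> words r t" if "f \<in> words r s" "g \<in> words s t" for f g using that by (auto simp: words_def)
  have "cong \<epsilon> r t (bilinear_extension (choice r t) (ev x) (ev y)) (bilinear_extension (choice r t) (ev x') (ev y'))"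
    unfolding coset_eq_iff[symmetric] compose_coset[OF ev_in[OF x(1)] ev_in[OF x(3)], symmetric]
      compose_coset[OF ev_in[OF x(2)] ev_in[OF x(4)], symmetric]
    using c unfolding coset_eq_iff[symmetric] by simp
  then show "cong \<epsilon> r t (ev (bilinear_extension (\<lambda>f g. basis (f \<odot> g)) x y)) (ev (bilinear_extension (\<lambda>f g. basis (f \<odot> g)) x' y'))"
    using ev_comp[OF x(1,3)] cong_sym[OF ev_comp[OF x(2,4)]] cong_trans by blast
  show "bilinear_extension (\<lambda>f g. basis (f \<odot> g)) x y \<in> exprs r t"
    using exprs_bilinear[of x "words r s" y "words s t" "(\<odot>)" "words r t"] x w unfolding exprs_def by blast
qed

lemma ev_tens_cong:
  assumes x: "x \<in> exprs r s" "x' \<in> exprs r s" "y \<in> exprs t u" "y' \<in> exprs t u"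
    and c: "cong \<epsilon> r s (ev x) (ev x')" "cong \<epsilon> t u (ev y) (ev y')"
  shows "bilinear_extension (\<lambda>f g. basis (f \<otimes> g)) x y \<in> exprs (r + t) (s + u)"
    and "cong \<epsilon> (r + t) (s + u) (ev (bilinear_extension (\<lambda>f g. basis (f \<otimes> g)) x y)) (ev (bilinear_extension (\<lambda>f g. basis (f \<otimes> g)) x' y'))"
proof -
  have w: "f \<otimes> g \<in> words (r + t) (s + u)" if "f \<in> words r s" "g \<in> words t u" for f g using that by (auto simp: words_def)
  have "cong \<epsilon> (r + t) (s + u) (bilinear_extension (\<lambda>D1 D2. basis (juxtapose r s D1 D2)) (ev x) (ev y))
      (bilinear_extension (\<lambda>D1 D2. basis (juxtapose r s D1 D2)) (ev x') (ev y'))"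
    unfolding coset_eq_iff[symmetric] tensor_coset[OF ev_in[OF x(1)] ev_in[OF x(3)], symmetric]
      tensor_coset[OF ev_in[OF x(2)] ev_in[OF x(4)], symmetric]
    using c unfolding coset_eq_iff[symmetric] by simp
  then show "cong \<epsilon> (r + t) (s + u) (ev (bilinear_extension (\<lambda>f g. basis (f \<otimes> g)) x y)) (ev (bilinear_extension (\<lambda>f g. basis (f \<otimes> g)) x' y'))"
    using ev_tens[OF x(1,3)] cong_sym[OF ev_tens[OF x(2,4)]] cong_trans by blast
  show "bilinear_extension (\<lambda>f g. basis (f \<otimes> g)) x y \<in> exprs (r + t) (s + u)"
    using exprs_bilinear[of x "words r s" y "words t u" "(\<otimes>)" "words (r + t) (s + u)"] x w unfolding exprs_def by blast
qed

theorem soundness: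
  assumes "derivable \<delta> \<epsilon> r s x y" "CHAR('k) \<noteq> 2"
  shows "x \<in> exprs r s \<and> y \<in> exprs r s \<and> cong \<epsilon> r s (ev x) (ev y)"
  using assms(1)
proof induction
  case (relation f c g)
  then have "same f c g" by (rule relation_same)
  then show ?case by (rule same_ev) (use relation_same[OF relation] in \<open>simp add: same_def words_def\<close>)
next
  case (comp_assoc f r s g t h u)
  have "same ((f \<odot> g) \<odot> h) 1 (f \<odot> (g \<odot> h))" by (rule same_assoc) (use comp_assoc in \<open>simp_all add: words_def\<close>)
  from same_ev[OF this, of r u] show ?case using comp_assoc by (simp add: words_def)
next
  case (comp_identity_left f r s)
  have "same (identity r \<odot> f) 1 f" using same_identity_left[of f] comp_identity_left by (simp add: words_def)
  from same_ev[OF this, of r s] show ?case using comp_identity_left by (simp add: words_def identity_typed)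
next
  case (comp_identity_right f r s)
  have "same (f \<odot> identity s) 1 f" using same_identity_right[of f] comp_identity_right by (simp add: words_def)
  from same_ev[OF this, of r s] show ?case using comp_identity_right by (simp add: words_def identity_typed)
next
  case (tens_assoc f r s g t u h v w)
  have "same ((f \<otimes> g) \<otimes> h) 1 (f \<otimes> (g \<otimes> h))" by (rule same_tens_assoc) (use tens_assoc in \<open>simp_all add: words_def\<close>)
  from same_ev[OF this, of "r + t + v" "s + u + w"] show ?case using tens_assoc by (simp add: words_def)
next
  case (tens_unit_left f r s)
  have "same (Unit \<otimes> f) 1 f" by (rule same_unit) (use tens_unit_left in \<open>simp_all add: words_def\<close>)
  from same_ev[OF this, of r s] show ?case using tens_unit_left by (simp add: words_def)
next
  case (tens_unit_right f r s)
  have "same (f \<otimes> Unit) 1 f" by (rule same_unit) (use tens_unit_right in \<open>simp_all add: words_def\<close>)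
  from same_ev[OF this, of r s] show ?case using tens_unit_right by (simp add: words_def)
next
  case (tens_comp f r s g t u h v j w)
  have "same ((f \<otimes> g) \<odot> (h \<otimes> j)) ((- 1) ^ (word_degree \<epsilon> g * word_degree \<epsilon> h)) ((f \<odot> h) \<otimes> (g \<odot> j))"
    by (rule same_interchange) (use tens_comp assms(2) in \<open>simp_all add: words_def\<close>)
  from same_ev[OF this, of "r + t" "v + w"] show ?case using tens_comp by (simp add: words_def)
next
  case (refl x r s) then show ?case by simp
next
  case (sym r s x y) then show ?case using cong_sym by blast
next
  case (trans r s x y z) then show ?case using cong_trans by blast
next
  case (add r s x x' y y')
  then show ?case unfolding exprs_def linear_extension_add by (blast intro: combinations_add cong_add)
next
  case (scale r s x x' c)
  then show ?case unfolding exprs_def linear_extension_scale by (blast intro: combinations_scale cong_scale)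
next
  case (comp r s x x' t y y')
  then have x: "x \<in> exprs r s" "x' \<in> exprs r s" "y \<in> exprs s t" "y' \<in> exprs s t"
    and c: "cong \<epsilon> r s (ev x) (ev x')" "cong \<epsilon> s t (ev y) (ev y')" by auto
  show ?case using ev_comp_cong[OF x c] ev_comp_cong(1)[OF x(2,1,4,3) cong_sym[OF c(1)] cong_sym[OF c(2)]] by blast
next
  case (tens r s x x' t u y y')
  then have x: "x \<in> exprs r s" "x' \<in> exprs r s" "y \<in> exprs t u" "y' \<in> exprs t u"
    and c: "cong \<epsilon> r s (ev x) (ev x')" "cong \<epsilon> t u (ev y) (ev y')" by auto
  show ?case using ev_tens_cong[OF x c] ev_tens_cong(1)[OF x(2,1,4,3) cong_sym[OF c(1)] cong_sym[OF c(2)]] by blast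
qed

end

section \<open>Rewriting words as lists of layers\<close>

section \<open>Lists of layers\<close>

context parameters
begin

definition der :: "'k \<Rightarrow> word \<Rightarrow> word \<Rightarrow> bool" where
  "der c f g \<longleftrightarrow> well_typed f \<and> well_typed g \<and> src g = src f \<and> tgt g = tgt f \<and>
     derivable \<delta> \<epsilon> (src f) (tgt f) (basis f) (scale c (basis g))"

text \<open>\<open>sim False\<close> is equality up to a sign, \<open>sim True\<close> equality up to any scalar, zero included.\<close>

definition sim :: "bool \<Rightarrow> word \<Rightarrow> word \<Rightarrow> bool" where
  "sim b f g \<longleftrightarrow> (\<exists>c. (b \<or> c = 1 \<or> c = \<epsilon>) \<and> der c f g)"

lemma der_refl: "well_typed f ==> der 1 f f"
  unfolding der_def by (auto intro!: derivable.refl simp: exprs_def combinations_basis words_def)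

lemma der_trans: "der c f g ==> der d g h ==> der (c * d) f h"
  unfolding der_def using derivable.trans derivable.scale[of \<delta> \<epsilon> _ _ "basis g" "scale d (basis h)" c]
  by (metis comb.scale_scale)

lemma der_sym: "der c f g ==> c * c = 1 ==> der c g f"
  unfolding der_def using derivable.sym derivable.scale[of \<delta> \<epsilon> _ _ "scale c (basis g)" "basis f" c]
  by (metis comb.scale_scale comb.scale_one)

lemma der_comp: "der c f f' ==> der d g g' ==> tgt f = src g ==> der (c * d) (f \<odot> g) (f' \<odot> g')"
  unfolding der_def using derivable.comp[of \<delta> \<epsilon> "src f" "tgt f" "basis f" "scale c (basis f')" "tgt g" "basis g" "scale d (basis g')"]
    bilinear_scaled[of "\<lambda>f g. basis (f \<odot> g)" "1::'k" f 1 g] bilinear_scaled[of "\<lambda>f g. basis (f \<odot> g)" c f' d g']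
  by simp

lemma der_tens: "der c f f' ==> der d g g' ==> der (c * d) (f \<otimes> g) (f' \<otimes> g')"
  unfolding der_def using derivable.tens[of \<delta> \<epsilon> "src f" "tgt f" "basis f" "scale c (basis f')" "src g" "tgt g" "basis g" "scale d (basis g')"]
    bilinear_scaled[of "\<lambda>f g. basis (f \<otimes> g)" "1::'k" f 1 g] bilinear_scaled[of "\<lambda>f g. basis (f \<otimes> g)" c f' d g']
  by simp

lemma sim_typed: "sim b f g ==> well_typed f \<and> well_typed g \<and> src g = src f \<and> tgt g = tgt f"
  unfolding sim_def der_def by auto

lemma sim_weaken: "sim False f g ==> sim b f g" unfolding sim_def by auto

lemma sim_refl: "well_typed f ==> sim b f f" unfolding sim_def using der_refl by blast

lemma sim_trans: "sim b f g ==> sim b g h ==> sim b f h"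
  unfolding sim_def using der_trans ee by (metis mult_1 mult.right_neutral)

lemma sim_sym: "sim False f g ==> sim False g f" unfolding sim_def using der_sym ee by (metis mult_1)

lemma sim_comp: "sim b f f' ==> sim b g g' ==> tgt f = src g ==> sim b (f \<odot> g) (f' \<odot> g')"
  unfolding sim_def using der_comp ee by (metis mult_1 mult.right_neutral)

lemma sim_tens: "sim b f f' ==> sim b g g' ==> sim b (f \<otimes> g) (f' \<otimes> g')"
  unfolding sim_def using der_tens ee by (metis mult_1 mult.right_neutral)

lemma sim_derivable:
  assumes "derivable \<delta> \<epsilon> (src f) (tgt f) (basis f) (basis g)" "well_typed f" "well_typed g" "src g = src f" "tgt g = tgt f"
  shows "sim b f g"
  unfolding sim_def der_def using assms by (intro exI[of _ 1]) simp

lemma word_in: "well_typed f ==> f \<in> words (src f) (tgt f)" by (simp add: words_def)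

lemma sim_assoc: "well_typed (f \<odot> g \<odot> h) ==> sim b (f \<odot> g \<odot> h) (f \<odot> (g \<odot> h))"
  using derivable.comp_assoc[of f "src f" "tgt f" g "tgt g" h "tgt h"] by (intro sim_derivable) (auto simp: words_def)

lemma sim_identity_left: "well_typed f ==> src f = a ==> sim b (identity a \<odot> f) f"
  using derivable.comp_identity_left[OF word_in, of f] by (intro sim_derivable) (auto simp: identity_typed)

lemma sim_identity_right: "well_typed f ==> tgt f = a ==> sim b (f \<odot> identity a) f"
  using derivable.comp_identity_right[OF word_in, of f] by (intro sim_derivable) (auto simp: identity_typed)

lemma sim_tens_assoc: "well_typed (f \<otimes> g \<otimes> h) ==> sim b (f \<otimes> g \<otimes> h) (f \<otimes> (g \<otimes> h))"
  using derivable.tens_assoc[OF word_in word_in word_in, of f g h] by (intro sim_derivable) (auto simp: add.assoc)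

lemma sim_unit_left: "well_typed f ==> sim b (Unit \<otimes> f) f"
  using derivable.tens_unit_left[OF word_in, of f] by (intro sim_derivable) auto

lemma sim_unit_right: "well_typed f ==> sim b (f \<otimes> Unit) f"
  using derivable.tens_unit_right[OF word_in, of f] by (intro sim_derivable) auto

text \<open>The sign in the interchange rule is 1 or \<epsilon> and is therefore absorbed by
  \<open>sim\<close>.\<close>

lemma sim_interchange:
  assumes w: "well_typed f" "well_typed g" "well_typed h" "well_typed j" "tgt f = src h" "tgt g = src j"
  shows "sim b ((f \<otimes> g) \<odot> (h \<otimes> j)) ((f \<odot> h) \<otimes> (g \<odot> j))"
proof -
  let ?c = "(- 1 :: 'k) ^ (word_degree \<epsilon> g * word_degree \<epsilon> h)"
  have "?c = 1 \<or> ?c = \<epsilon>"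
    by (cases "\<epsilon> = - 1") (auto simp: word_degree_def degree_of_def minus_one_power_iff)
  moreover have "der ?c ((f \<otimes> g) \<odot> (h \<otimes> j)) ((f \<odot> h) \<otimes> (g \<odot> j))"
    using derivable.tens_comp[OF word_in[OF w(1)] word_in[OF w(2)], of h "tgt h" j "tgt j" \<delta> \<epsilon>] w
    by (simp add: der_def words_def)
  ultimately show ?thesis unfolding sim_def by blast
qed

lemma sim_identity_tens: "sim b (identity a \<otimes> identity c) (identity (a + c))"
proof (induction a)
  case 0 show ?case using sim_unit_left[OF identity_typed(1), of b c] by simp
next
  case (Suc a)
  have "sim b (Strand \<otimes> identity a \<otimes> identity c) (Strand \<otimes> (identity a \<otimes> identity c))"
    by (rule sim_tens_assoc) (simp add: identity_typed)
  moreover have "sim b (Strand \<otimes> (identity a \<otimes> identity c)) (Strand \<otimes> identity (a + c))"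
    by (rule sim_tens[OF sim_refl Suc]) simp
  ultimately show ?case using sim_trans by simp
qed

definition lay :: "nat \<Rightarrow> word \<Rightarrow> nat \<Rightarrow> word" where
  "lay a f c = identity a \<otimes> (f \<otimes> identity c)"

lemma lay_typed [simp]:
  "well_typed (lay a f c) \<longleftrightarrow> well_typed f" "src (lay a f c) = a + src f + c" "tgt (lay a f c) = a + tgt f + c"
  by (simp_all add: lay_def identity_typed)

lemma lay_cong: "sim b f g ==> sim b (lay a f c) (lay a g c)"
  unfolding lay_def by (intro sim_tens sim_refl) (simp_all add: identity_typed)

lemma lay_comp:
  assumes w: "well_typed f" "well_typed g" "tgt f = src g"
  shows "sim b (lay a f c \<odot> lay a g c) (lay a (f \<odot> g) c)"
proof -
  note i = identity_typed
  have 1: "sim b (lay a f c \<odot> lay a g c) ((identity a \<odot> identity a) \<otimes> ((f \<otimes> identity c) \<odot> (g \<otimes> identity c)))"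
    unfolding lay_def by (rule sim_interchange) (use w in \<open>simp_all add: i\<close>)
  have 2: "sim b ((f \<otimes> identity c) \<odot> (g \<otimes> identity c)) ((f \<odot> g) \<otimes> (identity c \<odot> identity c))"
    by (rule sim_interchange) (use w in \<open>simp_all add: i\<close>)
  have 3: "sim b (identity d \<odot> identity d) (identity d)" for d by (rule sim_identity_left) (simp_all add: i)
  have "sim b ((f \<odot> g) \<otimes> (identity c \<odot> identity c)) ((f \<odot> g) \<otimes> identity c)"
    by (rule sim_tens[OF sim_refl 3]) (use w in simp)
  from sim_trans[OF 1 sim_tens[OF 3 sim_trans[OF 2 this]]] show ?thesis unfolding lay_def .
qed

lemma lay_shift_left: "well_typed g ==> sim b (lay (a + k) g c) (lay a (identity k \<otimes> g) c)"
proof -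
  assume w: "well_typed g"
  note i = identity_typed
  have 1: "sim b (lay (a + k) g c) ((identity a \<otimes> identity k) \<otimes> (g \<otimes> identity c))"
    unfolding lay_def by (intro sim_tens[OF sim_weaken[OF sim_sym[OF sim_identity_tens]] sim_refl]) (use w in \<open>simp add: i\<close>)
  have 2: "sim b ((identity a \<otimes> identity k) \<otimes> (g \<otimes> identity c)) (identity a \<otimes> (identity k \<otimes> (g \<otimes> identity c)))"
    by (rule sim_tens_assoc) (use w in \<open>simp add: i\<close>)
  have "sim b (identity a \<otimes> (identity k \<otimes> (g \<otimes> identity c))) (lay a (identity k \<otimes> g) c)"
    unfolding lay_def by (intro sim_tens[OF sim_refl] sim_weaken[OF sim_sym[OF sim_tens_assoc]]) (use w in \<open>simp_all add: i\<close>)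
  from sim_trans[OF sim_trans[OF 1 2] this] show ?thesis .
qed

lemma lay_shift_right: "well_typed f ==> sim b (lay a f (k + c)) (lay a (f \<otimes> identity k) c)"
proof -
  assume w: "well_typed f"
  note i = identity_typed
  have "sim b (f \<otimes> identity (k + c)) (f \<otimes> (identity k \<otimes> identity c))"
    by (rule sim_tens[OF sim_refl[OF w] sim_weaken[OF sim_sym[OF sim_identity_tens]]])
  moreover have "sim b (f \<otimes> (identity k \<otimes> identity c)) (f \<otimes> identity k \<otimes> identity c)"
    by (rule sim_weaken[OF sim_sym[OF sim_tens_assoc]]) (use w in \<open>simp add: i\<close>)
  ultimately have "sim b (f \<otimes> identity (k + c)) (f \<otimes> identity k \<otimes> identity c)" by (rule sim_trans)
  from sim_tens[OF sim_refl this] show ?thesis unfolding lay_def by (simp add: i)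
qed

text \<open>Each of the two orders is an interchange of \<open>f\<close> and \<open>g\<close> with
  identities in the complementary places.\<close>

lemma lay_tens:
  assumes w: "well_typed f" "well_typed g"
  shows "sim b (lay a f (src g + c) \<odot> lay (a + tgt f) g c) (lay a (f \<otimes> g) c)"
    and "sim b (lay (a + src f) g c \<odot> lay a f (tgt g + c)) (lay a (f \<otimes> g) c)"
proof -
  note i = identity_typed
  have "sim b (lay a f (src g + c) \<odot> lay (a + tgt f) g c) (lay a (f \<otimes> identity (src g)) c \<odot> lay a (identity (tgt f) \<otimes> g) c)"
    by (rule sim_comp[OF lay_shift_right[OF w(1)] lay_shift_left[OF w(2)]]) simp
  moreover have "sim b (lay a (f \<otimes> identity (src g)) c \<odot> lay a (identity (tgt f) \<otimes> g) c) (lay a ((f \<otimes> identity (src g)) \<odot> (identity (tgt f) \<otimes> g)) c)"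
    by (rule lay_comp) (use w in \<open>simp_all add: i\<close>)
  moreover have "sim b ((f \<otimes> identity (src g)) \<odot> (identity (tgt f) \<otimes> g)) ((f \<odot> identity (tgt f)) \<otimes> (identity (src g) \<odot> g))"
    by (rule sim_interchange) (use w in \<open>simp_all add: i\<close>)
  moreover have "sim b ((f \<odot> identity (tgt f)) \<otimes> (identity (src g) \<odot> g)) (f \<otimes> g)"
    by (rule sim_tens[OF sim_identity_right[OF w(1) HOL.refl] sim_identity_left[OF w(2) HOL.refl]])
  ultimately show "sim b (lay a f (src g + c) \<odot> lay (a + tgt f) g c) (lay a (f \<otimes> g) c)"
    using sim_trans lay_cong by meson
  have "sim b (lay (a + src f) g c \<odot> lay a f (tgt g + c)) (lay a (identity (src f) \<otimes> g) c \<odot> lay a (f \<otimes> identity (tgt g)) c)"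
    by (rule sim_comp[OF lay_shift_left[OF w(2)] lay_shift_right[OF w(1)]]) simp
  moreover have "sim b (lay a (identity (src f) \<otimes> g) c \<odot> lay a (f \<otimes> identity (tgt g)) c) (lay a ((identity (src f) \<otimes> g) \<odot> (f \<otimes> identity (tgt g))) c)"
    by (rule lay_comp) (use w in \<open>simp_all add: i\<close>)
  moreover have "sim b ((identity (src f) \<otimes> g) \<odot> (f \<otimes> identity (tgt g))) ((identity (src f) \<odot> f) \<otimes> (g \<odot> identity (tgt g)))"
    by (rule sim_interchange) (use w in \<open>simp_all add: i\<close>)
  moreover have "sim b ((identity (src f) \<odot> f) \<otimes> (g \<odot> identity (tgt g))) (f \<otimes> g)"
    by (rule sim_tens[OF sim_identity_left[OF w(1) HOL.refl] sim_identity_right[OF w(2) HOL.refl]])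
  ultimately show "sim b (lay (a + src f) g c \<odot> lay a f (tgt g + c)) (lay a (f \<otimes> g) c)"
    using sim_trans lay_cong by meson
qed

lemma lay_identity: "sim b (lay a (identity k) c) (identity (a + k + c))"
  unfolding lay_def using sim_trans[OF sim_tens[OF sim_refl sim_identity_tens] sim_identity_tens] identity_typed
  by (simp add: add.assoc)

lemma lay_strand: "sim b (lay a Strand c) (identity (a + 1 + c))"
proof -
  have "sim b Strand (identity 1)" using sim_weaken[OF sim_sym[OF sim_unit_right[of Strand]]] by simp
  from sim_trans[OF lay_cong[OF this] lay_identity] show ?thesis .
qed

text \<open>A pair (w, a) is the layer with \<open>w\<close> at offset \<open>a\<close>. The number
  of strands is not stored in the list but threaded through \<open>fits\<close>, \<open>out\<close>
  and \<open>word_of\<close>, so that one list can be read at every sufficient width.\<close>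

fun fits :: "nat \<Rightarrow> (word \<times> nat) list \<Rightarrow> bool" where
  "fits n [] = True"
| "fits n ((w, a) # L) = (well_typed w \<and> a + src w \<le> n \<and> fits (n - src w + tgt w) L)"

fun out :: "nat \<Rightarrow> (word \<times> nat) list \<Rightarrow> nat" where
  "out n [] = n"
| "out n ((w, a) # L) = out (n - src w + tgt w) L"

fun word_of :: "nat \<Rightarrow> (word \<times> nat) list \<Rightarrow> word" where
  "word_of n [] = identity n"
| "word_of n ((w, a) # L) = lay a w (n - a - src w) \<odot> word_of (n - src w + tgt w) L"

lemma word_of_typed:
  "fits n L ==> well_typed (word_of n L) \<and> src (word_of n L) = n \<and> tgt (word_of n L) = out n L"
proof (induction n L rule: fits.induct)
  case (2 n w a L)
  then have "a + tgt w + (n - a - src w) = n - src w + tgt w" "a + src w + (n - a - src w) = n" by auto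
  then show ?case using 2 by simp
qed (simp add: identity_typed)

lemma fits_append [simp]: "fits n (L @ M) \<longleftrightarrow> fits n L \<and> fits (out n L) M"
  by (induction n L rule: fits.induct) auto

lemma out_append [simp]: "out n (L @ M) = out (out n L) M"
  by (induction n L rule: fits.induct) auto

lemma word_append: "fits n (L @ M) ==> sim False (word_of n (L @ M)) (word_of n L \<odot> word_of (out n L) M)"
proof (induction n L rule: fits.induct)
  case (1 n)
  then show ?case using word_of_typed[of n M] sim_sym[OF sim_identity_left, of "word_of n M" n] by simp
next
  case (2 n w a L)
  let ?m = "n - src w + tgt w" and ?l = "lay a w (n - a - src w)"
  have f: "fits ?m (L @ M)" "fits ?m L" "fits (out ?m L) M" "well_typed w" "a + src w \<le> n" using 2(2) by auto
  have m: "tgt ?l = ?m" using f by simp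
  have "sim False (?l \<odot> word_of ?m (L @ M)) (?l \<odot> (word_of ?m L \<odot> word_of (out ?m L) M))"
    by (rule sim_comp[OF sim_refl 2(1)[OF f(1)]]) (use f m word_of_typed[OF f(1)] in simp_all)
  moreover have "sim False (?l \<odot> (word_of ?m L \<odot> word_of (out ?m L) M)) (?l \<odot> word_of ?m L \<odot> word_of (out ?m L) M)"
    by (rule sim_sym[OF sim_assoc]) (use f m word_of_typed[OF f(2)] word_of_typed[OF f(3)] in simp)
  ultimately show ?case unfolding append_Cons word_of.simps out.simps by (rule sim_trans)
qed

definition equivalent :: "bool \<Rightarrow> nat \<Rightarrow> (word \<times> nat) list \<Rightarrow> (word \<times> nat) list \<Rightarrow> bool" where
  "equivalent b n L M \<longleftrightarrow> fits n L \<and> fits n M \<and> out n M = out n L \<and> sim b (word_of n L) (word_of n M)"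

lemma equivalent_refl: "fits n L ==> equivalent b n L L"
  unfolding equivalent_def using word_of_typed sim_refl by blast

lemma equivalent_trans: "equivalent b n L M ==> equivalent b n M N ==> equivalent b n L N"
  unfolding equivalent_def using sim_trans by auto

lemma equivalent_sym: "equivalent False n L M ==> equivalent False n M L"
  unfolding equivalent_def using sim_sym by auto

lemma equivalent_weaken: "equivalent False n L M ==> equivalent b n L M"
  unfolding equivalent_def using sim_weaken by auto

lemma equivalent_append:
  assumes "equivalent b n L L'" "equivalent b (out n L) M M'"
  shows "equivalent b n (L @ M) (L' @ M')"
proof -
  have f: "fits n (L @ M)" "fits n (L' @ M')" "fits n L" "fits (out n L) M" "fits (out n L) M'" "out n L' = out n L"
    using assms unfolding equivalent_def by auto
  have "sim b (word_of n L \<odot> word_of (out n L) M) (word_of n L' \<odot> word_of (out n L) M')"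
    by (rule sim_comp) (use assms word_of_typed[OF f(3)] word_of_typed[OF f(4)] in \<open>simp_all add: equivalent_def\<close>)
  then have "sim b (word_of n (L @ M)) (word_of n (L' @ M'))"
    using sim_weaken[OF word_append[OF f(1)]] sim_weaken[OF sim_sym[OF word_append[OF f(2)]]] sim_trans f(6) by metis
  then show ?thesis unfolding equivalent_def using f assms by (auto simp: equivalent_def)
qed

lemma word_single:
  "well_typed f ==> a + src f \<le> n ==> sim b (word_of n [(f, a)]) (lay a f (n - a - src f))"
  by (simp, rule sim_identity_right) simp_all

lemma equivalent_single:
  assumes s: "sim b f g" and n: "a + src f \<le> n"
  shows "equivalent b n [(f, a)] [(g, a)]"
proof -
  have t: "well_typed f" "well_typed g" "src g = src f" "tgt g = tgt f" using sim_typed[OF s] by auto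
  have 1: "sim b (word_of n [(f, a)]) (lay a f (n - a - src f))" by (rule word_single[OF t(1) n])
  have 2: "sim b (lay a g (n - a - src f)) (word_of n [(g, a)])"
    using sim_weaken[OF sim_sym[OF word_single[of g a n False]]] t n by (simp del: word_of.simps)
  show ?thesis unfolding equivalent_def
    using sim_trans[OF 1 sim_trans[OF lay_cong[OF s] 2]] t n by (simp del: word_of.simps)
qed

lemma word_pair:
  assumes "well_typed f" "a + src f \<le> n" "well_typed g" "c + src g \<le> n - src f + tgt f"
  shows "sim b (word_of n [(f, a), (g, c)]) (lay a f (n - a - src f) \<odot> lay c g (n - src f + tgt f - c - src g))"
  unfolding word_of.simps(2)[of n f a]
  by (rule sim_comp[OF sim_refl word_single]) (use assms in auto)

lemma equivalent_comp:
  assumes "well_typed (f \<odot> g)" "a + src f \<le> n"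
  shows "equivalent False n [(f \<odot> g, a)] [(f, a), (g, a)]"
proof -
  have w: "well_typed f" "well_typed g" "tgt f = src g" using assms by auto
  have "sim False (word_of n [(f, a), (g, a)]) (lay a f (n - a - src f) \<odot> lay a g (n - a - src f))"
    using word_pair[of f a n g a] assms by (simp add: add.commute del: word_of.simps)
  moreover have "sim False (word_of n [(f \<odot> g, a)]) (lay a (f \<odot> g) (n - a - src f))"
    using word_single[OF assms(1), of a n] assms by simp
  ultimately have "sim False (word_of n [(f \<odot> g, a)]) (word_of n [(f, a), (g, a)])"
    using lay_comp[OF w, of False a "n - a - src f"] sim_trans sim_sym by blast
  then show ?thesis unfolding equivalent_def using assms by auto
qed

lemma equivalent_tens:
  assumes "well_typed (f \<otimes> g)" "a + src f + src g \<le> n"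
  shows "equivalent False n [(f \<otimes> g, a)] [(f, a), (g, a + tgt f)]"
    and "equivalent False n [(f \<otimes> g, a)] [(g, a + src f), (f, a)]"
proof -
  have w: "well_typed f" "well_typed g" using assms by auto
  obtain c where n: "n = a + src f + src g + c" using assms(2) le_Suc_ex by blast
  have s: "sim False (word_of n [(f \<otimes> g, a)]) (lay a (f \<otimes> g) c)"
    using word_single[OF assms(1), of a n] assms by (simp add: n del: word_of.simps)
  have "sim False (word_of n [(f, a), (g, a + tgt f)]) (lay a f (src g + c) \<odot> lay (a + tgt f) g c)"
    using word_pair[of f a n g "a + tgt f" False] w n by (simp add: algebra_simps del: word_of.simps)
  then have "sim False (word_of n [(f \<otimes> g, a)]) (word_of n [(f, a), (g, a + tgt f)])"
    using lay_tens(1)[OF w, of False a c] sim_trans sim_sym s by blast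
  then show "equivalent False n [(f \<otimes> g, a)] [(f, a), (g, a + tgt f)]"
    unfolding equivalent_def using assms by auto
  have "sim False (word_of n [(g, a + src f), (f, a)]) (lay (a + src f) g c \<odot> lay a f (tgt g + c))"
    using word_pair[of g "a + src f" n f a False] w n by (simp add: algebra_simps del: word_of.simps)
  then have "sim False (word_of n [(f \<otimes> g, a)]) (word_of n [(g, a + src f), (f, a)])"
    using lay_tens(2)[OF w, of False a c] sim_trans sim_sym s by blast
  then show "equivalent False n [(f \<otimes> g, a)] [(g, a + src f), (f, a)]"
    unfolding equivalent_def using assms by auto
qed

lemma equivalent_empty:
  assumes "\<And>c. sim False (lay a f c) (identity (a + src f + c))" "well_typed f" "tgt f = src f" "a + src f \<le> n"
  shows "equivalent False n [(f, a)] []"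
  unfolding equivalent_def using sim_trans[OF word_single[of f a n False] assms(1)[of "n - a - src f"]] assms by simp

text \<open>Strands and units leave no trace; what remains are crossings, cups and caps with their
  offsets.\<close>

primrec expand :: "word \<Rightarrow> nat \<Rightarrow> (word \<times> nat) list" where
  "expand Unit a = []"
| "expand Strand a = []"
| "expand Cross a = [(Cross, a)]"
| "expand Cup a = [(Cup, a)]"
| "expand Cap a = [(Cap, a)]"
| "expand (f \<odot> g) a = expand f a @ expand g a"
| "expand (f \<otimes> g) a = expand f a @ expand g (a + tgt f)"

lemma equivalent_expand: "well_typed w ==> a + src w \<le> n ==> equivalent False n [(w, a)] (expand w a)"
proof (induction w arbitrary: a n)
  case Unit
  then show ?case using equivalent_empty[of a Unit n] lay_identity[of False a 0] by simp
next
  case Strand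
  then show ?case using equivalent_empty[of a Strand n] lay_strand[of False a] by simp
next
  case (Comp f g)
  have "equivalent False (out n [(f, a)]) [(g, a)] (expand g a)"
    by (rule Comp.IH(2)) (use Comp.prems in auto)
  from equivalent_append[OF Comp.IH(1) this] show ?case
    using equivalent_trans[OF equivalent_comp[OF Comp.prems(1)]] Comp.prems by simp
next
  case (Tens f g)
  have "equivalent False (out n [(f, a)]) [(g, a + tgt f)] (expand g (a + tgt f))"
    by (rule Tens.IH(2)) (use Tens.prems in auto)
  from equivalent_append[OF Tens.IH(1) this] show ?case
    using equivalent_trans[OF equivalent_tens(1)[OF Tens.prems(1)]] Tens.prems by simp
qed (auto intro: equivalent_refl)

lemma expand_identity: "expand (identity k) a = []"
  by (induction k arbitrary: a) auto

text \<open>Quantifying over the widths at which the left list fits removes the width from the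
  calculations. The price is asymmetry: the right list may also fit at smaller widths, as after
  cancelling two crossings.\<close>

definition yields :: "bool \<Rightarrow> (word \<times> nat) list \<Rightarrow> (word \<times> nat) list \<Rightarrow> bool" where
  "yields b L M \<longleftrightarrow> (\<forall>n. fits n L \<longrightarrow> equivalent b n L M)"

lemma yields_refl: "yields b L L" unfolding yields_def using equivalent_refl by blast

lemma yields_trans [trans]: "yields b L M ==> yields b M N ==> yields b L N"
  unfolding yields_def using equivalent_trans by (metis equivalent_def)

lemma yields_weaken: "yields False L M ==> yields b L M"
  unfolding yields_def using equivalent_weaken by blast

lemma yields_append: "yields b L L' ==> yields b M M' ==> yields b (L @ M) (L' @ M')"
  unfolding yields_def using equivalent_append by (metis fits_append)

lemma yields_left: "yields b L L' ==> yields b (L @ M) (L' @ M)"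
  by (rule yields_append[OF _ yields_refl])

lemma yields_right: "yields b M M' ==> yields b (L @ M) (L @ M')"
  by (rule yields_append[OF yields_refl])

lemma yields_cons: "yields b M M' ==> yields b (x # M) (x # M')"
  using yields_right[of b M M' "[x]"] by simp

text \<open>The \<open>d\<close> strands between the two layers are filled in by
  \<open>identity d\<close>; both orders are then expansions of one tensor product.\<close>

lemma exchange:
  assumes w: "well_typed f" "well_typed g"
  shows "yields False [(f, a), (g, a + tgt f + d)] [(g, a + src f + d), (f, a)]"
    and "yields False [(g, a + src f + d), (f, a)] [(f, a), (g, a + tgt f + d)]"
proof -
  have e: "equivalent False n [(f, a), (g, a + tgt f + d)] [(g, a + src f + d), (f, a)]"
    if n: "a + src f + d + src g \<le> n" for n
  proof -
    let ?h = "identity d \<otimes> g"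
    note i = identity_typed and ex = equivalent_expand
    have h: "equivalent False m [(?h, e)] [(g, e + d)]" if "e + d + src g \<le> m" for m e
    proof -
      have "equivalent False (out m [(identity d, e)]) [(g, e + d)] [(g, e + d)]"
        by (rule equivalent_refl) (use that w in \<open>simp add: i\<close>)
      moreover have "equivalent False m [(identity d, e)] []"
        using ex[of "identity d" e m] that by (simp add: i expand_identity)
      ultimately have "equivalent False m ([(identity d, e)] @ [(g, e + d)]) ([] @ [(g, e + d)])"
        by (intro equivalent_append)
      moreover have "equivalent False m [(?h, e)] [(identity d, e), (g, e + d)]"
        using equivalent_tens(1)[of "identity d" g e m] that w by (simp add: i)
      ultimately show ?thesis using equivalent_trans by simp
    qed
    have t: "well_typed (f \<otimes> ?h)" "a + src f + src ?h \<le> n" using w n by (simp_all add: i)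
    have 1: "equivalent False n [(f, a)] [(f, a)]" by (rule equivalent_refl) (use w n in simp)
    have 2: "equivalent False (out n [(f, a)]) [(?h, a + tgt f)] [(g, a + tgt f + d)]"
      by (rule h) (use n in simp)
    have 3: "equivalent False n [(?h, a + src f)] [(g, a + src f + d)]" by (rule h) (use n in simp)
    have 4: "equivalent False (out n [(?h, a + src f)]) [(f, a)] [(f, a)]"
      by (rule equivalent_refl) (use w n in \<open>simp add: i\<close>)
    have 5: "equivalent False n [(f \<otimes> ?h, a)] [(f, a), (g, a + tgt f + d)]"
      using equivalent_trans[OF equivalent_tens(1)[OF t(1)]] t(2) equivalent_append[OF 1 2] by simp
    have 6: "equivalent False n [(f \<otimes> ?h, a)] [(g, a + src f + d), (f, a)]"
      using equivalent_trans[OF equivalent_tens(2)[OF t(1)]] t(2) equivalent_append[OF 3 4] by simp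
    show ?thesis by (rule equivalent_trans[OF equivalent_sym[OF 5] 6])
  qed
  show "yields False [(f, a), (g, a + tgt f + d)] [(g, a + src f + d), (f, a)]"
    unfolding yields_def using e by auto
  show "yields False [(g, a + src f + d), (f, a)] [(f, a), (g, a + tgt f + d)]"
    unfolding yields_def using equivalent_sym[OF e] by auto
qed

text \<open>The condition on widths is there because expansion drops strands, so that a list may fit
  on fewer strands than the relation involves. The flag records a coefficient other than 1 and
  \<epsilon>; a relation with such a coefficient is not read backwards.\<close>

lemma yields_relation:
  assumes r: "(f, c, g) \<in> relations \<delta> \<epsilon>"
  shows "(\<And>n. fits n (expand f a) ==> a + src f \<le> n) ==> yields (c \<noteq> 1 \<and> c \<noteq> \<epsilon>) (expand f a) (expand g a)"
    and "c = 1 \<or> c = \<epsilon> ==> (\<And>n. fits n (expand g a) ==> a + src f \<le> n) ==> yields False (expand g a) (expand f a)"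
proof -
  let ?b = "c \<noteq> 1 \<and> c \<noteq> \<epsilon>"
  have t: "well_typed f" "well_typed g" "src f = src g" "tgt f = tgt g"
    using relation_same[OF r] unfolding same_def by auto
  then have "sim ?b f g" unfolding sim_def der_def using derivable.relation[OF r] by (intro exI[of _ c]) auto
  then have e: "equivalent ?b n (expand f a) (expand g a)" if "a + src f \<le> n" for n
    using equivalent_trans[OF equivalent_weaken[OF equivalent_sym[OF equivalent_expand]] equivalent_trans[OF equivalent_single equivalent_weaken[OF equivalent_expand]], of f a n ?b g]
      that t by auto
  show "(\<And>n. fits n (expand f a) ==> a + src f \<le> n) ==> yields ?b (expand f a) (expand g a)"
    unfolding yields_def using e by blast
  assume "c = 1 \<or> c = \<epsilon>" "\<And>n. fits n (expand g a) ==> a + src f \<le> n"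
  then show "yields False (expand g a) (expand f a)"
    unfolding yields_def using equivalent_sym e by (smt (verit, best))
qed

abbreviation X :: "nat \<Rightarrow> word \<times> nat" where "X i \<equiv> (Cross, i)"
abbreviation U :: "nat \<Rightarrow> word \<times> nat" where "U i \<equiv> (Cup, i)"
abbreviation A :: "nat \<Rightarrow> word \<times> nat" where "A i \<equiv> (Cap, i)"

lemma fits_three:
  "fits n [X i, X (Suc i), X i] ==> i + 3 \<le> n" "fits n [X i, U (Suc i)] ==> Suc (Suc (Suc i)) \<le> n"
  by auto

lemma X_X: "yields False [X i, X i] []"
  using yields_relation(1)[of "Cross \<odot> Cross" 1 "Strand \<otimes> Strand" i] by (simp add: relations_def)

lemma X_U: "yields False [X i, U i] [U i]"
  using yields_relation(1)[of "Cross \<odot> Cup" 1 Cup i] by (simp add: relations_def)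

text \<open>The coefficient \<delta> may be any scalar, even 0, so the removal of a circle is a
  rewriting up to a scalar only.\<close>

lemma A_U: "yields True [A i, U i] []"
  using yields_relation(1)[of "Cap \<odot> Cup" \<delta> Unit i] yields_weaken[of "[A i, U i]" "[]" True]
  by (cases "\<delta> \<noteq> 1 \<and> \<delta> \<noteq> \<epsilon>") (auto simp: relations_def)

lemma A_U_Suc: "yields False [A i, U (Suc i)] []"
  using yields_relation(1)[of "Cap \<otimes> Strand \<odot> Strand \<otimes> Cup" 1 Strand i] by (simp add: relations_def)

lemma A_Suc_U: "yields False [A (Suc i), U i] []"
  using yields_relation(1)[of "Strand \<otimes> Cap \<odot> Cup \<otimes> Strand" \<epsilon> Strand i] by (simp add: relations_def)

lemma A_X: "yields False [A i, X (Suc i)] [A (Suc i), X i]" "yields False [A (Suc i), X i] [A i, X (Suc i)]"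
  using yields_relation[of "Cap \<otimes> Strand \<odot> Strand \<otimes> Cross" 1 "Strand \<otimes> Cap \<odot> Cross \<otimes> Strand" i]
  by (simp_all add: relations_def)

lemma X_Suc_U: "yields False [X (Suc i), U i] [X i, U (Suc i)]" "yields False [X i, U (Suc i)] [X (Suc i), U i]"
  using fits_three(2)[of _ i] yields_relation[of "Strand \<otimes> Cross \<odot> Cup \<otimes> Strand" 1 "Cross \<otimes> Strand \<odot> Strand \<otimes> Cup" i]
  by (simp_all add: relations_def)

lemma U_U: "yields False [U (i + 2), U i] [U i, U i]"
  using yields_relation(1)[of "Strand \<otimes> Strand \<otimes> Cup \<odot> Cup" \<epsilon> "Cup \<otimes> Strand \<otimes> Strand \<odot> Cup" i]
  by (simp add: relations_def)

lemma X_X_X: "yields False [X i, X (Suc i), X i] [X (Suc i), X i, X (Suc i)]"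
  using fits_three(1)[of _ i] yields_relation(1)[of "Cross \<otimes> Strand \<odot> Strand \<otimes> Cross \<odot> Cross \<otimes> Strand" 1
    "Strand \<otimes> Cross \<odot> Cross \<otimes> Strand \<odot> Strand \<otimes> Cross" i] by (simp add: relations_def)

lemma X_X_far: "i + 2 \<le> j ==> yields False [X i, X j] [X j, X i]" "i + 2 \<le> j ==> yields False [X j, X i] [X i, X j]"
  using exchange[of Cross Cross i "j - (i + 2)"] by (auto dest!: le_Suc_ex)

lemma X_U_far: "i \<le> j ==> yields False [X (j + 2), U i] [U i, X j]"
  using exchange(2)[of Cup Cross i "j - i"] by simp

lemma U_X_far: "i \<le> j ==> yields False [U i, X j] [X (j + 2), U i]" "j + 2 \<le> i ==> yields False [U i, X j] [X j, U i]"
  using exchange(1)[of Cup Cross i "j - i"] exchange(2)[of Cross Cup j "i - (j + 2)"] by (auto dest!: le_Suc_ex)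

lemma A_X_far: "i + 2 \<le> j ==> yields False [A i, X j] [X (j - 2), A i]"
  using exchange(1)[of Cap Cross i "j - (i + 2)"] by (auto dest!: le_Suc_ex)

end

section \<open>Normal forms of words and the reduction to them\<close>

section \<open>Normal forms\<close>

context parameters
begin

text \<open>\<open>cup_to j\<close> joins the first and the \<open>(j + 2)\<close>-nd strand.\<close>

primrec cup_to :: "nat \<Rightarrow> (word \<times> nat) list" where
  "cup_to 0 = [U 0]"
| "cup_to (Suc j) = X (Suc j) # cup_to j"

definition cup_normal :: "nat list \<Rightarrow> (word \<times> nat) list" where
  "cup_normal js = concat (map cup_to js)"

lemma cup_normal_simps [simp]: "cup_normal [] = []" "cup_normal (j # js) = cup_to j @ cup_normal js"
  by (simp_all add: cup_normal_def)

text \<open>The cup with index \<open>j\<close> leaves \<open>2 * length js\<close> strands, so its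
  second end \<open>j + 2\<close> has to be one of the \<open>2 * length js + 2\<close> strands
  present before it.\<close>

fun valid :: "nat list \<Rightarrow> bool" where
  "valid [] = True"
| "valid (j # js) = (j \<le> 2 * length js \<and> valid js)"

lemma pair_context: "yields b [x, y] [z, w] ==> yields b (x # y # M) (z # w # M)"
  using yields_left[of b "[x, y]" "[z, w]" M] by simp

text \<open>The crossing lies to the right of the second end of the cup and slides below it; the two
  strands consumed by the cup account for the shift.\<close>

lemma X_cup_to_far: "j + 1 < i ==> yields False (X i # cup_to j) (cup_to j @ [X (i - 2)])"
proof (induction j)
  case 0 then show ?case using X_U_far[of 0 "i - 2"] by (simp add: numeral_eq_Suc Suc_diff_Suc)
next
  case (Suc j)
  have "yields False (X i # X (Suc j) # cup_to j) (X (Suc j) # X i # cup_to j)"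
    by (rule pair_context[OF X_X_far(2)]) (use Suc.prems in simp)
  also have "yields False \<dots> (X (Suc j) # cup_to j @ [X (i - 2)])"
    by (rule yields_cons[OF Suc.IH]) (use Suc.prems in simp)
  finally show ?case by simp
qed

text \<open>The crossing lies between the two ends of the cup. The braid relation carries it across
  the strand of the cup that runs to the left, and it moves by one because the first strand
  disappears.\<close>

lemma X_cup_to_near: "1 \<le> i ==> i < j ==> yields False (X i # cup_to j) (cup_to j @ [X (i - 1)])"
proof (induction j)
  case (Suc j)
  show ?case
  proof (cases "i = j")
    case True
    obtain k where j: "j = Suc k" using True Suc.prems by (cases j) auto
    have "yields False (X j # X (Suc j) # X j # cup_to k) (X (Suc j) # X j # X (Suc j) # cup_to k)"
      using yields_left[OF X_X_X[of j], of "cup_to k"] by simp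
    also have "yields False \<dots> (X (Suc j) # X j # cup_to k @ [X k])"
      using X_cup_to_far[of k "Suc j"] by (intro yields_cons) (simp add: j)
    finally show ?thesis using True j by simp
  next
    case False
    have "yields False (X i # X (Suc j) # cup_to j) (X (Suc j) # X i # cup_to j)"
      by (rule pair_context[OF X_X_far(1)]) (use Suc.prems False in simp)
    also have "yields False \<dots> (X (Suc j) # cup_to j @ [X (i - 1)])"
      by (rule yields_cons[OF Suc.IH]) (use Suc.prems False in simp_all)
    finally show ?thesis by simp
  qed
qed simp

text \<open>Fixing the number \<open>m\<close> of cups makes it visible that crossings preserve it,
  cups raise it and caps lower it by one.\<close>

definition normalizes :: "bool \<Rightarrow> nat \<Rightarrow> (word \<times> nat) list \<Rightarrow> bool" where
  "normalizes b m L \<longleftrightarrow> (\<exists>js. valid js \<and> length js = m \<and> yields b L (cup_normal js))"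

lemma normalizes_yields: "yields b L M ==> normalizes b m M ==> normalizes b m L"
  unfolding normalizes_def using yields_trans by blast

lemma normalizes_cons:
  assumes "normalizes b m M" "\<And>js. valid js ==> length js = m ==> normalizes b m' (x # cup_normal js)"
  shows "normalizes b m' (x # M)"
  using assms normalizes_yields[OF yields_cons] unfolding normalizes_def[of b m M] by blast

lemma normalizes_append:
  assumes "normalizes b m M" "\<And>x js. x \<in> set K ==> valid js ==> length js = m ==> normalizes b m (x # cup_normal js)"
  shows "normalizes b m (K @ M)"
  using assms(2)
proof (induction K)
  case (Cons x K)
  then have "normalizes b m (K @ M)" by simp
  from normalizes_cons[OF this] show ?case using Cons.prems by simp
qed (use assms(1) in simp)

lemma normalizes_cup_to:
  assumes "normalizes b m M" "j \<le> 2 * m"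
  shows "normalizes b (Suc m) (cup_to j @ M)"
proof -
  obtain js where js: "valid js" "length js = m" "yields b M (cup_normal js)" using assms unfolding normalizes_def by blast
  show ?thesis unfolding normalizes_def
    by (rule exI[of _ "j # js"]) (use js assms(2) yields_right[OF js(3), of "cup_to j"] in simp)
qed

lemma normalizes_self: "valid js ==> length js = m ==> normalizes b m (cup_normal js)"
  unfolding normalizes_def using yields_refl by blast

text \<open>A descending run of crossings at the offsets j + p - 1, ..., p. The cup
  \<open>cup_to j\<close> is the run \<open>Xs 1 j\<close> closed by \<open>U 0\<close>.\<close>

definition Xs :: "nat \<Rightarrow> nat \<Rightarrow> (word \<times> nat) list" where
  "Xs p j = map (\<lambda>i. X (i + p)) (rev [0..<j])"

lemma Xs_simps [simp]: "Xs p 0 = []" "Xs p (Suc j) = X (j + p) # Xs p j"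
  by (simp_all add: Xs_def)

lemma Xs_set: "x \<in> set (Xs p j) ==> \<exists>i. x = X i \<and> p \<le> i \<and> i < j + p"
  by (auto simp: Xs_def)

lemma cup_to_Xs: "cup_to j = Xs 1 j @ [U 0]"
  by (induction j) auto

lemma Xs_shift: "Xs p (Suc j) = Xs (Suc p) j @ [X p]"
  by (induction j) auto

lemma cup_to_Suc: "cup_to (Suc j) = Xs 2 j @ [X 1, U 0]"
  unfolding cup_to_Xs Xs_shift by (simp add: numeral_eq_Suc)

lemma X_Xs_far: "i + 2 \<le> p ==> yields False (X i # Xs p j @ M) (Xs p j @ X i # M)"
proof (induction j)
  case (Suc j)
  have "yields False (X i # X (j + p) # Xs p j @ M) (X (j + p) # X i # Xs p j @ M)"
    by (rule pair_context[OF X_X_far(1)]) (use Suc.prems in simp)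
  also have "yields False \<dots> (X (j + p) # Xs p j @ X i # M)" by (rule yields_cons[OF Suc.IH[OF Suc.prems]])
  finally show ?case by simp
qed (simp add: yields_refl)

lemma U_Xs_far: "i \<le> p ==> yields False (U i # Xs p j @ M) (Xs (p + 2) j @ U i # M)"
proof (induction j)
  case (Suc j)
  have "yields False (U i # X (j + p) # Xs p j @ M) (X (j + p + 2) # U i # Xs p j @ M)"
    by (rule pair_context[OF U_X_far(1)]) (use Suc.prems in simp)
  also have "yields False \<dots> (X (j + p + 2) # Xs (p + 2) j @ U i # M)" by (rule yields_cons[OF Suc.IH[OF Suc.prems]])
  finally show ?case by (simp add: add.assoc)
qed (simp add: yields_refl)

lemma A_Xs_far: "i + 2 \<le> p ==> yields False (A i # Xs p j @ M) (Xs (p - 2) j @ A i # M)"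
proof (induction j)
  case (Suc j)
  have "yields False (A i # X (j + p) # Xs p j @ M) (X (j + p - 2) # A i # Xs p j @ M)"
    by (rule pair_context[OF A_X_far]) (use Suc.prems in simp)
  also have "yields False \<dots> (X (j + p - 2) # Xs (p - 2) j @ A i # M)" by (rule yields_cons[OF Suc.IH[OF Suc.prems]])
  finally show ?case using Suc.prems by simp
qed (simp add: yields_refl)

text \<open>Lowers the offset of a cup at the expense of crossings. The two relations used are read
  backwards, which is legitimate because the longer list fits at every width at which the cup
  does.\<close>

lemma U_Suc: "yields False [U (Suc i)] [X i, X (Suc i), U i]"
proof -
  have "equivalent False n [U (Suc i)] [X i, X (Suc i), U i]" if "Suc i + 2 \<le> n" for n
  proof -
    have f: "fits n [X i, X (Suc i), U i]" using that by auto
    have "yields False [X i, X (Suc i), U i] [X i, X i, U (Suc i)]" by (rule yields_cons[OF X_Suc_U(1)])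
    also have "yields False \<dots> [U (Suc i)]" using yields_left[OF X_X[of i], of "[U (Suc i)]"] by simp
    finally show ?thesis using f equivalent_sym unfolding yields_def by blast
  qed
  then show ?thesis unfolding yields_def by simp
qed

lemma A_Suc: "yields False [A (Suc i)] [A i, X (Suc i), X i]"
proof -
  have "equivalent False n [A (Suc i)] [A i, X (Suc i), X i]" if "Suc i \<le> n" for n
  proof -
    have f: "fits n [A i, X (Suc i), X i]" using that by auto
    have "yields False ([A i, X (Suc i)] @ [X i]) ([A (Suc i), X i] @ [X i])" by (rule yields_left[OF A_X(1)])
    also have "yields False \<dots> [A (Suc i)]" using yields_right[OF X_X[of i], of "[A (Suc i)]"] by simp
    finally show ?thesis using f equivalent_sym unfolding yields_def by auto
  qed
  then show ?thesis unfolding yields_def by simp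
qed

text \<open>Turns two nested cups into two neighbouring ones. Inserting a pair of cancelling
  crossings lets the inner cup slide to offset 2, where \<open>U_U\<close> exchanges the order of
  the two cups.\<close>

lemma U_one_zero: "yields False [U 1, U 0] [X 2, X 1, U 0, U 0]"
proof -
  have "equivalent False n [U 1, U 0] [X 2, X 1, U 0, U 0]" if "4 \<le> n" for n
  proof -
    have f: "fits n [X 2, X 1, U 0, U 0]" "fits n [X 2, X 1, U 2, U 0]" using that by auto
    have 1: "yields False [X 2, X 1, U 2, U 0] [X 2, X 1, U 0, U 0]"
      using yields_right[OF U_U[of 0], of "[X 2, X 1]"] by (simp add: numeral_eq_Suc)
    have "yields False [X 2, X 1, U 2, U 0] [X 2, X 2, U 1, U 0]"
      using yields_cons[OF yields_left[OF X_Suc_U(2)[of 1], of "[U 0]"], of "X 2"] by (simp add: numeral_eq_Suc)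
    also have "yields False \<dots> [U 1, U 0]" using yields_left[OF X_X[of 2], of "[U 1, U 0]"] by simp
    finally show ?thesis using f 1 equivalent_sym equivalent_trans unfolding yields_def by blast
  qed
  then show ?thesis unfolding yields_def by auto
qed

text \<open>A crossing that avoids the first strand (\<open>pos\<close>) slides through the first
  cup if it lies beyond or strictly between its ends; otherwise it touches the second end and
  changes the index \<open>j\<close> by one. The difficult crossing is that of the first two
  strands, which affects two cups at once.\<close>

lemma X_normal:
  "valid js ==> length js = m ==> i + 2 \<le> 2 * m ==> normalizes False m (X i # cup_normal js)"
proof (induction m arbitrary: i js)
  case (Suc m)
  have IH: "normalizes False m (X i # cup_normal js)" if "valid js" "length js = m" "i + 2 \<le> 2 * m" for i js
    by (rule Suc.IH[OF that])
  have pos: "normalizes False (Suc m) (X i # cup_normal js)"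
    if v: "valid js" "length js = Suc m" and i: "i + 2 \<le> 2 * Suc m" "1 \<le> i" for i js
  proof -
    obtain j ks where js: "js = j # ks" using v by (cases js) auto
    then have k: "valid ks" "length ks = m" "j \<le> 2 * m" using v by auto
    consider "j + 1 < i" | "i = Suc j" | "i = j" | "i < j" by linarith
    then show ?thesis
    proof cases
      case 1
      have "normalizes False m (X (i - 2) # cup_normal ks)" by (rule IH) (use k i 1 in auto)
      from normalizes_cup_to[OF this k(3)] show ?thesis
        using normalizes_yields[OF yields_left[OF X_cup_to_far[OF 1]], of "Suc m" "cup_normal ks"] js by simp
    next
      case 2
      have "normalizes False (Suc m) (cup_normal (i # ks))" by (rule normalizes_self) (use k i in auto)
      then show ?thesis using js 2 by simp
    next
      case 3
      obtain j' where j': "j = Suc j'" using 3 i by (cases j) auto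
      have "normalizes False (Suc m) (cup_normal (j' # ks))" by (rule normalizes_self) (use k j' in auto)
      then show ?thesis using js 3 j' normalizes_yields[OF yields_left[OF X_X[of j], of "cup_to j' @ cup_normal ks"]] by simp
    next
      case 4
      have "normalizes False m (X (i - 1) # cup_normal ks)" by (rule IH) (use k i 4 in auto)
      from normalizes_cup_to[OF this k(3)] show ?thesis
        using normalizes_yields[OF yields_left[OF X_cup_to_near[OF i(2) 4]], of "Suc m" "cup_normal ks"] js by simp
    qed
  qed
  have Xs: "normalizes False (Suc m) (Xs p j @ M)" if "normalizes False (Suc m) M" "1 \<le> p" "j + p \<le> 2 * m + 1" for p j M
    by (rule normalizes_append[OF that(1)]) (use that(2,3) Xs_set pos in fastforce)
  show ?case
  proof (cases "1 \<le> i")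
    case True
    then show ?thesis using pos Suc.prems by simp
  next
    case False
    then have i0: "i = 0" by simp
    obtain j ks where js: "js = j # ks" using Suc.prems by (cases js) auto
    then have k: "valid ks" "length ks = m" "j \<le> 2 * m" using Suc.prems by auto
    show ?thesis
    proof (cases j)
      case 0
      have "normalizes False (Suc m) (cup_normal js)" by (rule normalizes_self) (use Suc.prems in auto)
      then show ?thesis using normalizes_yields[OF yields_left[OF X_U[of 0], of "cup_normal ks"]] js 0 i0 by simp
    next
      case (Suc j')
      \<comment> \<open>The second cup is opened as well. The crossing turns the first cup into
        \<open>U 1\<close>, which becomes nested in the second; after \<open>U_one_zero\<close> only
        crossings at offsets at least 1 are left in front of two neighbouring cups, and these are
        covered by \<open>pos\<close>.\<close>
      obtain q ls where ks: "ks = q # ls" using k Suc by (cases ks) auto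
      obtain m' where m': "m = Suc m'" using k ks by auto
      have l: "valid ls" "length ls = m'" "q \<le> 2 * m'" using k ks m' by auto
      let ?R = "cup_normal ls"
      have "yields False (X 0 # Xs 2 j' @ X 1 # U 0 # cup_to q @ ?R) (Xs 2 j' @ X 0 # X 1 # U 0 # cup_to q @ ?R)"
        by (rule X_Xs_far) simp
      also have "yields False \<dots> (Xs 2 j' @ U 1 # cup_to q @ ?R)"
      proof (rule yields_right)
        have "yields False [X 0, X 1, U 0] [X 0, X 0, U 1]" using yields_cons[OF X_Suc_U(1)[of 0]] by simp
        also have "yields False \<dots> [U 1]" using yields_left[OF X_X[of 0], of "[U 1]"] by simp
        finally show "yields False (X 0 # X 1 # U 0 # cup_to q @ ?R) (U 1 # cup_to q @ ?R)"
          using yields_left[of False "[X 0, X 1, U 0]" "[U 1]"] by simp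
      qed
      also have "yields False \<dots> (Xs 2 j' @ Xs 3 q @ U 1 # U 0 # ?R)"
        using yields_right[OF U_Xs_far[of 1 1 q "U 0 # ?R"]] by (simp add: cup_to_Xs numeral_eq_Suc)
      also have "yields False \<dots> (Xs 2 j' @ Xs 3 q @ X 2 # X 1 # U 0 # U 0 # ?R)"
        using yields_right[OF yields_right[OF yields_left[OF U_one_zero]]] by simp
      finally have y: "yields False (X 0 # Xs 2 j' @ X 1 # U 0 # cup_to q @ ?R) (Xs 2 j' @ Xs 3 q @ X 2 # X 1 # U 0 # U 0 # ?R)" .
      have "normalizes False (Suc m) (cup_normal (0 # 0 # ls))" by (rule normalizes_self) (use l m' in auto)
      then have "normalizes False (Suc m) (Xs 2 j' @ Xs 3 q @ Xs 1 2 @ cup_normal (0 # 0 # ls))"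
        by (intro Xs) (use l k m' Suc in auto)
      then have "normalizes False (Suc m) (X 0 # Xs 2 j' @ X 1 # U 0 # cup_to q @ ?R)"
        by (intro normalizes_yields[OF y]) (simp add: numeral_eq_Suc)
      then show ?thesis using js i0 ks Suc by (simp add: cup_to_Suc del: cup_to.simps(2))
    qed
  qed
qed simp

lemma U_normal:
  "valid js ==> length js = m ==> a \<le> 2 * m ==> normalizes False (Suc m) (U a # cup_normal js)"
proof (induction a)
  case 0
  then show ?case using normalizes_self[of "0 # js" "Suc m"] by simp
next
  case (Suc a)
  have "normalizes False (Suc m) ([X a, X (Suc a)] @ U a # cup_normal js)"
    by (rule normalizes_append) (use Suc X_normal in auto)
  then show ?case using normalizes_yields[OF yields_left[OF U_Suc[of a], of "cup_normal js"]] by simp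
qed

lemma normalizes_weaken: "normalizes False m L ==> normalizes b m L"
  unfolding normalizes_def using yields_weaken by blast

text \<open>A cap at offset 0 meets the first cup in both ends, which gives a circle, or in one end,
  which gives a strand to be pulled straight; the remaining crossings move by two and are absorbed.
  A cap at a larger offset is brought to the left by crossings.\<close>

lemma A_normal:
  "valid js ==> length js = Suc m ==> a \<le> 2 * m ==> normalizes True m (A a # cup_normal js)"
proof (induction a arbitrary: js)
  case 0
  obtain j ks where js: "js = j # ks" using 0 by (cases js) auto
  then have k: "valid ks" "length ks = m" "j \<le> 2 * m" using 0 by auto
  let ?R = "cup_normal ks"
  have R: "normalizes b m ?R" for b by (rule normalizes_self[OF k(1,2)])
  show ?case
  proof (cases j)
    case 0
    then show ?thesis using js normalizes_yields[OF yields_left[OF A_U[of 0], of ?R]] R by simp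
  next
    case (Suc j')
    have "yields False [A 0, X 1, U 0] [A 1, X 0, U 0]" using yields_left[OF A_X(1)[of 0], of "[U 0]"] by simp
    also have "yields False \<dots> [A 1, U 0]" using yields_cons[OF X_U[of 0]] by simp
    also have "yields False \<dots> []" using A_Suc_U[of 0] by simp
    finally have z: "yields False ([A 0, X 1, U 0] @ ?R) ([] @ ?R)" by (rule yields_left)
    have "yields False (A 0 # Xs 2 j' @ X 1 # U 0 # ?R) (Xs 0 j' @ A 0 # X 1 # U 0 # ?R)"
      using A_Xs_far[of 0 2] by simp
    also have "yields False \<dots> (Xs 0 j' @ ?R)" using yields_right[OF z] by simp
    finally have y: "yields False (A 0 # Xs 2 j' @ X 1 # U 0 # ?R) (Xs 0 j' @ ?R)" .
    have "normalizes False m (Xs 0 j' @ ?R)"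
    proof (rule normalizes_append[OF R])
      fix x js assume "x \<in> set (Xs 0 j')" "valid js" "length js = m"
      then show "normalizes False m (x # cup_normal js)"
        using Xs_set[of x 0 j'] X_normal[of js m] k(3) Suc by fastforce
    qed
    then have "normalizes True m (A 0 # Xs 2 j' @ X 1 # U 0 # ?R)"
      by (rule normalizes_weaken[OF normalizes_yields[OF y]])
    then show ?thesis using js Suc by (simp add: cup_to_Suc del: cup_to.simps(2))
  qed
next
  case (Suc a)
  have "normalizes False (Suc m) (x # cup_normal ks)"
    if "x \<in> set [X (Suc a), X a]" "valid ks" "length ks = Suc m" for x ks
    using that(1) X_normal[OF that(2,3), of a] X_normal[OF that(2,3), of "Suc a"] Suc.prems(3) by auto
  from normalizes_append[OF normalizes_self[OF Suc.prems(1,2)] this]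
  have "normalizes False (Suc m) ([X (Suc a), X a] @ cup_normal js)" .
  then have "normalizes True m (A a # [X (Suc a), X a] @ cup_normal js)"
    by (rule normalizes_cons[OF normalizes_weaken]) (use Suc.IH Suc.prems(3) in simp)
  then show ?case
    using normalizes_yields[OF yields_weaken[OF yields_left[OF A_Suc[of a], of "cup_normal js"]]] by simp
qed

definition generators :: "(word \<times> nat) set" where
  "generators = {Cross, Cup, Cap} \<times> UNIV"

lemma expand_generators: "set (expand w a) \<subseteq> generators"
  by (induction w arbitrary: a) (auto simp: generators_def)

text \<open>The list is built up from its bottom end, where no strand is left, by adding one layer
  on top at a time.\<close>

lemma cups_normal:
  "set L \<subseteq> generators ==> fits n L ==> out n L = 0 ==> \<exists>m. n = 2 * m \<and> normalizes True m L"
proof (induction L arbitrary: n)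
  case Nil
  then show ?case using normalizes_self[of "[]" 0] by auto
next
  case (Cons x L)
  obtain w a where x: "x = (w, a)" by (cases x)
  have f: "a + src w \<le> n" "fits (n - src w + tgt w) L" "out (n - src w + tgt w) L = 0" using Cons.prems x by auto
  obtain m where m: "n - src w + tgt w = 2 * m" "normalizes True m L"
    using Cons.IH[OF _ f(2,3)] Cons.prems by auto
  consider "w = Cross" | "w = Cup" | "w = Cap" using Cons.prems(1) x by (auto simp: generators_def)
  then show ?case
  proof cases
    case 1
    then have n: "n = 2 * m" using m f by auto
    have "normalizes True m (x # L)"
      by (rule normalizes_cons[OF m(2)]) (use X_normal normalizes_weaken x 1 f n in auto)
    then show ?thesis using n by blast
  next
    case 2
    then have n: "n = 2 * Suc m" using m f by auto
    have "normalizes True (Suc m) (x # L)"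
      by (rule normalizes_cons[OF m(2)]) (use U_normal normalizes_weaken x 2 f n in auto)
    then show ?thesis using n by blast
  next
    case 3
    then obtain m' where m': "m = Suc m'" using m f by (cases m) auto
    then have n: "n = 2 * m'" using m 3 by auto
    have "normalizes True m' (x # L)"
      by (rule normalizes_cons[OF m(2)]) (use A_normal x 3 f n m' in auto)
    then show ?thesis using n by blast
  qed
qed

text \<open>A layer to the right of all strands of \<open>L\<close> is disjoint from each layer of
  \<open>L\<close> and moves up past one after the other.\<close>

lemma outermost_commute:
  assumes "set L \<subseteq> generators" "fits n L" "well_typed g"
  shows "yields False (L @ [(g, out n L)]) ((g, n) # L)"
  using assms(1,2)
proof (induction L arbitrary: n)
  case (Cons x L)
  obtain w a where x: "x = (w, a)" by (cases x)
  let ?k = "n - src w + tgt w"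
  have f: "well_typed w" "a + src w \<le> n" "fits ?k L" using Cons.prems x by auto
  have "yields False (x # L @ [(g, out ?k L)]) (x # (g, ?k) # L)"
    by (rule yields_cons[OF Cons.IH]) (use Cons.prems f in auto)
  also have "yields False \<dots> ((g, n) # x # L)"
  proof (rule pair_context)
    show "yields False [x, (g, ?k)] [(g, n), x]"
      using exchange(1)[OF f(1) assms(3), of a "n - src w - a"] f(2) x by (simp add: algebra_simps)
  qed
  finally show ?case using x by simp
qed (simp add: yields_refl)

lemma fits_add: "fits n L ==> fits (n + k) L \<and> out (n + k) L = out n L + k"
  by (induction n L rule: fits.induct) (auto simp: add.commute add.left_commute)

text \<open>At the right edge of the output of \<open>L\<close> a cap followed by a cup is a
  straight strand. Pulling the cap up to the top bends the last bottom vertex. The \<open>k\<close>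
  additional strands run idly on the right.\<close>

lemma bend:
  assumes "set L \<subseteq> generators" "fits n L" "out n L = Suc s"
  shows "equivalent False (n + k) L (A n # L @ [U s])"
proof -
  have f: "fits (n + k) (L @ [A (Suc s), U s])" "fits (n + k) L" using fits_add[OF assms(2), of k] assms(3) by auto
  have 1: "yields False (L @ [A (Suc s), U s]) (A n # L @ [U s])"
    using yields_left[OF outermost_commute[OF assms(1,2), of Cap], of "[U s]"] assms(3) by simp
  have "yields False (L @ [A (Suc s), U s]) L" using yields_right[OF A_Suc_U[of s], of L] by simp
  then show ?thesis using 1 f equivalent_sym equivalent_trans unfolding yields_def by blast
qed

text \<open>The caps at the start of a normal form bend the bottom vertices up to the right of the top ones.\<close>

definition normal :: "nat \<Rightarrow> nat \<Rightarrow> nat list \<Rightarrow> (word \<times> nat) list" where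
  "normal r s js = map A [r..<r + s] @ cup_normal js"

text \<open>The statement for all \<open>k\<close> is what the induction requires: every new cap
  leaves one of its legs as an idle strand, so the hypothesis is used for
  \<open>Suc k\<close>.\<close>

lemma list_normal:
  "set L \<subseteq> generators ==> fits r L ==> out r L = s ==>
   \<exists>js. valid js \<and> r + s = 2 * length js \<and> (\<forall>k. equivalent True (r + k) L (normal r s js))"
proof (induction s arbitrary: L r)
  case 0
  obtain m where m: "r = 2 * m" "normalizes True m L" using cups_normal[OF 0] by blast
  then obtain js where js: "valid js" "length js = m" "yields True L (cup_normal js)" unfolding normalizes_def by blast
  have "equivalent True (r + k) L (normal r 0 js)" for k
    using js(3) fits_add[OF 0(2), of k] unfolding yields_def normal_def by simp
  then show ?case using js m by auto
next
  case (Suc s)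
  have g: "set (L @ [U s]) \<subseteq> generators" using Suc.prems(1) by (auto simp: generators_def)
  have f: "fits (Suc r) (L @ [U s])" "out (Suc r) (L @ [U s]) = s"
    using fits_add[OF Suc.prems(2), of 1] Suc.prems(3) by auto
  obtain js where js: "valid js" "Suc r + s = 2 * length js" "\<forall>k. equivalent True (Suc r + k) (L @ [U s]) (normal (Suc r) s js)"
    using Suc.IH[OF g f] by blast
  have "equivalent True (r + k) L (normal r (Suc s) js)" for k
  proof -
    have "equivalent True (r + k) ([A r] @ (L @ [U s])) ([A r] @ normal (Suc r) s js)"
      by (rule equivalent_append[OF equivalent_refl]) (use js(3)[rule_format, of "Suc k"] in simp_all)
    moreover have "[A r] @ normal (Suc r) s js = normal r (Suc s) js"
      unfolding normal_def by (simp add: upt_conv_Cons del: upt_Suc)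
    moreover have "equivalent True (r + k) L ([A r] @ (L @ [U s]))"
      using equivalent_weaken[OF bend[OF Suc.prems]] by simp
    ultimately show ?thesis using equivalent_trans by metis
  qed
  then show ?case using js by auto
qed

theorem word_normal:
  assumes "w \<in> words r s"
  shows "\<exists>js c. valid js \<and> r + s = 2 * length js \<and> fits r (normal r s js) \<and> out r (normal r s js) = s \<and>
    derivable \<delta> \<epsilon> r s (basis w) (scale c (basis (word_of r (normal r s js))))"
proof -
  have w: "well_typed w" "src w = r" "tgt w = s" using assms by (auto simp: words_def)
  have e: "equivalent True r [(w, 0)] (expand w 0)" by (rule equivalent_weaken[OF equivalent_expand]) (use w in simp_all)
  then obtain js where js: "valid js" "r + s = 2 * length js" "\<forall>k. equivalent True (r + k) (expand w 0) (normal r s js)"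
    using list_normal[OF expand_generators, of r w 0 s] w unfolding equivalent_def by auto
  have n: "equivalent True r [(w, 0)] (normal r s js)" using equivalent_trans[OF e] js(3)[rule_format, of 0] by simp
  have wu: "well_typed (w \<otimes> Unit)" using w by simp
  have "sim False (lay 0 w 0) w"
    unfolding lay_def identity.simps by (rule sim_trans[OF sim_unit_left[OF wu] sim_unit_right[OF w(1)]])
  moreover have "sim False (word_of r [(w, 0)]) (lay 0 w 0)"
    using word_single[OF w(1), of 0 r False] w(2) by (simp del: word_of.simps)
  ultimately have "sim True w (word_of r [(w, 0)])" using sim_weaken[OF sim_sym[OF sim_trans]] by blast
  moreover have "sim True (word_of r [(w, 0)]) (word_of r (normal r s js))" using n unfolding equivalent_def by (elim conjE)
  ultimately have s: "sim True w (word_of r (normal r s js))" by (rule sim_trans)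
  have "fits r (normal r s js)" "out r (normal r s js) = s" using n w unfolding equivalent_def by simp_all
  moreover obtain c where "derivable \<delta> \<epsilon> r s (basis w) (scale c (basis (word_of r (normal r s js))))"
    using s w unfolding sim_def der_def by blast
  ultimately show ?thesis using js(1,2) by blast
qed

end

section \<open>Linear independence and spanning of the normal forms\<close>

section \<open>Normal forms and Brauer diagrams\<close>

text \<open>The permutation effected by the crossings of \<open>cup_to j\<close>. It fixes vertex 1
  and carries vertex 2 to \<open>j + 2\<close>.\<close>

primrec cycle :: "nat \<Rightarrow> vertex \<Rightarrow> vertex" where
  "cycle 0 = id"
| "cycle (Suc j) = swap_top (j + 2) \<circ> cycle j"

lemma swap_top_swap_top [simp]: "swap_top i (swap_top i v) = v"
  by (cases v) simp_all

lemma cycle_bij: "bij (cycle j)"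
proof (induction j)
  case (Suc j)
  have "bij (swap_top i)" for i by (rule o_bij[of "swap_top i"]) (simp_all add: fun_eq_iff)
  then show ?case unfolding cycle.simps using Suc bij_comp by blast
qed (simp add: bij_id del: cycle.simps(2) flip: id_def)

lemma cycle_one: "cycle j (Top 1) = Top 1"
  by (induction j) (simp_all add: sw_def)

lemma cycle_two: "cycle j (Top 2) = Top (j + 2)"
  by (induction j) (simp_all add: sw_def)

lemma cycle_image: "j + 2 \<le> n ==> cycle j ` Top ` {1..n} = Top ` {1..n}"
proof (induction j)
  case (Suc j)
  then have "cycle (Suc j) ` Top ` {1..n} = swap_top (j + 2) ` Top ` {1..n}" by (metis Suc_leD add_Suc cycle.simps(2) image_comp)
  also have "\<dots> = Top ` sw (j + 2) ` {1..n}" by (simp add: image_image)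
  finally show ?case using sw_image[of "j + 2" n] Suc.prems by simp
qed simp

lemma map_edges_inj: "inj f ==> map_edges f A = map_edges f B ==> A = B"
  unfolding map_edges_def by (meson inj_image_eq_iff inj_on_image inj_on_subset subset_UNIV)

definition cup_over :: "vertex set set \<Rightarrow> vertex set set" where
  "cup_over E = insert {Top 1, Top 2} (map_edges (shift 2 0) E)"

text \<open>The matching drawn by \<open>cup_normal js\<close>, given by a recursion that does not
  mention composition, so that it can be inverted combinatorially.\<close>

primrec cup_edges :: "nat list \<Rightarrow> vertex set set" where
  "cup_edges [] = {}"
| "cup_edges (j # js) = map_edges (cycle j) (cup_over (cup_edges js))"

lemma shift_two: "Top 1 \<notin> \<Union>(map_edges (shift 2 0) E)" "Top 2 \<notin> shift 2 0 ` ends n 0"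
proof -
  have "shift 2 0 v \<noteq> Top 1" for v by (cases v) simp_all
  then show "Top 1 \<notin> \<Union>(map_edges (shift 2 0) E)" unfolding Union_map_edges by (metis imageE)
qed auto

lemma cup_over_inj: "cup_over E = cup_over E' ==> E = E'"
proof -
  assume a: "cup_over E = cup_over E'"
  have n: "{Top 1, Top 2} \<notin> map_edges (shift 2 0) F" for F using shift_two(1)[of F] by blast
  have "map_edges (shift 2 0) E = map_edges (shift 2 0) E'"
    using a n[of E] n[of E'] unfolding cup_over_def by (rule insert_ident[THEN iffD1, rotated 2])
  then show ?thesis by (rule map_edges_inj[OF shift_inj])
qed

lemma cup_edges_first: "{Top 1, Top (j + 2)} \<in> cup_edges (j # js)"
proof -
  have "cycle j ` {Top 1, Top 2} \<in> cup_edges (j # js)" unfolding cup_edges.simps cup_over_def map_edges_def by blast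
  then show ?thesis unfolding image_insert image_empty cycle_one cycle_two .
qed

lemma null_space_zero: "null_space \<epsilon> 0 0 = {0}"
proof -
  have "L = []" if "(E, L) \<in> marked_diagrams 0 0" for E L
  proof -
    have m: "matching E" "\<Union>E = {}" "marked (E, L)"
      using that marks_ok_marked unfolding marked_diagrams_iff brauer_iff by auto
    have "E = {}" using matchingD(2)[OF m(1)] m(2) by fastforce
    then show ?thesis using m(3) by (simp add: marked_def)
  qed
  then have "diagram_relations \<epsilon> 0 0 = {}" unfolding diagram_relations_def by fastforce
  then show ?thesis by (simp add: null_space_def)
qed

text \<open>The linear functional that reads off the coefficient of the Brauer diagram
  \<open>E\<close>, with a sign compensating for the markings. Its value is a multiple of the empty
  diagram, so that \<open>linear_extension_respects\<close> applies with a target whose null space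
  is 0.\<close>

definition coordinate :: "'k::field \<Rightarrow> vertex set set \<Rightarrow> diagram \<Rightarrow> (diagram \<Rightarrow>\<^sub>0 'k)" where
  "coordinate \<epsilon> E D = (if fst D = E then scale (sign \<epsilon> (SOME \<rho>. arrangement \<rho> E) (snd D)) (basis ({}, [])) else 0)"

lemma coordinate_nonzero: "\<epsilon> * \<epsilon> = (1::'k::field) ==> scale a (coordinate \<epsilon> E (E, L)) = 0 ==> a = 0"
proof -
  assume e: "\<epsilon> * \<epsilon> = 1" and z: "scale a (coordinate \<epsilon> E (E, L)) = 0"
  let ?s = "sign \<epsilon> (SOME \<rho>. arrangement \<rho> E) L"
  have "Poly_Mapping.lookup (scale a (coordinate \<epsilon> E (E, L))) ({}, []) = a * ?s" by (simp add: coordinate_def basis_def)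
  then have "a * ?s = 0" using z by simp
  then show ?thesis using sign_sq[OF e, of "SOME \<rho>. arrangement \<rho> E" L] by auto
qed

text \<open>The factor is the product of the two signs, whose square is 1.\<close>

lemma remark:
  assumes "\<epsilon> * \<epsilon> = (1::'k::field)" "(E, L) \<in> marked_diagrams r s" "(E, L') \<in> marked_diagrams r s"
  obtains k where "k \<noteq> 0" "cong \<epsilon> r s (basis (E, L)) (scale k (basis (E, L')))"
proof -
  have b: "brauer_diagram r s E" "marks_ok top_flow E L" "marks_ok top_flow E L'" using assms by (auto simp: marked_diagrams_iff)
  obtain \<rho> where \<rho>: "arrangement \<rho> E" using brauer_arrangement[OF b(1)] by blast
  interpret remarking \<epsilon> r s E \<rho> using assms(1) b(1) \<rho> by unfold_locales
  have sq: "sign \<epsilon> \<rho> L * sign \<epsilon> \<rho> L = 1" "sign \<epsilon> \<rho> L' * sign \<epsilon> \<rho> L' = 1" using sign_sq[OF assms(1)] by auto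
  have "cong \<epsilon> r s (scale (sign \<epsilon> \<rho> L) (N L)) (scale (sign \<epsilon> \<rho> L) (N L'))" by (rule cong_scale[OF N_unique[OF b(2,3)]])
  then have "cong \<epsilon> r s (basis (E, L)) (scale (sign \<epsilon> \<rho> L * sign \<epsilon> \<rho> L') (basis (E, L')))" unfolding N_def using sq by simp
  moreover have "sign \<epsilon> \<rho> L * sign \<epsilon> \<rho> L' \<noteq> 0" using sq by auto
  ultimately show ?thesis using that by blast
qed

definition brauers :: "nat \<Rightarrow> nat \<Rightarrow> vertex set set set" where
  "brauers r s = {E. brauer_diagram r s E}"

lemma brauers_finite: "finite (brauers r s)"
proof -
  have "brauers r s \<subseteq> Pow (Pow (ends r s))" unfolding brauers_def brauer_iff by auto
  then show ?thesis by (rule finite_subset) simp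
qed

text \<open>Turning the bottom vertices into top vertices r + 1, ..., r + s is injective on
  diagrams. For the count below the inequality is enough.\<close>

lemma brauers_card: "card (brauers r s) \<le> card (brauers (r + s) 0)"
proof -
  define f where "f v = (case v of Top i \<Rightarrow> Top i | Mid i \<Rightarrow> Mid i | Bot i \<Rightarrow> Top (r + i))" for v
  have inj: "inj_on f (ends r s)" by (auto simp: inj_on_def f_def)
  have im: "f ` ends r s = ends (r + s) 0"
  proof -
    have "Top ` {1..r + s} = Top ` {1..r} \<union> Top ` {r + 1..r + s}" by (simp add: ivl_disj_un_two(6)[symmetric] image_Un[symmetric] del: image_Un) (rule arg_cong[of _ _ "(`) Top"], auto)
    then show ?thesis unfolding ends_image f_def using add_image[of Top r s] by simp
  qed
  have "inj_on (map_edges f) (brauers r s)"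
  proof (rule inj_onI)
    fix E E' assume "E \<in> brauers r s" "E' \<in> brauers r s" and eq: "map_edges f E = map_edges f E'"
    then have "E \<subseteq> Pow (ends r s)" "E' \<subseteq> Pow (ends r s)" unfolding brauers_def brauer_iff by auto
    then show "E = E'" using inj_on_image_eq_iff[OF inj_on_image_Pow[OF inj], of E E'] eq unfolding map_edges_def by simp
  qed
  moreover have "map_edges f ` brauers r s \<subseteq> brauers (r + s) 0"
  proof
    fix F assume "F \<in> map_edges f ` brauers r s"
    then obtain E where E: "F = map_edges f E" "matching E" "\<Union>E = ends r s" unfolding brauers_def brauer_iff by blast
    have "\<Union>F = ends (r + s) 0" unfolding E(1) Union_map_edges E(3) by (rule im)
    moreover have "matching F" unfolding E(1) by (rule matching_map[OF E(2)]) (use inj E(3) in simp)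
    ultimately show "F \<in> brauers (r + s) 0" unfolding brauers_def brauer_iff by simp
  qed
  ultimately show ?thesis using brauers_finite by (rule card_inj_on_le)
qed

context parameters
begin

lemma coordinate_respects:
  assumes "cong \<epsilon> r s x 0"
  shows "linear_extension (coordinate \<epsilon> E) x = 0"
proof -
  have "cong \<epsilon> 0 0 (linear_extension (coordinate \<epsilon> E) x) (linear_extension (coordinate \<epsilon> E) 0)"
  proof (rule linear_extension_respects[OF assms])
    fix E' K K' assume D: "(E', K) \<in> marked_diagrams r s" "elementary K K'"
    have "coordinate \<epsilon> E (E', K) = scale \<epsilon> (coordinate \<epsilon> E (E', K'))"
    proof (cases "E' = E")
      case True
      have b: "brauer_diagram r s E" "marked (E, K)" using D(1) True marks_ok_marked by (auto simp: marked_diagrams_iff)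
      define \<rho> where "\<rho> = (SOME \<rho>. arrangement \<rho> E)"
      have "arrangement \<rho> E" unfolding \<rho>_def by (rule someI_ex[OF brauer_arrangement[OF b(1)]])
      then have "sign \<epsilon> \<rho> K = \<epsilon> * sign \<epsilon> \<rho> K'"
        using D(2) b(2) sign_swap[OF ee] sign_reverse[OF ee] unfolding elementary_def by blast
      then show ?thesis using True by (simp add: coordinate_def \<rho>_def)
    qed (simp add: coordinate_def)
    then show "cong \<epsilon> 0 0 (coordinate \<epsilon> E (E', K)) (scale \<epsilon> (coordinate \<epsilon> E (E', K')))" by simp
  qed
  then show ?thesis by (simp add: cong_def null_space_zero linear_extension_zero)
qed

text \<open>The index \<open>j\<close> is read off from the partner \<open>j + 2\<close> of the
  first vertex. Undoing the cycle and removing the cup leaves a diagram on two vertices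
  fewer.\<close>

lemma brauer_cup_surj: "brauer_diagram (2 * m) 0 E ==> \<exists>js. valid js \<and> length js = m \<and> cup_edges js = E"
proof (induction m arbitrary: E)
  case 0
  then have m: "matching E" "\<Union>E = {}" unfolding brauer_iff by auto
  then have "E = {}" using matchingD(2)[OF m(1)] by fastforce
  then show ?case by (intro exI[of _ "[]"]) simp
next
  case (Suc m)
  then have m: "matching E" "\<Union>E = Top ` {1..2 * m + 2}" unfolding brauer_iff by auto
  have "Top 1 \<in> \<Union>E" unfolding m(2) by simp
  then obtain e where e: "e \<in> E" "Top 1 \<in> e" by blast
  obtain v where v: "e = {Top 1, v}" "v \<noteq> Top 1" using matchingD(2)[OF m(1) e(1)] e(2) unfolding card_2_iff by fastforce
  then have "v \<in> Top ` {1..2 * m + 2}" using e(1) m(2) by blast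
  then obtain p where p: "v = Top p" "p \<in> {1..2 * m + 2}" by blast
  then have "p \<noteq> 1" using v by auto
  then obtain j where j: "p = j + 2" "j \<le> 2 * m" using p(2) by (intro that[of "p - 2"]) auto
  define F where "F = map_edges (inv (cycle j)) E"
  have c: "bij (cycle j)" by (rule cycle_bij)
  have EF: "map_edges (cycle j) F = E"
    unfolding F_def map_edges_comp using c by (simp add: map_edges_def bij_is_surj surj_iff[THEN iffD1])
  have i: "inv (cycle j) (Top 1) = Top 1" "inv (cycle j) (Top (j + 2)) = Top 2"
    using inv_f_f[OF bij_is_inj[OF c]] cycle_one[of j] cycle_two[of j] by metis+
  have F: "matching F" unfolding F_def
    by (rule matching_map[OF m(1)]) (rule inj_on_subset[OF bij_is_inj[OF bij_imp_bij_inv[OF c]] subset_UNIV])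
  have "\<Union>F = inv (cycle j) ` cycle j ` Top ` {1..2 * m + 2}"
    unfolding F_def Union_map_edges m(2) by (subst cycle_image) (use j in simp_all)
  then have UF: "\<Union>F = Top ` {1..2 * m + 2}" using bij_is_inj[OF c] by (simp add: image_inv_f_f)
  have "inv (cycle j) ` e \<in> F" unfolding F_def map_edges_def using e(1) by (rule imageI)
  then have eF: "{Top 1, Top 2} \<in> F" unfolding v(1) p(1) j(1) image_insert image_empty i .
  define G where "G = F - {{Top 1, Top 2}}"
  have G: "matching G" unfolding G_def by (rule matching_subset[OF F]) blast
  have not: "Top 1 \<notin> \<Union>G" "Top 2 \<notin> \<Union>G" using matchingD(3)[OF F eF] unfolding G_def by auto
  have "\<Union>F = \<Union>G \<union> {Top 1, Top 2}" unfolding G_def using eF by blast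
  then have UG: "\<Union>G = Top ` {3..2 * m + 2}"
  proof -
    assume a: "\<Union>F = \<Union>G \<union> {Top 1, Top 2}"
    have "\<Union>G = \<Union>F - {Top 1, Top 2}" using a not by blast
    moreover have "{1..2 * m + 2} = insert 1 (insert 2 {3..2 * m + 2})" by auto
    ultimately show ?thesis unfolding UF by auto
  qed
  define g where "g v = (case v of Top i \<Rightarrow> Top (i - 2) | _ \<Rightarrow> v)" for v
  have sg: "shift 2 0 (g v) = v" if "v \<in> \<Union>G" for v using that unfolding UG g_def by auto
  define H where "H = map_edges g G"
  have "matching H" unfolding H_def by (rule matching_map[OF G]) (metis inj_onI sg)
  moreover have "\<Union>H = ends (2 * m) 0"
  proof -
    have "i \<in> (\<lambda>i. i - 2) ` {3..2 * m + 2}" if "i \<in> {1..2 * m}" for i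
      using that by (intro image_eqI[of _ _ "i + 2"]) auto
    then have "(\<lambda>i. i - 2) ` {3..2 * m + 2} = {1..2 * m}" by auto
    then have "Top ` (\<lambda>i. i - 2) ` {3..2 * m + 2} = Top ` {1..2 * m}" by simp
    then show ?thesis unfolding H_def Union_map_edges UG g_def by (simp add: image_image)
  qed
  ultimately have "brauer_diagram (2 * m) 0 H" unfolding brauer_iff by simp
  then obtain js where js: "valid js" "length js = m" "cup_edges js = H" using Suc.IH by blast
  have "map_edges (shift 2 0) H = map_edges id G" unfolding H_def map_edges_comp by (rule map_edges_cong) (simp add: sg)
  then have "cup_over H = F" unfolding cup_over_def G_def using eF by (simp add: map_edges_def insert_absorb)
  then have "cup_edges (j # js) = E" using EF js by simp
  then show ?case using js j by (intro exI[of _ "j # js"]) simp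
qed

text \<open>Retains the edge set and the fact that the coefficient is nonzero, and forgets the
  coefficient and the markings. This much is stable under rewriting up to a sign.\<close>

definition shape :: "word \<Rightarrow> vertex set set \<Rightarrow> bool" where
  "shape w E \<longleftrightarrow> (\<exists>c L. c \<noteq> 0 \<and> evaluates w c (E, L))"

lemma shape_sim:
  assumes "shape g E" "sim False f g" "CHAR('k) \<noteq> 2"
  shows "shape f E"
proof -
  obtain c L where g: "c \<noteq> 0" "evaluates g c (E, L)" using assms(1) unfolding shape_def by blast
  obtain d where d: "d = 1 \<or> d = \<epsilon>" "der d f g" using assms(2) unfolding sim_def by blast
  have t: "well_typed f" "well_typed g" "src g = src f" "tgt g = tgt f"
    and "derivable \<delta> \<epsilon> (src f) (tgt f) (basis f) (scale d (basis g))" using d(2) unfolding der_def by auto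
  then have "cong \<epsilon> (src f) (tgt f) (rep f) (scale d (rep g))"
    using soundness[OF _ assms(3)] by (fastforce simp: linear_extension_basis linear_extension_scale)
  moreover have "cong \<epsilon> (src f) (tgt f) (scale d (rep g)) (scale d (scale c (basis (E, L))))"
    by (rule cong_scale[OF rep_evaluates[OF _ g(2)]]) (use t in \<open>simp add: words_def\<close>)
  ultimately have "cong \<epsilon> (src f) (tgt f) (rep f) (scale (d * c) (basis (E, L)))" using cong_trans by fastforce
  then have "evaluates f (d * c) (E, L)"
    using g(2) t rep_coset[of f "src f" "tgt f"] unfolding evaluates_def coset_eq_iff[symmetric] by (simp add: words_def)
  moreover have "d * c \<noteq> 0" using d(1) g(1) ee by auto
  ultimately show ?thesis unfolding shape_def by blast
qed

lemma evaluates_lay_cross: "evaluates (lay i Cross k) 1 (swap_diagram (i + (2 + k)) (Suc i))"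
proof -
  have "evaluates (Cross \<otimes> identity k) 1 (swap_diagram (2 + k) 1)"
    using evaluates_tens[OF evaluates_base(3) evaluates_identity[of k]] juxtapose_swap_identity[of 1 2 k] by simp
  from evaluates_tens[OF evaluates_identity[of i] this] show ?thesis
    unfolding lay_def identity_typed using juxtapose_identity_swap[of 1 i "2 + k"] by simp
qed

lemma shape_swap:
  assumes "shape W E" "src W = i + (2 + k)"
  shows "shape (lay i Cross k \<odot> W) (map_edges (swap_top (Suc i)) E)"
proof -
  obtain c L where g: "c \<noteq> 0" "evaluates W c (E, L)" using assms(1) unfolding shape_def by blast
  have "evaluates (lay i Cross k \<odot> W) c (map_diagram (swap_top (Suc i)) (E, L))"
    by (rule evaluates_swap_left[OF _ g(2)]) (use evaluates_lay_cross[of i k] assms(2) in simp_all)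
  then show ?thesis unfolding shape_def map_diagram_def using g(1) by auto
qed

text \<open>Up to a sign the cup layer followed by \<open>W\<close> is the tensor product
  \<open>Cup \<otimes> W\<close>, whose value is a mere juxtaposition.\<close>

lemma shape_cup:
  assumes "shape W E" "well_typed W" "src W = n" "CHAR('k) \<noteq> 2"
  shows "shape (lay 0 Cup n \<odot> W) (cup_over E)"
proof (rule shape_sim[OF _ _ assms(4)])
  obtain c L where g: "c \<noteq> 0" "evaluates W c (E, L)" using assms(1) unfolding shape_def by blast
  show "shape (Cup \<otimes> W) (cup_over E)"
    using evaluates_tens[OF evaluates_base(4) g(2)] g(1) unfolding shape_def cup_over_def cup_diagram_def by auto
  note i = identity_typed
  have "sim False (lay 0 Cup n \<odot> W) ((Cup \<otimes> identity n) \<odot> (Unit \<otimes> W))"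
    unfolding lay_def identity.simps
    by (intro sim_comp sim_unit_left sim_sym[OF sim_unit_left]) (use assms in \<open>simp_all add: i\<close>)
  moreover have "sim False ((Cup \<otimes> identity n) \<odot> (Unit \<otimes> W)) ((Cup \<odot> Unit) \<otimes> (identity n \<odot> W))"
    by (rule sim_interchange) (use assms in \<open>simp_all add: i\<close>)
  moreover have "sim False ((Cup \<odot> Unit) \<otimes> (identity n \<odot> W)) (Cup \<otimes> W)"
    using sim_identity_right[of Cup 0] sim_identity_left[of W n] assms by (intro sim_tens) simp_all
  ultimately show "sim False (lay 0 Cup n \<odot> W) (Cup \<otimes> W)" using sim_trans by blast
qed

lemma fits_cup_to: "j \<le> n ==> fits (n + 2) (cup_to j) \<and> out (n + 2) (cup_to j) = n"
  by (induction j) auto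

lemma fits_cup_normal: "valid js ==> fits (2 * length js + k) (cup_normal js) \<and> out (2 * length js + k) (cup_normal js) = k"
proof (induction js)
  case (Cons j js)
  then show ?case using fits_cup_to[of j "2 * length js + k"] by (simp add: add.commute add.left_commute)
qed simp

lemma shape_cup_to:
  assumes "shape (word_of n L) E" "fits n L" "CHAR('k) \<noteq> 2"
  shows "j \<le> n ==> shape (word_of (n + 2) (cup_to j @ L)) (map_edges (cycle j) (cup_over E))"
proof (induction j)
  case 0
  have "shape (lay 0 Cup n \<odot> word_of n L) (cup_over E)"
    by (rule shape_cup) (use assms word_of_typed[OF assms(2)] in simp_all)
  then show ?case by (simp add: map_edges_def)
next
  case (Suc j)
  have f: "fits (n + 2) (cup_to j @ L)" using fits_cup_to[of j n] assms(2) Suc.prems by simp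
  have "shape (lay (Suc j) Cross (n - Suc j) \<odot> word_of (n + 2) (cup_to j @ L)) (map_edges (swap_top (Suc (Suc j))) (map_edges (cycle j) (cup_over E)))"
    by (rule shape_swap) (use Suc word_of_typed[OF f] in simp_all)
  then show ?case by (simp add: map_edges_comp comp_def)
qed

lemma shape_normal: "valid js ==> CHAR('k) \<noteq> 2 ==> shape (word_of (2 * length js) (cup_normal js)) (cup_edges js)"
proof (induction js)
  case Nil
  show ?case using evaluates_base(1) unfolding shape_def identity_diagram_def by (auto intro!: exI[of _ 1])
next
  case (Cons j js)
  then show ?case
    using shape_cup_to[of "2 * length js" "cup_normal js" "cup_edges js" j] fits_cup_normal[of js 0] by (simp add: add.commute)
qed

lemma shape_marked: "shape w E ==> brauer_diagram (src w) (tgt w) E"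
  unfolding shape_def evaluates_def by (auto simp: marked_diagrams_iff)

text \<open>The partner of vertex 1 determines the first index; cycle and cup can then be
  undone.\<close>

lemma cup_edges_inj:
  "valid js ==> valid js' ==> length js = length js' ==> cup_edges js = cup_edges js' ==> CHAR('k) \<noteq> 2 ==> js = js'"
proof (induction js arbitrary: js')
  case (Cons j js)
  obtain j' ks where js': "js' = j' # ks" using Cons.prems(3) by (cases js') auto
  have m: "matching (cup_edges (j # js))"
    using shape_marked[OF shape_normal[OF Cons.prems(1,5)]] unfolding brauer_iff by simp
  have "{Top 1, Top (j' + 2)} \<in> cup_edges (j # js)"
    unfolding Cons.prems(4) js' by (rule cup_edges_first)
  from matchingD(3)[OF m cup_edges_first this, of "Top 1"] have "{Top 1, Top (j + 2)} = {Top 1, Top (j' + 2)}" by simp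
  then have j: "j' = j" by (auto simp: doubleton_eq_iff)
  have "cup_over (cup_edges js) = cup_over (cup_edges ks)"
    by (rule map_edges_inj[OF bij_is_inj[OF cycle_bij[of j]]]) (use Cons.prems(4) js' j in simp)
  then have c: "cup_edges js = cup_edges ks" by (rule cup_over_inj)
  have "js = ks" by (rule Cons.IH[OF _ _ _ c Cons.prems(5)]) (use Cons.prems(1-3) js' in simp_all)
  then show ?case using js' j by simp
qed simp

text \<open>Undoes the bending of the bottom vertices.\<close>

primrec cups_down :: "nat \<Rightarrow> (word \<times> nat) list" where
  "cups_down 0 = []"
| "cups_down (Suc s) = U s # cups_down s"

lemma fits_cups_down: "fits (s + s) (cups_down s) \<and> out (s + s) (cups_down s) = 0"
  by (induction s) simp_all

lemma normal_Suc: "normal r (Suc s) js = A r # normal (Suc r) s js"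
  unfolding normal_def by (simp add: upt_conv_Cons del: upt_Suc)

lemma cup_to_generators: "set (cup_to j) \<subseteq> generators"
  by (induction j) (auto simp: generators_def)

lemma normal_generators: "set (normal r s js) \<subseteq> generators"
  using cup_to_generators unfolding normal_def cup_normal_def by (fastforce simp: generators_def)

lemma fits_normal: "valid js ==> r + s = 2 * length js ==> fits r (normal r s js) \<and> out r (normal r s js) = s"
proof (induction s arbitrary: r)
  case 0
  then show ?case using fits_cup_normal[of js 0] by (simp add: normal_def)
next
  case (Suc s)
  then show ?case using fits_add[of "Suc r" "normal (Suc r) s js" 1] unfolding normal_Suc by simp
qed

text \<open>Each added cup is moved up along the right edge until it meets the matching cap of the
  normal form and forms a snake with it.\<close>

lemma unbend:
  "valid js ==> r + s = 2 * length js ==> yields False (normal r s js @ cups_down s) (cup_normal js)"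
proof (induction s arbitrary: r)
  case 0
  then show ?case by (simp add: normal_def yields_refl)
next
  case (Suc s)
  let ?M = "normal (Suc r) s js"
  have f: "fits (Suc r) ?M" "out (Suc r) ?M = s" using fits_normal[of js "Suc r" s] Suc.prems by simp_all
  have "yields False (A r # (?M @ [U s]) @ cups_down s) (A r # (U (Suc r) # ?M) @ cups_down s)"
    using outermost_commute[OF normal_generators f(1), of Cup] f(2) by (intro yields_cons yields_left) simp
  also have "yields False \<dots> (?M @ cups_down s)"
    using yields_left[OF A_U_Suc[of r], of "?M @ cups_down s"] by simp
  also have "yields False \<dots> (cup_normal js)" by (rule Suc.IH) (use Suc.prems in simp_all)
  finally show ?case unfolding normal_Suc by simp
qed

lemma expand_word_of: "set L \<subseteq> generators ==> expand (word_of n L) 0 = L"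
proof (induction n L rule: fits.induct)
  case (2 n w a L)
  then have "expand w a = [(w, a)]" by (auto simp: generators_def)
  then show ?case using 2 by (simp add: lay_def expand_identity identity_typed)
qed (simp add: expand_identity)

lemma sim_unbend:
  assumes v: "valid js" "r + s = 2 * length js"
  shows "sim False ((word_of r (normal r s js) \<otimes> identity s) \<odot> word_of (s + s) (cups_down s)) (word_of (r + s) (cup_normal js))"
proof -
  let ?L = "normal r s js"
  let ?W = "word_of r ?L" and ?u = "word_of (s + s) (cups_down s)"
  note i = identity_typed
  have f: "fits r ?L" "out r ?L = s" using fits_normal[OF v] by auto
  have f': "fits (r + s) ?L" "out (r + s) ?L = s + s" using fits_add[OF f(1), of s] f(2) by auto
  have t: "well_typed ?W" "src ?W = r" "tgt ?W = s" using word_of_typed[OF f(1)] f(2) by auto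
  have u: "well_typed ?u" "src ?u = s + s" using word_of_typed fits_cups_down by blast+
  have "equivalent False (r + s) [(?W, 0)] ?L"
    using equivalent_expand[OF t(1), of 0 "r + s"] t expand_word_of[OF normal_generators] by simp
  then have "sim False (word_of (r + s) [(?W, 0)]) (word_of (r + s) ?L)" unfolding equivalent_def by (elim conjE)
  moreover have "sim False (word_of (r + s) [(?W, 0)]) (lay 0 ?W s)"
    using word_single[OF t(1), of 0 "r + s" False] t by (simp del: word_of.simps)
  moreover have "sim False (lay 0 ?W s) (?W \<otimes> identity s)"
    unfolding lay_def identity.simps(1) by (rule sim_unit_left) (use t i in simp)
  ultimately have "sim False (?W \<otimes> identity s) (word_of (r + s) ?L)" using sim_trans sim_sym by meson
  then have "sim False ((?W \<otimes> identity s) \<odot> ?u) (word_of (r + s) ?L \<odot> ?u)"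
    by (rule sim_comp[OF _ sim_refl]) (use t u i in simp_all)
  moreover have "sim False (word_of (r + s) ?L \<odot> ?u) (word_of (r + s) (?L @ cups_down s))"
    using sim_sym[OF word_append[of "r + s" ?L "cups_down s"]] f' fits_cups_down[of s] by simp
  moreover have "sim False (word_of (r + s) (?L @ cups_down s)) (word_of (r + s) (cup_normal js))"
    using unbend[OF v] f' fits_cups_down[of s] unfolding yields_def equivalent_def by simp
  ultimately show ?thesis using sim_trans by meson
qed

text \<open>The functional \<open>coordinate \<epsilon> (E i)\<close> annihilates all members of the
  family except the one with index \<open>i\<close>.\<close>

lemma independent:
  assumes J: "finite J" and w: "\<And>j. j \<in> J ==> w j \<in> words r s" "\<And>j. j \<in> J ==> shape (w j) (E j)" and inj: "inj_on E J"
    and z: "cong \<epsilon> r s (\<Sum>j\<in>J. scale (a j) (rep (w j))) 0" and i: "i \<in> J"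
  shows "a i = 0"
proof -
  have "\<forall>j\<in>J. \<exists>c L. c \<noteq> 0 \<and> evaluates (w j) c (E j, L)" using w(2) unfolding shape_def by blast
  then obtain c L where c: "\<And>j. j \<in> J ==> c j \<noteq> 0" "\<And>j. j \<in> J ==> evaluates (w j) (c j) (E j, L j)" by metis
  let ?h = "linear_extension (coordinate \<epsilon> (E i))"
  have "cong \<epsilon> r s (\<Sum>j\<in>J. scale (a j) (scale (c j) (basis (E j, L j)))) (\<Sum>j\<in>J. scale (a j) (rep (w j)))"
    by (intro cong_sum cong_scale cong_sym[OF rep_evaluates[OF w(1) c(2)]])
  from cong_trans[OF this z] have "?h (\<Sum>j\<in>J. scale (a j) (scale (c j) (basis (E j, L j)))) = 0" by (rule coordinate_respects)
  then have "(\<Sum>j\<in>J. scale (a j * c j) (coordinate \<epsilon> (E i) (E j, L j))) = 0"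
    by (simp add: linear_extension_sum linear_extension_scale linear_extension_basis)
  moreover have "scale (a j * c j) (coordinate \<epsilon> (E i) (E j, L j)) = 0" if "j \<in> J - {i}" for j
    using that inj_onD[OF inj, of j i] i by (auto simp: coordinate_def)
  ultimately have "scale (a i * c i) (coordinate \<epsilon> (E i) (E i, L i)) = 0"
    using sum.remove[OF J i, of "\<lambda>j. scale (a j * c j) (coordinate \<epsilon> (E i) (E j, L j))"] by simp
  then have "a i * c i = 0" by (rule coordinate_nonzero[OF ee])
  then show ?thesis using c(1)[OF i] by simp
qed

definition indices :: "nat \<Rightarrow> nat \<Rightarrow> nat list set" where
  "indices r s = {js. valid js \<and> r + s = 2 * length js}"

abbreviation nf :: "nat \<Rightarrow> nat \<Rightarrow> nat list \<Rightarrow> word" where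
  "nf r s js \<equiv> word_of r (normal r s js)"

lemma nf_words: "js \<in> indices r s ==> nf r s js \<in> words r s"
  using word_of_typed[of r "normal r s js"] fits_normal[of js r s] unfolding indices_def words_def by simp

lemma indices_bij:
  assumes "CHAR('k) \<noteq> 2" "even (r + s)"
  shows "bij_betw cup_edges (indices r s) (brauers (r + s) 0)"
  unfolding bij_betw_def
proof (intro conjI inj_onI set_eqI iffI)
  fix js js' assume "js \<in> indices r s" "js' \<in> indices r s" "cup_edges js = cup_edges js'"
  then show "js = js'" using cup_edges_inj assms(1) unfolding indices_def by auto
next
  fix E assume "E \<in> cup_edges ` indices r s"
  then obtain js where js: "E = cup_edges js" "valid js" "r + s = 2 * length js" unfolding indices_def by auto
  have t: "well_typed (word_of (2 * length js) (cup_normal js)) \<and> src (word_of (2 * length js) (cup_normal js)) = 2 * length js \<and>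
      tgt (word_of (2 * length js) (cup_normal js)) = 0"
    using word_of_typed[of "2 * length js" "cup_normal js"] fits_cup_normal[OF js(2), of 0] by simp
  show "E \<in> brauers (r + s) 0"
    using shape_marked[OF shape_normal[OF js(2) assms(1)]] js t unfolding brauers_def by simp
next
  fix E assume "E \<in> brauers (r + s) 0"
  then have "brauer_diagram (2 * ((r + s) div 2)) 0 E" using assms(2) unfolding brauers_def by simp
  then obtain js where "valid js" "length js = (r + s) div 2" "cup_edges js = E" using brauer_cup_surj by blast
  then show "E \<in> cup_edges ` indices r s" using assms(2) unfolding indices_def by auto
qed

lemma indices_finite: "CHAR('k) \<noteq> 2 ==> finite (indices r s)"
proof (cases "even (r + s)")
  case True
  assume "CHAR('k) \<noteq> 2"
  then show ?thesis using bij_betw_finite[OF indices_bij[OF _ True]] brauers_finite by blast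
next
  case False
  then have "r + s \<noteq> 2 * n" for n by (metis dvd_triv_left)
  then have "indices r s = {}" unfolding indices_def by simp
  then show ?thesis by simp
qed

lemma nf_exprs: "(\<Sum>js\<in>indices r s. scale (a js) (basis (nf r s js))) \<in> exprs r s"
  unfolding exprs_def by (intro combinations_sum_in combinations_scale combinations_basis nf_words)

text \<open>Tensoring with \<open>identity s\<close> and composing with the cups of
  \<open>cups_down\<close> carries a linear relation among the normal forms to one among words with
  \<open>s = 0\<close>, whose edge sets \<open>cup_edges js\<close> are known and distinct. The
  edges of the normal forms themselves are never computed.\<close>

lemma nf_independent:
  assumes ch: "CHAR('k) \<noteq> 2" and z: "cong \<epsilon> r s (\<Sum>js\<in>indices r s. scale (a js) (rep (nf r s js))) 0"
    and i: "i \<in> indices r s"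
  shows "a i = 0"
proof -
  let ?J = "indices r s" and ?u = "word_of (s + s) (cups_down s)"
  let ?w = "\<lambda>js. (nf r s js \<otimes> identity s) \<odot> ?u"
  have J: "finite ?J" by (rule indices_finite[OF ch])
  have u: "?u \<in> words (s + s) 0" using word_of_typed fits_cups_down unfolding words_def by simp
  define x where "x = (\<Sum>js\<in>?J. scale (a js) (basis (nf r s js)))"
  have x: "x \<in> exprs r s" "0 \<in> exprs r s" unfolding x_def exprs_def using nf_exprs combinations_zero by (auto simp: exprs_def)
  have e: "basis (identity s) \<in> exprs s s" "basis ?u \<in> exprs (s + s) 0" "0 \<in> exprs (r + s) (s + s)"
    unfolding exprs_def by (auto intro: combinations_basis combinations_zero simp: u) (simp add: combinations_basis words_def identity_typed)
  have cx: "cong \<epsilon> r s (ev x) (ev 0)"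
    using z unfolding x_def by (simp add: linear_extension_sum linear_extension_scale linear_extension_basis linear_extension_zero)
  let ?y = "bilinear_extension (\<lambda>f g. basis (f \<otimes> g)) x (basis (identity s))"
  have b: "bilinear_extension h (\<Sum>js\<in>?J. scale (a js) (basis (v js))) (basis g) = (\<Sum>js\<in>?J. scale (a js) (h (v js) g))"
    for h :: "word \<Rightarrow> word \<Rightarrow> (word \<Rightarrow>\<^sub>0 'k)" and v g
    unfolding bilinear_left by (simp add: linear_extension_sum linear_extension_scale linear_extension_basis)
  have b0: "bilinear_extension h 0 y = 0" for h :: "word \<Rightarrow> word \<Rightarrow> (word \<Rightarrow>\<^sub>0 'k)" and y
    unfolding bilinear_left by (rule linear_extension_zero)
  have y: "?y \<in> exprs (r + s) (s + s)" "cong \<epsilon> (r + s) (s + s) (ev ?y) (ev 0)"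
    using ev_tens_cong[OF x e(1,1) cx cong_refl] unfolding b0 by simp_all
  have "cong \<epsilon> (r + s) 0 (ev (bilinear_extension (\<lambda>f g. basis (f \<odot> g)) ?y (basis ?u))) (ev 0)"
    using ev_comp_cong(2)[OF y(1) e(3) e(2,2) y(2) cong_refl] unfolding b0 .
  then have c: "cong \<epsilon> (r + s) 0 (\<Sum>js\<in>?J. scale (a js) (rep (?w js))) 0"
    unfolding x_def b by (simp add: linear_extension_sum linear_extension_scale linear_extension_basis linear_extension_zero)
  show ?thesis
  proof (rule independent[OF J _ _ _ c i])
    fix js assume "js \<in> ?J"
    then have js: "valid js" "r + s = 2 * length js" unfolding indices_def by auto
    show "?w js \<in> words (r + s) 0"
      using nf_words[OF \<open>js \<in> ?J\<close>] u by (auto simp: words_def identity_typed)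
    show "shape (?w js) (cup_edges js)"
      by (rule shape_sim[OF _ sim_unbend[OF js] ch]) (use shape_normal[OF js(1) ch] js(2) in simp)
  next
    show "inj_on cup_edges ?J" using cup_edges_inj ch unfolding inj_on_def indices_def by auto
  qed
qed

text \<open>Independence alone yields that the coefficients \<open>c js\<close> are nonzero and that
  the edge sets \<open>F js\<close> are pairwise different, for normal forms with the same edges
  would be proportional. As there are at least as many indices as Brauer diagrams for (r, s), every
  Brauer diagram occurs.\<close>

lemma nf_spans_diagrams:
  assumes ch: "CHAR('k) \<noteq> 2" and D: "(E, L) \<in> marked_diagrams r s"
  obtains w k where "w \<in> words r s" "cong \<epsilon> r s (basis (E, L)) (scale k (rep w))"
proof -
  let ?J = "indices r s"
  have J: "finite ?J" by (rule indices_finite[OF ch])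
  have "\<forall>js\<in>?J. \<exists>c F K. evaluates (nf r s js) c (F, K) \<and> rep (nf r s js) = scale c (basis (F, K))"
    using nf_words unfolding words_def by (metis (mono_tags, lifting) mem_Collect_eq rep surj_pair)
  then obtain c F K where c: "\<And>js. js \<in> ?J ==> evaluates (nf r s js) (c js) (F js, K js)"
      "\<And>js. js \<in> ?J ==> rep (nf r s js) = scale (c js) (basis (F js, K js))" by metis
  have M: "(F js, K js) \<in> marked_diagrams r s" if "js \<in> ?J" for js
    using c(1)[OF that] nf_words[OF that] unfolding evaluates_def words_def by simp
  have c0: "c js \<noteq> 0" if js: "js \<in> ?J" for js
  proof
    assume "c js = 0"
    then have "(\<Sum>i\<in>?J. scale (if i = js then 1 else 0) (rep (nf r s i))) = 0"
      using c(2)[OF js] by (intro sum.neutral) auto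
    then show False using nf_independent[OF ch, of r s "\<lambda>i. if i = js then 1 else 0" js] js by simp
  qed
  have "inj_on F ?J"
  proof (rule inj_onI, rule ccontr)
    fix i j assume ij: "i \<in> ?J" "j \<in> ?J" "F i = F j" "i \<noteq> j"
    obtain k where k: "cong \<epsilon> r s (basis (F i, K i)) (scale k (basis (F i, K j)))"
      using remark[OF ee M[OF ij(1)], of "K j"] M[OF ij(2)] ij(3) by auto
    \<comment> \<open>The dependency between \<open>c i\<close> times a diagram and
      \<open>c j\<close> times its other marking, which differ by the factor
      \<open>k\<close>.\<close>
    define a where "a l = (if l = i then c j else if l = j then - (c i * k) else 0)" for l
    have "(\<Sum>l\<in>?J. scale (a l) (rep (nf r s l))) = (\<Sum>l\<in>{i, j}. scale (a l) (rep (nf r s l)))"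
      by (rule sum.mono_neutral_right[OF J]) (use ij in \<open>auto simp: a_def\<close>)
    also have "\<dots> = scale (c i * c j) (basis (F i, K i)) - scale (c i * c j) (scale k (basis (F i, K j)))"
      using ij c(2) by (simp add: a_def comb.scale_minus_left mult.commute mult.left_commute)
    finally have "cong \<epsilon> r s (\<Sum>l\<in>?J. scale (a l) (rep (nf r s l))) 0" using cong_scale[OF k, of "c i * c j"] unfolding cong_def by simp
    then have "a i = 0" by (rule nf_independent[OF ch _ ij(1)])
    then show False using c0[OF ij(2)] by (simp add: a_def)
  qed
  then have "card (F ` ?J) = card ?J" by (rule card_image)
  moreover have "even (r + s)" using marked_length(2)[OF D] by simp
  then have "card ?J = card (brauers (r + s) 0)" using bij_betw_same_card[OF indices_bij[OF ch]] by blast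
  moreover have sub: "F ` ?J \<subseteq> brauers r s" using M unfolding brauers_def by (auto simp: marked_diagrams_iff)
  ultimately have "F ` ?J = brauers r s" using card_seteq[OF brauers_finite sub] brauers_card[of r s] by simp
  moreover have "E \<in> brauers r s" using D unfolding brauers_def by (simp add: marked_diagrams_iff)
  ultimately obtain js where js: "js \<in> ?J" "E = F js" by blast
  obtain k where "cong \<epsilon> r s (basis (E, L)) (scale k (basis (E, K js)))"
    using remark[OF ee D, of "K js"] M[OF js(1)] js(2) by auto
  then have "cong \<epsilon> r s (basis (E, L)) (scale (k / c js) (rep (nf r s js)))"
    using c(2)[OF js(1)] c0[OF js(1)] js(2) by simp
  then show ?thesis using that nf_words[OF js(1)] by blast
qed

lemma derivable_sum:
  "(\<And>i. i \<in> I ==> derivable \<delta> \<epsilon> r s (f i) (g i)) ==> derivable \<delta> \<epsilon> r s (sum f I) (sum g I)"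
proof (induction I rule: infinite_finite_induct)
  case (insert i I)
  then show ?case using derivable.add[of \<delta> \<epsilon> r s "f i" "g i" "sum f I" "sum g I"] by simp
qed (auto intro: derivable.refl simp: exprs_def combinations_zero)

lemma expr_normal:
  assumes "x \<in> exprs r s" "CHAR('k) \<noteq> 2"
  obtains a where "derivable \<delta> \<epsilon> r s x (\<Sum>js\<in>indices r s. scale (a js) (basis (nf r s js)))"
proof -
  let ?J = "indices r s"
  have "\<forall>w\<in>words r s. \<exists>js c. js \<in> ?J \<and> derivable \<delta> \<epsilon> r s (basis w) (scale c (basis (nf r s js)))"
    using word_normal unfolding indices_def by blast
  then obtain js c where c: "\<And>w. w \<in> words r s ==> js w \<in> ?J"
      "\<And>w. w \<in> words r s ==> derivable \<delta> \<epsilon> r s (basis w) (scale (c w) (basis (nf r s (js w))))" by metis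
  let ?K = "Poly_Mapping.keys x" and ?l = "Poly_Mapping.lookup x"
  have K: "w \<in> words r s" if "w \<in> ?K" for w using assms(1) that unfolding exprs_def combinations_def by blast
  have "derivable \<delta> \<epsilon> r s (\<Sum>w\<in>?K. scale (?l w) (basis w)) (\<Sum>w\<in>?K. scale (?l w) (scale (c w) (basis (nf r s (js w)))))"
    by (intro derivable_sum derivable.scale c(2) K)
  moreover have "(\<Sum>w\<in>?K. scale (?l w) (basis w)) = x" using combinations_sum[of x "words r s"] assms(1) unfolding exprs_def by simp
  \<comment> \<open>Words with the same normal form are collected, so that the combination is
    indexed by normal forms instead of words.\<close>
  moreover have "(\<Sum>w\<in>?K. scale (?l w) (scale (c w) (basis (nf r s (js w))))) =
      (\<Sum>i\<in>?J. scale (\<Sum>w\<in>?K. if js w = i then ?l w * c w else 0) (basis (nf r s i)))"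
  proof -
    have "scale (?l w) (scale (c w) (basis (nf r s (js w)))) =
        (\<Sum>i\<in>?J. scale (if js w = i then ?l w * c w else 0) (basis (nf r s i)))" if "w \<in> ?K" for w
      using c(1)[OF K[OF that]] indices_finite[OF assms(2), of r s]
      by (simp add: if_distrib[of "\<lambda>b. scale b _"] sum.delta cong: if_cong)
    then have "(\<Sum>w\<in>?K. scale (?l w) (scale (c w) (basis (nf r s (js w))))) =
        (\<Sum>w\<in>?K. \<Sum>i\<in>?J. scale (if js w = i then ?l w * c w else 0) (basis (nf r s i)))" by (rule sum.cong[OF HOL.refl])
    also have "\<dots> = (\<Sum>i\<in>?J. \<Sum>w\<in>?K. scale (if js w = i then ?l w * c w else 0) (basis (nf r s i)))" by (rule sum.swap)
    finally show ?thesis unfolding comb.scale_sum_left .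
  qed
  ultimately have "derivable \<delta> \<epsilon> r s x (\<Sum>i\<in>?J. scale (\<Sum>w\<in>?K. if js w = i then ?l w * c w else 0) (basis (nf r s i)))"
    by (simp only:)
  then show ?thesis by (rule that)
qed

theorem completeness:
  assumes x: "x \<in> exprs r s" and y: "y \<in> exprs r s" and ch: "CHAR('k) \<noteq> 2" and c: "cong \<epsilon> r s (ev x) (ev y)"
  shows "derivable \<delta> \<epsilon> r s x y"
proof -
  let ?J = "indices r s"
  obtain a where a: "derivable \<delta> \<epsilon> r s x (\<Sum>js\<in>?J. scale (a js) (basis (nf r s js)))" using expr_normal[OF x ch] .
  obtain b where b: "derivable \<delta> \<epsilon> r s y (\<Sum>js\<in>?J. scale (b js) (basis (nf r s js)))" using expr_normal[OF y ch] .
  have s: "cong \<epsilon> r s (ev x) (\<Sum>js\<in>?J. scale (a js) (rep (nf r s js)))" "cong \<epsilon> r s (ev y) (\<Sum>js\<in>?J. scale (b js) (rep (nf r s js)))"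
    using soundness[OF a ch] soundness[OF b ch] by (simp_all add: linear_extension_sum linear_extension_scale linear_extension_basis)
  have "cong \<epsilon> r s (\<Sum>js\<in>?J. scale (a js) (rep (nf r s js))) (\<Sum>js\<in>?J. scale (b js) (rep (nf r s js)))"
    by (rule cong_trans[OF cong_sym[OF s(1)] cong_trans[OF c s(2)]])
  then have "cong \<epsilon> r s (\<Sum>js\<in>?J. scale (a js - b js) (rep (nf r s js))) 0"
    unfolding cong_def by (simp add: comb.scale_left_diff_distrib sum_subtractf)
  then have "a js = b js" if "js \<in> ?J" for js using nf_independent[OF ch, of r s "\<lambda>js. a js - b js"] that by simp
  then have "(\<Sum>js\<in>?J. scale (a js) (basis (nf r s js))) = (\<Sum>js\<in>?J. scale (b js) (basis (nf r s js)))" by simp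
  then show ?thesis using derivable.trans[OF a] derivable.sym[OF b] by simp
qed

theorem surjectivity:
  assumes "CHAR('k) \<noteq> 2"
  shows "eval_expr \<delta> \<epsilon> r s ` exprs r s = Hom \<epsilon> r s"
proof (intro set_eqI iffI)
  fix F assume "F \<in> eval_expr \<delta> \<epsilon> r s ` exprs r s"
  then show "F \<in> Hom \<epsilon> r s" using eval_expr_coset ev_in unfolding Hom_def by auto
next
  fix F assume "F \<in> Hom \<epsilon> r s"
  then obtain f where f: "f \<in> combinations (marked_diagrams r s)" "F = coset \<epsilon> r s f" unfolding Hom_def by blast
  let ?K = "Poly_Mapping.keys f"
  have "\<forall>D\<in>?K. \<exists>w k. w \<in> words r s \<and> cong \<epsilon> r s (basis D) (scale k (rep w))"
  proof
    fix D assume "D \<in> ?K"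
    then have "(fst D, snd D) \<in> marked_diagrams r s" using f(1) unfolding combinations_def by auto
    then show "\<exists>w k. w \<in> words r s \<and> cong \<epsilon> r s (basis D) (scale k (rep w))" using nf_spans_diagrams[OF assms] by (metis prod.collapse)
  qed
  then obtain w k where w: "\<And>D. D \<in> ?K ==> w D \<in> words r s" "\<And>D. D \<in> ?K ==> cong \<epsilon> r s (basis D) (scale (k D) (rep (w D)))" by metis
  define x where "x = (\<Sum>D\<in>?K. scale (Poly_Mapping.lookup f D) (scale (k D) (basis (w D))))"
  have x: "x \<in> exprs r s" unfolding x_def exprs_def by (intro combinations_sum_in combinations_scale combinations_basis w(1))
  have "cong \<epsilon> r s (\<Sum>D\<in>?K. scale (Poly_Mapping.lookup f D) (basis D)) (\<Sum>D\<in>?K. scale (Poly_Mapping.lookup f D) (scale (k D) (rep (w D))))"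
    by (intro cong_sum cong_scale w(2))
  then have "cong \<epsilon> r s f (ev x)"
    using combinations_sum[OF f(1)] unfolding x_def by (simp add: linear_extension_sum linear_extension_scale linear_extension_basis)
  then have "F = eval_expr \<delta> \<epsilon> r s x" unfolding eval_expr_coset[OF x] f(2) coset_eq_iff .
  then show "F \<in> eval_expr \<delta> \<epsilon> r s ` exprs r s" using x by blast
qed

section \<open>Comparison of the two gradings\<close>

definition degree :: "nat \<Rightarrow> nat \<Rightarrow> nat" where
  "degree r s = degree_of \<epsilon> ((3 * r + s) div 2)"

lemma degree_of_cong: "(even m \<longleftrightarrow> even n) ==> degree_of \<epsilon> m = degree_of \<epsilon> n"
  unfolding degree_of_def by presburger

lemma degree_of_add: "(degree_of \<epsilon> m + degree_of \<epsilon> n) mod 2 = degree_of \<epsilon> (m + n)"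
  by (cases "\<epsilon> = - 1") (simp_all add: degree_of_def mod_simps)

text \<open>Each Hom-space is concentrated in one degree, so a grading on it amounts to a single
  number.\<close>

lemma Hom_part_eq: "Hom_part \<epsilon> r s p = (if p = degree r s then Hom \<epsilon> r s else {null_space \<epsilon> r s})"
proof -
  have d: "degree_of \<epsilon> (length L) = degree r s" if "(E, L) \<in> marked_diagrams r s" for E L
    unfolding degree_def by (rule degree_of_cong[OF marked_length(1)[OF that]])
  show ?thesis
  proof (cases "p = degree r s")
    case True
    have "{(E, L) \<in> marked_diagrams r s. degree_of \<epsilon> (length L) = p} = marked_diagrams r s" using d True by auto
    then show ?thesis using True unfolding Hom_part_def Hom_def by simp
  next
    case False
    have "{(E, L) \<in> marked_diagrams r s. degree_of \<epsilon> (length L) = p} = {}" using d False by auto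
    moreover have "combinations {} = {0 :: diagram \<Rightarrow>\<^sub>0 'k}" unfolding combinations_def by auto
    ultimately show ?thesis using False unfolding Hom_part_def by (simp only: coset_zero image_insert image_empty if_False)
  qed
qed

lemma generated_part_eq:
  assumes "CHAR('k) \<noteq> 2"
  shows "generated_part \<delta> \<epsilon> r s p = Hom_part \<epsilon> r s p"
proof -
  have d: "word_degree \<epsilon> w = degree r s" if "w \<in> words r s" for w
    unfolding degree_def word_degree_def using that word_degree_formula[of w] by (intro degree_of_cong) (simp add: words_def)
  show ?thesis
  proof (cases "p = degree r s")
    case True
    have "{w \<in> words r s. word_degree \<epsilon> w = p} = words r s" using d True by auto
    then show ?thesis using True surjectivity[OF assms, of r s] unfolding generated_part_def exprs_def Hom_part_eq by simp
  next
    case False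
    have "{w \<in> words r s. word_degree \<epsilon> w = p} = {}" using d False by auto
    moreover have "combinations {} = {0 :: word \<Rightarrow>\<^sub>0 'k}" unfolding combinations_def by auto
    moreover have "eval_expr \<delta> \<epsilon> r s 0 = null_space \<epsilon> r s"
      using eval_expr_coset[of 0 r s] by (simp add: exprs_def combinations_zero linear_extension_zero coset_zero)
    ultimately show ?thesis using False unfolding generated_part_def Hom_part_eq by (simp only: image_insert image_empty if_False)
  qed
qed

text \<open>The alternative \<open>f = 0\<close> also takes care of odd 3r + s. There the rounded
  division in \<open>degree\<close> has no meaning, but the Hom-space is zero.\<close>

lemma Hom_partE:
  assumes "F \<in> Hom_part \<epsilon> r s p"
  obtains f where "f \<in> combinations (marked_diagrams r s)" "F = coset \<epsilon> r s f" "p = degree r s \<and> even (3 * r + s) \<or> f = 0"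
proof (cases "p = degree r s \<and> even (3 * r + s)")
  case True
  then have "F \<in> Hom \<epsilon> r s" using assms unfolding Hom_part_eq by simp
  then show ?thesis using that True unfolding Hom_def by blast
next
  case False
  have "F = null_space \<epsilon> r s"
  proof (cases "p = degree r s")
    case True
    then have "marked_diagrams r s = {}" using False marked_length(2) by fastforce
    then have "Hom \<epsilon> r s = coset \<epsilon> r s ` {0}" unfolding Hom_def combinations_def by (intro arg_cong2[of _ _ _ _ "(`)"]) auto
    then show ?thesis using assms True unfolding Hom_part_eq by (simp add: coset_zero)
  qed (use assms in \<open>simp add: Hom_part_eq\<close>)
  then show ?thesis using that[OF combinations_zero] coset_zero by simp
qed

lemma Hom_partI:
  assumes "f \<in> combinations (marked_diagrams r s)" "p = degree r s \<or> f = 0"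
  shows "coset \<epsilon> r s f \<in> Hom_part \<epsilon> r s p"
proof -
  have "coset \<epsilon> r s f \<in> Hom \<epsilon> r s" unfolding Hom_def using assms(1) by (rule imageI)
  then show ?thesis using assms(2) unfolding Hom_part_eq by (auto simp: coset_zero)
qed

lemma choice_in: "D1 \<in> marked_diagrams r s ==> D2 \<in> marked_diagrams s t ==> choice r t D1 D2 \<in> combinations (marked_diagrams r t)"
  using choice[of D1 r s D2 t] unfolding composites_def by (auto intro!: combinations_scale combinations_basis)

lemma bilinear_in:
  assumes "f \<in> combinations M" "g \<in> combinations N" "\<And>a b. a \<in> M ==> b \<in> N ==> h a b \<in> combinations K"
  shows "bilinear_extension h f g \<in> combinations K"
  unfolding bilinear_extension_def
  by (intro combinations_sum_in combinations_scale assms(3)) (use assms(1,2) in \<open>auto simp: combinations_def\<close>)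

lemma bilinear_zero: "f = 0 \<or> g = 0 ==> bilinear_extension h f g = 0"
  unfolding bilinear_extension_def by auto

text \<open>Treats composition and tensor product together. By \<open>deg\<close> the halved weights
  add up except for an even number \<open>2 * c\<close>; here \<open>c = s\<close> for the
  composition and \<open>c = 0\<close> for the tensor product.\<close>

lemma bilinear_part:
  assumes F: "F \<in> Hom_part \<epsilon> r s p" "G \<in> Hom_part \<epsilon> t u q"
    and h: "\<And>D D'. D \<in> marked_diagrams r s ==> D' \<in> marked_diagrams t u ==> h D D' \<in> combinations (marked_diagrams v w)"
    and H: "\<And>f g. f \<in> combinations (marked_diagrams r s) ==> g \<in> combinations (marked_diagrams t u) ==>
      H (coset \<epsilon> r s f) (coset \<epsilon> t u g) = coset \<epsilon> v w (bilinear_extension h f g)"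
    and deg: "\<And>a b. 3 * r + s = 2 * a ==> 3 * t + u = 2 * b ==> \<exists>c. 3 * v + w + 4 * c = 2 * a + 2 * b"
  shows "H F G \<in> Hom_part \<epsilon> v w ((p + q) mod 2)"
proof -
  obtain f where f: "f \<in> combinations (marked_diagrams r s)" "F = coset \<epsilon> r s f" "p = degree r s \<and> even (3 * r + s) \<or> f = 0"
    using Hom_partE[OF F(1)] .
  obtain g where g: "g \<in> combinations (marked_diagrams t u)" "G = coset \<epsilon> t u g" "q = degree t u \<and> even (3 * t + u) \<or> g = 0"
    using Hom_partE[OF F(2)] .
  have "(p + q) mod 2 = degree v w" if e: "p = degree r s" "even (3 * r + s)" "q = degree t u" "even (3 * t + u)"
    unfolding e(1,3) degree_def degree_of_add
  proof (rule degree_of_cong)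
    obtain a b where ab: "3 * r + s = 2 * a" "3 * t + u = 2 * b" using evenE[OF e(2)] evenE[OF e(4)] by metis
    then obtain c where c: "3 * v + w + 4 * c = 2 * a + 2 * b" using deg by blast
    have "2 * c \<le> a + b" using c by linarith
    moreover have "3 * v + w = 2 * (a + b - 2 * c)" using c by presburger
    ultimately have "(3 * v + w) div 2 = a + b - 2 * c" "2 * c \<le> a + b" by (simp_all only: nonzero_mult_div_cancel_left)
    then show "even ((3 * r + s) div 2 + (3 * t + u) div 2) \<longleftrightarrow> even ((3 * v + w) div 2)" unfolding ab by simp
  qed
  then show ?thesis
    unfolding f(2) g(2) H[OF f(1) g(1)]
    by (intro Hom_partI bilinear_in[OF f(1) g(1) h]) (use f(3) g(3) bilinear_zero in blast)+
qed

lemma compose_part: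
  assumes "F \<in> Hom_part \<epsilon> r s p" "G \<in> Hom_part \<epsilon> s t q"
  shows "compose \<delta> \<epsilon> r s t F G \<in> Hom_part \<epsilon> r t ((p + q) mod 2)"
  by (rule bilinear_part[OF assms choice_in[of _ r s _ t] compose_coset]; (assumption | (rule exI[of _ s], linarith)))

lemma tensor_part:
  assumes "F \<in> Hom_part \<epsilon> r s p" "G \<in> Hom_part \<epsilon> t u q"
  shows "tensor \<epsilon> r s t u F G \<in> Hom_part \<epsilon> (r + t) (s + u) ((p + q) mod 2)"
  by (rule bilinear_part[OF assms combinations_basis[OF juxtapose_marked] tensor_coset]; (assumption | (rule exI[of _ 0], simp add: distrib_left)))

lemma Hom_part_grading: "Z2_grading \<delta> \<epsilon> (Hom_part \<epsilon>)"
proof -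
  have 1: "Hom_part \<epsilon> r s p \<subseteq> Hom \<epsilon> r s \<and> null_space \<epsilon> r s \<in> Hom_part \<epsilon> r s p \<and>
      (\<forall>F\<in>Hom_part \<epsilon> r s p. \<forall>G\<in>Hom_part \<epsilon> r s p. F + G \<in> Hom_part \<epsilon> r s p) \<and>
      (\<forall>F\<in>Hom_part \<epsilon> r s p. \<forall>c. scale c ` F + null_space \<epsilon> r s \<in> Hom_part \<epsilon> r s p)" for r s p
  proof (intro conjI ballI allI subsetI)
    show "null_space \<epsilon> r s \<in> Hom_part \<epsilon> r s p" using Hom_partI[OF combinations_zero, of p r s] by (simp add: coset_zero)
  next
    fix F assume F: "F \<in> Hom_part \<epsilon> r s p"
    obtain f where f: "f \<in> combinations (marked_diagrams r s)" "F = coset \<epsilon> r s f" "p = degree r s \<and> even (3 * r + s) \<or> f = 0"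
      using Hom_partE[OF F] .
    show "F \<in> Hom \<epsilon> r s" unfolding Hom_def f(2) using f(1) by (rule imageI)
    show "scale c ` F + null_space \<epsilon> r s \<in> Hom_part \<epsilon> r s p" for c
      unfolding f(2) coset_scale_null by (rule Hom_partI[OF combinations_scale[OF f(1)]]) (use f(3) in auto)
    fix G assume G: "G \<in> Hom_part \<epsilon> r s p"
    obtain g where g: "g \<in> combinations (marked_diagrams r s)" "G = coset \<epsilon> r s g" "p = degree r s \<and> even (3 * r + s) \<or> g = 0"
      using Hom_partE[OF G] .
    show "F + G \<in> Hom_part \<epsilon> r s p"
      unfolding f(2) g(2) coset_add by (rule Hom_partI[OF combinations_add[OF f(1) g(1)]]) (use f(3) g(3) in auto)
  qed
  have 2: "\<exists>!(F0, F1). F0 \<in> Hom_part \<epsilon> r s 0 \<and> F1 \<in> Hom_part \<epsilon> r s 1 \<and> F = F0 + F1" if F: "F \<in> Hom \<epsilon> r s" for r s F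
  proof -
    obtain f where f: "F = coset \<epsilon> r s f" using F unfolding Hom_def by blast
    have z: "G + null_space \<epsilon> r s = G \<and> null_space \<epsilon> r s + G = G" if "G \<in> Hom \<epsilon> r s" for G
      using that unfolding Hom_def coset_zero[symmetric] by (auto simp: coset_add)
    \<comment> \<open>One of the two parts is the whole Hom-space and the other one is zero, which
      forces the decomposition.\<close>
    have "degree r s = 0 \<or> degree r s = 1" unfolding degree_def degree_of_def by auto
    then show ?thesis
    proof
      assume d: "degree r s = 0"
      show ?thesis
        by (rule ex1I[of _ "(F, null_space \<epsilon> r s)"]) (use F z d in \<open>auto simp: Hom_part_eq\<close>)
    next
      assume d: "degree r s = 1"
      show ?thesis
        by (rule ex1I[of _ "(null_space \<epsilon> r s, F)"]) (use F z d in \<open>auto simp: Hom_part_eq\<close>)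
    qed
  qed
  show ?thesis unfolding Z2_grading_def using 1 2 compose_part tensor_part by (intro conjI allI ballI) simp_all
qed

end

theorem theorem3p2p1:
  fixes \<delta> \<epsilon> :: "'k::field"
  assumes "CHAR('k) \<noteq> 2"
    and "\<epsilon> = 1 \<or> \<epsilon> = - 1"
    and "\<epsilon> = - 1 \<longrightarrow> \<delta> = 0"
  shows "(\<forall>r s. eval_expr \<delta> \<epsilon> r s ` exprs r s = Hom \<epsilon> r s) \<and>
    (\<forall>r s. \<forall>x\<in>exprs r s. \<forall>y\<in>exprs r s.
       eval_expr \<delta> \<epsilon> r s x = eval_expr \<delta> \<epsilon> r s y \<longleftrightarrow> derivable \<delta> \<epsilon> r s x y) \<and>
    Z2_grading \<delta> \<epsilon> (generated_part \<delta> \<epsilon>) \<and>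
    (\<forall>r s. \<forall>p\<in>{0, 1}. generated_part \<delta> \<epsilon> r s p = Hom_part \<epsilon> r s p)"
proof -
  interpret parameters \<delta> \<epsilon> using assms by unfold_locales auto
  have "generated_part \<delta> \<epsilon> = Hom_part \<epsilon>" by (intro ext generated_part_eq assms(1))
  moreover have "eval_expr \<delta> \<epsilon> r s x = eval_expr \<delta> \<epsilon> r s y \<longleftrightarrow> derivable \<delta> \<epsilon> r s x y"
    if "x \<in> exprs r s" "y \<in> exprs r s" for r s x y
    unfolding eval_expr_coset[OF that(1)] eval_expr_coset[OF that(2)] coset_eq_iff
    using soundness[OF _ assms(1)] completeness[OF that assms(1)] by blast
  ultimately show ?thesis using surjectivity[OF assms(1)] Hom_part_grading by simp
qed

end
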